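(* There exist a universal constant $C_1>0$ and constants $C_2(p)>0$ depending only on $p$ such that for every $w\in L^2(\mathbb{T}^2)$ with vanishing mean in $x_1$ the following hold. (i) For every $s\in(0,\tfrac13]$, $$\|w\|_{\dot{\mathcal{B}}^s_{3;1}}\le C_1\,\mathcal{E}(w)^{1/3}.$$ (ii) For every $1\le p<\tfrac{10}{3}$, with $\alpha=\max\{2,p\}$, $$\|w\|_{L^p(\mathbb{T}^2)}\le C_2(p)\,\mathcal{E}(w)^{\frac{2}{3\alpha}}\left(\mathcal{E}(w)+\mathcal{E}(w)^{2/3}\right)^{\frac{\alpha-2}{2\alpha}}.$$ (iii) For every $\varepsilon>0$ and every $1\le p<6$, with $\alpha=\max\{2,p\}$, $$\|w\|_{L^p(\mathbb{T}^2)}\le C_2(p)\,\varepsilon^{-\frac1\alpha}\,\mathcal{E}_\varepsilon(w)^{\frac1\alpha}\left(\mathcal{E}_\varepsilon(w)+\mathcal{E}_\varepsilon(w)^{2/3}\right)^{\frac{\alpha-2}{2\alpha}}.$$ Moreover, the constant $C_1$ in (i) is one for which also, for all such $w$ and all $h\in(0,1]$, $\int_{\mathbb{T}^2}|\partial_1^hw|^3dx\le C_1h\,\mathcal{E}(w)$ and $\sup_{x_2\in[0,1)}\int_0^h\int_0^1|\partial_1^{h'}w(x_1,x_2)|^2dx_1dh'\le C_1\left(h\,\mathcal{E}(w)+h^{5/3}\mathcal{E}(w)^{2/3}\right)$.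
   Context: $\mathbb{T}^2=[0,1)^2$ is the flat torus with Lebesgue measure; functions are real valued and 1-periodic in each variable. Fourier coefficients $\widehat f(k)$ are indexed by $k=(k_1,k_2)\in(2\pi\mathbb{Z})^2$. A periodic distribution $f$ on $\mathbb{T}^2$ has vanishing mean in $x_1$ if $\widehat f(k)=0$ for all $k\in(2\pi\mathbb{Z})^2$ with $k_1=0$ (for integrable functions: $\int_0^1 f(x_1,x_2)\,dx_1=0$ for a.e. $x_2$). For such $f$, $|\partial_1|^{-1}f$ is defined by $\widehat{|\partial_1|^{-1}f}(k)=|k_1|^{-1}\widehat f(k)$ for $k_1\ne0$ (and $0$ for $k_1=0$). For $h\in\mathbb{R}$, $\partial_1^h f(x)=f(x+h\mathbf{e}_1)-f(x)$ with $\mathbf{e}_1=(1,0)$. The directional Besov seminorm is, for $s\in(0,1]$, $p\in[1,\infty)$, $$\|f\|_{\dot{\mathcal{B}}^s_{p;1}}=\sup_{h\in(0,1]}\frac{1}{h^s}\left(\int_{\mathbb{T}^2}|\partial_1^hf|^p\,dx\right)^{1/p}.$$ For $w\in L^2(\mathbb{T}^2)$ with vanishing mean in $x_1$, put $\eta_w=\partial_2 w-\partial_1\tfrac12w^2$ (a distribution with vanishing mean in $x_1$), and $$\mathcal{E}(w)=\left(\int_{\mathbb{T}^2}(|\partial_1|^{-1}\eta_w)^2dx\right)^{1/2}\left(\int_{\mathbb{T}^2}(\partial_1 w)^2dx\right)^{1/2},\qquad \mathcal{E}_\varepsilon(w)=\frac12\int_{\mathbb{T}^2}\frac1\varepsilon(|\partial_1|^{-1}\eta_w)^2+\varepsilon(\partial_1w)^2\,dx,$$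 with values in $[0,\infty]$, where an integral is $+\infty$ if the corresponding distribution is not in $L^2(\mathbb{T}^2)$, and $\mathcal{E}(w)=+\infty$ as soon as one of the two integrals is $+\infty$. The convention $t^0=1$ is used when $\alpha=2$. Suprema over $x_2$ are essential suprema. *)

theory Defs
  imports "HOL-Analysis.Analysis" "HOL-Probability.Essential_Supremum"
begin

definition torus :: "(real \<times> real) measure" where
  "torus = lebesgue_on ({0..<1} \<times> {0..<1})"

definition torus_periodic :: "(real \<times> real \<Rightarrow> 'a) \<Rightarrow> bool" where
  "torus_periodic f \<longleftrightarrow> (\<forall>x. f (x + (1, 0)) = f x \<and> f (x + (0, 1)) = f x)"

definition L2_torus :: "(real \<times> real \<Rightarrow> real) \<Rightarrow> bool" where
  "L2_torus f \<longleftrightarrow> torus_periodic f \<and> f \<in> borel_measurable torus \<and> integrable torus (\<lambda>x. (f x)\<^sup>2)"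

text \<open>The power \<open>t\<^sup>a\<close> for \<open>t \<in> [0,\<infinity>]\<close> and \<open>a \<ge> 0\<close>, with \<open>t\<^sup>0 = 1\<close> also for \<open>t = 0\<close>
  (where \<open>powr\<close> would give \<open>0\<close>) and for \<open>t = \<infinity>\<close>.\<close>

definition epow :: "ennreal \<Rightarrow> real \<Rightarrow> ennreal" where
  "epow t a = (if a = 0 then 1 else if t = \<infinity> then \<infinity> else ennreal (enn2real t powr a))"

definition Lp_norm :: "real \<Rightarrow> (real \<times> real \<Rightarrow> real) \<Rightarrow> ennreal" where
  "Lp_norm p f = epow (\<integral>\<^sup>+x. ennreal (\<bar>f x\<bar> powr p) \<partial>torus) (1 / p)"

definition diff1 :: "real \<Rightarrow> (real \<times> real \<Rightarrow> real) \<Rightarrow> real \<times> real \<Rightarrow> real" where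
  "diff1 h f x = f (x + (h, 0)) - f x"

definition besov_seminorm :: "real \<Rightarrow> real \<Rightarrow> (real \<times> real \<Rightarrow> real) \<Rightarrow> ennreal" where
  "besov_seminorm s p f = (SUP h\<in>{0<..1}. ennreal (1 / h powr s) * Lp_norm p (diff1 h f))"

text \<open>Periodic distributions, as functionals on (complex-valued, smooth, periodic) test functions.
  Only their values at such test functions matter; continuity is never needed, because every
  distribution below is built from integrable functions by differentiation.\<close>

type_synonym distribution = "(real \<times> real \<Rightarrow> complex) \<Rightarrow> complex"

definition dist_of :: "(real \<times> real \<Rightarrow> real) \<Rightarrow> distribution" where
  "dist_of f = (\<lambda>\<phi>. \<integral>x. complex_of_real (f x) * \<phi> x \<partial>torus)"

definition dist_diff :: "distribution \<Rightarrow> distribution \<Rightarrow> distribution" where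
  "dist_diff S T = (\<lambda>\<phi>. S \<phi> - T \<phi>)"

definition dist_D1 :: "distribution \<Rightarrow> distribution" where
  "dist_D1 T = (\<lambda>\<phi>. - T (\<lambda>x. vector_derivative (\<lambda>t. \<phi> (t, snd x)) (at (fst x))))"

definition dist_D2 :: "distribution \<Rightarrow> distribution" where
  "dist_D2 T = (\<lambda>\<phi>. - T (\<lambda>x. vector_derivative (\<lambda>t. \<phi> (fst x, t)) (at (snd x))))"

definition freqs :: "(real \<times> real) set" where
  "freqs = {(2 * pi * of_int m, 2 * pi * of_int n) | m n :: int. True}"

definition fourier_coeff :: "distribution \<Rightarrow> real \<times> real \<Rightarrow> complex" where
  "fourier_coeff T k = T (\<lambda>x. exp (- \<i> * complex_of_real (k \<bullet> x)))"

definition vanishing_mean1 :: "distribution \<Rightarrow> bool" where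
  "vanishing_mean1 T \<longleftrightarrow> (\<forall>k\<in>freqs. fst k = 0 \<longrightarrow> fourier_coeff T k = 0)"

text \<open>The Fourier coefficients of \<open>|\<partial>\<^sub>1|\<^sup>-\<^sup>1 T\<close>.\<close>

definition inv_abs_D1_coeff :: "distribution \<Rightarrow> real \<times> real \<Rightarrow> complex" where
  "inv_abs_D1_coeff T k = (if fst k = 0 then 0 else fourier_coeff T k / complex_of_real \<bar>fst k\<bar>)"

text \<open>The integral \<open>\<integral> F\<^sup>2\<close> of the periodic distribution \<open>F\<close> with Fourier coefficients \<open>c\<close>
  (a periodic distribution is determined by these). If \<open>F\<close> is an \<open>L\<^sup>2\<close> function \<open>g\<close>, then \<open>g\<close> is
  unique up to null sets and the infimum is over the single value \<open>\<integral> g\<^sup>2\<close>; otherwise the infimum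
  is over the empty set and equals \<open>\<infinity>\<close>.\<close>

definition square_integral :: "(real \<times> real \<Rightarrow> complex) \<Rightarrow> ennreal" where
  "square_integral c =
     (INF g\<in>{g. L2_torus g \<and> (\<forall>k\<in>freqs. fourier_coeff (dist_of g) k = c k)}.
        \<integral>\<^sup>+x. ennreal ((g x)\<^sup>2) \<partial>torus)"

definition eta :: "(real \<times> real \<Rightarrow> real) \<Rightarrow> distribution" where
  "eta w = dist_diff (dist_D2 (dist_of w)) (dist_D1 (dist_of (\<lambda>x. 1 / 2 * (w x)\<^sup>2)))"

definition eta_integral :: "(real \<times> real \<Rightarrow> real) \<Rightarrow> ennreal" where
  "eta_integral w = square_integral (inv_abs_D1_coeff (eta w))"

definition D1_integral :: "(real \<times> real \<Rightarrow> real) \<Rightarrow> ennreal" where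
  "D1_integral w = square_integral (fourier_coeff (dist_D1 (dist_of w)))"

text \<open>The case distinction is needed because \<open>0 * \<infinity> = 0\<close> in \<^typ>\<open>ennreal\<close>.\<close>

definition energy :: "(real \<times> real \<Rightarrow> real) \<Rightarrow> ennreal" where
  "energy w = (if eta_integral w = \<infinity> \<or> D1_integral w = \<infinity> then \<infinity>
     else epow (eta_integral w) (1 / 2) * epow (D1_integral w) (1 / 2))"

definition energy_eps :: "real \<Rightarrow> (real \<times> real \<Rightarrow> real) \<Rightarrow> ennreal" where
  "energy_eps \<epsilon> w =
     ennreal (1 / 2) * (ennreal (1 / \<epsilon>) * eta_integral w + ennreal \<epsilon> * D1_integral w)"

end

theory Submission
  imports Defs "HOL-Probability.Probability"
begin

text \<open>
  Let \<open>u = \<partial>\<^sub>1\<^sup>h w\<close> and write the equation as \<open>\<partial>\<^sub>2 w = \<partial>\<^sub>1 (w\<^sup>2/2) + \<partial>\<^sub>1 G\<close>, where \<open>G\<close> is the Hilbert transform in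
  \<open>x\<^sub>1\<close> of \<open>|\<partial>\<^sub>1|\<^sup>-\<^sup>1 \<eta>\<close> and has the same \<open>L\<^sup>2\<close> norm. For \<open>\<Phi>' = \<psi>\<close>, \<open>S' = \<Phi>\<close>, \<open>H u = u \<Phi> u - S u\<close> and \<open>Q' = H\<close>,
  the quantity \<open>\<partial>\<^sub>2 (S u) - \<partial>\<^sub>h (Q u)\<close> is, up to an exact \<open>x\<^sub>1\<close>-derivative, equal to \<open>- \<psi> u \<partial>\<^sub>1 u \<partial>\<^sub>1\<^sup>h G\<close>, which is controlled
  by the energy. The choice \<open>\<psi> = sgn\<close> gives \<open>\<integral> |u|\<^sup>3 \<le> 24 h E\<close> and \<open>\<psi> = 1\<close> gives the bound uniform in \<open>x\<^sub>2\<close>.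

  For a function of finite energy the identity is applied to Fejer means. With compactly supported \<open>\<psi>\<close> the test
  function \<open>\<Phi> u\<close> is bounded, so the commutator error, which tends to \<open>0\<close> in \<open>L\<^sup>1\<close> only, disappears in the limit
  and no a priori integrability of \<open>w\<close> beyond \<open>L\<^sup>2\<close> is needed.

  The \<open>L\<^sup>p\<close> bounds follow by comparing \<open>w\<close> with its averages over a distance depending on \<open>|w|\<close> (ii), and from the
  one-dimensional inequalities \<open>w\<^sup>2 \<le> 2 \<integral> |w \<partial>\<^sub>1 w| dx\<^sub>1\<close> and \<open>|w| \<le> \<integral> |\<partial>\<^sub>1 w| dx\<^sub>1\<close> (iii).
\<close>

section \<open>Lebesgue measure on intervals and the unit square\<close>

text \<open>The constant 24 is \<open>6 * 4\<close>: the product of the increments of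
  \<open>\<partial>\<^sub>1 w\<close> and \<open>G\<close> expands into four products, each at most
  the energy, and the cubic profile \<open>Q\<close> tends to \<open>|u| ^ 3 / 6\<close>. Fejer
  means are the regularisation for two reasons. They are Fourier multipliers, so the linear terms of
  the equation keep their form and only the quadratic term leaves an error. Their kernel is
  nonnegative, so they contract \<open>L1\<close>, the only space in which the product of
  \<open>w\<close> and \<open>\<partial>\<^sub>1 w\<close> is available. For the bound uniform in
  \<open>x2\<close> the obstacle is that a single slice of an \<open>L2\<close> function has no
  meaning. The slices of the means are compared pairwise, one of the two is averaged out, and only
  the excess over the bound, integrated in \<open>x2\<close>, is sent to the limit. In (iii) the
  range of \<open>p\<close> comes from \<open>|w|^p = (w\<^sup>2)^q w\<^sup>2\<close> with
  \<open>q = (p - 2) / 2\<close>. On a slice with \<open>L2\<close> norms \<open>a\<close> of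
  \<open>w\<close> and \<open>b\<close> of \<open>\<partial>\<^sub>1 w\<close> one has
  \<open>w\<^sup>2 \<le> 2 a b\<close>, and the factor \<open>a^(2 - q)\<close> is traded for
  \<open>b^(2 - q)\<close>; this asks for \<open>q \<le> 2\<close>.\<close>

lemma borel_measurable_fst_snd [measurable]:
  "fst \<in> borel_measurable (borel :: ('a::topological_space \<times> 'b::topological_space) measure)"
  "snd \<in> borel_measurable (borel :: ('a::topological_space \<times> 'b::topological_space) measure)"
  by (intro borel_measurable_continuous_onI continuous_intros)+

text \<open>A density on the whole line instead of a restricted space: measurability is plain Borel
  measurability, and arguments \<open>x + h\<close> that leave the interval cause no side
  conditions. For \<open>b < a\<close> this is the zero measure.\<close>

definition seg :: "real \<Rightarrow> real \<Rightarrow> real measure" where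
  "seg a b = density lborel (indicator {a..b})"

abbreviation U :: "real measure" where "U \<equiv> seg 0 1"
abbreviation U2 :: "(real \<times> real) measure" where "U2 \<equiv> U \<Otimes>\<^sub>M U"

lemma space_seg [simp]: "space (seg a b) = UNIV"
  by (simp add: seg_def)

lemma sets_seg [simp, measurable_cong]: "sets (seg a b) = sets borel"
  by (simp add: seg_def)

lemma emeasure_seg_UNIV: "emeasure (seg a b) UNIV = ennreal (b - a)"
  by (cases "a \<le> b") (simp_all add: seg_def emeasure_density ennreal_neg)

lemma measure_seg_UNIV: "a \<le> b \<Longrightarrow> measure (seg a b) UNIV = b - a"
  by (simp add: measure_def emeasure_seg_UNIV)

lemma finite_measure_seg: "finite_measure (seg a b)"
  by (rule finite_measureI) (simp add: emeasure_seg_UNIV)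

lemma prob_space_U: "prob_space U"
  by (rule prob_spaceI) (simp add: emeasure_seg_UNIV)

interpretation U: prob_space U by (rule prob_space_U)
interpretation U2: pair_prob_space U U ..
interpretation seg: finite_measure "seg a b" for a b by (rule finite_measure_seg)
interpretation segs: pair_sigma_finite "seg a b" "seg c d" for a b c d ..

lemma sets_segs [simp]: "sets (seg a b \<Otimes>\<^sub>M seg c d) = sets borel"
  by (metis borel_prod sets_pair_measure_cong sets_seg)

lemma measurable_seg [simp]: "measurable (seg a b) N = measurable borel N"
  by (rule measurable_cong_sets) simp_all

lemma measurable_segs [simp]: "measurable (seg a b \<Otimes>\<^sub>M seg c d) N = measurable borel N"
  by (rule measurable_cong_sets[OF sets_segs refl])

lemma space_segs [simp]: "space (seg a b \<Otimes>\<^sub>M seg c d) = UNIV"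
  by (simp add: space_pair_measure)

lemma AE_seg: "(AE x in seg a b. P x) \<longleftrightarrow> (AE x in lborel. a \<le> x \<and> x \<le> b \<longrightarrow> P x)"
  unfolding seg_def by (subst AE_density) (auto simp: indicator_def)

lemma AE_seg_mem: "AE x in seg a b. a \<le> x \<and> x \<le> b"
  by (simp add: AE_seg)

lemma nn_integral_seg:
  "f \<in> borel_measurable borel \<Longrightarrow> (\<integral>\<^sup>+x. f x \<partial>seg a b) = (\<integral>\<^sup>+x. f x * indicator {a..b} x \<partial>lborel)"
  by (simp add: seg_def nn_integral_density mult.commute)

lemma nn_integral_segs:
  assumes [measurable]: "f \<in> borel_measurable borel"
  shows "(\<integral>\<^sup>+x. f x \<partial>(seg a b \<Otimes>\<^sub>M seg c d)) = (\<integral>\<^sup>+x. f x * indicator ({a..b} \<times> {c..d}) x \<partial>lborel)"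
proof -
  have "seg a b \<Otimes>\<^sub>M seg c d = density (lborel \<Otimes>\<^sub>M lborel) (\<lambda>(x, y). indicator {a..b} x * indicator {c..d} y)"
    unfolding seg_def
    by (rule pair_measure_density) (auto intro: seg.sigma_finite_measure_axioms[unfolded seg_def] lborel.sigma_finite_measure_axioms)
  also have "\<dots> = density lborel (indicator ({a..b} \<times> {c..d}))"
    unfolding lborel_prod by (rule arg_cong[of _ _ "density lborel"]) (auto simp: fun_eq_iff indicator_def)
  finally have eq: "seg a b \<Otimes>\<^sub>M seg c d = density lborel (indicator ({a..b} \<times> {c..d}))" .
  have [measurable]: "{a..b} \<times> {c..d} \<in> sets borel"
    by (intro borel_closed closed_Times) auto
  show ?thesis
    unfolding eq by (subst nn_integral_density) (auto simp: mult.commute)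
qed

lemma integral_seg:
  fixes f :: "real \<Rightarrow> 'a::euclidean_space"
  assumes [measurable]: "f \<in> borel_measurable borel"
  shows "(\<integral>x. f x \<partial>seg a b) = (\<integral>x. indicator {a..b} x *\<^sub>R f x \<partial>lborel)"
  unfolding seg_def ennreal_indicator[symmetric] by (rule integral_density) auto

lemma integral_seg_FTC:
  fixes F :: "real \<Rightarrow> 'a::euclidean_space"
  assumes "a \<le> b" "continuous_on UNIV f" "\<And>x. (F has_vector_derivative f x) (at x)"
  shows "(\<integral>x. f x \<partial>seg a b) = F b - F a"
proof -
  have "f \<in> borel_measurable borel"
    using assms(2) by (rule borel_measurable_continuous_onI)
  then show ?thesis
    using assms by (subst integral_seg) (auto intro!: integral_FTC_Icc intro: has_vector_derivative_at_within continuous_on_subset)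
qed

lemma integrable_seg_continuous:
  fixes f :: "real \<Rightarrow> 'a::euclidean_space"
  assumes "continuous_on UNIV f"
  shows "integrable (seg a b) f"
proof -
  obtain B where B: "\<And>x. x \<in> {a..b} \<Longrightarrow> norm (f x) \<le> B"
    using compact_imp_bounded[OF compact_continuous_image[OF continuous_on_subset[OF assms, of "{a..b}"]]]
    unfolding bounded_iff by fastforce
  show ?thesis
    by (rule seg.integrable_const_bound[where B = B])
       (use AE_seg_mem[of a b] B borel_measurable_continuous_onI[OF assms] in \<open>auto elim!: AE_mp\<close>)
qed

lemma AE_segs_mem: "AE x in seg a b \<Otimes>\<^sub>M seg c d. x \<in> {a..b} \<times> {c..d}"
  by (rule segs.AE_pair_measure) (use AE_seg_mem[of a b] AE_seg_mem[of c d] in \<open>auto elim!: AE_mp\<close>)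

lemma integrable_segs_continuous:
  fixes f :: "real \<times> real \<Rightarrow> 'a::euclidean_space"
  assumes "continuous_on UNIV f"
  shows "integrable (seg a b \<Otimes>\<^sub>M seg c d) f"
proof -
  interpret F: finite_measure "seg a b \<Otimes>\<^sub>M seg c d"
    by (intro finite_measure_pair_measure finite_measure_seg)
  have "compact ({a..b} \<times> {c..d})"
    by (intro compact_Times) auto
  then obtain B where B: "\<And>x. x \<in> {a..b} \<times> {c..d} \<Longrightarrow> norm (f x) \<le> B"
    using compact_imp_bounded[OF compact_continuous_image[OF continuous_on_subset[OF assms, of "{a..b} \<times> {c..d}"]]]
    unfolding bounded_iff by auto
  show ?thesis
    by (rule F.integrable_const_bound[where B = B])
       (use AE_segs_mem[of a b c d] B borel_measurable_continuous_onI[OF assms] in \<open>auto elim!: AE_mp\<close>)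
qed

text \<open>Cut \<open>[0, 1]\<close> at \<open>1 - h\<close>. Translation carries the left piece to
  \<open>[h, 1]\<close>, and, after a period is subtracted, the right piece to
  \<open>[0, h]\<close>; the common endpoint is null.\<close>

lemma nn_integral_U_shift:
  fixes f :: "real \<Rightarrow> ennreal"
  assumes [measurable]: "f \<in> borel_measurable borel"
    and per: "\<And>x. f (x + 1) = f x" and h: "0 \<le> h" "h \<le> 1"
  shows "(\<integral>\<^sup>+x. f (x + h) \<partial>U) = (\<integral>\<^sup>+x. f x \<partial>U)"
proof -
  have sh: "(\<integral>\<^sup>+x. g x \<partial>lborel) = (\<integral>\<^sup>+x. g (x + c) \<partial>lborel)" if "g \<in> borel_measurable borel"
    for g :: "real \<Rightarrow> ennreal" and c
    using nn_integral_real_affine[OF that, of 1 c] by (simp add: add.commute)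
  have "(\<integral>\<^sup>+x. f (x + h) \<partial>U) = (\<integral>\<^sup>+x. f (x + h) * indicator {0..1} x \<partial>lborel)"
    by (simp add: nn_integral_seg)
  also have "\<dots> = (\<integral>\<^sup>+x. f (x + h) * indicator {0..1-h} x + f (x + h) * indicator {1-h..1} x \<partial>lborel)"
    using AE_lborel_singleton[of "1-h"] h
    by (intro nn_integral_cong_AE) (auto elim!: AE_mp simp: indicator_def)
  also have "\<dots> = (\<integral>\<^sup>+x. f (x + h) * indicator {0..1-h} x \<partial>lborel) + (\<integral>\<^sup>+x. f (x + h) * indicator {1-h..1} x \<partial>lborel)"
    by (rule nn_integral_add) auto
  also have "(\<integral>\<^sup>+x. f (x + h) * indicator {0..1-h} x \<partial>lborel) = (\<integral>\<^sup>+x. f x * indicator {h..1} x \<partial>lborel)"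
    by (subst sh[of "\<lambda>x. f x * indicator {h..1} x" h]) (auto intro!: nn_integral_cong simp: indicator_def)
  also have "(\<integral>\<^sup>+x. f (x + h) * indicator {1-h..1} x \<partial>lborel) = (\<integral>\<^sup>+x. f x * indicator {0..h} x \<partial>lborel)"
    by (subst sh[of "\<lambda>x. f (x+h) * indicator {1-h..1} x" "1-h"])
       (auto intro!: nn_integral_cong simp: indicator_def per)
  also have "(\<integral>\<^sup>+x. f x * indicator {h..1} x \<partial>lborel) + (\<integral>\<^sup>+x. f x * indicator {0..h} x \<partial>lborel)
     = (\<integral>\<^sup>+x. f x * indicator {h..1} x + f x * indicator {0..h} x \<partial>lborel)"
    by (rule nn_integral_add[symmetric]) auto
  also have "\<dots> = (\<integral>\<^sup>+x. f x * indicator {0..1} x \<partial>lborel)"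
    using AE_lborel_singleton[of h] h
    by (intro nn_integral_cong_AE) (auto elim!: AE_mp simp: indicator_def)
  finally show ?thesis by (simp add: nn_integral_seg)
qed

lemma nn_integral_U2:
  assumes "f \<in> borel_measurable borel"
  shows "(\<integral>\<^sup>+x. f x \<partial>U2) = (\<integral>\<^sup>+y. \<integral>\<^sup>+x. f (x, y) \<partial>U \<partial>U)"
  using assms by (subst U2.nn_integral_snd[symmetric]) (auto simp: borel_prod)

lemma nn_integral_U2_shift:
  fixes f :: "real \<times> real \<Rightarrow> ennreal"
  assumes [measurable]: "f \<in> borel_measurable borel"
    and per: "\<And>x. f (x + (1, 0)) = f x" and h: "0 \<le> h" "h \<le> 1"
  shows "(\<integral>\<^sup>+x. f (x + (h, 0)) \<partial>U2) = (\<integral>\<^sup>+x. f x \<partial>U2)"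
proof -
  have "(\<integral>\<^sup>+x. f (x + h, y) \<partial>U) = (\<integral>\<^sup>+x. f (x, y) \<partial>U)" for y
    using per[of "(x, y)" for x] h by (intro nn_integral_U_shift) auto
  then show ?thesis
    by (simp add: nn_integral_U2)
qed

section \<open>Square-integrable functions, their norm and the Cauchy-Schwarz inequality\<close>

definition square_integrable :: "'a measure \<Rightarrow> ('a \<Rightarrow> real) \<Rightarrow> bool" where
  "square_integrable M f \<longleftrightarrow> f \<in> borel_measurable M \<and> integrable M (\<lambda>x. (f x)\<^sup>2)"

lemma square_integrableD: "square_integrable M f \<Longrightarrow> f \<in> borel_measurable M" "square_integrable M f \<Longrightarrow> integrable M (\<lambda>x. (f x)\<^sup>2)"
  by (auto simp: square_integrable_def)

lemma square_integrable_mult_integrable: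
  assumes "square_integrable M f" "square_integrable M g"
  shows "integrable M (\<lambda>x. f x * g x)"
proof (rule Bochner_Integration.integrable_bound)
  show "integrable M (\<lambda>x. (f x)\<^sup>2 + (g x)\<^sup>2)"
    using assms by (auto simp: square_integrable_def)
  show "AE x in M. norm (f x * g x) \<le> norm ((f x)\<^sup>2 + (g x)\<^sup>2)"
  proof (rule AE_I2)
    fix x
    have "2 * (\<bar>f x\<bar> * \<bar>g x\<bar>) \<le> (f x)\<^sup>2 + (g x)\<^sup>2"
      using sum_squares_bound[of "\<bar>f x\<bar>" "\<bar>g x\<bar>"] by (simp add: mult.assoc)
    moreover have "0 \<le> \<bar>f x\<bar> * \<bar>g x\<bar>" by simp
    ultimately have "\<bar>f x\<bar> * \<bar>g x\<bar> \<le> (f x)\<^sup>2 + (g x)\<^sup>2" by linarith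
    then show "norm (f x * g x) \<le> norm ((f x)\<^sup>2 + (g x)\<^sup>2)"
      by (simp add: abs_mult)
  qed
qed (use assms in \<open>auto simp: square_integrable_def\<close>)

lemma square_integrable_add:
  assumes "square_integrable M f" "square_integrable M g"
  shows "square_integrable M (\<lambda>x. f x + g x)"
  using assms square_integrable_mult_integrable[OF assms] unfolding square_integrable_def power2_sum
  by (auto intro!: Bochner_Integration.integrable_add simp: mult.assoc)

lemma square_integrable_cmult: "square_integrable M f \<Longrightarrow> square_integrable M (\<lambda>x. c * f x)"
  unfolding square_integrable_def power_mult_distrib by auto

lemma square_integrable_diff: "square_integrable M f \<Longrightarrow> square_integrable M g \<Longrightarrow> square_integrable M (\<lambda>x. f x - g x)"
  using square_integrable_add[of M f "\<lambda>x. (-1) * g x"] square_integrable_cmult[of M g "-1"] by simp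

lemma square_integrable_abs: "square_integrable M f \<Longrightarrow> square_integrable M (\<lambda>x. \<bar>f x\<bar>)"
  by (auto simp: square_integrable_def)

lemma (in finite_measure) square_integrable_integrable: "square_integrable M f \<Longrightarrow> integrable M f"
  using square_integrable_mult_integrable[of M f "\<lambda>_. 1"] by (auto simp: square_integrable_def)

text \<open>If the square of \<open>f\<close> is not integrable, the Bochner integral is 0; the
  value is the \<open>L2\<close> norm only together with \<open>square_integrable\<close>.\<close>

definition norm2 :: "'a measure \<Rightarrow> ('a \<Rightarrow> real) \<Rightarrow> real" where
  "norm2 M f = sqrt (\<integral>x. (f x)\<^sup>2 \<partial>M)"

lemma norm2_nonneg [simp]: "0 \<le> norm2 M f"
  by (simp add: norm2_def)

lemma norm2_square: "(norm2 M f)\<^sup>2 = (\<integral>x. (f x)\<^sup>2 \<partial>M)"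
  by (simp add: norm2_def)

lemma Cauchy_Schwarz_norm2_abs:
  assumes "square_integrable M f" "square_integrable M g"
  shows "(\<integral>x. \<bar>f x\<bar> * \<bar>g x\<bar> \<partial>M) \<le> norm2 M f * norm2 M g"
proof -
  note [measurable] = square_integrableD(1)[OF assms(1)] square_integrableD(1)[OF assms(2)]
  have i: "integrable M (\<lambda>x. \<bar>f x\<bar> * \<bar>g x\<bar>)"
    by (intro square_integrable_mult_integrable square_integrable_abs assms)
  have "ennreal ((\<integral>x. \<bar>f x\<bar> * \<bar>g x\<bar> \<partial>M)\<^sup>2) = (\<integral>\<^sup>+x. ennreal \<bar>f x\<bar> * ennreal \<bar>g x\<bar> \<partial>M)\<^sup>2"
    using i by (subst ennreal_power[symmetric]) (auto simp: nn_integral_eq_integral ennreal_mult[symmetric])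
  also have "\<dots> \<le> (\<integral>\<^sup>+x. (ennreal \<bar>f x\<bar>)\<^sup>2 \<partial>M) * (\<integral>\<^sup>+x. (ennreal \<bar>g x\<bar>)\<^sup>2 \<partial>M)"
    by (rule Cauchy_Schwarz_nn_integral) auto
  also have "\<dots> = ennreal ((norm2 M f)\<^sup>2) * ennreal ((norm2 M g)\<^sup>2)"
    using assms by (simp add: ennreal_power nn_integral_eq_integral norm2_square square_integrable_def)
  also have "\<dots> = ennreal ((norm2 M f * norm2 M g)\<^sup>2)"
    by (simp add: ennreal_mult power_mult_distrib)
  finally have "(\<integral>x. \<bar>f x\<bar> * \<bar>g x\<bar> \<partial>M)\<^sup>2 \<le> (norm2 M f * norm2 M g)\<^sup>2"
    by simp
  then show ?thesis
    by (rule power2_le_imp_le) simp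
qed

lemma Cauchy_Schwarz_norm2:
  assumes "square_integrable M f" "square_integrable M g"
  shows "\<bar>\<integral>x. f x * g x \<partial>M\<bar> \<le> norm2 M f * norm2 M g"
  using integral_abs_bound[of M "\<lambda>x. f x * g x"] Cauchy_Schwarz_norm2_abs[OF assms]
  by (simp add: abs_mult)

lemma norm2_triangle:
  assumes "square_integrable M f" "square_integrable M g"
  shows "norm2 M (\<lambda>x. f x + g x) \<le> norm2 M f + norm2 M g"
proof (rule power2_le_imp_le)
  have "(norm2 M (\<lambda>x. f x + g x))\<^sup>2 = (\<integral>x. (f x)\<^sup>2 + (g x)\<^sup>2 + 2 * (f x * g x) \<partial>M)"
    unfolding norm2_square by (simp add: power2_sum mult.assoc)
  also have "\<dots> = (norm2 M f)\<^sup>2 + (norm2 M g)\<^sup>2 + 2 * (\<integral>x. f x * g x \<partial>M)"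
    using assms square_integrable_mult_integrable[OF assms] by (simp add: norm2_square square_integrable_def)
  also have "\<dots> \<le> (norm2 M f)\<^sup>2 + (norm2 M g)\<^sup>2 + 2 * (norm2 M f * norm2 M g)"
    using Cauchy_Schwarz_norm2[OF assms] by simp
  finally show "(norm2 M (\<lambda>x. f x + g x))\<^sup>2 \<le> (norm2 M f + norm2 M g)\<^sup>2"
    by (simp add: power2_sum)
qed simp

lemma norm2_minus: "norm2 M (\<lambda>x. g x - f x) = norm2 M (\<lambda>x. f x - g x)"
  by (simp add: norm2_def power2_commute)

lemma norm2_diff_triangle:
  assumes "square_integrable M f" "square_integrable M g" "square_integrable M k"
  shows "norm2 M (\<lambda>x. f x - k x) \<le> norm2 M (\<lambda>x. f x - g x) + norm2 M (\<lambda>x. g x - k x)"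
  using norm2_triangle[OF square_integrable_diff[OF assms(1,2)] square_integrable_diff[OF assms(2,3)]] by simp

lemma norm2_triangle_le: "square_integrable M f \<Longrightarrow> square_integrable M g \<Longrightarrow> norm2 M f \<le> norm2 M (\<lambda>x. f x - g x) + norm2 M g"
  using norm2_triangle[OF square_integrable_diff, of M f g g] by simp

lemma (in prob_space) norm2_one: "norm2 M (\<lambda>_. 1) = 1"
  by (simp add: norm2_def prob_space)

lemma (in prob_space) integral_abs_le_norm2:
  assumes "square_integrable M f" shows "(\<integral>x. \<bar>f x\<bar> \<partial>M) \<le> norm2 M f"
  using Cauchy_Schwarz_norm2_abs[OF assms, of "\<lambda>_. 1"] by (simp add: square_integrable_def norm2_one)

lemma square_integrable_U2_shift:
  assumes f: "square_integrable U2 f" and per: "\<And>x. f (x + (1, 0)) = f x" and h: "0 \<le> h" "h \<le> 1"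
  shows "square_integrable U2 (\<lambda>x. f (x + (h, 0)))" and "norm2 U2 (\<lambda>x. f (x + (h, 0))) = norm2 U2 f"
proof -
  have [measurable]: "f \<in> borel_measurable borel"
    using square_integrableD(1)[OF f] by simp
  have eq: "(\<integral>\<^sup>+x. ennreal ((f (x + (h, 0)))\<^sup>2) \<partial>U2) = (\<integral>\<^sup>+x. ennreal ((f x)\<^sup>2) \<partial>U2)"
    by (rule nn_integral_U2_shift) (auto simp: per h)
  have m: "(\<lambda>x. f (x + (h, 0))) \<in> borel_measurable U2"
    by simp
  then show s: "square_integrable U2 (\<lambda>x. f (x + (h, 0)))"
    using f unfolding square_integrable_def by (auto simp: integrable_iff_bounded eq)
  show "norm2 U2 (\<lambda>x. f (x + (h, 0))) = norm2 U2 f"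
    unfolding norm2_def using eq s f m by (simp add: integral_eq_nn_integral square_integrable_def)
qed

section \<open>Fourier coefficients on the unit square\<close>

lemma norm2_mono:
  assumes "square_integrable M g" "f \<in> borel_measurable M" "\<And>x. \<bar>f x\<bar> \<le> \<bar>g x\<bar>"
  shows "square_integrable M f" "norm2 M f \<le> norm2 M g"
proof -
  have *: "(f x)\<^sup>2 \<le> (g x)\<^sup>2" for x
    using assms(3)[of x] by (metis abs_le_square_iff)
  show "square_integrable M f"
    unfolding square_integrable_def
    by (safe intro!: assms(2) Bochner_Integration.integrable_bound[OF square_integrableD(2)[OF assms(1)]])
       (use assms(2) * in auto)
  then show "norm2 M f \<le> norm2 M g"
    unfolding norm2_def using * assms(1) by (auto intro!: integral_mono simp: square_integrable_def)
qed

lemma (in finite_measure) square_integrable_bounded: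
  assumes "f \<in> borel_measurable M" "\<And>x. \<bar>f x\<bar> \<le> B"
  shows "square_integrable M f"
proof (rule norm2_mono(1))
  show "square_integrable M (\<lambda>_. B)" by (simp add: square_integrable_def)
  show "\<bar>f x\<bar> \<le> \<bar>B\<bar>" for x using assms(2)[of x] by linarith
qed (rule assms(1))

lemma borel_measurable_cnj [measurable]: "cnj \<in> borel_measurable borel"
  by (intro borel_measurable_continuous_onI continuous_intros)

text \<open>Measurability is asked of \<open>f\<close> itself, since it does not follow from that of
  the modulus.\<close>

definition csquare_integrable :: "(real \<times> real \<Rightarrow> complex) \<Rightarrow> bool" where
  "csquare_integrable f \<longleftrightarrow> f \<in> borel_measurable borel \<and> square_integrable U2 (\<lambda>x. norm (f x))"

definition cnorm2 :: "(real \<times> real \<Rightarrow> complex) \<Rightarrow> real" where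
  "cnorm2 f = norm2 U2 (\<lambda>x. norm (f x))"

lemma cnorm2_nonneg [simp]: "0 \<le> cnorm2 f"
  by (simp add: cnorm2_def)

lemma csquare_integrableD: "csquare_integrable f \<Longrightarrow> f \<in> borel_measurable borel" "csquare_integrable f \<Longrightarrow> square_integrable U2 (\<lambda>x. norm (f x))"
  by (auto simp: csquare_integrable_def)

lemma csquare_integrable_add:
  assumes "csquare_integrable f" "csquare_integrable g"
  shows "csquare_integrable (\<lambda>x. f x + g x)" "cnorm2 (\<lambda>x. f x + g x) \<le> cnorm2 f + cnorm2 g"
proof -
  note [measurable] = csquare_integrableD(1)[OF assms(1)] csquare_integrableD(1)[OF assms(2)]
  have s: "square_integrable U2 (\<lambda>x. norm (f x) + norm (g x))"
    using assms by (intro square_integrable_add csquare_integrableD)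
  have *: "\<bar>norm (f x + g x)\<bar> \<le> \<bar>norm (f x) + norm (g x)\<bar>" for x
    by (simp add: norm_triangle_ineq)
  have m: "(\<lambda>x. norm (f x + g x)) \<in> borel_measurable U2" by simp
  show "csquare_integrable (\<lambda>x. f x + g x)"
    using norm2_mono(1)[OF s m *] by (simp add: csquare_integrable_def)
  show "cnorm2 (\<lambda>x. f x + g x) \<le> cnorm2 f + cnorm2 g"
    unfolding cnorm2_def using norm2_mono(2)[OF s m *] norm2_triangle[OF assms[THEN csquare_integrableD(2)]] by linarith
qed

lemma csquare_integrable_cmult:
  assumes "csquare_integrable f"
  shows "csquare_integrable (\<lambda>x. c * f x)" "cnorm2 (\<lambda>x. c * f x) = norm c * cnorm2 f"
proof -
  note [measurable] = csquare_integrableD(1)[OF assms(1)]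
  show "csquare_integrable (\<lambda>x. c * f x)"
    using square_integrable_cmult[OF csquare_integrableD(2)[OF assms], of "norm c"] by (simp add: csquare_integrable_def norm_mult)
  show "cnorm2 (\<lambda>x. c * f x) = norm c * cnorm2 f"
    by (simp add: cnorm2_def norm2_def norm_mult power_mult_distrib real_sqrt_mult)
qed

lemma csquare_integrable_diff:
  assumes "csquare_integrable f" "csquare_integrable g"
  shows "csquare_integrable (\<lambda>x. f x - g x)"
  using csquare_integrable_add(1)[OF assms(1) csquare_integrable_cmult(1)[OF assms(2), of "-1"]] by simp

lemma cnorm2_diff_triangle:
  assumes "csquare_integrable f" "csquare_integrable g" "csquare_integrable h"
  shows "cnorm2 (\<lambda>x. f x - h x) \<le> cnorm2 (\<lambda>x. f x - g x) + cnorm2 (\<lambda>x. g x - h x)"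
  using csquare_integrable_add(2)[OF csquare_integrable_diff[OF assms(1,2)] csquare_integrable_diff[OF assms(2,3)]] by simp

lemma csquare_integrable_bounded:
  assumes "f \<in> borel_measurable borel" "\<And>x. norm (f x) \<le> B"
  shows "csquare_integrable f" "cnorm2 f \<le> B"
proof -
  have "0 \<le> B" using norm_ge_zero assms(2) by (rule order_trans)
  have "square_integrable U2 (\<lambda>_. B)" by (simp add: square_integrable_def)
  note n = norm2_mono[OF this, of "\<lambda>x. norm (f x)"]
  show "csquare_integrable f" unfolding csquare_integrable_def using n(1) assms \<open>0 \<le> B\<close> by auto
  have "cnorm2 f \<le> norm2 U2 (\<lambda>_. B)"
    unfolding cnorm2_def using n(2) assms \<open>0 \<le> B\<close> by auto
  also have "\<dots> = B" using \<open>0 \<le> B\<close> U2.prob_space by (simp add: norm2_def)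
  finally show "cnorm2 f \<le> B" .
qed

lemma csquare_integrable_integrable:
  assumes "csquare_integrable f" shows "integrable U2 f"
  using U2.square_integrable_integrable[OF csquare_integrableD(2)[OF assms]] csquare_integrableD(1)[OF assms] by (simp add: integrable_norm_iff)

lemma csquare_integrable_of_real: "csquare_integrable (\<lambda>x. of_real (f x)) \<longleftrightarrow> square_integrable U2 f"
proof
  assume a: "csquare_integrable (\<lambda>x. of_real (f x))"
  have "f = (\<lambda>x. Re (of_real (f x)))" by simp
  also have "\<dots> \<in> borel_measurable borel"
    by (intro measurable_compose[OF csquare_integrableD(1)[OF a]]) simp
  finally show "square_integrable U2 f" using csquare_integrableD(2)[OF a] by (simp add: square_integrable_def)
qed (auto simp: csquare_integrable_def square_integrable_def)

lemma cnorm2_of_real: "cnorm2 (\<lambda>x. of_real (f x)) = norm2 U2 f"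
  by (simp add: cnorm2_def norm2_def)

lemma csquare_integrable_Re:
  assumes "csquare_integrable f" shows "square_integrable U2 (\<lambda>x. Re (f x))" "norm2 U2 (\<lambda>x. Re (f x)) \<le> cnorm2 f"
proof -
  have m: "(\<lambda>x. Re (f x)) \<in> borel_measurable U2" using csquare_integrableD(1)[OF assms] by simp
  show "square_integrable U2 (\<lambda>x. Re (f x))" "norm2 U2 (\<lambda>x. Re (f x)) \<le> cnorm2 f"
    unfolding cnorm2_def using norm2_mono[OF csquare_integrableD(2)[OF assms] m] abs_Re_le_cmod by auto
qed

section \<open>Characters of the torus, finite Fourier sums and Bessel's inequality\<close>

definition echar :: "int \<times> int \<Rightarrow> real \<times> real \<Rightarrow> complex" where
  "echar k x = cis (2 * pi * (of_int (fst k) * fst x + of_int (snd k) * snd x))"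

lemma norm_echar [simp]: "norm (echar k x) = 1"
  by (simp add: echar_def)

lemma continuous_echar [continuous_intros]:
  assumes "continuous_on S f" shows "continuous_on S (\<lambda>x. echar k (f x))"
  unfolding echar_def cis_conv_exp by (intro continuous_intros assms)

lemma borel_measurable_echar [measurable]: "echar k \<in> borel_measurable borel"
  by (intro borel_measurable_continuous_onI continuous_intros)

lemma echar_mult: "echar k x * echar l x = echar (k + l) x"
  by (simp add: echar_def cis_mult algebra_simps)

lemma cnj_echar: "cnj (echar k x) = echar (- k) x"
  by (simp add: echar_def cis_cnj algebra_simps)

lemma echar_add: "echar k (x + y) = echar k x * echar k y"
  by (simp add: echar_def cis_mult algebra_simps)

lemma echar_0 [simp]: "echar 0 x = 1"
  by (simp add: echar_def)

lemma echar_periodic: "echar k (x + (1, 0)) = echar k x" "echar k (x + (0, 1)) = echar k x"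
proof -
  have "echar k (1, 0) = 1" "echar k (0, 1) = 1"
    by (simp_all add: echar_def cis_multiple_2pi)
  then show "echar k (x + (1, 0)) = echar k x" "echar k (x + (0, 1)) = echar k x"
    by (simp_all add: echar_add)
qed

lemma integral_cis_U: "(\<integral>x. cis (2 * pi * (of_int m * x)) \<partial>U) = (if m = 0 then 1 else 0)"
proof (cases "m = 0")
  case True
  then show ?thesis using U.prob_space by simp
next
  case False
  let ?c = "2 * pi * of_int m * \<i>"
  have D: "((\<lambda>x. cis (2 * pi * (of_int m * x)) / ?c) has_vector_derivative cis (2 * pi * (of_int m * x))) (at x)" for x
  proof -
    have "((\<lambda>z. exp (?c * z) / ?c) has_field_derivative exp (?c * of_real x)) (at (of_real x))"
      using False by (auto intro!: derivative_eq_intros)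
    from has_vector_derivative_real_field[OF this] show ?thesis
      by (simp add: cis_conv_exp mult_ac)
  qed
  have "(\<integral>x. cis (2 * pi * (of_int m * x)) \<partial>U) = cis (2 * pi * (of_int m * 1)) / ?c - cis (2 * pi * (of_int m * 0)) / ?c"
    by (rule integral_seg_FTC[OF _ _ D]) (auto intro!: continuous_intros simp: cis_conv_exp)
  also have "\<dots> = 0"
    using cis_multiple_2pi[of "of_int m"] by (simp add: Ints_of_int)
  finally show ?thesis using False by simp
qed

lemma integral_U2:
  fixes f :: "real \<times> real \<Rightarrow> 'a::euclidean_space"
  assumes "integrable U2 f"
  shows "(\<integral>x. f x \<partial>U2) = (\<integral>y. \<integral>x. f (x, y) \<partial>U \<partial>U)"
  using U2.integral_snd[of "\<lambda>x y. f (x, y)"] assms by simp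

lemma integral_echar: "(\<integral>x. echar k x \<partial>U2) = (if k = 0 then 1 else 0)"
proof -
  have i: "integrable U2 (echar k)"
    by (intro integrable_segs_continuous continuous_intros)
  have e: "echar k (x, y) = cis (2 * pi * (of_int (fst k) * x)) * cis (2 * pi * (of_int (snd k) * y))" for x y
    by (simp add: echar_def cis_mult algebra_simps)
  show ?thesis
    unfolding integral_U2[OF i] e by (simp add: integral_cis_U zero_prod_def prod_eq_iff)
qed

lemma integral_echar_cnj: "(\<integral>x. echar k x * cnj (echar l x) \<partial>U2) = (if k = l then 1 else 0)"
  by (simp add: cnj_echar echar_mult integral_echar)

definition fcoeff :: "(real \<times> real \<Rightarrow> complex) \<Rightarrow> int \<times> int \<Rightarrow> complex" where
  "fcoeff f k = (\<integral>x. f x * cnj (echar k x) \<partial>U2)"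

definition fourier_sum :: "(int \<times> int) set \<Rightarrow> (int \<times> int \<Rightarrow> complex) \<Rightarrow> real \<times> real \<Rightarrow> complex" where
  "fourier_sum K a x = (\<Sum>k\<in>K. a k * echar k x)"

lemma continuous_fourier_sum [continuous_intros]: "continuous_on S f \<Longrightarrow> continuous_on S (\<lambda>x. fourier_sum K a (f x))"
  unfolding fourier_sum_def by (intro continuous_intros)

lemma borel_measurable_fourier_sum [measurable]: "fourier_sum K a \<in> borel_measurable borel"
  by (intro borel_measurable_continuous_onI continuous_intros)

lemma norm_fourier_sum_le: "norm (fourier_sum K a x) \<le> (\<Sum>k\<in>K. norm (a k))"
  unfolding fourier_sum_def by (rule order_trans[OF norm_sum]) (simp add: norm_mult)

lemma csquare_integrable_fourier_sum: "csquare_integrable (fourier_sum K a)"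
  by (rule csquare_integrable_bounded(1)[OF borel_measurable_fourier_sum norm_fourier_sum_le])

lemma integrable_mult_echar:
  assumes "integrable U2 f" shows "integrable U2 (\<lambda>x. f x * cnj (echar k x))"
  by (rule Bochner_Integration.integrable_bound[OF assms])
     (use borel_measurable_integrable[OF assms] in \<open>auto simp: norm_mult intro!: borel_measurable_times\<close>)

lemma fcoeff_add: "integrable U2 f \<Longrightarrow> integrable U2 g \<Longrightarrow> fcoeff (\<lambda>x. f x + g x) k = fcoeff f k + fcoeff g k"
  unfolding fcoeff_def by (simp add: distrib_right integrable_mult_echar)

lemma fcoeff_diff: "integrable U2 f \<Longrightarrow> integrable U2 g \<Longrightarrow> fcoeff (\<lambda>x. f x - g x) k = fcoeff f k - fcoeff g k"
  unfolding fcoeff_def by (simp add: left_diff_distrib integrable_mult_echar)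

lemma fcoeff_cmult: "fcoeff (\<lambda>x. c * f x) k = c * fcoeff f k"
  unfolding fcoeff_def by (simp add: mult.assoc)

lemma fcoeff_echar: "fcoeff (echar l) k = (if k = l then 1 else 0)"
  unfolding fcoeff_def integral_echar_cnj by auto

lemma norm_fcoeff_le:
  assumes "integrable U2 f" shows "norm (fcoeff f k) \<le> (\<integral>x. norm (f x) \<partial>U2)"
  unfolding fcoeff_def by (rule order_trans[OF integral_norm_bound]) (simp add: norm_mult)

lemma fourier_sum_norm_square:
  assumes "finite K"
  shows "(cnorm2 (fourier_sum K a))\<^sup>2 = (\<Sum>k\<in>K. (norm (a k))\<^sup>2)"
proof -
  have i: "integrable U2 (\<lambda>x. b * (echar k x * cnj (echar l x)))" for b k l
    by (intro integrable_segs_continuous continuous_intros)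
  have "complex_of_real ((cnorm2 (fourier_sum K a))\<^sup>2) = (\<integral>x. fourier_sum K a x * cnj (fourier_sum K a x) \<partial>U2)"
    unfolding cnorm2_def norm2_square integral_complex_of_real[symmetric] complex_norm_square ..
  also have "\<dots> = (\<integral>x. (\<Sum>k\<in>K. \<Sum>l\<in>K. a k * cnj (a l) * (echar k x * cnj (echar l x))) \<partial>U2)"
    by (simp add: fourier_sum_def sum_product mult_ac)
  also have "\<dots> = (\<Sum>k\<in>K. \<Sum>l\<in>K. a k * cnj (a l) * (\<integral>x. echar k x * cnj (echar l x) \<partial>U2))"
    using i by (simp add: Bochner_Integration.integral_sum Bochner_Integration.integrable_sum)
  also have "\<dots> = (\<Sum>k\<in>K. a k * cnj (a k))"
    using assms by (simp add: integral_echar_cnj if_distrib sum.delta cong: if_cong)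
  also have "\<dots> = complex_of_real (\<Sum>k\<in>K. (norm (a k))\<^sup>2)"
    by (simp only: of_real_sum complex_norm_square)
  finally show ?thesis by (simp only: of_real_eq_iff)
qed

text \<open>Expand the squared distance between \<open>f\<close> and its partial sum: the mixed term
  and the square of the partial sum are both given by the sum of the squared coefficients.\<close>

lemma Bessel:
  assumes f: "csquare_integrable f" and K: "finite K"
  shows "(\<Sum>k\<in>K. (norm (fcoeff f k))\<^sup>2) \<le> (cnorm2 f)\<^sup>2"
proof -
  let ?s = "fourier_sum K (fcoeff f)"
  note [measurable] = csquare_integrableD(1)[OF f]
  have if2: "integrable U2 (\<lambda>x. (norm (f x))\<^sup>2)" "integrable U2 (\<lambda>x. (norm (?s x))\<^sup>2)"
    using csquare_integrableD(2)[OF f] csquare_integrableD(2)[OF csquare_integrable_fourier_sum] by (auto simp: square_integrable_def)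
  have ifs: "integrable U2 (\<lambda>x. f x * cnj (?s x))"
    unfolding fourier_sum_def cnj_sum sum_distrib_left complex_cnj_mult mult.left_commute[of "f _"]
    by (intro Bochner_Integration.integrable_sum integrable_mult_right integrable_mult_echar csquare_integrable_integrable f)
  have "(\<integral>x. f x * cnj (?s x) \<partial>U2) = (\<Sum>k\<in>K. cnj (fcoeff f k) * fcoeff f k)"
    unfolding fourier_sum_def cnj_sum sum_distrib_left complex_cnj_mult mult.left_commute[of "f _"]
    by (subst Bochner_Integration.integral_sum, intro integrable_mult_right integrable_mult_echar csquare_integrable_integrable f)
       (simp add: fcoeff_def)
  also have "\<dots> = of_real (\<Sum>k\<in>K. (norm (fcoeff f k))\<^sup>2)"
    by (simp only: of_real_sum complex_norm_square mult.commute)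
  finally have I: "(\<integral>x. Re (f x * cnj (?s x)) \<partial>U2) = (\<Sum>k\<in>K. (norm (fcoeff f k))\<^sup>2)"
    by (metis Re_complex_of_real ifs integral_Re)
  have "0 \<le> (\<integral>x. (norm (f x - ?s x))\<^sup>2 \<partial>U2)" by simp
  also have "\<dots> = (\<integral>x. (norm (f x))\<^sup>2 + (norm (?s x))\<^sup>2 - 2 * Re (f x * cnj (?s x)) \<partial>U2)"
    by (intro Bochner_Integration.integral_cong refl, simp only: cmod_power2)
       (simp add: power2_eq_square algebra_simps)
  also have "\<dots> = (cnorm2 f)\<^sup>2 + (cnorm2 ?s)\<^sup>2 - 2 * (\<Sum>k\<in>K. (norm (fcoeff f k))\<^sup>2)"
    using if2 integrable_Re[OF ifs] I by (simp add: cnorm2_def norm2_square del: times_complex.sel distrib_left_numeral)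
  finally show ?thesis by (simp add: fourier_sum_norm_square[OF K])
qed

text \<open>Orthonormality of the characters followed by Bessel. It serves twice: for Fejer means,
  and for the Hilbert transform, whose multipliers have modulus at most 1.\<close>

lemma multiplier_bound:
  assumes "csquare_integrable f" "finite K" "\<And>k. k \<in> K \<Longrightarrow> norm (c k) \<le> 1"
  shows "cnorm2 (fourier_sum K (\<lambda>k. c k * fcoeff f k)) \<le> cnorm2 f"
proof (rule power2_le_imp_le)
  have "(cnorm2 (fourier_sum K (\<lambda>k. c k * fcoeff f k)))\<^sup>2 \<le> (\<Sum>k\<in>K. (norm (fcoeff f k))\<^sup>2)"
    unfolding fourier_sum_norm_square[OF assms(2)] norm_mult
    by (intro sum_mono power_mono) (use assms(3) in \<open>auto intro: mult_left_le_one_le\<close>)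
  also have "\<dots> \<le> (cnorm2 f)\<^sup>2" by (rule Bessel[OF assms(1,2)])
  finally show "(cnorm2 (fourier_sum K (\<lambda>k. c k * fcoeff f k)))\<^sup>2 \<le> (cnorm2 f)\<^sup>2" .
qed simp

section \<open>Fejer means\<close>

text \<open>This is \<open>max 0 (1 - |m| / (N + 1))\<close>. The count of pairs is the form in
  which the coefficient appears when the squared modulus in \<open>fejk\<close> is multiplied
  out.\<close>

definition fejw :: "nat \<Rightarrow> int \<Rightarrow> real" where
  "fejw N m = real (card {p \<in> {..N} \<times> {..N}. int (fst p) - int (snd p) = m}) / (real N + 1)"

text \<open>The Fejer kernel, written as a squared modulus so that its sign is visible.\<close>

definition fejk :: "nat \<Rightarrow> real \<Rightarrow> real" where
  "fejk N t = (norm (\<Sum>j\<le>N. cis (2 * pi * (real j * t))))\<^sup>2 / (real N + 1)"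

definition fbox :: "nat \<Rightarrow> (int \<times> int) set" where
  "fbox N = {- int N..int N} \<times> {- int N..int N}"

definition fej2 :: "nat \<Rightarrow> int \<times> int \<Rightarrow> real" where
  "fej2 N k = fejw N (fst k) * fejw N (snd k)"

definition Fej :: "nat \<Rightarrow> (real \<times> real \<Rightarrow> complex) \<Rightarrow> real \<times> real \<Rightarrow> complex" where
  "Fej N f = fourier_sum (fbox N) (\<lambda>k. of_real (fej2 N k) * fcoeff f k)"

lemma finite_fbox [simp]: "finite (fbox N)"
  by (simp add: fbox_def)

lemma fejw_nonneg: "0 \<le> fejw N m"
  by (simp add: fejw_def)

lemma fejw_le_1: "fejw N m \<le> 1"
proof -
  have "card {p \<in> {..N} \<times> {..N}. int (fst p) - int (snd p) = m} \<le> card {..N}"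
    by (rule card_inj_on_le[of fst]) (auto simp: inj_on_def)
  then show ?thesis by (simp add: fejw_def)
qed

lemma fejw_0: "fejw N 0 = 1"
proof -
  have "{p \<in> {..N} \<times> {..N}. int (fst p) - int (snd p) = 0} = (\<lambda>j. (j, j)) ` {..N}"
    by auto
  then show ?thesis
    by (simp add: fejw_def card_image inj_on_def)
qed

lemma fejw_ge: "1 - real_of_int \<bar>m\<bar> / (real N + 1) \<le> fejw N m"
proof -
  let ?f = "\<lambda>j. (j + nat m, j + nat (- m))"
  have "card {j. j + nat \<bar>m\<bar> \<le> N} \<le> card {p \<in> {..N} \<times> {..N}. int (fst p) - int (snd p) = m}"
    by (rule card_inj_on_le[of ?f]) (auto simp: inj_on_def)
  moreover have "{j. j + nat \<bar>m\<bar> \<le> N} = {..<N + 1 - nat \<bar>m\<bar>}" by auto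
  ultimately have "real (N + 1) - real (nat \<bar>m\<bar>) \<le> real (card {p \<in> {..N} \<times> {..N}. int (fst p) - int (snd p) = m})"
    by simp
  from divide_right_mono[OF this, of "real N + 1"] show ?thesis
    by (simp add: fejw_def diff_divide_distrib add.commute)
qed

lemma fejw_tendsto: "(\<lambda>N. fejw N m) \<longlonglongrightarrow> 1"
proof (rule tendsto_sandwich)
  show "(\<lambda>N. 1 - real_of_int \<bar>m\<bar> / (real N + 1)) \<longlonglongrightarrow> 1"
    by real_asymp
qed (use fejw_ge fejw_le_1 in auto)

lemma fejw_outside: "int N < \<bar>m\<bar> \<Longrightarrow> fejw N m = 0"
proof -
  assume "int N < \<bar>m\<bar>"
  then have "{p \<in> {..N} \<times> {..N}. int (fst p) - int (snd p) = m} = {}" by auto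
  then show ?thesis unfolding fejw_def by (metis card.empty div_0 of_nat_0)
qed

lemma fej2_outside: "k \<notin> fbox N \<Longrightarrow> fej2 N k = 0"
  by (cases k) (auto simp: fej2_def fbox_def fejw_outside not_le)

lemma fej2_nonneg: "0 \<le> fej2 N k"
  by (simp add: fej2_def fejw_nonneg)

lemma fej2_le_1: "fej2 N k \<le> 1"
  unfolding fej2_def using mult_mono[OF fejw_le_1 fejw_le_1] by (simp add: fejw_nonneg)

lemma fej2_tendsto: "(\<lambda>N. fej2 N k) \<longlonglongrightarrow> 1"
  unfolding fej2_def using tendsto_mult[OF fejw_tendsto fejw_tendsto] by simp

lemma fejk_nonneg: "0 \<le> fejk N t"
  by (simp add: fejk_def)

text \<open>The product of the exponential sum with its conjugate is a sum over pairs, which is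
  regrouped by their difference.\<close>

lemma fejk_eq_sum: "complex_of_real (fejk N t) = (\<Sum>m\<in>{- int N..int N}. of_real (fejw N m) * cis (2 * pi * (of_int m * t)))"
proof -
  let ?S = "{..N} \<times> {..N}"
  have nz: "complex_of_nat N + 1 \<noteq> 0"
    by (metis of_nat_Suc of_nat_neq_0 add.commute)
  have "complex_of_real ((norm (\<Sum>j\<le>N. cis (2 * pi * (real j * t))))\<^sup>2)
     = (\<Sum>p\<in>?S. cis (2 * pi * (real_of_int (int (fst p) - int (snd p)) * t)))"
    unfolding complex_norm_square cnj_sum sum_product sum.cartesian_product
    by (intro sum.cong) (auto simp: cis_cnj cis_mult algebra_simps)
  also have "\<dots> = (\<Sum>m\<in>{- int N..int N}. \<Sum>p\<in>{p \<in> ?S. int (fst p) - int (snd p) = m}.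
      cis (2 * pi * (real_of_int (int (fst p) - int (snd p)) * t)))"
    by (rule sum.group[symmetric]) auto
  also have "\<dots> = (\<Sum>m\<in>{- int N..int N}. \<Sum>p\<in>{p \<in> ?S. int (fst p) - int (snd p) = m}.
      cis (2 * pi * (real_of_int m * t)))"
    by (intro sum.cong) auto
  also have "\<dots> = (\<Sum>m\<in>{- int N..int N}. (real N + 1) * (of_real (fejw N m) * cis (2 * pi * (of_int m * t))))"
    using nz by (intro sum.cong) (auto simp: fejw_def)
  finally have "complex_of_real ((norm (\<Sum>j\<le>N. cis (2 * pi * (real j * t))))\<^sup>2) =
     (real N + 1) * (\<Sum>m\<in>{- int N..int N}. of_real (fejw N m) * cis (2 * pi * (of_int m * t)))"
    by (simp add: sum_distrib_left)
  then show ?thesis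
    using nz by (simp add: fejk_def field_simps)
qed

lemma continuous_fejk [continuous_intros]: "continuous_on S f \<Longrightarrow> continuous_on S (\<lambda>x. fejk N (f x))"
  unfolding fejk_def cis_conv_exp by (intro continuous_intros) auto

lemma borel_measurable_fejk [measurable]: "fejk N \<in> borel_measurable borel"
  by (intro borel_measurable_continuous_onI continuous_intros)

lemma integral_fejk: "(\<integral>x. fejk N (x - y) \<partial>U) = 1"
proof -
  have i: "integrable U (\<lambda>x. c * cis (2 * pi * (of_int m * (x - y))))" for m c
    unfolding cis_conv_exp by (intro integrable_seg_continuous continuous_intros)
  have e: "cis (2 * pi * (of_int m * (x - y))) = cis (2 * pi * (of_int m * x)) * cis (- 2 * pi * (of_int m * y))" for m x
    by (simp add: cis_mult algebra_simps)
  have "complex_of_real (\<integral>x. fejk N (x - y) \<partial>U) = (\<integral>x. complex_of_real (fejk N (x - y)) \<partial>U)"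
    by simp
  also have "\<dots> = (\<Sum>m\<in>{- int N..int N}. \<integral>x. of_real (fejw N m) * cis (2 * pi * (of_int m * (x - y))) \<partial>U)"
    unfolding fejk_eq_sum by (rule Bochner_Integration.integral_sum) (rule i)
  also have "\<dots> = (\<Sum>m\<in>{- int N..int N}. of_real (fejw N m) * ((if m = 0 then 1 else 0) * cis (- 2 * pi * (of_int m * y))))"
    unfolding e by (simp add: integral_cis_U)
  also have "\<dots> = (\<Sum>m\<in>{- int N..int N}. if m = 0 then 1 else 0)"
    by (intro sum.cong) (auto simp: fejw_0)
  also have "\<dots> = 1" by simp
  finally show ?thesis by (simp only: of_real_eq_1_iff)
qed

lemma nn_integral_fejk: "(\<integral>\<^sup>+x. ennreal (fejk N (x - y)) \<partial>U) = 1"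
  using integral_fejk[of N y]
  by (subst nn_integral_eq_integral)
     (auto intro!: integrable_seg_continuous continuous_intros fejk_nonneg)

lemma fejk_product:
  "complex_of_real (fejk N (fst x - fst y) * fejk N (snd x - snd y)) = (\<Sum>k\<in>fbox N. of_real (fej2 N k) * echar k x * cnj (echar k y))"
  unfolding of_real_mult fejk_eq_sum sum_product sum.cartesian_product fbox_def
  by (intro sum.cong) (auto simp: fej2_def echar_def cis_cnj cis_mult algebra_simps)

lemma Fej_kernel:
  assumes "integrable U2 f"
  shows "Fej N f x = (\<integral>y. f y * of_real (fejk N (fst x - fst y) * fejk N (snd x - snd y)) \<partial>U2)"
proof -
  have "(\<integral>y. f y * of_real (fejk N (fst x - fst y) * fejk N (snd x - snd y)) \<partial>U2)
    = (\<integral>y. (\<Sum>k\<in>fbox N. (of_real (fej2 N k) * echar k x) * (f y * cnj (echar k y))) \<partial>U2)"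
    unfolding fejk_product by (simp add: sum_distrib_left mult_ac)
  also have "\<dots> = (\<Sum>k\<in>fbox N. (of_real (fej2 N k) * echar k x) * fcoeff f k)"
    by (subst Bochner_Integration.integral_sum, intro integrable_mult_right integrable_mult_echar assms)
       (simp add: fcoeff_def)
  finally show ?thesis by (simp add: Fej_def fourier_sum_def mult_ac)
qed

text \<open>The kernel is nonnegative and has integral 1 for each fixed \<open>y\<close>, so
  Tonelli's theorem suffices. Plain partial sums, whose kernel changes sign, are not uniformly
  bounded on \<open>L1\<close>.\<close>

lemma Fej_L1_contraction:
  assumes f: "integrable U2 f"
  shows "(\<integral>x. norm (Fej N f x) \<partial>U2) \<le> (\<integral>x. norm (f x) \<partial>U2)"
proof -
  have [measurable]: "f \<in> borel_measurable borel"
    using borel_measurable_integrable[OF f] by simp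
  have K: "(\<integral>\<^sup>+x. ennreal (fejk N (fst x - fst y) * fejk N (snd x - snd y)) \<partial>U2) = 1" for y
    by (subst nn_integral_U2) (simp_all add: ennreal_mult fejk_nonneg nn_integral_cmult nn_integral_multc nn_integral_fejk)
  have i: "integrable U2 (\<lambda>y. f y * of_real (fejk N (fst x - fst y) * fejk N (snd x - snd y)))" for x
  proof -
    show ?thesis
      unfolding fejk_product sum_distrib_left mult.left_commute[of "f _"]
      by (intro Bochner_Integration.integrable_sum integrable_mult_right integrable_mult_echar f)
  qed
  have "ennreal (\<integral>x. norm (Fej N f x) \<partial>U2) = (\<integral>\<^sup>+x. ennreal (norm (Fej N f x)) \<partial>U2)"
    by (subst nn_integral_eq_integral)
       (auto simp: Fej_def intro!: integrable_segs_continuous continuous_intros)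
  also have "\<dots> \<le> (\<integral>\<^sup>+x. \<integral>\<^sup>+y. ennreal (norm (f y)) * ennreal (fejk N (fst x - fst y) * fejk N (snd x - snd y)) \<partial>U2 \<partial>U2)"
  proof (rule nn_integral_mono)
    fix x
    have "ennreal (norm (Fej N f x)) \<le> (\<integral>\<^sup>+y. norm (f y * of_real (fejk N (fst x - fst y) * fejk N (snd x - snd y))) \<partial>U2)"
      unfolding Fej_kernel[OF f] using i by (rule integral_norm_bound_ennreal)
    then show "ennreal (norm (Fej N f x)) \<le> (\<integral>\<^sup>+y. ennreal (norm (f y)) * ennreal (fejk N (fst x - fst y) * fejk N (snd x - snd y)) \<partial>U2)"
      by (simp add: norm_mult ennreal_mult fejk_nonneg)
  qed
  also have "\<dots> = (\<integral>\<^sup>+y. \<integral>\<^sup>+x. ennreal (norm (f y)) * ennreal (fejk N (fst x - fst y) * fejk N (snd x - snd y)) \<partial>U2 \<partial>U2)"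
  proof -
    interpret P: pair_sigma_finite U2 U2 ..
    show ?thesis
      using borel_measurable_integrable[OF f, measurable] by (intro P.Fubini'[symmetric]) measurable
  qed
  also have "\<dots> = (\<integral>\<^sup>+y. ennreal (norm (f y)) \<partial>U2)"
    by (simp add: nn_integral_cmult K)
  also have "\<dots> = ennreal (\<integral>x. norm (f x) \<partial>U2)"
    using f by (simp add: nn_integral_eq_integral)
  finally show ?thesis by simp
qed

lemma csquare_integrable_Fej: "csquare_integrable (Fej N f)"
  unfolding Fej_def by (rule csquare_integrable_fourier_sum)

lemma continuous_Fej [continuous_intros]: "continuous_on S g \<Longrightarrow> continuous_on S (\<lambda>x. Fej N f (g x))"
  unfolding Fej_def by (intro continuous_intros)

lemma Fej_L2_contraction: "csquare_integrable f \<Longrightarrow> cnorm2 (Fej N f) \<le> cnorm2 f"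
  unfolding Fej_def by (rule multiplier_bound) (auto simp: fej2_nonneg fej2_le_1)

lemma Fej_add: "integrable U2 f \<Longrightarrow> integrable U2 g \<Longrightarrow> Fej N (\<lambda>x. f x + g x) x = Fej N f x + Fej N g x"
  by (simp add: Fej_def fourier_sum_def fcoeff_add algebra_simps sum.distrib)

lemma Fej_diff: "integrable U2 f \<Longrightarrow> integrable U2 g \<Longrightarrow> Fej N (\<lambda>x. f x - g x) x = Fej N f x - Fej N g x"
  by (simp add: Fej_def fourier_sum_def fcoeff_diff algebra_simps sum_subtractf)

lemma Fej_cmult: "Fej N (\<lambda>x. c * f x) x = c * Fej N f x"
  by (simp add: Fej_def fourier_sum_def fcoeff_cmult sum_distrib_left mult_ac)

text \<open>The inductive form lets convergence of Fejer means be checked on characters alone.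
  Closure under products, proved below, admits polynomials in cosines and the product of two Fejer
  means.\<close>

inductive trig :: "(real \<times> real \<Rightarrow> complex) \<Rightarrow> bool" where
  echar: "trig (echar k)"
| add: "trig f \<Longrightarrow> trig g \<Longrightarrow> trig (\<lambda>x. f x + g x)"
| cmult: "trig f \<Longrightarrow> trig (\<lambda>x. c * f x)"

lemma trig_const: "trig (\<lambda>x. c)"
  using trig.cmult[OF trig.echar[of 0], of c] by simp

lemma trig_continuous: "trig f \<Longrightarrow> continuous_on UNIV f"
  by (induction rule: trig.induct) (auto intro!: continuous_intros)

lemma trig_sum: "(\<And>i. i \<in> I \<Longrightarrow> trig (f i)) \<Longrightarrow> trig (\<lambda>x. \<Sum>i\<in>I. f i x)"
  by (induction I rule: infinite_finite_induct) (auto intro: trig_const trig.add)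

lemma trig_fourier_sum: "trig (fourier_sum K a)"
  unfolding fourier_sum_def[abs_def] by (intro trig_sum trig.intros)

lemma trig_mult: 
  assumes "trig f" "trig g" shows "trig (\<lambda>x. f x * g x)"
  using assms(1)
proof induction
  case (echar k)
  show ?case using assms(2)
  proof induction
    case (echar l)
    then show ?case by (simp add: echar_mult trig.echar[unfolded eta_contract_eq])
  next
    case (add f g)
    then show ?case by (auto simp: distrib_left intro: trig.add)
  next
    case (cmult f c)
    then show ?case using trig.cmult[OF cmult.IH, of c] by (simp add: mult_ac)
  qed
qed (auto simp: distrib_right mult.assoc intro: trig.intros)

lemma trig_cnj: "trig f \<Longrightarrow> trig (\<lambda>x. cnj (f x))"
proof (induction rule: trig.induct)
  case (echar k)
  show ?case unfolding cnj_echar by (rule trig.echar)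
qed (auto intro: trig.intros)

lemma trig_Re:
  assumes "trig f" shows "trig (\<lambda>x. of_real (Re (f x)))"
proof -
  have "(\<lambda>x. complex_of_real (Re (f x))) = (\<lambda>x. 1/2 * (f x + cnj (f x)))"
    by (auto simp: fun_eq_iff complex_eq_iff)
  then show ?thesis
    using trig.cmult[OF trig.add[OF assms trig_cnj[OF assms]], of "1/2"] by simp
qed

lemma trig_csquare_integrable:
  assumes "trig f" shows "csquare_integrable f"
proof -
  have "\<exists>B. \<forall>x. norm (f x) \<le> B" using assms
  proof induction
    case (echar k)
    then show ?case by (intro exI[of _ 1]) simp
  next
    case (add f g)
    then obtain A B where "\<And>x. norm (f x) \<le> A" "\<And>x. norm (g x) \<le> B" by auto
    then show ?case
      by (intro exI[of _ "A + B"]) (auto intro!: order_trans[OF norm_triangle_ineq] add_mono)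
  next
    case (cmult f c)
    then obtain A where "\<And>x. norm (f x) \<le> A" by auto
    then show ?case
      by (intro exI[of _ "norm c * A"]) (auto simp: norm_mult intro: mult_left_mono)
  qed
  then show ?thesis
    using csquare_integrable_bounded(1) borel_measurable_continuous_onI[OF trig_continuous[OF assms]] by blast
qed

text \<open>On a character \<open>Fej N\<close> is multiplication by \<open>fej2 N k\<close>, which
  tends to 1; the error is therefore uniform in \<open>x\<close>, and this is stable under sums and
  multiples.\<close>

lemma Fej_trig:
  assumes "trig f"
  shows "\<exists>B. B \<longlonglongrightarrow> 0 \<and> (\<forall>N x. norm (Fej N f x - f x) \<le> B N)"
  using assms
proof induction
  case (echar k)
  have "Fej N (echar k) x = of_real (fej2 N k) * echar k x" for N x
  proof -
    have "Fej N (echar k) x = (\<Sum>l\<in>fbox N. if l = k then of_real (fej2 N k) * echar k x else 0)"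
      unfolding Fej_def fourier_sum_def by (intro sum.cong) (auto simp: fcoeff_echar)
    \<comment> \<open>For \<open>k\<close> outside the box no summand matches, and the formula
      persists because \<open>fej2 N k = 0\<close>.\<close>
    then show ?thesis using fej2_outside[of k N] by auto
  qed
  then have "norm (Fej N (echar k) x - echar k x) = \<bar>fej2 N k - 1\<bar>" for N x
  proof -
    have "of_real (fej2 N k) * echar k x - echar k x = of_real (fej2 N k - 1) * echar k x" by (simp add: algebra_simps)
    then show ?thesis using \<open>\<And>N x. Fej N (echar k) x = _\<close> by (simp only: norm_mult norm_of_real norm_echar mult_1_right)
  qed
  moreover have "(\<lambda>N. \<bar>fej2 N k - 1\<bar>) \<longlonglongrightarrow> 0"
    using tendsto_rabs_zero[OF LIM_zero[OF fej2_tendsto]] .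
  ultimately show ?case by (intro exI[of _ "\<lambda>N. \<bar>fej2 N k - 1\<bar>"]) auto
next
  case (add f g)
  then obtain A B where "A \<longlonglongrightarrow> 0" "\<And>N x. norm (Fej N f x - f x) \<le> A N"
     "B \<longlonglongrightarrow> 0" "\<And>N x. norm (Fej N g x - g x) \<le> B N" by blast
  note AB = this
  have *: "norm (Fej N (\<lambda>x. f x + g x) x - (f x + g x)) \<le> norm (Fej N f x - f x) + norm (Fej N g x - g x)" for N x
    using add.hyps norm_triangle_ineq[of "Fej N f x - f x" "Fej N g x - g x"]
    by (subst Fej_add) (auto intro: csquare_integrable_integrable trig_csquare_integrable simp: algebra_simps)
  show ?case
    by (intro exI[of _ "\<lambda>N. A N + B N"] conjI allI tendsto_add_zero AB
        order_trans[OF * add_mono[OF AB(2) AB(4)]])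
next
  case (cmult f c)
  then obtain A where "A \<longlonglongrightarrow> 0" "\<And>N x. norm (Fej N f x - f x) \<le> A N" by blast
  moreover have "Fej N (\<lambda>x. c * f x) x - c * f x = c * (Fej N f x - f x)" for N x
    by (simp add: Fej_cmult algebra_simps)
  ultimately show ?case
    by (intro exI[of _ "\<lambda>N. norm c * A N"])
       (auto simp: norm_mult intro!: tendsto_mult_right_zero mult_left_mono)
qed

section \<open>Density of trigonometric polynomials\<close>

text \<open>Membership in the \<open>L2\<close> closure of the trigonometric polynomials, later
  shown to contain every real square-integrable function.\<close>

definition approx :: "(real \<times> real \<Rightarrow> complex) \<Rightarrow> bool" where
  "approx f \<longleftrightarrow> csquare_integrable f \<and> (\<forall>e>0. \<exists>A. trig A \<and> cnorm2 (\<lambda>x. f x - A x) < e)"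

lemma approx_trig: "trig A \<Longrightarrow> approx A"
  unfolding approx_def by (auto intro!: trig_csquare_integrable exI[of _ A] simp: cnorm2_def norm2_def)

lemma approx_limit:
  assumes "csquare_integrable f" "\<And>e. 0 < e \<Longrightarrow> \<exists>g. approx g \<and> cnorm2 (\<lambda>x. f x - g x) < e"
  shows "approx f"
  unfolding approx_def
proof (intro conjI allI impI assms(1))
  fix e :: real assume "0 < e"
  then obtain g where g: "approx g" "cnorm2 (\<lambda>x. f x - g x) < e/2"
    using assms(2)[of "e/2"] by auto
  then obtain A where A: "trig A" "cnorm2 (\<lambda>x. g x - A x) < e/2"
    using \<open>0 < e\<close> unfolding approx_def by (meson half_gt_zero)
  have "cnorm2 (\<lambda>x. f x - A x) \<le> cnorm2 (\<lambda>x. f x - g x) + cnorm2 (\<lambda>x. g x - A x)"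
    using g A assms(1) by (intro cnorm2_diff_triangle) (auto simp: approx_def trig_csquare_integrable)
  then show "\<exists>A. trig A \<and> cnorm2 (\<lambda>x. f x - A x) < e"
    using A g by (intro exI[of _ A]) auto
qed

lemma approx_add:
  assumes "approx f" "approx g" shows "approx (\<lambda>x. f x + g x)"
  unfolding approx_def
proof (intro conjI allI impI)
  show "csquare_integrable (\<lambda>x. f x + g x)" using assms by (auto intro: csquare_integrable_add simp: approx_def)
  fix e :: real assume e: "0 < e"
  obtain A B where A: "trig A" "cnorm2 (\<lambda>x. f x - A x) < e/2" and B: "trig B" "cnorm2 (\<lambda>x. g x - B x) < e/2"
    using e assms unfolding approx_def by (meson half_gt_zero)
  have "cnorm2 (\<lambda>x. (f x - A x) + (g x - B x)) \<le> cnorm2 (\<lambda>x. f x - A x) + cnorm2 (\<lambda>x. g x - B x)"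
    using A B assms by (intro csquare_integrable_add csquare_integrable_diff) (auto simp: approx_def trig_csquare_integrable)
  then have "cnorm2 (\<lambda>x. f x + g x - (A x + B x)) < e"
    using A B by (simp add: algebra_simps)
  then show "\<exists>A. trig A \<and> cnorm2 (\<lambda>x. f x + g x - A x) < e"
    using trig.add[OF A(1) B(1)] by blast
qed

lemma approx_cmult:
  assumes "approx f" shows "approx (\<lambda>x. c * f x)"
  unfolding approx_def
proof (intro conjI allI impI)
  show "csquare_integrable (\<lambda>x. c * f x)" using assms by (auto intro: csquare_integrable_cmult simp: approx_def)
  fix e :: real assume e: "0 < e"
  then have "0 < e / (norm c + 1)"
    by (intro divide_pos_pos) (auto intro: add_nonneg_pos)
  then obtain A where A: "trig A" "cnorm2 (\<lambda>x. f x - A x) < e / (norm c + 1)"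
    using assms unfolding approx_def by meson
  have "cnorm2 (\<lambda>x. c * (f x - A x)) = norm c * cnorm2 (\<lambda>x. f x - A x)"
    using A assms by (intro csquare_integrable_cmult csquare_integrable_diff) (auto simp: approx_def trig_csquare_integrable)
  also have "\<dots> \<le> (norm c + 1) * cnorm2 (\<lambda>x. f x - A x)"
    by (intro mult_right_mono) auto
  also have "\<dots> < e"
    using A(2) by (simp add: pos_less_divide_eq mult.commute add_nonneg_pos)
  finally show "\<exists>A. trig A \<and> cnorm2 (\<lambda>x. c * f x - A x) < e"
    using trig.cmult[OF A(1), of c] by (auto simp: algebra_simps)
qed

text \<open>Dominated convergence for the squared error, with majorant \<open>4 * d\<^sup>2\<close>.
  Each enlargement of the class below, from polynomials in cosines to indicators to general
  functions, is a limit of this kind.\<close>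

lemma approx_dominated:
  assumes f: "f \<in> borel_measurable borel" and g: "\<And>n. approx (g n)"
    and lim: "AE x in U2. (\<lambda>n. g n x) \<longlonglongrightarrow> f x"
    and d: "square_integrable U2 d" "\<And>n x. norm (g n x) \<le> d x" "\<And>x. norm (f x) \<le> d x"
  shows "approx f"
proof (rule approx_limit)
  have [measurable]: "d \<in> borel_measurable borel" "g n \<in> borel_measurable borel" for n
    using d(1) g by (auto simp: square_integrable_def approx_def csquare_integrable_def)
  note [measurable] = f
  have d0: "0 \<le> d x" for x using d(3)[of x] norm_ge_zero order_trans by blast
  have "(\<lambda>x. norm (f x)) \<in> borel_measurable U2" by simp
  then show "csquare_integrable f" unfolding csquare_integrable_def using f norm2_mono(1)[OF d(1), of "\<lambda>x. norm (f x)"] d(3) d0 by auto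
  fix e :: real assume e: "0 < e"
  have i4: "integrable U2 (\<lambda>x. 4 * (d x)\<^sup>2)" using d(1) by (simp add: square_integrable_def)
  have bnd: "(norm (f x - g n x))\<^sup>2 \<le> 4 * (d x)\<^sup>2" for n x
  proof -
    have "norm (f x - g n x) \<le> 2 * d x"
      using norm_triangle_ineq4[of "f x" "g n x"] d(2)[of n x] d(3)[of x] by linarith
    then have "(norm (f x - g n x))\<^sup>2 \<le> (2 * d x)\<^sup>2" by (intro power_mono) auto
    then show ?thesis by (simp add: power_mult_distrib)
  qed
  have "(\<lambda>n. \<integral>x. (norm (f x - g n x))\<^sup>2 \<partial>U2) \<longlonglongrightarrow> (\<integral>x. 0 \<partial>U2)"
  proof (rule integral_dominated_convergence[OF _ _ i4])
    show "AE x in U2. (\<lambda>n. (norm (f x - g n x))\<^sup>2) \<longlonglongrightarrow> 0"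
      using lim
    proof (rule AE_mp, intro AE_I2 impI)
      fix x assume "(\<lambda>n. g n x) \<longlonglongrightarrow> f x"
      then have "(\<lambda>n. (norm (f x - g n x))\<^sup>2) \<longlonglongrightarrow> (norm (f x - f x))\<^sup>2"
        by (intro tendsto_intros)
      then show "(\<lambda>n. (norm (f x - g n x))\<^sup>2) \<longlonglongrightarrow> 0" by simp
    qed
  qed (use bnd in auto)
  then have "\<forall>\<^sub>F n in sequentially. (\<integral>x. (norm (f x - g n x))\<^sup>2 \<partial>U2) < e\<^sup>2"
    using e by (intro order_tendstoD(2)[of _ 0]) auto
  then obtain n where n: "(\<integral>x. (norm (f x - g n x))\<^sup>2 \<partial>U2) < e\<^sup>2"
    by (auto simp: eventually_sequentially)
  have "cnorm2 (\<lambda>x. f x - g n x) < e"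
    unfolding cnorm2_def norm2_def using real_sqrt_less_mono[OF n] e by simp
  then show "\<exists>g. approx g \<and> cnorm2 (\<lambda>x. f x - g x) < e" using g by blast
qed

lemma trig_polynomial:
  assumes "real_polynomial_function p" "trig (\<lambda>x. of_real (t x))"
  shows "trig (\<lambda>x. of_real (p (t x)))"
  using assms(1)
proof (induction p rule: real_polynomial_function.induct)
  case (linear f)
  have "f y = f 1 * y" for y
    using linear_cmul[OF bounded_linear.linear[OF linear], of y 1] by (simp add: mult.commute)
  then have *: "of_real (f (t x)) = complex_of_real (f 1) * of_real (t x)" for x
    by (metis of_real_mult)
  show ?case unfolding * by (intro trig.cmult assms)
qed (auto intro: trig_const trig_mult trig.add)

text \<open>On \<open>[0,1]\<close> the arc \<open>cos (2\<pi>(x - c)) > d\<close> is an open interval; this makes the indicators of boxes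
  pointwise limits of bounded trigonometric polynomials.\<close>

lemma arc_interval:
  fixes a b :: real
  shows "\<exists>c d. \<forall>x\<in>{0..1}. (a < x \<and> x < b \<and> 0 < x \<and> x < 1) \<longleftrightarrow> cos (2 * pi * (x - c)) > d"
proof -
  let ?a = "max a 0" and ?b = "min b 1"
  show ?thesis
  proof (cases "?a < ?b")
    case False
    then have "b \<le> a \<or> b \<le> 0 \<or> 1 \<le> a" by auto
    moreover have c2: "\<not> 2 < cos y" for y :: real
      using cos_le_one[of y] by linarith
    \<comment> \<open>An empty interval is encoded by the threshold 2, which no cosine
      exceeds.\<close>
    ultimately show ?thesis
      by (rule_tac exI[of _ "0"], rule_tac exI[of _ 2])
         (auto simp: c2)
  next
    case True
    \<comment> \<open>Midpoint and half-length of the interval clipped to \<open>[0, 1]\<close>; the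
      threshold is the value of the cosine at distance \<open>?r\<close> from the midpoint.\<close>
    let ?c = "(?a + ?b) / 2" and ?r = "(?b - ?a) / 2"
    have r: "0 < ?r" "?r \<le> 1/2" "?r \<le> ?c" "?c \<le> 1 - ?r" using True by (auto simp: field_simps)
    have "(a < x \<and> x < b \<and> 0 < x \<and> x < 1) \<longleftrightarrow> cos (2 * pi * (x - ?c)) > cos (2 * pi * ?r)" if x: "x \<in> {0..1}" for x
    proof -
      have 1: "(a < x \<and> x < b \<and> 0 < x \<and> x < 1) \<longleftrightarrow> \<bar>x - ?c\<bar> < ?r"
        by (auto simp: abs_less_iff field_simps)
      let ?y = "\<bar>x - ?c\<bar>"
      have "\<bar>x - (A + B) / 2\<bar> \<le> 1 - (B - A) / 2" if "0 \<le> A" "B \<le> 1" for A B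
        using x that by (auto simp: abs_if field_simps)
      then have y: "?y \<le> 1 - ?r" by simp
      have 2: "cos (2 * pi * (x - ?c)) = cos (2 * pi * ?y)"
        by (cases "x - ?c \<ge> 0") (auto simp: abs_if algebra_simps intro: cos_minus[symmetric, THEN trans])
      have 3: "?y < ?r \<longleftrightarrow> cos (2 * pi * ?y) > cos (2 * pi * ?r)"
      proof (cases "?y \<le> 1/2")
        case True
        then have "cos (2 * pi * ?r) < cos (2 * pi * ?y) \<longleftrightarrow> 2 * pi * ?y < 2 * pi * ?r"
          using r by (intro cos_mono_less_eq) auto
        then show ?thesis by (simp add: mult.commute)
      next
        case False
        \<comment> \<open>Beyond half a period the cosine rises again. Points of
          \<open>[0, 1]\<close> satisfy \<open>?y \<le> 1 - ?r\<close>, so it does not rise above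
          the threshold.\<close>
        have "cos (2 * pi * ?y) = cos (2 * pi * (1 - ?y))"
          using cos_diff[of "2*pi" "2*pi*?y"] by (simp add: algebra_simps)
        also have "\<dots> \<le> cos (2 * pi * ?r)"
        proof (rule cos_monotone_0_pi_le)
          show "0 \<le> 2 * pi * ?r" using less_imp_le[OF r(1)] by (intro mult_nonneg_nonneg pi_ge_zero) simp_all
          have "?r \<le> 1 - ?y" using y by linarith
          then show "2 * pi * ?r \<le> 2 * pi * (1 - ?y)" by (intro mult_left_mono) auto
          have "2 * pi * (1 - ?y) \<le> 2 * pi * (1/2)" using False by (intro mult_left_mono) auto
          then show "2 * pi * (1 - ?y) \<le> pi" by simp
        qed
        finally show ?thesis using False r by auto
      qed
      show ?thesis unfolding 1 2 3 ..
    qed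
    then show ?thesis by blast
  qed
qed

text \<open>Ramps of slope \<open>n\<close> starting at \<open>d\<close> converge to the strict
  threshold. Weierstrass replaces the \<open>n\<close>-th ramp by a polynomial within
  \<open>1 / (n + 1)\<close>, whence the uniform bound 2.\<close>

lemma threshold_polynomials:
  fixes d :: real
  shows "\<exists>p. (\<forall>n. real_polynomial_function (p n)) \<and> (\<forall>n. \<forall>t\<in>{-1..1}. \<bar>p n t\<bar> \<le> 2) \<and>
     (\<forall>t\<in>{-1..1}. (\<lambda>n. p n t) \<longlonglongrightarrow> (if t > d then 1 else 0))"
proof -
  let ?\<phi> = "\<lambda>n t. min 1 (max 0 (real n * (t - d)))"
  have "\<exists>g. real_polynomial_function g \<and> (\<forall>t\<in>{-1..1}. \<bar>?\<phi> n t - g t\<bar> < 1 / (real n + 1))" for n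
  proof -
    have "continuous_on {-1..1} (?\<phi> n)" by (intro continuous_intros)
    from Stone_Weierstrass_real_polynomial_function[OF _ this, of "1 / (real n + 1)"] show ?thesis
      by (metis compact_Icc divide_pos_pos of_nat_0_le_iff add_nonneg_pos zero_less_one)
  qed
  then obtain p where p: "\<And>n. real_polynomial_function (p n)"
    "\<And>n t. t \<in> {-1..1} \<Longrightarrow> \<bar>?\<phi> n t - p n t\<bar> < 1 / (real n + 1)" by metis
  show ?thesis
  proof (intro exI[of _ p] conjI allI ballI p(1))
    fix n :: nat and t :: real assume t: "t \<in> {-1..1}"
    have "1 / (real n + 1) \<le> 1" by simp
    then show "\<bar>p n t\<bar> \<le> 2" using p(2)[OF t, of n] by linarith
  next
    fix t :: real assume t: "t \<in> {-1..1}"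
    have 1: "(\<lambda>n. ?\<phi> n t) \<longlonglongrightarrow> (if t > d then 1 else 0)"
    proof (cases "t > d")
      case True
      obtain m :: nat where m: "1 / (t - d) < m" using reals_Archimedean2 by blast
      have "?\<phi> n t = 1" if "n \<ge> m" for n
      proof -
        have "1 / (t - d) < n" using m that by linarith
        then have "1 < n * (t - d)" using True by (simp add: field_simps)
        then show ?thesis by simp
      qed
      then show ?thesis using True by (intro tendsto_eventually) (auto simp: eventually_sequentially)
    next
      case False
      then have "?\<phi> n t = 0" for n by (simp add: max_absorb1 mult_nonneg_nonpos)
      then show ?thesis using False by simp
    qed
    have 2: "(\<lambda>n. ?\<phi> n t - p n t) \<longlonglongrightarrow> 0"
    proof (rule Lim_null_comparison)
      show "\<forall>\<^sub>F n in sequentially. norm (?\<phi> n t - p n t) \<le> 1 / (real n + 1)"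
        using p(2)[OF t] by (intro always_eventually allI) (simp add: less_imp_le)
      show "(\<lambda>n. 1 / (real n + 1)) \<longlonglongrightarrow> 0" by real_asymp
    qed
    show "(\<lambda>n. p n t) \<longlonglongrightarrow> (if t > d then 1 else 0)"
      using tendsto_diff[OF 1 2] by simp
  qed
qed

lemma trig_cos:
  "trig (\<lambda>x. of_real (cos (2 * pi * (fst x - c))))" "trig (\<lambda>x. of_real (cos (2 * pi * (snd x - c))))"
proof -
  have "of_real (cos (2 * pi * (fst x - c))) = complex_of_real (Re (cis (- 2 * pi * c) * echar (1, 0) x))" for x
    by (simp add: echar_def cis_mult algebra_simps)
  then show "trig (\<lambda>x. of_real (cos (2 * pi * (fst x - c))))"
    by (simp only: trig_Re[OF trig.cmult[OF trig.echar]])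
  have "of_real (cos (2 * pi * (snd x - c))) = complex_of_real (Re (cis (- 2 * pi * c) * echar (0, 1) x))" for x
    by (simp add: echar_def cis_mult algebra_simps)
  then show "trig (\<lambda>x. of_real (cos (2 * pi * (snd x - c))))"
    by (simp only: trig_Re[OF trig.cmult[OF trig.echar]])
qed

lemma AE_U2_interior: "AE x in U2. 0 < fst x \<and> fst x < 1 \<and> 0 < snd x \<and> snd x < 1"
proof (rule U2.AE_pair_measure)
  have "AE x in U. 0 < x \<and> x < 1"
    using AE_lborel_singleton[of 0] AE_lborel_singleton[of 1] unfolding AE_seg by eventually_elim auto
  then show "AE x in U. AE y in U. 0 < fst (x, y) \<and> fst (x, y) < 1 \<and> 0 < snd (x, y) \<and> snd (x, y) < 1"
    by (auto elim!: AE_mp)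
  have "Measurable.pred borel (\<lambda>x::real \<times> real. 0 < fst x \<and> fst x < 1 \<and> 0 < snd x \<and> snd x < 1)"
    by measurable
  then show "{x \<in> space U2. 0 < fst x \<and> fst x < 1 \<and> 0 < snd x \<and> snd x < 1} \<in> sets U2"
    unfolding pred_def sets_segs space_segs space_borel .
qed

lemma approx_box: "approx (indicator (box (a::real \<times> real) b))"
proof -
  obtain c1 d1 where 1: "\<forall>x\<in>{0..1}. (fst a < x \<and> x < fst b \<and> 0 < x \<and> x < 1) \<longleftrightarrow> cos (2 * pi * (x - c1)) > d1"
    using arc_interval by blast
  obtain c2 d2 where 2: "\<forall>x\<in>{0..1}. (snd a < x \<and> x < snd b \<and> 0 < x \<and> x < 1) \<longleftrightarrow> cos (2 * pi * (x - c2)) > d2"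
    using arc_interval by blast
  obtain p where p: "\<And>n. real_polynomial_function (p n)" "\<And>n t. t\<in>{-1..1} \<Longrightarrow> \<bar>p n t\<bar> \<le> 2"
     "\<And>t. t\<in>{-1..1} \<Longrightarrow> (\<lambda>n. p n t) \<longlonglongrightarrow> (if t > d1 then 1 else 0)"
    using threshold_polynomials[of d1] by blast
  obtain q where q: "\<And>n. real_polynomial_function (q n)" "\<And>n t. t\<in>{-1..1} \<Longrightarrow> \<bar>q n t\<bar> \<le> 2"
     "\<And>t. t\<in>{-1..1} \<Longrightarrow> (\<lambda>n. q n t) \<longlonglongrightarrow> (if t > d2 then 1 else 0)"
    using threshold_polynomials[of d2] by blast
  let ?c = "\<lambda>x. cos (2 * pi * (fst x - c1))" and ?d = "\<lambda>x. cos (2 * pi * (snd x - c2))"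
  let ?g = "\<lambda>n x. complex_of_real (p n (?c x)) * complex_of_real (q n (?d x))"
  show ?thesis
  proof (rule approx_dominated[where g = ?g and d = "\<lambda>_. 4"])
    show "approx (?g n)" for n
      by (rule approx_trig[OF trig_mult[OF trig_polynomial[OF p(1) trig_cos(1)] trig_polynomial[OF q(1) trig_cos(2)]]])
    show "norm (?g n x) \<le> 4" for n x
      using mult_mono[OF p(2)[of "?c x" n] q(2)[of "?d x" n]] by (simp add: norm_mult)
    show "norm (indicator (box a b) x :: complex) \<le> 4" for x
      by (simp add: indicator_def)
    show "square_integrable U2 (\<lambda>_. 4)" by (simp add: square_integrable_def)
    show "AE x in U2. (\<lambda>n. ?g n x) \<longlonglongrightarrow> indicator (box a b) x"
      using AE_U2_interior
    proof (rule AE_mp, intro AE_I2 impI)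
      fix x :: "real \<times> real" assume x: "0 < fst x \<and> fst x < 1 \<and> 0 < snd x \<and> snd x < 1"
      have "(\<lambda>n. ?g n x) \<longlonglongrightarrow> of_real (if ?c x > d1 then 1 else 0) * of_real (if ?d x > d2 then 1 else 0)"
        by (intro tendsto_mult tendsto_of_real p q) auto
      also have "of_real (if ?c x > d1 then 1 else 0) * of_real (if ?d x > d2 then 1 else 0) = (indicator (box a b) x :: complex)"
        using 1[rule_format, of "fst x"] 2[rule_format, of "snd x"] x
        by (cases x) (auto simp: indicator_def box_prod box_real)
      finally show "(\<lambda>n. ?g n x) \<longlonglongrightarrow> indicator (box a b) x" .
    qed
  qed auto
qed

text \<open>Dynkin's argument: open boxes are stable under intersection and generate the Borel sets,
  and the class is closed under complements and countable disjoint unions.\<close>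

lemma approx_indicator:
  assumes "A \<in> sets (borel :: (real \<times> real) measure)"
  shows "approx (indicator A)"
proof -
  let ?G = "range (\<lambda>(a, b). box a b :: (real \<times> real) set)"
  have "Int_stable ?G"
    unfolding Int_stable_def by (auto simp: box_Int_box)
  moreover have "?G \<subseteq> Pow UNIV" by auto
  moreover have "A \<in> sigma_sets UNIV ?G"
    using assms unfolding borel_eq_box by simp
  ultimately show ?thesis
  proof (induction rule: sigma_sets_induct_disjoint)
    case (basic A)
    then show ?case using approx_box by auto
  next
    case empty
    then show ?case using approx_trig[OF trig_const[of 0]] by simp
  next
    case (compl A)
    have "indicator (UNIV - A) = (\<lambda>x. 1 + (-1) * indicator A x :: complex)"
      by (auto simp: indicator_def)
    then show ?case
      using approx_add[OF approx_trig[OF trig_const[of 1]] approx_cmult[OF compl.IH, of "-1"]] by simp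
  next
    case (union A)
    let ?g = "\<lambda>n x. \<Sum>i<n. indicator (A i) x :: complex"
    have e: "?g n x = indicator (\<Union>i<n. A i) x" for n x
      using union(1) by (intro indicator_UN_disjoint[symmetric]) (auto simp: disjoint_family_on_def)
    have A: "A i \<in> sets borel" for i
      using union(2) unfolding borel_eq_box by auto
    show ?case
    proof (rule approx_dominated[where g = ?g and d = "\<lambda>_. 1"])
      show "approx (?g n)" for n
        by (induction n) (use approx_trig[OF trig_const[of 0]] in \<open>auto intro: approx_add union\<close>)
      show "norm (?g n x) \<le> 1" for n x
        unfolding e by (simp add: indicator_def)
      show "AE x in U2. (\<lambda>n. ?g n x) \<longlonglongrightarrow> indicator (\<Union> (range A)) x"
      proof (rule AE_I2)
        fix x
        have "(\<lambda>n. indicator (\<Union>i<n. A i) x :: complex) \<longlonglongrightarrow> indicator (\<Union> (range A)) x"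
          by (rule LIMSEQ_indicator_UN)
        then show "(\<lambda>n. ?g n x) \<longlonglongrightarrow> indicator (\<Union> (range A)) x" unfolding e .
      qed
    qed (use A in \<open>auto simp: square_integrable_def indicator_def\<close>)
  qed
qed

lemma approx_square_integrable:
  assumes f: "square_integrable U2 f"
  shows "approx (\<lambda>x. of_real (f x))"
proof -
  have fm: "f \<in> borel_measurable borel" using f by (simp add: square_integrable_def)
  obtain F where F: "\<And>i. simple_function borel (F i)" "\<And>x. (\<lambda>i. F i x) \<longlonglongrightarrow> f x" "\<And>i x. norm (F i x) \<le> 2 * norm (f x)"
    using borel_measurable_implies_sequence_metric[OF fm, of 0] by (auto simp: dist_norm)
  show ?thesis
  proof (rule approx_dominated[where g = "\<lambda>i x. of_real (F i x)" and d = "\<lambda>x. 2 * \<bar>f x\<bar>"])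
    show "approx (\<lambda>x. complex_of_real (F i x))" for i
    proof -
      have fin: "finite (range (F i))" and m: "F i -` {y} \<in> sets borel" for y
        using simple_functionD[OF F(1)[of i]] by auto
      have "of_real (F i x) = (\<Sum>y\<in>range (F i). complex_of_real y * indicator (F i -` {y}) x)" for x
        using fin by (subst sum.mono_neutral_right[of _ "{F i x}"]) (auto simp: indicator_def)
      moreover have "approx (\<lambda>x. \<Sum>y\<in>Y. complex_of_real y * indicator (F i -` {y}) x)" if "finite Y" for Y
        using that
      proof induction
        case empty
        show ?case using approx_trig[OF trig_const[of 0]] by simp
      next
        case (insert y Y)
        show ?case
          unfolding sum.insert[OF insert.hyps] by (intro approx_add approx_cmult approx_indicator m insert.IH)
      qed
      ultimately show ?thesis using fin by simp
    qed
    show "square_integrable U2 (\<lambda>x. 2 * \<bar>f x\<bar>)" by (intro square_integrable_cmult square_integrable_abs f)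
  qed (use F(2,3) fm in \<open>auto intro!: tendsto_intros\<close>)
qed

text \<open>Three terms: the difference to a trigonometric polynomial \<open>A\<close>, its Fejer
  mean, which is no larger by contraction, and the uniform error on \<open>A\<close>.\<close>

lemma Fej_tendsto:
  assumes "approx f"
  shows "(\<lambda>N. cnorm2 (\<lambda>x. Fej N f x - f x)) \<longlonglongrightarrow> 0"
proof (rule LIMSEQ_I)
  fix e :: real assume e: "0 < e"
  have f: "csquare_integrable f" using assms by (simp add: approx_def)
  obtain A where A: "trig A" "cnorm2 (\<lambda>x. f x - A x) < e/3"
    using assms e unfolding approx_def by (meson divide_pos_pos zero_less_numeral)
  note cA = trig_csquare_integrable[OF A(1)]
  obtain B where B: "B \<longlonglongrightarrow> 0" "\<And>N x. norm (Fej N A x - A x) \<le> B N"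
    using Fej_trig[OF A(1)] by blast
  have "\<forall>\<^sub>F N in sequentially. B N < e/3" using B(1) e by (intro order_tendstoD) auto
  then obtain N0 where N0: "\<And>N. N \<ge> N0 \<Longrightarrow> B N < e/3" by (auto simp: eventually_sequentially)
  have "norm (cnorm2 (\<lambda>x. Fej N f x - f x) - 0) < e" if N: "N \<ge> N0" for N
  proof -
    have "cnorm2 (\<lambda>x. Fej N f x - f x) \<le> cnorm2 (\<lambda>x. Fej N f x - Fej N A x) + cnorm2 (\<lambda>x. Fej N A x - f x)"
      by (intro cnorm2_diff_triangle csquare_integrable_Fej f)
    also have "cnorm2 (\<lambda>x. Fej N A x - f x) \<le> cnorm2 (\<lambda>x. Fej N A x - A x) + cnorm2 (\<lambda>x. A x - f x)"
      by (intro cnorm2_diff_triangle csquare_integrable_Fej f cA)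
    also have "cnorm2 (\<lambda>x. Fej N f x - Fej N A x) = cnorm2 (Fej N (\<lambda>x. f x - A x))"
      by (intro arg_cong[of _ _ cnorm2] ext Fej_diff[symmetric] csquare_integrable_integrable f cA)
    also have "\<dots> \<le> cnorm2 (\<lambda>x. f x - A x)"
      by (intro Fej_L2_contraction csquare_integrable_diff f cA)
    also have "cnorm2 (\<lambda>x. A x - f x) = cnorm2 (\<lambda>x. f x - A x)"
      by (simp add: cnorm2_def norm_minus_commute)
    also have "cnorm2 (\<lambda>x. Fej N A x - A x) \<le> B N"
      using csquare_integrable_diff[OF csquare_integrable_Fej cA] B(2) by (intro csquare_integrable_bounded(2)) (auto simp: csquare_integrable_def)
    finally show ?thesis using A(2) N0[OF N] by simp
  qed
  then show "\<exists>no. \<forall>n\<ge>no. norm (cnorm2 (\<lambda>x. Fej n f x - f x) - 0) < e" by blast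
qed

section \<open>The integrated Karman--Howarth--Monin identity\<close>

lemma integral_seg_subset_mono:
  fixes f :: "real \<Rightarrow> real"
  assumes f: "integrable U f" "f \<in> borel_measurable borel" and nn: "\<And>x. 0 \<le> f x" and ab: "0 \<le> a" "b \<le> 1"
  shows "(\<integral>x. f x \<partial>seg a b) \<le> (\<integral>x. f x \<partial>U)"
proof -
  have "(\<integral>\<^sup>+x. ennreal (f x) \<partial>seg a b) \<le> (\<integral>\<^sup>+x. ennreal (f x) \<partial>U)"
    using f(2) ab by (auto simp: nn_integral_seg indicator_def intro!: nn_integral_mono)
  also have "\<dots> = ennreal (\<integral>x. f x \<partial>U)"
    using f nn by (simp add: nn_integral_eq_integral)
  finally show ?thesis
    using f(2) nn by (subst integral_eq_nn_integral) (auto intro!: enn2real_leI)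
qed

lemma integrable_bounded_segs:
  fixes f :: "real \<times> real \<Rightarrow> real"
  assumes "f \<in> borel_measurable borel" "\<And>x. \<bar>f x\<bar> \<le> B"
  shows "integrable (seg a b \<Otimes>\<^sub>M seg c d) f"
proof -
  interpret F: finite_measure "seg a b \<Otimes>\<^sub>M seg c d"
    by (intro finite_measure_pair_measure finite_measure_seg)
  show ?thesis
    using assms by (intro F.integrable_const_bound[where B = B]) auto
qed

lemma integrable_bounded_seg:
  fixes f :: "real \<Rightarrow> real"
  assumes "f \<in> borel_measurable borel" "\<And>x. \<bar>f x\<bar> \<le> B"
  shows "integrable (seg a b) f"
  using assms by (intro seg.integrable_const_bound[where B = B]) auto

lemma abs_integral_seg_le:
  fixes f :: "real \<Rightarrow> real"
  assumes "a \<le> b" "f \<in> borel_measurable borel" "\<And>x. a \<le> x \<Longrightarrow> x \<le> b \<Longrightarrow> \<bar>f x\<bar> \<le> B"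
  shows "\<bar>\<integral>x. f x \<partial>seg a b\<bar> \<le> (b - a) * B"
proof -
  have AE: "AE x in seg a b. \<bar>f x\<bar> \<le> B"
    using AE_seg_mem[of a b] assms(3) by (auto elim!: AE_mp)
  then have i: "integrable (seg a b) f"
    using assms(2) by (intro seg.integrable_const_bound[where B = B]) auto
  have "\<bar>\<integral>x. f x \<partial>seg a b\<bar> \<le> (\<integral>x. \<bar>f x\<bar> \<partial>seg a b)" by (rule integral_abs_bound)
  also have "\<dots> \<le> (\<integral>x. B \<partial>seg a b)"
    using i AE by (intro integral_mono_AE) auto
  finally show ?thesis using assms(1) by (simp add: measure_seg_UNIV)
qed

definition bounded_cont :: "(real \<times> real \<Rightarrow> real) \<Rightarrow> bool" where
  "bounded_cont f \<longleftrightarrow> continuous_on UNIV f \<and> (\<exists>B. \<forall>x. \<bar>f x\<bar> \<le> B)"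

lemma bounded_cont_borel: "bounded_cont f \<Longrightarrow> f \<in> borel_measurable borel"
  unfolding bounded_cont_def by (blast intro: borel_measurable_continuous_onI)

lemma bounded_cont_square_integrable: "bounded_cont f \<Longrightarrow> square_integrable U2 f"
  using bounded_cont_borel[of f] U2.square_integrable_bounded[of f] by (auto simp: bounded_cont_def)

text \<open>The choice of \<open>H\<close> gives \<open>H' u = u * \<psi> u\<close>. The bound
  \<open>K\<close> lets the error of the equation enter through its \<open>L1\<close> norm alone and
  makes \<open>S\<close> Lipschitz; the bound \<open>C\<close> makes \<open>Q\<close> Lipschitz.
  With Lipschitz \<open>S\<close> and \<open>Q\<close> the limit of the Fejer means can be taken at
  a fixed profile.\<close>

locale profile =
  fixes \<psi> \<Phi> S H Q :: "real \<Rightarrow> real" and K C :: real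
  assumes cont_\<psi>: "continuous_on UNIV \<psi>" and \<psi>_le: "\<bar>\<psi> u\<bar> \<le> 1"
    and D\<Phi>: "(\<Phi> has_real_derivative \<psi> u) (at u)" and \<Phi>_le: "\<bar>\<Phi> u\<bar> \<le> K"
    and DS: "(S has_real_derivative \<Phi> u) (at u)"
    and H_eq: "H u = u * \<Phi> u - S u" and H_le: "\<bar>H u\<bar> \<le> C"
    and DQ: "(Q has_real_derivative H u) (at u)" and Q0: "Q 0 = 0"
begin

lemma K_nonneg: "0 \<le> K" using \<Phi>_le[of 0] by linarith
lemma C_nonneg: "0 \<le> C" using H_le[of 0] by linarith

lemma continuous: "continuous_on UNIV \<Phi>" "continuous_on UNIV S" "continuous_on UNIV H" "continuous_on UNIV Q"
proof -
  show \<Phi>: "continuous_on UNIV \<Phi>" using D\<Phi> by (rule DERIV_continuous_on)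
  show S: "continuous_on UNIV S" using DS by (rule DERIV_continuous_on)
  have "H = (\<lambda>u. u * \<Phi> u - S u)" using H_eq by auto
  with \<Phi> S show "continuous_on UNIV H" by (auto intro!: continuous_intros)
  show "continuous_on UNIV Q" using DQ by (rule DERIV_continuous_on)
qed

lemmas measurable_profile [measurable] =
  borel_measurable_continuous_onI[OF cont_\<psi>]
  continuous[THEN borel_measurable_continuous_onI]

lemma Lipschitz:
  assumes "\<And>u. (f has_real_derivative f' u) (at u)" "\<And>u. \<bar>f' u\<bar> \<le> L"
  shows "\<bar>f x - f y\<bar> \<le> L * \<bar>x - y\<bar>"
  using field_differentiable_bound[of UNIV f f' L x y] assms by (simp add: abs_minus_commute)

lemmas S_Lipschitz = Lipschitz[OF DS \<Phi>_le]
lemmas Q_Lipschitz = Lipschitz[OF DQ H_le]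

end

text \<open>The components \<open>w1\<close>, \<open>w2\<close>, \<open>G1\<close> are the partial derivatives \<open>\<partial>\<^sub>1 w\<close>, \<open>\<partial>\<^sub>2 w\<close>, \<open>\<partial>\<^sub>1 G\<close>; the error \<open>e\<close> will be
  the commutator of regularisation and nonlinearity.\<close>

locale forced_flow =
  fixes w w1 w2 G G1 e :: "real \<times> real \<Rightarrow> real"
  assumes bounded_cont: "bounded_cont w" "bounded_cont w1" "bounded_cont w2" "bounded_cont G" "bounded_cont G1" "bounded_cont e"
    and per: "w (x + (1, 0)) = w x" "w1 (x + (1, 0)) = w1 x" "G (x + (1, 0)) = G x" "e (x + (1, 0)) = e x"
    and Dw1: "((\<lambda>s. w (s, y)) has_real_derivative w1 (s, y)) (at s)"
    and Dw2: "((\<lambda>y. w (s, y)) has_real_derivative w2 (s, y)) (at y)"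
    and DG: "((\<lambda>s. G (s, y)) has_real_derivative G1 (s, y)) (at s)"
    and flow: "w2 x = w x * w1 x + G1 x + e x"
begin

lemmas [measurable] = bounded_cont[THEN bounded_cont_borel]

lemma cont [continuous_intros]:
  assumes "continuous_on A f"
  shows "continuous_on A (\<lambda>z. w (f z))" "continuous_on A (\<lambda>z. w1 (f z))" "continuous_on A (\<lambda>z. w2 (f z))"
    "continuous_on A (\<lambda>z. G (f z))" "continuous_on A (\<lambda>z. G1 (f z))" "continuous_on A (\<lambda>z. e (f z))"
  using bounded_cont assms unfolding bounded_cont_def by (auto intro: continuous_on_compose2)

end

locale flow_profile = forced_flow + profile
begin

text \<open>With \<open>u = diff1 t w\<close>, \<open>X\<close> is the \<open>y\<close>-derivative
  of \<open>S u\<close> and \<open>Y\<close> is the \<open>t\<close>-derivative of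
  \<open>Q u\<close>. \<open>R\<close> holds what the equation leaves after an exact
  \<open>x\<close>-derivative is removed: the error, and the forcing after integration by
  parts.\<close>

definition X where "X t x y = \<Phi> (diff1 t w (x, y)) * diff1 t w2 (x, y)"
definition Y where "Y t x y = H (diff1 t w (x, y)) * w1 (x + t, y)"
definition R where "R t x y = \<Phi> (diff1 t w (x, y)) * diff1 t e (x, y)
  - \<psi> (diff1 t w (x, y)) * diff1 t w1 (x, y) * diff1 t G (x, y)"

lemma cont_profile [continuous_intros]:
  assumes "continuous_on A f"
  shows "continuous_on A (\<lambda>z. \<Phi> (f z))" "continuous_on A (\<lambda>z. \<psi> (f z))" "continuous_on A (\<lambda>z. S (f z))"
    "continuous_on A (\<lambda>z. H (f z))"
  using continuous cont_\<psi> assms by (auto intro: continuous_on_compose2)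

text \<open>The integrands differ by the \<open>x\<close>-derivative of the periodic function \<open>Z\<close> below.\<close>

lemma balance: "(\<integral>x. X t x y \<partial>U) = (\<integral>x. Y t x y \<partial>U) + (\<integral>x. R t x y \<partial>U)"
proof -
  obtain T where T: "\<And>u. (T has_real_derivative S u) (at u)"
    using einterval_antiderivative[of "-\<infinity>" "\<infinity>" S] continuous(2)
    by (auto simp: continuous_on_eq_continuous_at has_real_derivative_iff_has_vector_derivative)
  let ?u = "\<lambda>x. diff1 t w (x, y)"
  \<comment> \<open>The first two summands produce the convective terms, because
    \<open>S u * w1 (x + t, y)\<close> splits into \<open>S u * w1 (x, y)\<close> and
    \<open>S u * diff1 t w1 (x, y)\<close>, the latter being the derivative of \<open>T u\<close>.
    The third summand moves the derivative off \<open>G\<close>.\<close>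
  let ?Z = "\<lambda>x. S (?u x) * w (x, y) + T (?u x) + \<Phi> (?u x) * diff1 t G (x, y)"
  let ?Z' = "\<lambda>x. X t x y - Y t x y - R t x y"
  have sh: "((\<lambda>x. f (x + t, y)) has_real_derivative f' (x + t, y)) (at x)"
    if "\<And>s. ((\<lambda>s. f (s, y)) has_real_derivative f' (s, y)) (at s)" for f f' :: "real \<times> real \<Rightarrow> real" and x
    using DERIV_shift[of "\<lambda>s. f (s, y)" "f' (x + t, y)" x t] that by simp
  have Du: "(?u has_real_derivative diff1 t w1 (x, y)) (at x)" for x
    unfolding diff1_def using sh[of w w1, OF Dw1] Dw1 by (auto intro!: derivative_eq_intros)
  have DdG: "((\<lambda>x. diff1 t G (x, y)) has_real_derivative diff1 t G1 (x, y)) (at x)" for x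
    unfolding diff1_def using sh[of G G1, OF DG] DG by (auto intro!: derivative_eq_intros)
  have "(?Z has_real_derivative ?Z' x) (at x)" for x
  proof -
    have "(?Z has_real_derivative (\<Phi> (?u x) * diff1 t w1 (x, y) * w (x, y) + S (?u x) * w1 (x, y)
       + S (?u x) * diff1 t w1 (x, y) + (\<psi> (?u x) * diff1 t w1 (x, y) * diff1 t G (x, y) + \<Phi> (?u x) * diff1 t G1 (x, y)))) (at x)"
      by (auto intro!: derivative_eq_intros Du DdG Dw1 DERIV_chain2[OF DS] DERIV_chain2[OF D\<Phi>] DERIV_chain2[OF T])
    also have "\<Phi> (?u x) * diff1 t w1 (x, y) * w (x, y) + S (?u x) * w1 (x, y)
       + S (?u x) * diff1 t w1 (x, y) + (\<psi> (?u x) * diff1 t w1 (x, y) * diff1 t G (x, y) + \<Phi> (?u x) * diff1 t G1 (x, y))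
       = ?Z' x"
      by (simp add: X_def Y_def R_def diff1_def H_eq flow algebra_simps)
    finally show ?thesis .
  qed
  then have "(\<integral>x. ?Z' x \<partial>U) = ?Z 1 - ?Z 0"
    by (intro integral_seg_FTC)
       (auto simp: X_def Y_def R_def diff1_def has_real_derivative_iff_has_vector_derivative[symmetric] intro!: continuous_intros)
  also have "\<dots> = 0"
    using per(1)[of "(0, y)"] per(1)[of "(t, y)"] per(3)[of "(0, y)"] per(3)[of "(t, y)"]
    by (simp add: diff1_def add.commute)
  finally have "(\<integral>x. ?Z' x \<partial>U) = 0" .
  moreover have "integrable U (\<lambda>x. X t x y)" "integrable U (\<lambda>x. Y t x y)" "integrable U (\<lambda>x. R t x y)"
    by (auto simp: X_def Y_def R_def diff1_def intro!: integrable_seg_continuous continuous_intros)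
  ultimately show ?thesis by simp
qed

lemma diff1_bounded:
  assumes "bounded_cont f" obtains B where "\<And>t x. \<bar>diff1 t f x\<bar> \<le> B" "0 \<le> B"
proof -
  obtain B where B: "\<And>x. \<bar>f x\<bar> \<le> B" using assms by (auto simp: bounded_cont_def)
  have "\<bar>diff1 t f x\<bar> \<le> 2 * B" for t x
    unfolding diff1_def using B[of "x + (t, 0)"] B[of x] by linarith
  moreover have "0 \<le> 2 * B" using B[of 0] by linarith
  ultimately show ?thesis using that by blast
qed

lemma XYR_bounded: "\<exists>B. \<forall>t x y. \<bar>X t x y\<bar> \<le> B" "\<exists>B. \<forall>t x y. \<bar>Y t x y\<bar> \<le> B" "\<exists>B. \<forall>t x y. \<bar>R t x y\<bar> \<le> B"
proof -
  obtain A where A: "\<And>t x. \<bar>diff1 t w2 x\<bar> \<le> A" using diff1_bounded[OF bounded_cont(3)] by metis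
  have "\<bar>X t x y\<bar> \<le> K * A" for t x y
    unfolding X_def abs_mult by (intro mult_mono \<Phi>_le A) (auto simp: K_nonneg)
  then show "\<exists>B. \<forall>t x y. \<bar>X t x y\<bar> \<le> B" by blast
  obtain W where W: "\<And>x. \<bar>w1 x\<bar> \<le> W" using bounded_cont(2) by (auto simp: bounded_cont_def)
  have "\<bar>Y t x y\<bar> \<le> C * W" for t x y
    unfolding Y_def abs_mult by (intro mult_mono H_le W) (auto simp: C_nonneg)
  then show "\<exists>B. \<forall>t x y. \<bar>Y t x y\<bar> \<le> B" by blast
  obtain E where E: "\<And>t x. \<bar>diff1 t e x\<bar> \<le> E" using diff1_bounded[OF bounded_cont(6)] by metis
  obtain V where V: "\<And>t x. \<bar>diff1 t w1 x\<bar> \<le> V" "0 \<le> V" using diff1_bounded[OF bounded_cont(2)] by metis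
  obtain g where g: "\<And>t x. \<bar>diff1 t G x\<bar> \<le> g" using diff1_bounded[OF bounded_cont(4)] by metis
  have "\<bar>R t x y\<bar> \<le> K * E + 1 * V * g" for t x y
    unfolding R_def
    by (rule order_trans[OF abs_triangle_ineq4], unfold abs_mult)
       (intro add_mono mult_mono \<Phi>_le \<psi>_le E V g, auto simp: K_nonneg V)
  then show "\<exists>B. \<forall>t x y. \<bar>R t x y\<bar> \<le> B" by blast
qed

lemma XYR_measurable [measurable]:
  assumes [measurable]: "f \<in> borel_measurable M" "g \<in> borel_measurable M" "k \<in> borel_measurable M"
  shows "(\<lambda>z. X (f z) (g z) (k z)) \<in> borel_measurable M" "(\<lambda>z. Y (f z) (g z) (k z)) \<in> borel_measurable M"
    "(\<lambda>z. R (f z) (g z) (k z)) \<in> borel_measurable M"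
  unfolding X_def Y_def R_def diff1_def by simp_all

lemma X_integral:
  assumes ab: "a \<le> b"
  shows "(\<integral>y. \<integral>x. X t x y \<partial>U \<partial>seg a b) = (\<integral>x. S (diff1 t w (x, b)) - S (diff1 t w (x, a)) \<partial>U)"
proof -
  obtain B where B: "\<And>t x y. \<bar>X t x y\<bar> \<le> B" using XYR_bounded(1) by blast
  have "integrable (U \<Otimes>\<^sub>M seg a b) (\<lambda>(x, y). X t x y)"
    by (intro integrable_bounded_segs[where B = B]) (auto simp: B split_beta)
  then have 1: "(\<integral>y. \<integral>x. X t x y \<partial>U \<partial>seg a b) = (\<integral>x. \<integral>y. X t x y \<partial>seg a b \<partial>U)"
    by (rule segs.Fubini_integral)
  have 2: "(\<integral>y. X t x y \<partial>seg a b) = S (diff1 t w (x, b)) - S (diff1 t w (x, a))" for x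
  proof (rule integral_seg_FTC[OF ab])
    show "continuous_on UNIV (X t x)"
      by (auto simp: X_def[abs_def] diff1_def intro!: continuous_intros)
    have "((\<lambda>y. diff1 t w (x, y)) has_real_derivative diff1 t w2 (x, y)) (at y)" for y
      unfolding diff1_def using Dw2[of "x + t"] Dw2[of x] by (auto intro!: derivative_eq_intros)
    then show "((\<lambda>y. S (diff1 t w (x, y))) has_vector_derivative X t x y) (at y)" for y
      unfolding X_def has_real_derivative_iff_has_vector_derivative[symmetric]
      by (rule DERIV_chain2[OF DS])
  qed
  show ?thesis unfolding 1 2 ..
qed

text \<open>\<open>Y\<close> is bounded and Borel, so Fubini brings the \<open>t\<close>-integral
  inside, where the fundamental theorem applies. The lower limit contributes
  \<open>Q 0 = 0\<close>.\<close>

lemma Y_integral: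
  assumes h: "0 \<le> h"
  shows "(\<integral>t. \<integral>y. \<integral>x. Y t x y \<partial>U \<partial>seg a b \<partial>seg 0 h) = (\<integral>y. \<integral>x. Q (diff1 h w (x, y)) \<partial>U \<partial>seg a b)"
proof -
  obtain B where B: "\<And>t x y. \<bar>Y t x y\<bar> \<le> B" using XYR_bounded(2) by blast
  have 1: "\<bar>\<integral>x. Y t x y \<partial>U\<bar> \<le> B" for t y
    using abs_integral_seg_le[of 0 1 "\<lambda>x. Y t x y" B] B by simp
  have "integrable (seg 0 h \<Otimes>\<^sub>M seg a b) (\<lambda>(t, y). \<integral>x. Y t x y \<partial>U)"
  proof (intro integrable_bounded_segs[where B = B])
    have "(\<lambda>z. \<integral>x. Y (fst z) x (snd z) \<partial>U) \<in> borel_measurable borel"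
      by (intro U.borel_measurable_lebesgue_integral) (simp add: split_beta)
    then show "(\<lambda>(t, y). \<integral>x. Y t x y \<partial>U) \<in> borel_measurable borel" by (simp add: split_beta)
  qed (auto simp: 1)
  then have 2: "(\<integral>t. \<integral>y. \<integral>x. Y t x y \<partial>U \<partial>seg a b \<partial>seg 0 h) = (\<integral>y. \<integral>t. \<integral>x. Y t x y \<partial>U \<partial>seg 0 h \<partial>seg a b)"
    by (rule segs.Fubini_integral[symmetric])
  have 3: "(\<integral>t. \<integral>x. Y t x y \<partial>U \<partial>seg 0 h) = (\<integral>x. \<integral>t. Y t x y \<partial>seg 0 h \<partial>U)" for y
  proof -
    have "integrable (seg 0 h \<Otimes>\<^sub>M U) (\<lambda>(t, x). Y t x y)"
      by (intro integrable_bounded_segs[where B = B]) (auto simp: B split_beta)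
    then show ?thesis by (rule segs.Fubini_integral[symmetric])
  qed
  have 4: "(\<integral>t. Y t x y \<partial>seg 0 h) = Q (diff1 h w (x, y))" for x y
  proof -
    have "(\<integral>t. Y t x y \<partial>seg 0 h) = Q (diff1 h w (x, y)) - Q (diff1 0 w (x, y))"
    proof (rule integral_seg_FTC[OF h])
      show "continuous_on UNIV (\<lambda>t. Y t x y)"
        by (auto simp: Y_def[abs_def] diff1_def intro!: continuous_intros)
      have "((\<lambda>t. diff1 t w (x, y)) has_real_derivative w1 (x + t, y)) (at t)" for t
        unfolding diff1_def using DERIV_shift[of "\<lambda>s. w (s, y)" "w1 (x + t, y)" t x] Dw1
        by (auto intro!: derivative_eq_intros simp: add.commute)
      then show "((\<lambda>t. Q (diff1 t w (x, y))) has_vector_derivative Y t x y) (at t)" for t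
        unfolding Y_def has_real_derivative_iff_has_vector_derivative[symmetric]
        by (rule DERIV_chain2[OF DQ])
    qed
    then show ?thesis by (simp add: diff1_def Q0)
  qed
  show ?thesis unfolding 2 3 4 ..
qed

text \<open>Taking absolute values allows the strip to be enlarged to the whole square, so the bound
  is the same for all strips. The factor \<open>2 * K\<close> counts the two values in
  \<open>diff1 t e\<close>, the factor 4 the products of two increments; periodicity in
  \<open>x1\<close> removes the shifts.\<close>

lemma R_bound:
  assumes t: "0 \<le> t" "t \<le> 1" and ab: "0 \<le> a" "b \<le> 1"
  shows "\<bar>\<integral>y. \<integral>x. R t x y \<partial>U \<partial>seg a b\<bar> \<le> 2 * K * (\<integral>x. \<bar>e x\<bar> \<partial>U2) + 4 * norm2 U2 w1 * norm2 U2 G"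
proof -
  obtain B where B: "\<And>t x y. \<bar>R t x y\<bar> \<le> B" using XYR_bounded(3) by blast
  have iR: "integrable (seg c d \<Otimes>\<^sub>M seg c' d') (\<lambda>z. \<bar>R t (fst z) (snd z)\<bar>)" for c d c' d'
    by (intro integrable_bounded_segs[where B = B]) (auto simp: B split_beta)
  have m: "(\<lambda>y. \<integral>x. \<bar>R t x y\<bar> \<partial>U) \<in> borel_measurable borel" "(\<lambda>y. \<integral>x. R t x y \<partial>U) \<in> borel_measurable borel"
    by (intro U.borel_measurable_lebesgue_integral; simp add: split_beta)+
  have 1: "\<bar>\<integral>x. \<bar>R t x y\<bar> \<partial>U\<bar> \<le> B" "\<bar>\<integral>x. R t x y \<partial>U\<bar> \<le> B" for y
    using abs_integral_seg_le[of 0 1 "\<lambda>x. \<bar>R t x y\<bar>" B] abs_integral_seg_le[of 0 1 "\<lambda>x. R t x y" B] B by simp_all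
  note i = integrable_bounded_seg[OF m(1) 1(1)] integrable_bounded_seg[OF m(2) 1(2)]
  have "\<bar>\<integral>y. \<integral>x. R t x y \<partial>U \<partial>seg a b\<bar> \<le> (\<integral>y. \<integral>x. \<bar>R t x y\<bar> \<partial>U \<partial>seg a b)"
    using i by (intro order_trans[OF integral_abs_bound] integral_mono integral_abs_bound) auto
  also have "\<dots> \<le> (\<integral>y. \<integral>x. \<bar>R t x y\<bar> \<partial>U \<partial>U)"
    using ab i m by (intro integral_seg_subset_mono) auto
  also have "\<dots> = (\<integral>z. \<bar>R t (fst z) (snd z)\<bar> \<partial>U2)"
    using integral_U2[OF iR] by simp
  also have "\<dots> \<le> (\<integral>z. K * (\<bar>e (z + (t, 0))\<bar> + \<bar>e z\<bar>) + (\<bar>w1 (z + (t, 0))\<bar> * \<bar>G (z + (t, 0))\<bar>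
     + \<bar>w1 (z + (t, 0))\<bar> * \<bar>G z\<bar> + \<bar>w1 z\<bar> * \<bar>G (z + (t, 0))\<bar> + \<bar>w1 z\<bar> * \<bar>G z\<bar>) \<partial>U2)"
  proof (rule integral_mono[OF iR])
    show "integrable U2 (\<lambda>z. K * (\<bar>e (z + (t, 0))\<bar> + \<bar>e z\<bar>) + (\<bar>w1 (z + (t, 0))\<bar> * \<bar>G (z + (t, 0))\<bar>
     + \<bar>w1 (z + (t, 0))\<bar> * \<bar>G z\<bar> + \<bar>w1 z\<bar> * \<bar>G (z + (t, 0))\<bar> + \<bar>w1 z\<bar> * \<bar>G z\<bar>))"
      by (intro integrable_segs_continuous continuous_intros)
    fix z :: "real \<times> real"
    have "\<bar>R t (fst z) (snd z)\<bar> \<le> K * \<bar>diff1 t e z\<bar> + 1 * \<bar>diff1 t w1 z\<bar> * \<bar>diff1 t G z\<bar>"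
      unfolding R_def by (rule order_trans[OF abs_triangle_ineq4], unfold abs_mult)
       (intro add_mono mult_mono \<Phi>_le \<psi>_le, auto simp: K_nonneg)
    also have "\<dots> \<le> K * (\<bar>e (z + (t, 0))\<bar> + \<bar>e z\<bar>) + 1 * (\<bar>w1 (z + (t, 0))\<bar> + \<bar>w1 z\<bar>) * (\<bar>G (z + (t, 0))\<bar> + \<bar>G z\<bar>)"
      unfolding diff1_def by (intro add_mono mult_mono abs_triangle_ineq4) (auto simp: K_nonneg)
    finally show "\<bar>R t (fst z) (snd z)\<bar> \<le> K * (\<bar>e (z + (t, 0))\<bar> + \<bar>e z\<bar>) + (\<bar>w1 (z + (t, 0))\<bar> * \<bar>G (z + (t, 0))\<bar>
     + \<bar>w1 (z + (t, 0))\<bar> * \<bar>G z\<bar> + \<bar>w1 z\<bar> * \<bar>G (z + (t, 0))\<bar> + \<bar>w1 z\<bar> * \<bar>G z\<bar>)"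
      by (simp add: algebra_simps)
  qed
  also have "\<dots> = K * ((\<integral>z. \<bar>e (z + (t, 0))\<bar> \<partial>U2) + (\<integral>z. \<bar>e z\<bar> \<partial>U2)) + ((\<integral>z. \<bar>w1 (z + (t, 0))\<bar> * \<bar>G (z + (t, 0))\<bar> \<partial>U2)
     + (\<integral>z. \<bar>w1 (z + (t, 0))\<bar> * \<bar>G z\<bar> \<partial>U2) + (\<integral>z. \<bar>w1 z\<bar> * \<bar>G (z + (t, 0))\<bar> \<partial>U2) + (\<integral>z. \<bar>w1 z\<bar> * \<bar>G z\<bar> \<partial>U2))"
  proof -
    have i: "integrable U2 (\<lambda>z. \<bar>e (z + (t, 0))\<bar>)" "integrable U2 (\<lambda>z. \<bar>e z\<bar>)"
      "integrable U2 (\<lambda>z. \<bar>w1 (z + (t, 0))\<bar> * \<bar>G (z + (t, 0))\<bar>)" "integrable U2 (\<lambda>z. \<bar>w1 (z + (t, 0))\<bar> * \<bar>G z\<bar>)"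
      "integrable U2 (\<lambda>z. \<bar>w1 z\<bar> * \<bar>G (z + (t, 0))\<bar>)" "integrable U2 (\<lambda>z. \<bar>w1 z\<bar> * \<bar>G z\<bar>)"
      by (intro integrable_segs_continuous continuous_intros)+
    show ?thesis using i by simp
  qed
  also have "\<dots> \<le> K * ((\<integral>z. \<bar>e z\<bar> \<partial>U2) + (\<integral>z. \<bar>e z\<bar> \<partial>U2)) + (norm2 U2 w1 * norm2 U2 G + norm2 U2 w1 * norm2 U2 G + norm2 U2 w1 * norm2 U2 G + norm2 U2 w1 * norm2 U2 G)"
  proof (intro add_mono)
    note sw = square_integrable_U2_shift[OF bounded_cont_square_integrable[OF bounded_cont(2)] per(2) t] and sG = square_integrable_U2_shift[OF bounded_cont_square_integrable[OF bounded_cont(4)] per(3) t]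
    note cw = bounded_cont_square_integrable[OF bounded_cont(2)] and cG = bounded_cont_square_integrable[OF bounded_cont(4)]
    show "(\<integral>z. \<bar>w1 (z + (t, 0))\<bar> * \<bar>G (z + (t, 0))\<bar> \<partial>U2) \<le> norm2 U2 w1 * norm2 U2 G"
      using Cauchy_Schwarz_norm2_abs[OF sw(1) sG(1)] by (simp add: sw(2) sG(2))
    show "(\<integral>z. \<bar>w1 (z + (t, 0))\<bar> * \<bar>G z\<bar> \<partial>U2) \<le> norm2 U2 w1 * norm2 U2 G"
      using Cauchy_Schwarz_norm2_abs[OF sw(1) cG] by (simp add: sw(2))
    show "(\<integral>z. \<bar>w1 z\<bar> * \<bar>G (z + (t, 0))\<bar> \<partial>U2) \<le> norm2 U2 w1 * norm2 U2 G"
      using Cauchy_Schwarz_norm2_abs[OF cw sG(1)] by (simp add: sG(2))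
    show "(\<integral>z. \<bar>w1 z\<bar> * \<bar>G z\<bar> \<partial>U2) \<le> norm2 U2 w1 * norm2 U2 G"
      by (rule Cauchy_Schwarz_norm2_abs[OF cw cG])
    have "(\<integral>\<^sup>+z. ennreal \<bar>e (z + (t, 0))\<bar> \<partial>U2) = (\<integral>\<^sup>+z. ennreal \<bar>e z\<bar> \<partial>U2)"
      using t by (intro nn_integral_U2_shift) (auto simp: per)
    then have "(\<integral>z. \<bar>e (z + (t, 0))\<bar> \<partial>U2) = (\<integral>z. \<bar>e z\<bar> \<partial>U2)"
      by (simp add: integral_eq_nn_integral)
    then show "K * ((\<integral>z. \<bar>e (z + (t, 0))\<bar> \<partial>U2) + (\<integral>z. \<bar>e z\<bar> \<partial>U2)) \<le> K * ((\<integral>z. \<bar>e z\<bar> \<partial>U2) + (\<integral>z. \<bar>e z\<bar> \<partial>U2))"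
      by simp
  qed
  finally show ?thesis by (simp add: algebra_simps)
qed

text \<open>Integrated over \<open>[0, h]\<close> and \<open>[a, b]\<close>, both derivatives in
  \<open>balance\<close> turn into boundary values. For a full period in \<open>y\<close> the
  \<open>S\<close> terms cancel and the \<open>Q\<close> term is controlled; for general
  \<open>a\<close>, \<open>b\<close> two slices are compared with each other.\<close>

lemma Karman_Howarth_Monin:
  assumes h: "0 \<le> h" "h \<le> 1" and ab: "0 \<le> a" "a \<le> b" "b \<le> 1"
  shows "\<bar>(\<integral>t. \<integral>x. S (diff1 t w (x, b)) - S (diff1 t w (x, a)) \<partial>U \<partial>seg 0 h) - (\<integral>y. \<integral>x. Q (diff1 h w (x, y)) \<partial>U \<partial>seg a b)\<bar>
     \<le> h * (2 * K * (\<integral>x. \<bar>e x\<bar> \<partial>U2) + 4 * norm2 U2 w1 * norm2 U2 G)"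
proof -
  obtain B where B: "\<And>t x y. \<bar>Y t x y\<bar> \<le> B" using XYR_bounded(2) by blast
  obtain B' where B': "\<And>t x y. \<bar>R t x y\<bar> \<le> B'" using XYR_bounded(3) by blast
  have mx: "(\<lambda>y. \<integral>x. Y t x y \<partial>U) \<in> borel_measurable borel" "(\<lambda>y. \<integral>x. R t x y \<partial>U) \<in> borel_measurable borel" for t
    by (intro U.borel_measurable_lebesgue_integral; simp add: split_beta)+
  have bx: "\<bar>\<integral>x. Y t x y \<partial>U\<bar> \<le> B" "\<bar>\<integral>x. R t x y \<partial>U\<bar> \<le> B'" for t y
    using abs_integral_seg_le[of 0 1 "\<lambda>x. Y t x y" B] abs_integral_seg_le[of 0 1 "\<lambda>x. R t x y" B'] B B' by simp_all
  have bxy: "\<bar>\<integral>y. \<integral>x. Y t x y \<partial>U \<partial>seg a b\<bar> \<le> (b - a) * B" "\<bar>\<integral>y. \<integral>x. R t x y \<partial>U \<partial>seg a b\<bar> \<le> (b - a) * B'" for t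
    by (intro abs_integral_seg_le ab mx bx)+
  have my: "(\<lambda>t. \<integral>y. \<integral>x. Y t x y \<partial>U \<partial>seg a b) \<in> borel_measurable borel" "(\<lambda>t. \<integral>y. \<integral>x. R t x y \<partial>U \<partial>seg a b) \<in> borel_measurable borel"
    unfolding split_beta
    by (intro seg.borel_measurable_lebesgue_integral U.borel_measurable_lebesgue_integral; simp add: split_beta)+
  have "(\<integral>y. \<integral>x. X t x y \<partial>U \<partial>seg a b) = (\<integral>y. \<integral>x. Y t x y \<partial>U \<partial>seg a b) + (\<integral>y. \<integral>x. R t x y \<partial>U \<partial>seg a b)" for t
    unfolding balance using integrable_bounded_seg[OF mx(1) bx(1)] integrable_bounded_seg[OF mx(2) bx(2)] by simp
  then have "(\<integral>t. \<integral>x. S (diff1 t w (x, b)) - S (diff1 t w (x, a)) \<partial>U \<partial>seg 0 h) =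
    (\<integral>t. \<integral>y. \<integral>x. Y t x y \<partial>U \<partial>seg a b \<partial>seg 0 h) + (\<integral>t. \<integral>y. \<integral>x. R t x y \<partial>U \<partial>seg a b \<partial>seg 0 h)"
    unfolding X_integral[OF ab(2), symmetric]
    using integrable_bounded_seg[OF my(1) bxy(1)] integrable_bounded_seg[OF my(2) bxy(2)] by simp
  moreover have "\<bar>\<integral>t. \<integral>y. \<integral>x. R t x y \<partial>U \<partial>seg a b \<partial>seg 0 h\<bar> \<le> (h - 0) * (2 * K * (\<integral>x. \<bar>e x\<bar> \<partial>U2) + 4 * norm2 U2 w1 * norm2 U2 G)"
    using h ab by (intro abs_integral_seg_le my R_bound) auto
  ultimately show ?thesis
    unfolding Y_integral[OF h(1)] by simp
qed

end

section \<open>Profiles\<close>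

text \<open>Both \<open>g - f\<close> and \<open>g + f\<close> are nondecreasing.\<close>

lemma abs_diff_le_of_deriv:
  fixes f g :: "real \<Rightarrow> real"
  assumes "0 \<le> u" "\<And>r. (f has_real_derivative f' r) (at r)" "\<And>r. (g has_real_derivative g' r) (at r)"
    and le: "\<And>r. 0 \<le> r \<Longrightarrow> r \<le> u \<Longrightarrow> \<bar>f' r\<bar> \<le> g' r"
  shows "\<bar>f u - f 0\<bar> \<le> g u - g 0"
proof -
  have "g 0 - f 0 \<le> g u - f u"
  proof (rule DERIV_nonneg_imp_nondecreasing[OF assms(1)])
    fix r assume "0 \<le> r" "r \<le> u"
    then show "\<exists>y. ((\<lambda>r. g r - f r) has_real_derivative y) (at r) \<and> 0 \<le> y"
      using le[of r] by (intro exI[of _ "g' r - f' r"] conjI DERIV_diff assms) auto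
  qed
  moreover have "g 0 + f 0 \<le> g u + f u"
  proof (rule DERIV_nonneg_imp_nondecreasing[OF assms(1)])
    fix r assume "0 \<le> r" "r \<le> u"
    then show "\<exists>y. ((\<lambda>r. g r + f r) has_real_derivative y) (at r) \<and> 0 \<le> y"
      using le[of r] by (intro exI[of _ "g' r + f' r"] conjI DERIV_add assms) auto
  qed
  ultimately show ?thesis by linarith
qed

lemma DERIV_reflect:
  fixes f :: "real \<Rightarrow> real"
  assumes "\<And>r. (f has_real_derivative f' r) (at r)"
  shows "((\<lambda>r. f (s * r)) has_real_derivative s * f' (s * r)) (at r)"
proof -
  have "((\<lambda>r. s * r) has_real_derivative s) (at r)"
    by (auto intro!: derivative_eq_intros)
  then have "((\<lambda>r. f (s * r)) has_real_derivative f' (s * r) * s) (at r)"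
    by (rule DERIV_chain2[rotated]) (rule assms)
  then show ?thesis by (simp add: mult.commute)
qed

lemma abs_le_of_deriv:
  fixes f g :: "real \<Rightarrow> real"
  assumes f: "\<And>r. (f has_real_derivative f' r) (at r)" and g: "\<And>r. (g has_real_derivative g' r) (at r)"
    and le: "\<And>r. \<bar>r\<bar> \<le> \<bar>u\<bar> \<Longrightarrow> \<bar>f' r\<bar> \<le> g' \<bar>r\<bar>" and "f 0 = 0" "g 0 = 0"
  shows "\<bar>f u\<bar> \<le> g \<bar>u\<bar>"
proof -
  let ?s = "if u < 0 then -1 else 1 :: real"
  have "\<bar>f (?s * \<bar>u\<bar>) - f (?s * 0)\<bar> \<le> g \<bar>u\<bar> - g 0"
  proof (rule abs_diff_le_of_deriv[OF _ DERIV_reflect[OF f] g])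
    fix r :: real assume "0 \<le> r" "r \<le> \<bar>u\<bar>"
    then show "\<bar>?s * f' (?s * r)\<bar> \<le> g' r"
      using le[of "?s * r"] by (auto simp: abs_mult)
  qed simp
  then show ?thesis using assms by (auto split: if_splits)
qed

lemma nonneg_of_deriv:
  fixes f :: "real \<Rightarrow> real"
  assumes f: "\<And>r. (f has_real_derivative f' r) (at r)" and "f 0 = 0"
    and f': "\<And>r. 0 \<le> r \<Longrightarrow> 0 \<le> f' r" "\<And>r. r \<le> 0 \<Longrightarrow> f' r \<le> 0"
  shows "0 \<le> f u"
proof -
  let ?s = "if u < 0 then -1 else 1 :: real"
  have "f (?s * 0) \<le> f (?s * \<bar>u\<bar>)"
  proof (rule DERIV_nonneg_imp_nondecreasing[of 0 "\<bar>u\<bar>" "\<lambda>r. f (?s * r)"])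
    fix r :: real assume r: "0 \<le> r"
    show "\<exists>y. ((\<lambda>r. f (?s * r)) has_real_derivative y) (at r) \<and> 0 \<le> y"
      using r f' by (intro exI[of _ "?s * f' (?s * r)"] conjI DERIV_reflect f) auto
  qed simp
  then show ?thesis using assms by (auto split: if_splits)
qed

lemma constant_outside:
  fixes f :: "real \<Rightarrow> real"
  assumes f: "\<And>r. (f has_real_derivative f' r) (at r)" and L: "0 \<le> L" "\<And>r. L \<le> \<bar>r\<bar> \<Longrightarrow> f' r = 0"
  shows "\<exists>x. \<bar>x\<bar> \<le> L \<and> f u = f x"
proof -
  consider "\<bar>u\<bar> \<le> L" | "L < u" | "u < - L" by linarith
  then show ?thesis
  proof cases
    case 2
    then obtain z where "L < z" "z < u" "f u - f L = (u - L) * f' z"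
      using MVT2[of L u f f'] f by blast
    then show ?thesis using L by (intro exI[of _ L]) auto
  next
    case 3
    then obtain z where "u < z" "z < - L" "f (- L) - f u = (- L - u) * f' z"
      using MVT2[of u "- L" f f'] f by blast
    then show ?thesis using L by (intro exI[of _ "- L"]) auto
  qed auto
qed

lemma antiderivative_exists:
  fixes f :: "real \<Rightarrow> real"
  assumes "continuous_on UNIV f"
  obtains F where "\<And>u. (F has_real_derivative f u) (at u)" "F 0 = 0"
proof -
  obtain T where T: "\<And>u. (T has_real_derivative f u) (at u)"
    using einterval_antiderivative[of "-\<infinity>" "\<infinity>" f] assms
    by (auto simp: continuous_on_eq_continuous_at has_real_derivative_iff_has_vector_derivative)
  have "((\<lambda>u. T u - T 0) has_real_derivative f u) (at u)" for u
    using T by (auto intro!: derivative_eq_intros)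
  then show ?thesis by (rule that) simp
qed

text \<open>In \<open>H' = \<Phi> + u * \<psi> - \<Phi>\<close> the function \<open>\<Phi>\<close>
  cancels, so both \<open>\<Phi>\<close> and \<open>H\<close> are constant on either side of
  \<open>[-L, L]\<close>. They are thus bounded by their values on the interval, where
  \<open>|\<Phi> u| \<le> |u|\<close> and \<open>|H u| \<le> u\<^sup>2 / 2\<close>.\<close>

lemma profile_exists:
  assumes c: "continuous_on UNIV \<psi>" and le: "\<And>r. \<bar>\<psi> r\<bar> \<le> 1" and L: "0 \<le> L" "\<And>r. L \<le> \<bar>r\<bar> \<Longrightarrow> \<psi> r = 0"
  obtains \<Phi> S H Q where "profile \<psi> \<Phi> S H Q L (L * L)" "\<Phi> 0 = 0" "S 0 = 0"
    "\<And>u. (H has_real_derivative u * \<psi> u) (at u)" "H 0 = 0"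
proof -
  obtain \<Phi> where D\<Phi>: "\<And>u. (\<Phi> has_real_derivative \<psi> u) (at u)" and \<Phi>0: "\<Phi> 0 = 0"
    using antiderivative_exists[OF c] by metis
  have "continuous_on UNIV \<Phi>" using D\<Phi> by (rule DERIV_continuous_on)
  then obtain S where DS: "\<And>u. (S has_real_derivative \<Phi> u) (at u)" and S0: "S 0 = 0"
    using antiderivative_exists by metis
  define H where "H u = u * \<Phi> u - S u" for u
  have DH: "(H has_real_derivative u * \<psi> u) (at u)" for u
    unfolding H_def using D\<Phi> DS by (auto intro!: derivative_eq_intros)
  then have "continuous_on UNIV H" by (rule DERIV_continuous_on)
  then obtain Q where DQ: "\<And>u. (Q has_real_derivative H u) (at u)" and Q0: "Q 0 = 0"
    using antiderivative_exists by metis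
  have H0: "H 0 = 0" by (simp add: H_def S0)
  have "\<bar>\<Phi> u\<bar> \<le> L" for u
  proof -
    obtain x where x: "\<bar>x\<bar> \<le> L" "\<Phi> u = \<Phi> x" using constant_outside[OF D\<Phi> L] by blast
    have "\<bar>\<Phi> x\<bar> \<le> \<bar>x\<bar>" by (rule abs_le_of_deriv[OF D\<Phi> DERIV_ident]) (auto simp: le \<Phi>0)
    with x show ?thesis by simp
  qed
  moreover have "\<bar>H u\<bar> \<le> L * L" for u
  proof -
    obtain x where x: "\<bar>x\<bar> \<le> L" "H u = H x" using constant_outside[OF DH L(1)] L(2) by (metis mult_zero_right)
    have "\<bar>H x\<bar> \<le> \<bar>x\<bar>\<^sup>2 / 2"
      by (rule abs_le_of_deriv[OF DH, of "\<lambda>r. r\<^sup>2 / 2" "\<lambda>r. r"])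
         (auto simp: H0 abs_mult le mult_left_le intro!: derivative_eq_intros)
    also have "\<dots> \<le> L * L"
      unfolding power2_eq_square
      using mult_mono[OF x(1) x(1) L(1) abs_ge_zero] mult_nonneg_nonneg[OF L(1) L(1)] by linarith
    finally show ?thesis using x by simp
  qed
  ultimately have "profile \<psi> \<Phi> S H Q L (L * L)"
    by (intro profile.intro c le D\<Phi> DS DQ Q0 H_def)
  then show ?thesis using that \<Phi>0 S0 DH H0 by blast
qed

definition cutoff :: "nat \<Rightarrow> real \<Rightarrow> real" where
  "cutoff n r = max 0 (min 1 (real n + 1 - \<bar>r\<bar>))"

lemma cutoff: "continuous_on UNIV (cutoff n)" "0 \<le> cutoff n r" "cutoff n r \<le> 1"
  "real n + 1 \<le> \<bar>r\<bar> \<Longrightarrow> cutoff n r = 0" "\<bar>r\<bar> \<le> real n \<Longrightarrow> cutoff n r = 1"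
  unfolding cutoff_def[abs_def] by (auto intro!: continuous_intros)

text \<open>\<open>\<psi> \<rightarrow> 1\<close>, the profile of the quadratic identity.\<close>

lemma quadratic_profiles:
  obtains \<psi> \<Phi> S H Q :: "nat \<Rightarrow> real \<Rightarrow> real" and K :: "nat \<Rightarrow> real"
  where "\<And>n. profile (\<psi> n) (\<Phi> n) (S n) (H n) (Q n) (K n) (K n * K n)"
    "\<And>n u. 0 \<le> S n u" "\<And>n u. S n u \<le> u\<^sup>2 / 2" "\<And>n u. \<bar>u\<bar> \<le> real n \<Longrightarrow> S n u = u\<^sup>2 / 2"
    "\<And>n u. \<bar>Q n u\<bar> \<le> \<bar>u\<bar> ^ 3 / 6"
proof -
  have "\<exists>\<Phi> S H Q. profile (cutoff n) \<Phi> S H Q (real n + 1) ((real n + 1) * (real n + 1)) \<and>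
     (\<forall>u. 0 \<le> S u \<and> S u \<le> u\<^sup>2 / 2 \<and> (\<bar>u\<bar> \<le> real n \<longrightarrow> S u = u\<^sup>2 / 2) \<and> \<bar>Q u\<bar> \<le> \<bar>u\<bar> ^ 3 / 6)" for n
  proof -
    obtain \<Phi> S H Q where P: "profile (cutoff n) \<Phi> S H Q (real n + 1) ((real n + 1) * (real n + 1))"
      and z: "\<Phi> 0 = 0" "S 0 = 0" "H 0 = 0" and DH: "\<And>u. (H has_real_derivative u * cutoff n u) (at u)"
      using profile_exists[of "cutoff n" "real n + 1"] cutoff by (smt (verit) of_nat_0_le_iff)
    interpret profile "cutoff n" \<Phi> S H Q "real n + 1" "(real n + 1) * (real n + 1)" by (rule P)
    have \<Phi>: "\<bar>\<Phi> u\<bar> \<le> \<bar>u\<bar>" for u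
      by (rule abs_le_of_deriv[OF D\<Phi> DERIV_ident]) (auto simp: cutoff z)
    have \<Phi>s: "0 \<le> u \<Longrightarrow> 0 \<le> \<Phi> u" "u \<le> 0 \<Longrightarrow> \<Phi> u \<le> 0" for u
    proof -
      have "mono \<Phi>"
        by (rule monoI, rule DERIV_nonneg_imp_nondecreasing) (use D\<Phi> cutoff(2) in blast)+
      then show "0 \<le> u \<Longrightarrow> 0 \<le> \<Phi> u" "u \<le> 0 \<Longrightarrow> \<Phi> u \<le> 0" using monoD[of \<Phi> 0 u] monoD[of \<Phi> u 0] z by auto
    qed
    have S: "0 \<le> S u" for u
      by (rule nonneg_of_deriv[OF DS]) (auto simp: z \<Phi>s)
    have D2: "((\<lambda>r. r\<^sup>2 / 2) has_real_derivative r) (at r)" "((\<lambda>r. r ^ 3 / 6) has_real_derivative r\<^sup>2 / 2) (at r)" for r :: real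
      by (auto intro!: derivative_eq_intros)
    have S2: "\<bar>S u\<bar> \<le> \<bar>u\<bar>\<^sup>2 / 2" for u
      by (rule abs_le_of_deriv[OF DS D2(1)]) (auto simp: z \<Phi>)
    have H2: "\<bar>H u\<bar> \<le> \<bar>u\<bar>\<^sup>2 / 2" for u
      by (rule abs_le_of_deriv[OF DH D2(1)]) (auto simp: z abs_mult cutoff mult_left_le)
    have Q: "\<bar>Q u\<bar> \<le> \<bar>u\<bar> ^ 3 / 6" for u
      by (rule abs_le_of_deriv[OF DQ D2(2)]) (use H2 in \<open>auto simp: Q0\<close>)
    have eq: "S u = u\<^sup>2 / 2" if "\<bar>u\<bar> \<le> real n" for u
    proof -
      have 1: "\<bar>\<Phi> r - r\<bar> \<le> 0" if "\<bar>r\<bar> \<le> real n" for r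
        by (rule abs_le_of_deriv[OF DERIV_diff[OF D\<Phi> DERIV_ident] DERIV_const]) (use that in \<open>auto simp: cutoff z\<close>)
      have "\<bar>S u - u\<^sup>2 / 2\<bar> \<le> 0"
        by (rule abs_le_of_deriv[OF DERIV_diff[OF DS D2(1)] DERIV_const]) (use that 1 in \<open>auto simp: z\<close>)
      then show ?thesis by simp
    qed
    have "S u \<le> u\<^sup>2 / 2" for u using S2[of u] by simp
    with P S Q eq show ?thesis by blast
  qed
  then obtain \<Phi> S H Q where "\<And>n. profile (cutoff n) (\<Phi> n) (S n) (H n) (Q n) (real n + 1) ((real n + 1) * (real n + 1)) \<and>
     (\<forall>u. 0 \<le> S n u \<and> S n u \<le> u\<^sup>2 / 2 \<and> (\<bar>u\<bar> \<le> real n \<longrightarrow> S n u = u\<^sup>2 / 2) \<and> \<bar>Q n u\<bar> \<le> \<bar>u\<bar> ^ 3 / 6)"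
    by metis
  then show ?thesis by (intro that[of cutoff \<Phi> S H Q "\<lambda>n. real n + 1"]) auto
qed

text \<open>\<open>\<psi> \<rightarrow> sgn\<close>, the profile of the cubic identity.\<close>

lemma cubic_profiles:
  obtains \<psi> \<Phi> S H Q :: "nat \<Rightarrow> real \<Rightarrow> real" and K :: "nat \<Rightarrow> real"
  where "\<And>n. profile (\<psi> n) (\<Phi> n) (S n) (H n) (Q n) (K n) (K n * K n)"
    "\<And>n u. 0 \<le> Q n u" "\<And>u. (\<lambda>n. Q n u) \<longlonglongrightarrow> \<bar>u\<bar> ^ 3 / 6"
proof -
  \<comment> \<open>A ramp of slope \<open>n\<close> in place of the sign, cut off beyond
    \<open>|r| = n\<close>. It vanishes identically for \<open>n = 0\<close>, hence the clause
    \<open>0 < n\<close> in the error estimate below.\<close>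
  define \<psi> where "\<psi> n r = max (-1) (min 1 (real n * r)) * cutoff n r" for n r
  have \<psi>: "continuous_on UNIV (\<psi> n)" "\<bar>\<psi> n r\<bar> \<le> 1" "real n + 1 \<le> \<bar>r\<bar> \<Longrightarrow> \<psi> n r = 0" "0 \<le> r * \<psi> n r" for n r
  proof -
    show "continuous_on UNIV (\<psi> n)"
      unfolding \<psi>_def by (intro continuous_intros cutoff)
    have "\<bar>max (-1) (min 1 (real n * r))\<bar> * \<bar>cutoff n r\<bar> \<le> 1 * 1"
      by (intro mult_mono) (use cutoff in auto)
    then show "\<bar>\<psi> n r\<bar> \<le> 1" by (simp add: \<psi>_def abs_mult)
    show "real n + 1 \<le> \<bar>r\<bar> \<Longrightarrow> \<psi> n r = 0" by (simp add: \<psi>_def cutoff)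
    have "0 \<le> r * max (-1) (min 1 (real n * r))"
    proof (cases "0 \<le> r")
      case True
      then show ?thesis by (intro mult_nonneg_nonneg) (auto simp: le_max_iff_disj)
    next
      case False
      then have "real n * r \<le> 0" by (simp add: mult_nonneg_nonpos)
      with False show ?thesis by (intro mult_nonpos_nonpos) (auto simp: min_le_iff_disj)
    qed
    then show "0 \<le> r * \<psi> n r"
      unfolding \<psi>_def mult.assoc[symmetric] by (rule mult_nonneg_nonneg[OF _ cutoff(2)])
  qed
  have "\<exists>\<Phi> S H Q. profile (\<psi> n) \<Phi> S H Q (real n + 1) ((real n + 1) * (real n + 1)) \<and>
     (\<forall>u. 0 \<le> Q u \<and> (0 < n \<and> \<bar>u\<bar> \<le> real n \<longrightarrow> \<bar>Q u - \<bar>u\<bar> ^ 3 / 6\<bar> \<le> u\<^sup>2 / (2 * real n)))" for n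
  proof -
    obtain \<Phi> S H Q where P: "profile (\<psi> n) \<Phi> S H Q (real n + 1) ((real n + 1) * (real n + 1))"
      and z: "\<Phi> 0 = 0" "S 0 = 0" "H 0 = 0" and DH: "\<And>u. (H has_real_derivative u * \<psi> n u) (at u)"
      using profile_exists[of "\<psi> n" "real n + 1"] \<psi>(1-3) by (smt (verit) of_nat_0_le_iff)
    interpret profile "\<psi> n" \<Phi> S H Q "real n + 1" "(real n + 1) * (real n + 1)" by (rule P)
    have "mono H"
      by (rule monoI, rule DERIV_nonneg_imp_nondecreasing) (use DH \<psi>(4) in blast)+
    then have "0 \<le> u \<Longrightarrow> 0 \<le> H u" "u \<le> 0 \<Longrightarrow> H u \<le> 0" for u
      using monoD[of H 0 u] monoD[of H u 0] z by auto
    then have Q: "0 \<le> Q u" for u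
      by (intro nonneg_of_deriv[OF DQ]) (auto simp: Q0)
    have lim: "\<bar>Q u - \<bar>u\<bar> ^ 3 / 6\<bar> \<le> u\<^sup>2 / (2 * real n)" if u: "\<bar>u\<bar> \<le> real n" and n: "0 < n" for u
    proof -
      define s :: real where "s = (if u < 0 then -1 else 1)"
      have s: "\<bar>s\<bar> = 1" "s * s = 1" by (auto simp: s_def)
      have D2: "((\<lambda>r. r\<^sup>2 / 2) has_real_derivative r) (at r)" "((\<lambda>r. r ^ 3 / 6) has_real_derivative r\<^sup>2 / 2) (at r)"
        "((\<lambda>r. r\<^sup>2 / (2 * real n)) has_real_derivative r / real n) (at r)"
        "((\<lambda>r. r / real n) has_real_derivative 1 / real n) (at r)" for r :: real
        using n by (auto intro!: derivative_eq_intros)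
      \<comment> \<open>Reflection by \<open>s\<close> reduces to \<open>r \<ge> 0\<close>. There
        \<open>r * min 1 (n * r)\<close> differs from \<open>r\<close> only below
        \<open>1 / n\<close>, by at most \<open>1 / n\<close>. Integrating once gives
        \<open>r / n\<close> for \<open>H\<close>, twice \<open>u\<^sup>2 / (2 * n)\<close> for
        \<open>Q\<close>.\<close>
      have 1: "\<bar>s * H (s * r) - r\<^sup>2 / 2\<bar> \<le> r / real n" if r: "0 \<le> r" "r \<le> real n" for r
      proof -
        have "\<bar>(s * H (s * r) - r\<^sup>2 / 2) - (s * H (s * 0) - 0\<^sup>2 / 2)\<bar> \<le> r / real n - 0 / real n"
        proof (rule abs_diff_le_of_deriv[OF r(1) _ D2(4)])
          show "((\<lambda>r. s * H (s * r) - r\<^sup>2 / 2) has_real_derivative s * (s * (s * r * \<psi> n (s * r))) - r) (at r)" for r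
            by (intro DERIV_diff DERIV_cmult D2 DERIV_reflect[OF DH])
          fix x assume x: "0 \<le> x" "x \<le> r"
          have nx: "0 \<le> real n * x" using x by simp
          have c: "cutoff n (s * x) = 1"
            using x r s by (intro cutoff) (simp add: abs_mult)
          have "s * \<psi> n (s * x) = min 1 (real n * x)"
            unfolding \<psi>_def c using nx by (auto simp: s_def min_def max_def)
          then have "s * (s * (s * x * \<psi> n (s * x))) - x = x * (min 1 (real n * x) - 1)"
            using s by (simp add: algebra_simps)
          also have "\<bar>\<dots>\<bar> \<le> 1 / real n"
          proof (cases "real n * x \<le> 1")
            case True
            have "x * (1 - real n * x) \<le> x * 1" using x nx by (intro mult_left_mono) auto
            also have "\<dots> \<le> 1 / real n" using True n by (simp add: field_simps)
            finally show ?thesis using True x by (simp add: abs_mult min_def)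
          qed (simp add: min_def)
          finally show "\<bar>s * (s * (s * x * \<psi> n (s * x))) - x\<bar> \<le> 1 / real n" .
        qed
        then show ?thesis by (simp add: z)
      qed
      have "\<bar>(Q (s * \<bar>u\<bar>) - \<bar>u\<bar> ^ 3 / 6) - (Q (s * 0) - 0 ^ 3 / 6)\<bar> \<le> \<bar>u\<bar>\<^sup>2 / (2 * real n) - 0\<^sup>2 / (2 * real n)"
        by (rule abs_diff_le_of_deriv[OF _ DERIV_diff[OF DERIV_reflect[OF DQ] D2(2)] D2(3)]) (use 1 u in auto)
      moreover have "s * \<bar>u\<bar> = u" by (auto simp: s_def)
      ultimately show ?thesis by (simp add: Q0)
    qed
    show ?thesis using P Q lim by blast
  qed
  then obtain \<Phi> S H Q where P: "\<And>n. profile (\<psi> n) (\<Phi> n) (S n) (H n) (Q n) (real n + 1) ((real n + 1) * (real n + 1))"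
     "\<And>n u. 0 \<le> Q n u" "\<And>n u. 0 < n \<Longrightarrow> \<bar>u\<bar> \<le> real n \<Longrightarrow> \<bar>Q n u - \<bar>u\<bar> ^ 3 / 6\<bar> \<le> u\<^sup>2 / (2 * real n)"
    by metis
  have "(\<lambda>n. Q n u) \<longlonglongrightarrow> \<bar>u\<bar> ^ 3 / 6" for u
  proof (rule LIM_zero_cancel, rule Lim_null_comparison)
    obtain m where m: "\<bar>u\<bar> < real m" using reals_Archimedean2 by blast
    show "\<forall>\<^sub>F n in sequentially. norm (Q n u - \<bar>u\<bar> ^ 3 / 6) \<le> u\<^sup>2 / (2 * real n)"
      using eventually_ge_at_top[of "Suc m"] by eventually_elim (use m P(3) in auto)
    show "(\<lambda>n. u\<^sup>2 / (2 * real n)) \<longlonglongrightarrow> 0" by real_asymp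
  qed
  then show ?thesis using P by (intro that[of \<psi> \<Phi> S H Q "\<lambda>n. real n + 1"]) auto
qed

section \<open>Fejer approximation of solutions of the forced Burgers equation\<close>

text \<open>Write \<open>f g - F G = (f - F) g + F (g - G)\<close> and apply Cauchy-Schwarz to each
  part. Convergence in \<open>L1\<close> is what two \<open>L2\<close> factors allow.\<close>

lemma norm2_tendsto_mult_L1:
  fixes f g :: "nat \<Rightarrow> 'a \<Rightarrow> real"
  assumes sq: "\<And>n. square_integrable M (f n)" "\<And>n. square_integrable M (g n)" "square_integrable M F" "square_integrable M G"
    and f: "(\<lambda>n. norm2 M (\<lambda>x. f n x - F x)) \<longlonglongrightarrow> 0" and g: "(\<lambda>n. norm2 M (\<lambda>x. g n x - G x)) \<longlonglongrightarrow> 0"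
  shows "(\<lambda>n. \<integral>x. \<bar>f n x * g n x - F x * G x\<bar> \<partial>M) \<longlonglongrightarrow> 0"
proof (rule Lim_null_comparison)
  let ?a = "\<lambda>n. norm2 M (\<lambda>x. f n x - F x)" and ?b = "\<lambda>n. norm2 M (\<lambda>x. g n x - G x)"
  show "\<forall>\<^sub>F n in sequentially. norm (\<integral>x. \<bar>f n x * g n x - F x * G x\<bar> \<partial>M) \<le> ?a n * (?b n + norm2 M G) + norm2 M F * ?b n"
  proof (rule always_eventually, rule allI)
    fix n
    note d = square_integrable_diff[OF sq(1)[of n] sq(3)] square_integrable_diff[OF sq(2)[of n] sq(4)]
    note i = square_integrable_mult_integrable
    have "(\<integral>x. \<bar>f n x * g n x - F x * G x\<bar> \<partial>M) \<le> (\<integral>x. \<bar>f n x - F x\<bar> * \<bar>g n x\<bar> + \<bar>F x\<bar> * \<bar>g n x - G x\<bar> \<partial>M)"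
    proof (rule integral_mono)
      show "integrable M (\<lambda>x. \<bar>f n x * g n x - F x * G x\<bar>)"
        by (intro integrable_abs Bochner_Integration.integrable_diff i sq)
      show "integrable M (\<lambda>x. \<bar>f n x - F x\<bar> * \<bar>g n x\<bar> + \<bar>F x\<bar> * \<bar>g n x - G x\<bar>)"
        by (intro Bochner_Integration.integrable_add i square_integrable_abs d sq)
      fix x
      have "f n x * g n x - F x * G x = (f n x - F x) * g n x + F x * (g n x - G x)"
        by (simp add: algebra_simps)
      then show "\<bar>f n x * g n x - F x * G x\<bar> \<le> \<bar>f n x - F x\<bar> * \<bar>g n x\<bar> + \<bar>F x\<bar> * \<bar>g n x - G x\<bar>"
        by (metis abs_mult abs_triangle_ineq)
    qed
    also have "\<dots> = (\<integral>x. \<bar>f n x - F x\<bar> * \<bar>g n x\<bar> \<partial>M) + (\<integral>x. \<bar>F x\<bar> * \<bar>g n x - G x\<bar> \<partial>M)"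
      by (intro Bochner_Integration.integral_add i square_integrable_abs d sq)
    also have "\<dots> \<le> ?a n * norm2 M (g n) + norm2 M F * ?b n"
      by (intro add_mono Cauchy_Schwarz_norm2_abs d sq)
    also have "\<dots> \<le> ?a n * (?b n + norm2 M G) + norm2 M F * ?b n"
      using norm2_triangle_le[OF sq(2)[of n] sq(4)] by (intro add_mono mult_left_mono) auto
    finally show "norm (\<integral>x. \<bar>f n x * g n x - F x * G x\<bar> \<partial>M) \<le> ?a n * (?b n + norm2 M G) + norm2 M F * ?b n"
      by simp
  qed
  have "(\<lambda>n. ?a n * (?b n + norm2 M G) + norm2 M F * ?b n) \<longlonglongrightarrow> 0 * (0 + norm2 M G) + norm2 M F * 0"
    by (intro tendsto_intros f g)
  then show "(\<lambda>n. ?a n * (?b n + norm2 M G) + norm2 M F * ?b n) \<longlonglongrightarrow> 0" by simp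
qed

lemma DERIV_echar:
  "((\<lambda>s. echar k (s, y)) has_vector_derivative 2 * pi * \<i> * of_int (fst k) * echar k (x, y)) (at x)"
  "((\<lambda>s. echar k (x, s)) has_vector_derivative 2 * pi * \<i> * of_int (snd k) * echar k (x, y)) (at y)"
proof -
  show "((\<lambda>s. echar k (s, y)) has_vector_derivative 2 * pi * \<i> * of_int (fst k) * echar k (x, y)) (at x)"
  proof -
    have "((\<lambda>z. exp (\<i> * (2 * pi * (of_int (fst k) * z + of_int (snd k) * of_real y)))) has_field_derivative
      2 * pi * \<i> * of_int (fst k) * exp (\<i> * (2 * pi * (of_int (fst k) * of_real x + of_int (snd k) * of_real y)))) (at (of_real x))"
      by (auto intro!: derivative_eq_intros)
    from has_vector_derivative_real_field[OF this] show ?thesis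
      by (simp add: echar_def cis_conv_exp)
  qed
  show "((\<lambda>s. echar k (x, s)) has_vector_derivative 2 * pi * \<i> * of_int (snd k) * echar k (x, y)) (at y)"
  proof -
    have "((\<lambda>z. exp (\<i> * (2 * pi * (of_int (fst k) * of_real x + of_int (snd k) * z)))) has_field_derivative
      2 * pi * \<i> * of_int (snd k) * exp (\<i> * (2 * pi * (of_int (fst k) * of_real x + of_int (snd k) * of_real y)))) (at (of_real y))"
      by (auto intro!: derivative_eq_intros)
    from has_vector_derivative_real_field[OF this] show ?thesis
      by (simp add: echar_def cis_conv_exp)
  qed
qed

lemma DERIV_Re_fourier_sum:
  "((\<lambda>s. Re (fourier_sum K a (s, y))) has_real_derivative Re (fourier_sum K (\<lambda>k. 2 * pi * \<i> * of_int (fst k) * a k) (x, y))) (at x)"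
  "((\<lambda>s. Re (fourier_sum K a (x, s))) has_real_derivative Re (fourier_sum K (\<lambda>k. 2 * pi * \<i> * of_int (snd k) * a k) (x, y))) (at y)"
proof -
  have 1: "((\<lambda>s. fourier_sum K a (s, y)) has_vector_derivative fourier_sum K (\<lambda>k. 2 * pi * \<i> * of_int (fst k) * a k) (x, y)) (at x)"
    unfolding fourier_sum_def by (auto intro!: derivative_eq_intros DERIV_echar simp: mult_ac sum.distrib)
  have 2: "((\<lambda>s. fourier_sum K a (x, s)) has_vector_derivative fourier_sum K (\<lambda>k. 2 * pi * \<i> * of_int (snd k) * a k) (x, y)) (at y)"
    unfolding fourier_sum_def by (auto intro!: derivative_eq_intros DERIV_echar simp: mult_ac sum.distrib)
  show "((\<lambda>s. Re (fourier_sum K a (s, y))) has_real_derivative Re (fourier_sum K (\<lambda>k. 2 * pi * \<i> * of_int (fst k) * a k) (x, y))) (at x)"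
    "((\<lambda>s. Re (fourier_sum K a (x, s))) has_real_derivative Re (fourier_sum K (\<lambda>k. 2 * pi * \<i> * of_int (snd k) * a k) (x, y))) (at y)"
    using bounded_linear.has_vector_derivative[OF bounded_linear_Re 1]
      bounded_linear.has_vector_derivative[OF bounded_linear_Re 2]
    by (auto simp: has_real_derivative_iff_has_vector_derivative)
qed

lemma bounded_cont_Re_fourier_sum: "bounded_cont (\<lambda>x. Re (fourier_sum K a x))"
  unfolding bounded_cont_def
proof (intro conjI exI allI)
  show "continuous_on UNIV (\<lambda>x. Re (fourier_sum K a x))" by (intro continuous_intros)
  show "\<bar>Re (fourier_sum K a x)\<bar> \<le> (\<Sum>k\<in>K. norm (a k))" for x
    using abs_Re_le_cmod norm_fourier_sum_le by (rule order_trans)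
qed

lemma fourier_sum_periodic: "fourier_sum K a (x + (1, 0)) = fourier_sum K a x" "fourier_sum K a (x + (0, 1)) = fourier_sum K a x"
  by (simp_all add: fourier_sum_def echar_periodic)

lemma bounded_cont_mult: "bounded_cont f \<Longrightarrow> bounded_cont g \<Longrightarrow> bounded_cont (\<lambda>x. f x * g x)"
proof -
  assume "bounded_cont f" "bounded_cont g"
  then obtain A B where *: "\<And>x. \<bar>f x\<bar> \<le> A" "\<And>x. \<bar>g x\<bar> \<le> B" "continuous_on UNIV f" "continuous_on UNIV g"
    unfolding bounded_cont_def by blast
  have "0 \<le> A" using *(1)[of 0] by linarith
  then have "\<bar>f x * g x\<bar> \<le> A * B" for x
    unfolding abs_mult by (intro mult_mono *) auto
  with * show ?thesis unfolding bounded_cont_def by (auto intro: continuous_intros)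
qed

lemma bounded_cont_diff: "bounded_cont f \<Longrightarrow> bounded_cont g \<Longrightarrow> bounded_cont (\<lambda>x. f x - g x)"
proof -
  assume "bounded_cont f" "bounded_cont g"
  then obtain A B where *: "\<And>x. \<bar>f x\<bar> \<le> A" "\<And>x. \<bar>g x\<bar> \<le> B" "continuous_on UNIV f" "continuous_on UNIV g"
    unfolding bounded_cont_def by blast
  have "\<bar>f x - g x\<bar> \<le> A + B" for x
    using *(1)[of x] *(2)[of x] by linarith
  with * show ?thesis unfolding bounded_cont_def by (auto intro: continuous_intros)
qed

abbreviation rfcoeff :: "(real \<times> real \<Rightarrow> real) \<Rightarrow> int \<times> int \<Rightarrow> complex" where
  "rfcoeff f \<equiv> fcoeff (\<lambda>x. of_real (f x))"

abbreviation Fejr :: "nat \<Rightarrow> (real \<times> real \<Rightarrow> real) \<Rightarrow> real \<times> real \<Rightarrow> real" where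
  "Fejr N f \<equiv> (\<lambda>x. Re (Fej N (\<lambda>x. of_real (f x)) x))"

lemma Fejr_tendsto:
  assumes "square_integrable U2 f"
  shows "(\<lambda>N. norm2 U2 (\<lambda>x. Fejr N f x - f x)) \<longlonglongrightarrow> 0"
proof (rule Lim_null_comparison[OF _ Fej_tendsto[OF approx_square_integrable[OF assms]]], rule always_eventually, rule allI)
  fix N
  have "csquare_integrable (\<lambda>x. Fej N (\<lambda>x. of_real (f x)) x - of_real (f x))"
    using assms by (intro csquare_integrable_diff csquare_integrable_Fej) (simp add: csquare_integrable_of_real)
  from csquare_integrable_Re(2)[OF this] show "norm (norm2 U2 (\<lambda>x. Fejr N f x - f x)) \<le> cnorm2 (\<lambda>x. Fej N (\<lambda>x. of_real (f x)) x - of_real (f x))"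
    by simp
qed

lemma square_integrable_Fejr: "square_integrable U2 (Fejr N f)"
  using bounded_cont_square_integrable[OF bounded_cont_Re_fourier_sum] by (simp add: Fej_def)

lemma trig_Fejr: "trig (\<lambda>x. of_real (Fejr N f x))"
  unfolding Fej_def by (intro trig_Re trig_fourier_sum)

lemma rfcoeff_L1_tendsto:
  assumes "\<And>n. integrable U2 (f n)" "integrable U2 F" "(\<lambda>n. \<integral>x. \<bar>f n x - F x\<bar> \<partial>U2) \<longlonglongrightarrow> 0"
  shows "(\<lambda>n. rfcoeff (f n) k) \<longlonglongrightarrow> rfcoeff F k"
proof (rule LIM_zero_cancel, rule Lim_null_comparison[OF _ assms(3)], rule always_eventually, rule allI)
  fix n
  have "rfcoeff (f n) k - rfcoeff F k = rfcoeff (\<lambda>x. f n x - F x) k"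
    using assms(1,2) by (simp add: fcoeff_diff)
  also have "norm \<dots> \<le> (\<integral>x. norm (complex_of_real (f n x - F x)) \<partial>U2)"
    using assms(1,2) by (intro norm_fcoeff_le) auto
  finally show "norm (rfcoeff (f n) k - rfcoeff F k) \<le> (\<integral>x. \<bar>f n x - F x\<bar> \<partial>U2)"
    by (simp only: norm_of_real)
qed

text \<open>The \<open>x1\<close>-derivative of \<open>1/2 * w\<^sup>2 * cnj (echar k)\<close>
  integrates to 0 over a period.\<close>

lemma rfcoeff_half_square_smooth:
  assumes w: "bounded_cont w" "bounded_cont w1" "\<And>x. w (x + (1, 0)) = w x"
    and D: "\<And>x y. ((\<lambda>s. w (s, y)) has_real_derivative w1 (x, y)) (at x)"
  shows "rfcoeff (\<lambda>x. w x * w1 x) k = 2 * pi * \<i> * of_int (fst k) * rfcoeff (\<lambda>x. 1/2 * (w x)\<^sup>2) k"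
proof -
  have [continuous_intros]: "continuous_on A (\<lambda>z. w (f z))" "continuous_on A (\<lambda>z. w1 (f z))"
    if "continuous_on A f" for A and f :: "real \<times> real \<Rightarrow> real \<times> real"
    using w that unfolding bounded_cont_def by (auto intro: continuous_on_compose2)
  have c': "continuous_on A (\<lambda>z. w (f z))" "continuous_on A (\<lambda>z. w1 (f z))"
    if "continuous_on A f" for A and f :: "real \<Rightarrow> real \<times> real"
    using w that unfolding bounded_cont_def by (auto intro: continuous_on_compose2)
  let ?c = "2 * pi * \<i> * of_int (fst k)"
  let ?f = "\<lambda>x. complex_of_real (w x * w1 x) * cnj (echar k x)" and ?g = "\<lambda>x. complex_of_real (1/2 * (w x)\<^sup>2) * cnj (echar k x)"
  have i: "integrable U2 ?f" "integrable U2 ?g"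
    by (intro integrable_segs_continuous continuous_intros)+
  have "(\<integral>x. ?f (x, y) - ?c * ?g (x, y) \<partial>U) = 0" for y
  proof -
    have Dw: "((\<lambda>s. w (s, y)) has_vector_derivative w1 (x, y)) (at x)" for x
      using D by (simp add: has_real_derivative_iff_has_vector_derivative)
    have De: "((\<lambda>s. cnj (echar k (s, y))) has_vector_derivative - ?c * cnj (echar k (x, y))) (at x)" for x
      using DERIV_echar(1)[of "- k" y x] by (simp add: cnj_echar)
    have Dw2: "((\<lambda>s. complex_of_real (1/2 * (w (s, y))\<^sup>2)) has_vector_derivative complex_of_real (w (x, y) * w1 (x, y))) (at x)" for x
      by (intro has_vector_derivative_of_real)
         (auto intro!: derivative_eq_intros D)
    have "(\<integral>x. ?f (x, y) - ?c * ?g (x, y) \<partial>U) = ?g (1, y) - ?g (0, y)"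
    proof (rule integral_seg_FTC)
      show "continuous_on UNIV (\<lambda>x. ?f (x, y) - ?c * ?g (x, y))"
        by (intro continuous_intros c')
      show "((\<lambda>x. ?g (x, y)) has_vector_derivative ?f (x, y) - ?c * ?g (x, y)) (at x)" for x
        using has_vector_derivative_mult[OF Dw2[of x] De[of x]] by (simp add: algebra_simps)
    qed simp
    also have "\<dots> = 0"
      using w(3)[of "(0, y)"] echar_periodic(1)[of k "(0, y)"] by simp
    finally show ?thesis .
  qed
  then have "(\<integral>x. ?f x - ?c * ?g x \<partial>U2) = 0"
    by (subst integral_U2[OF Bochner_Integration.integrable_diff[OF i(1) integrable_mult_right[OF i(2)]]])
       (simp only: integral_zero)
  then have "(\<integral>x. ?f x \<partial>U2) - ?c * (\<integral>x. ?g x \<partial>U2) = 0"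
    by (simp only: Bochner_Integration.integral_diff[OF i(1) integrable_mult_right[OF i(2)]] integral_mult_right_zero)
  then show ?thesis
    unfolding fcoeff_def by (simp only: right_minus_eq)
qed

text \<open>Here \<open>v = \<partial>\<^sub>1 w\<close> and \<open>g = |\<partial>\<^sub>1|\<^sup>-\<^sup>1 \<eta>\<close>, expressed through Fourier coefficients.\<close>

locale burgers =
  fixes w v g :: "real \<times> real \<Rightarrow> real"
  assumes sq: "square_integrable U2 w" "square_integrable U2 v" "square_integrable U2 g"
    and fcoeff_v: "rfcoeff v k = 2 * pi * \<i> * of_int (fst k) * rfcoeff w k"
    and fcoeff_eq: "2 * pi * \<i> * of_int (snd k) * rfcoeff w k =
      2 * pi * \<i> * of_int (fst k) * rfcoeff (\<lambda>x. 1/2 * (w x)\<^sup>2) k + 2 * pi * of_int \<bar>fst k\<bar> * rfcoeff g k"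
    and fcoeff_0: "fst k = 0 \<Longrightarrow> rfcoeff w k = 0"
    and per: "w (x + (1, 0)) = w x"
begin

definition wN where "wN N = Fejr N w"
definition vN where "vN N = Fejr N v"
definition w2N where "w2N N x = Re (fourier_sum (fbox N) (\<lambda>k. 2 * pi * \<i> * of_int (snd k) * (fej2 N k * rfcoeff w k)) x)"
text \<open>Fejer mean of the Hilbert transform of \<open>g\<close> in \<open>x1\<close>: the
  multiplier \<open>- \<i> * sgn k1\<close> times the symbol \<open>2 * pi * \<i> * k1\<close> of
  the derivative is \<open>2 * pi * |k1|\<close>, so
  \<open>\<partial>\<^sub>1 G = |\<partial>\<^sub>1| g\<close>.\<close>

definition GN where "GN N x = Re (fourier_sum (fbox N) (\<lambda>k. (fej2 N k * (- \<i> * of_int (sgn (fst k)))) * rfcoeff g k) x)"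
definition G1N where "G1N N x = Re (fourier_sum (fbox N) (\<lambda>k. 2 * pi * \<i> * of_int (fst k) * ((fej2 N k * (- \<i> * of_int (sgn (fst k)))) * rfcoeff g k)) x)"
text \<open>Fejer mean of the distribution \<open>\<partial>\<^sub>1 (w\<^sup>2 / 2)\<close>, given
  by coefficients because at this point it is not known to be a function; \<open>DN_eq\<close>
  identifies it afterwards.\<close>

definition DN where "DN N x = Re (fourier_sum (fbox N) (\<lambda>k. fej2 N k * (2 * pi * \<i> * of_int (fst k) * rfcoeff (\<lambda>x. 1/2 * (w x)\<^sup>2) k)) x)"
definition eN where "eN N x = DN N x - wN N x * vN N x"

lemma bounded_contN: "bounded_cont (wN N)" "bounded_cont (vN N)" "bounded_cont (w2N N)" "bounded_cont (GN N)" "bounded_cont (G1N N)" "bounded_cont (DN N)" "bounded_cont (eN N)"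
proof -
  show 1: "bounded_cont (wN N)" "bounded_cont (vN N)" "bounded_cont (w2N N)" "bounded_cont (GN N)" "bounded_cont (G1N N)" "bounded_cont (DN N)"
    unfolding wN_def vN_def w2N_def[abs_def] GN_def[abs_def] G1N_def[abs_def] DN_def[abs_def] Fej_def
    by (rule bounded_cont_Re_fourier_sum)+
  show "bounded_cont (eN N)"
    unfolding eN_def[abs_def] by (rule bounded_cont_diff[OF 1(6) bounded_cont_mult[OF 1(1,2)]])
qed

lemma DERIV_wN: "((\<lambda>s. wN N (s, y)) has_real_derivative vN N (x, y)) (at x)"
proof -
  have "vN N (x, y) = Re (fourier_sum (fbox N) (\<lambda>k. 2 * pi * \<i> * of_int (fst k) * (fej2 N k * rfcoeff w k)) (x, y))"
    unfolding vN_def Fej_def fcoeff_v by (simp add: mult_ac)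
  then show ?thesis
    unfolding wN_def Fej_def by (simp only: DERIV_Re_fourier_sum(1))
qed

lemma perN: "wN N (x + (1, 0)) = wN N x" "vN N (x + (1, 0)) = vN N x" "GN N (x + (1, 0)) = GN N x" "eN N (x + (1, 0)) = eN N x"
  by (simp_all add: wN_def vN_def GN_def eN_def DN_def Fej_def fourier_sum_periodic)

text \<open>The multipliers \<open>fej2 N k\<close> pass through the equation mode by mode. What
  they yield is \<open>DN\<close>, and \<open>eN\<close> is by definition its deviation from the
  product \<open>wN * vN\<close>.\<close>

lemma flowN: "w2N N x = wN N x * vN N x + G1N N x + eN N x"
proof -
  have "w2N N x = DN N x + G1N N x"
    unfolding w2N_def DN_def G1N_def plus_complex.sel[symmetric] fourier_sum_def sum.distrib[symmetric]
  proof (intro arg_cong[of _ _ Re] sum.cong refl)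
    fix k
    have "2 * pi * \<i> * of_int (snd k) * (fej2 N k * rfcoeff w k) = fej2 N k * (2 * pi * \<i> * of_int (snd k) * rfcoeff w k)"
      by (simp add: mult_ac)
    also have "\<dots> = fej2 N k * (2 * pi * \<i> * of_int (fst k) * rfcoeff (\<lambda>x. 1/2 * (w x)\<^sup>2) k) + fej2 N k * (2 * pi * of_int \<bar>fst k\<bar> * rfcoeff g k)"
      unfolding fcoeff_eq by (simp only: distrib_left)
    also have "fej2 N k * (2 * pi * of_int \<bar>fst k\<bar> * rfcoeff g k) = 2 * pi * \<i> * of_int (fst k) * ((fej2 N k * (- \<i> * of_int (sgn (fst k)))) * rfcoeff g k)"
      by (simp add: sgn_if abs_if)
    finally show "2 * pi * \<i> * of_int (snd k) * (fej2 N k * rfcoeff w k) * echar k x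
       = fej2 N k * (2 * pi * \<i> * of_int (fst k) * rfcoeff (\<lambda>x. 1/2 * (w x)\<^sup>2) k) * echar k x
       + 2 * pi * \<i> * of_int (fst k) * ((fej2 N k * (- \<i> * of_int (sgn (fst k)))) * rfcoeff g k) * echar k x"
      by (simp only: distrib_right)
  qed
  then show ?thesis by (simp add: eN_def)
qed

sublocale flow: forced_flow "wN N" "vN N" "w2N N" "GN N" "G1N N" "eN N" for N
proof
  show "((\<lambda>y. wN N (s, y)) has_real_derivative w2N N (s, y)) (at y)" for s y
    unfolding wN_def w2N_def Fej_def by (rule DERIV_Re_fourier_sum(2))
  show "((\<lambda>s. GN N (s, y)) has_real_derivative G1N N (s, y)) (at s)" for s y
    unfolding GN_def G1N_def by (rule DERIV_Re_fourier_sum(1))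
qed (auto simp: bounded_contN perN DERIV_wN flowN)

lemma wN_tendsto: "(\<lambda>N. norm2 U2 (\<lambda>x. wN N x - w x)) \<longlonglongrightarrow> 0"
  and vN_tendsto: "(\<lambda>N. norm2 U2 (\<lambda>x. vN N x - v x)) \<longlonglongrightarrow> 0"
  unfolding wN_def vN_def by (intro Fejr_tendsto sq)+

lemma norm2_vN_le: "norm2 U2 (vN N) \<le> norm2 U2 v"
  using csquare_integrable_Re(2)[OF csquare_integrable_Fej] Fej_L2_contraction[of "\<lambda>x. of_real (v x)" N] sq(2)
  unfolding vN_def csquare_integrable_of_real cnorm2_of_real by (blast intro: order_trans)

lemma norm2_GN_le: "norm2 U2 (GN N) \<le> norm2 U2 g"
proof -
  have "norm2 U2 (GN N) \<le> cnorm2 (fourier_sum (fbox N) (\<lambda>k. (fej2 N k * (- \<i> * of_int (sgn (fst k)))) * rfcoeff g k))"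
    unfolding GN_def[abs_def] by (intro csquare_integrable_Re(2) csquare_integrable_fourier_sum)
  also have "\<dots> \<le> cnorm2 (\<lambda>x. of_real (g x))"
    by (rule multiplier_bound)
       (use sq fej2_nonneg fej2_le_1 in \<open>auto simp: csquare_integrable_of_real norm_mult sgn_if\<close>)
  finally show ?thesis by (simp add: cnorm2_of_real)
qed

text \<open>For the Fejer means this is integration by parts. Both \<open>wN * vN\<close> and
  \<open>wN * wN\<close> converge in \<open>L1\<close>, which controls coefficients, so the
  distribution \<open>\<partial>\<^sub>1 (w\<^sup>2 / 2)\<close> is the integrable function
  \<open>w * v\<close>.\<close>

lemma fcoeff_wv: "rfcoeff (\<lambda>x. w x * v x) k = 2 * pi * \<i> * of_int (fst k) * rfcoeff (\<lambda>x. 1/2 * (w x)\<^sup>2) k"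
proof (rule LIMSEQ_unique)
  note s = bounded_cont_square_integrable[OF bounded_contN(1)] bounded_cont_square_integrable[OF bounded_contN(2)]
  show "(\<lambda>N. rfcoeff (\<lambda>x. wN N x * vN N x) k) \<longlonglongrightarrow> rfcoeff (\<lambda>x. w x * v x) k"
    by (rule rfcoeff_L1_tendsto)
       (intro square_integrable_mult_integrable s sq norm2_tendsto_mult_L1 wN_tendsto vN_tendsto)+
  have 1: "(\<lambda>N. rfcoeff (\<lambda>x. wN N x * wN N x) k) \<longlonglongrightarrow> rfcoeff (\<lambda>x. w x * w x) k"
    by (rule rfcoeff_L1_tendsto)
       (intro square_integrable_mult_integrable s sq norm2_tendsto_mult_L1 wN_tendsto vN_tendsto)+
  have 2: "rfcoeff (\<lambda>x. 1/2 * (f x)\<^sup>2) k = 1/2 * rfcoeff (\<lambda>x. f x * f x) k" for f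
    using fcoeff_cmult[of "1/2" "\<lambda>x. of_real (f x * f x)"] by (simp add: power2_eq_square)
  have 3: "rfcoeff (\<lambda>x. wN N x * vN N x) k = 2 * pi * \<i> * of_int (fst k) * rfcoeff (\<lambda>x. 1/2 * (wN N x)\<^sup>2) k" for N
    by (rule rfcoeff_half_square_smooth[OF bounded_contN(1,2) perN(1) DERIV_wN])
  show "(\<lambda>N. rfcoeff (\<lambda>x. wN N x * vN N x) k) \<longlonglongrightarrow> 2 * pi * \<i> * of_int (fst k) * rfcoeff (\<lambda>x. 1/2 * (w x)\<^sup>2) k"
    unfolding 3 2 by (intro tendsto_intros 1)
qed

lemma DN_eq: "DN N = Fejr N (\<lambda>x. w x * v x)"
  by (rule ext) (simp only: DN_def Fej_def fcoeff_wv)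

text \<open>\<open>w * v\<close> is only in \<open>L1\<close>, where convergence of Fejer means has
  not been shown directly. It is replaced by \<open>wM * vM\<close> with \<open>M\<close> fixed:
  this is a trigonometric polynomial, on which the means converge uniformly, and the
  \<open>L1\<close> contraction absorbs the replacement. Four errors of size
  \<open>\<epsilon> / 4\<close> result.\<close>

lemma eN_tendsto: "(\<lambda>N. \<integral>x. \<bar>eN N x\<bar> \<partial>U2) \<longlonglongrightarrow> 0"
proof (rule LIMSEQ_I)
  fix \<epsilon> :: real assume \<epsilon>: "0 < \<epsilon>"
  note s = bounded_cont_square_integrable[OF bounded_contN(1)] bounded_cont_square_integrable[OF bounded_contN(2)]
  let ?p = "\<lambda>x. complex_of_real (w x * v x)"
  let ?A = "\<lambda>M x. complex_of_real (wN M x * vN M x)"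
  have ip: "integrable U2 (\<lambda>x. w x * v x)" and iA: "integrable U2 (\<lambda>x. wN M x * vN M x)" for M
    by (intro square_integrable_mult_integrable s sq)+
  have ip': "integrable U2 ?p" and iA': "integrable U2 (?A M)" for M
    using ip iA by (auto simp del: of_real_mult)
  have L: "(\<lambda>N. \<integral>x. \<bar>wN N x * vN N x - w x * v x\<bar> \<partial>U2) \<longlonglongrightarrow> 0"
    by (intro norm2_tendsto_mult_L1 s sq wN_tendsto vN_tendsto)
  then obtain M where M: "(\<integral>x. \<bar>wN n x * vN n x - w x * v x\<bar> \<partial>U2) < \<epsilon> / 4" if "n \<ge> M" for n
    using LIMSEQ_D[OF L, of "\<epsilon> / 4"] \<epsilon> by auto
  have "trig (?A M)"
    unfolding of_real_mult wN_def vN_def by (intro trig_mult trig_Fejr)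
  then obtain B where B: "B \<longlonglongrightarrow> 0" "\<And>N x. norm (Fej N (?A M) x - ?A M x) \<le> B N"
    using Fej_trig by blast
  then obtain N0 where N0: "B N < \<epsilon> / 4" if "N \<ge> N0" for N
    using LIMSEQ_D[OF B(1), of "\<epsilon> / 4"] \<epsilon> by fastforce
  have "norm ((\<integral>x. \<bar>eN N x\<bar> \<partial>U2) - 0) < \<epsilon>" if N: "N \<ge> max M N0" for N
  proof -
    let ?d = "\<lambda>x. ?p x - ?A M x"
    have id: "integrable U2 ?d" using ip' iA' by auto
    have iF: "integrable U2 (\<lambda>x. norm (Fej N ?d x))"
      by (intro integrable_segs_continuous continuous_intros)
    have ie: "integrable U2 (\<lambda>x. \<bar>eN N x\<bar>)"
      using bounded_contN(7)[of N] by (intro integrable_abs U2.square_integrable_integrable bounded_cont_square_integrable)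
    have iB: "integrable U2 (\<lambda>x. B N + norm (Fej N ?d x) + \<bar>wN M x * vN M x - w x * v x\<bar> + \<bar>wN N x * vN N x - w x * v x\<bar>)"
      using iF ip iA by auto
    have "(\<integral>x. \<bar>eN N x\<bar> \<partial>U2) \<le> (\<integral>x. B N + norm (Fej N ?d x) + \<bar>wN M x * vN M x - w x * v x\<bar> + \<bar>wN N x * vN N x - w x * v x\<bar> \<partial>U2)"
    proof (rule integral_mono[OF ie iB])
      fix x
      have "eN N x = Re (Fej N (?A M) x - ?A M x) + Re (Fej N ?d x) + (wN M x * vN M x - w x * v x) - (wN N x * vN N x - w x * v x)"
        unfolding eN_def DN_eq Fej_diff[OF ip' iA'] by simp
      moreover have "\<bar>Re (Fej N (?A M) x - ?A M x)\<bar> \<le> B N"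
        using abs_Re_le_cmod B(2) by (rule order_trans)
      ultimately show "\<bar>eN N x\<bar> \<le> B N + norm (Fej N ?d x) + \<bar>wN M x * vN M x - w x * v x\<bar> + \<bar>wN N x * vN N x - w x * v x\<bar>"
        using abs_Re_le_cmod[of "Fej N ?d x"] by linarith
    qed
    also have "\<dots> = B N + (\<integral>x. norm (Fej N ?d x) \<partial>U2) + (\<integral>x. \<bar>wN M x * vN M x - w x * v x\<bar> \<partial>U2) + (\<integral>x. \<bar>wN N x * vN N x - w x * v x\<bar> \<partial>U2)"
      using iF ip iA U2.prob_space by simp
    also have "(\<integral>x. norm (Fej N ?d x) \<partial>U2) \<le> (\<integral>x. norm (?d x) \<partial>U2)"
      by (rule Fej_L1_contraction[OF id])
    also have "(\<integral>x. norm (?d x) \<partial>U2) = (\<integral>x. \<bar>wN M x * vN M x - w x * v x\<bar> \<partial>U2)"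
      by (simp add: abs_minus_commute flip: of_real_mult of_real_diff del: of_real_mult of_real_diff)
    finally show ?thesis
      using M[of M] M[of N] N0[of N] N by simp
  qed
  then show "\<exists>no. \<forall>n\<ge>no. norm ((\<integral>x. \<bar>eN n x\<bar> \<partial>U2) - 0) < \<epsilon>" by blast
qed

end

section \<open>Bounds on the increments\<close>

lemma diff1_square_integrable:
  assumes f: "square_integrable U2 f" and per: "\<And>x. f (x + (1, 0)) = f x" and h: "0 \<le> h" "h \<le> 1"
  shows "square_integrable U2 (diff1 h f)" "norm2 U2 (diff1 h f) \<le> 2 * norm2 U2 f"
proof -
  note s = square_integrable_U2_shift[OF f per h]
  show "square_integrable U2 (diff1 h f)"
    unfolding diff1_def[abs_def] by (rule square_integrable_diff[OF s(1) f])
  have "norm2 U2 (diff1 h f) \<le> norm2 U2 (\<lambda>x. f (x + (h, 0)) - 0) + norm2 U2 (\<lambda>x. 0 - f x)"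
    unfolding diff1_def[abs_def] by (rule norm2_diff_triangle[OF s(1) _ f]) (simp add: square_integrable_def)
  also have "norm2 U2 (\<lambda>x. 0 - f x) = norm2 U2 f" by (simp add: norm2_def)
  finally show "norm2 U2 (diff1 h f) \<le> 2 * norm2 U2 f" by (simp add: s(2))
qed

text \<open>Integration over slices \<open>b\<close> turns slice quantities into integrals over the
  full square at fixed shift \<open>t\<close>, for which the increment bounds are available.\<close>

lemma nn_integral_rotate:
  fixes \<phi> :: "real \<Rightarrow> real \<times> real \<Rightarrow> ennreal"
  assumes [measurable]: "(\<lambda>(t, z). \<phi> t z) \<in> borel_measurable (borel \<Otimes>\<^sub>M borel)"
  shows "(\<integral>\<^sup>+b. \<integral>\<^sup>+z. \<phi> (fst z) (snd z, b) \<partial>(seg 0 h \<Otimes>\<^sub>M U) \<partial>U) = (\<integral>\<^sup>+t. \<integral>\<^sup>+z. \<phi> t z \<partial>U2 \<partial>seg 0 h)"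
proof -
  have m: "(\<lambda>x. \<phi> (f x) (g x, k x)) \<in> borel_measurable M"
    if [measurable]: "f \<in> borel_measurable M" "g \<in> borel_measurable M" "k \<in> borel_measurable M" for f g k and M :: "'x measure"
    using measurable_compose[OF measurable_Pair[of f M borel "\<lambda>x. (g x, k x)" borel] assms] by simp
  have 1: "(\<integral>\<^sup>+z. \<phi> (fst z) (snd z, b) \<partial>(seg 0 h \<Otimes>\<^sub>M U)) = (\<integral>\<^sup>+t. \<integral>\<^sup>+x. \<phi> t (x, b) \<partial>U \<partial>seg 0 h)" for b
    by (subst U.nn_integral_fst[symmetric]) (auto intro!: m)
  have "(\<integral>\<^sup>+b. \<integral>\<^sup>+t. \<integral>\<^sup>+x. \<phi> t (x, b) \<partial>U \<partial>seg 0 h \<partial>U) = (\<integral>\<^sup>+t. \<integral>\<^sup>+b. \<integral>\<^sup>+x. \<phi> t (x, b) \<partial>U \<partial>U \<partial>seg 0 h)"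
    by (rule segs.Fubini') (auto simp: split_beta intro!: U.borel_measurable_nn_integral m)
  moreover have "(\<integral>\<^sup>+b. \<integral>\<^sup>+x. \<phi> t (x, b) \<partial>U \<partial>U) = (\<integral>\<^sup>+z. \<phi> t z \<partial>U2)" for t
    using m[of "\<lambda>_. t" borel fst snd] by (subst nn_integral_U2) auto
  ultimately show ?thesis unfolding 1 by simp
qed

text \<open>Split at the level \<open>X powr (1/q)\<close>. Below it \<open>|u|^p\<close> is at most
  the level to the power \<open>p\<close>, above it \<open>|u|^(p-q)\<close> is at most the level to
  the power \<open>p - q\<close>; each part contributes \<open>X powr (p/q)\<close>, whence the
  factor 2. For \<open>X = 0\<close> the level is 0 and \<open>0 powr (p - q) = 0\<close> would
  spoil the split.\<close>

lemma nn_integral_lower_power: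
  fixes u :: "'a \<Rightarrow> real"
  assumes M: "prob_space M" and [measurable]: "u \<in> borel_measurable M" and pq: "0 < p" "p \<le> q"
    and X: "(\<integral>\<^sup>+x. ennreal (\<bar>u x\<bar> powr q) \<partial>M) \<le> ennreal X" and X0: "0 \<le> X"
  shows "(\<integral>\<^sup>+x. ennreal (\<bar>u x\<bar> powr p) \<partial>M) \<le> ennreal (2 * X powr (p / q))"
proof (cases "X = 0")
  case True
  then have "(\<integral>\<^sup>+x. ennreal (\<bar>u x\<bar> powr q) \<partial>M) = 0" using X by simp
  then have "AE x in M. ennreal (\<bar>u x\<bar> powr q) = 0"
    by (subst nn_integral_0_iff_AE[symmetric]) auto
  then have "AE x in M. ennreal (\<bar>u x\<bar> powr p) = 0"
    by eventually_elim (auto simp: ennreal_eq_0_iff powr_def split: if_splits)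
  then have "(\<integral>\<^sup>+x. ennreal (\<bar>u x\<bar> powr p) \<partial>M) = 0"
    by (subst nn_integral_0_iff_AE) auto
  then show ?thesis by simp
next
  case False
  then have X: "0 < X" "(\<integral>\<^sup>+x. ennreal (\<bar>u x\<bar> powr q) \<partial>M) \<le> ennreal X" using X X0 by auto
  interpret prob_space M by (rule M)
  let ?l = "X powr (1 / q)"
  let ?c = "?l powr (p - q)"
  have l: "0 < ?l" using X by simp
  have p: "\<bar>u x\<bar> powr p \<le> ?c * \<bar>u x\<bar> powr q + ?l powr p" for x
  proof (cases "\<bar>u x\<bar> \<le> ?l")
    case True
    then have "\<bar>u x\<bar> powr p \<le> ?l powr p" using pq by (intro powr_mono2) auto
    then show ?thesis by (simp add: add_increasing)
  next
    case False
    then have "\<bar>u x\<bar> powr (p - q) \<le> ?c" using pq l by (intro powr_mono2') auto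
    then have "\<bar>u x\<bar> powr (p - q) * \<bar>u x\<bar> powr q \<le> ?c * \<bar>u x\<bar> powr q" by (intro mult_right_mono) auto
    then have "\<bar>u x\<bar> powr p \<le> ?c * \<bar>u x\<bar> powr q" by (simp flip: powr_add)
    then show ?thesis by (simp add: add_increasing2)
  qed
  have "(\<integral>\<^sup>+x. ennreal (\<bar>u x\<bar> powr p) \<partial>M) \<le> (\<integral>\<^sup>+x. ennreal ?c * ennreal (\<bar>u x\<bar> powr q) + ennreal (?l powr p) \<partial>M)"
  proof (rule nn_integral_mono)
    fix x
    show "ennreal (\<bar>u x\<bar> powr p) \<le> ennreal ?c * ennreal (\<bar>u x\<bar> powr q) + ennreal (?l powr p)"
      using ennreal_leI[OF p[of x]] by (subst ennreal_mult'[symmetric], simp, subst ennreal_plus[symmetric]) auto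
  qed
  also have "\<dots> = ennreal ?c * (\<integral>\<^sup>+x. ennreal (\<bar>u x\<bar> powr q) \<partial>M) + ennreal (?l powr p)"
    by (simp add: nn_integral_add nn_integral_cmult emeasure_space_1)
  also have "\<dots> \<le> ennreal ?c * ennreal X + ennreal (?l powr p)"
    by (intro add_mono mult_left_mono X) auto
  also have "\<dots> = ennreal (?c * X + ?l powr p)"
    using X by (subst ennreal_mult'[symmetric], simp, subst ennreal_plus[symmetric]) auto
  also have "?c * X = X powr (p / q)"
  proof -
    have "?c * X = X powr ((p - q) / q) * X powr 1" using X by (simp add: powr_powr)
    also have "\<dots> = X powr ((p - q) / q + 1)" by (simp only: powr_add)
    also have "(p - q) / q + 1 = p / q" using pq by (simp add: field_simps)
    finally show ?thesis .
  qed
  finally show ?thesis by (simp add: powr_powr)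
qed

lemma tendsto_zero_le:
  fixes a b :: real
  assumes "\<And>N. a \<le> b + r N" "r \<longlonglongrightarrow> 0" shows "a \<le> b"
proof -
  have "(\<lambda>N. b + r N) \<longlonglongrightarrow> b + 0" by (intro tendsto_intros assms)
  then show ?thesis using assms(1) by (intro LIMSEQ_le_const[of _ b a]) auto
qed

section \<open>Increment bounds in the limit of the Fejer means\<close>

context burgers
begin

lemma w_borel [measurable]: "w \<in> borel_measurable borel" "v \<in> borel_measurable borel"
  using sq by (simp_all add: square_integrable_def)

text \<open>The value of \<open>energy\<close> when both of its integrals are finite.\<close>

definition E0 where "E0 = norm2 U2 v * norm2 U2 g"

lemma E0_nonneg: "0 \<le> E0" by (simp add: E0_def)

lemma diff1_wN:
  assumes h: "0 \<le> h" "h \<le> 1"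
  shows "(\<integral>x. \<bar>diff1 h (wN N) x - diff1 h w x\<bar> \<partial>U2) \<le> 2 * norm2 U2 (\<lambda>x. wN N x - w x)"
    "integrable U2 (\<lambda>x. \<bar>diff1 h (wN N) x - diff1 h w x\<bar>)"
proof -
  let ?f = "\<lambda>x. wN N x - w x"
  have f: "square_integrable U2 ?f" by (intro square_integrable_diff bounded_cont_square_integrable bounded_contN sq)
  have p: "?f (x + (1, 0)) = ?f x" for x by (simp add: perN per)
  have e: "diff1 h (wN N) x - diff1 h w x = diff1 h ?f x" for x by (simp add: diff1_def)
  note d = diff1_square_integrable[OF f p h]
  show "(\<integral>x. \<bar>diff1 h (wN N) x - diff1 h w x\<bar> \<partial>U2) \<le> 2 * norm2 U2 ?f"
    unfolding e using U2.integral_abs_le_norm2[OF d(1)] d(2) by linarith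
  show "integrable U2 (\<lambda>x. \<bar>diff1 h (wN N) x - diff1 h w x\<bar>)"
    unfolding e by (intro integrable_abs U2.square_integrable_integrable d)
qed

lemma Karman_Howarth_Monin_error:
  assumes "0 \<le> K" "0 \<le> h"
  shows "h * (2 * K * (\<integral>x. \<bar>eN N x\<bar> \<partial>U2) + 4 * norm2 U2 (vN N) * norm2 U2 (GN N)) \<le> 2 * K * h * (\<integral>x. \<bar>eN N x\<bar> \<partial>U2) + 4 * h * E0"
proof -
  have "h * (norm2 U2 (vN N) * norm2 U2 (GN N)) \<le> h * (norm2 U2 v * norm2 U2 g)"
    by (intro mult_left_mono mult_mono norm2_vN_le norm2_GN_le assms) auto
  then show ?thesis by (simp add: E0_def algebra_simps)
qed

text \<open>A Lipschitz bound gives at most linear growth, hence integrability, and an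
  \<open>L1\<close> error proportional to the \<open>L2\<close> error of the means. It is applied to
  \<open>S\<close> and to \<open>Q\<close>.\<close>

lemma integrable_profile:
  assumes "\<And>x y. \<bar>f x - f y\<bar> \<le> L * \<bar>x - y\<bar>" and [measurable]: "f \<in> borel_measurable borel" and h: "0 \<le> h" "h \<le> 1"
  shows "integrable U2 (\<lambda>x. f (diff1 h w x))" "integrable U2 (\<lambda>x. f (diff1 h (wN N) x))"
    "(\<integral>x. \<bar>f (diff1 h (wN N) x) - f (diff1 h w x)\<bar> \<partial>U2) \<le> 2 * L * norm2 U2 (\<lambda>x. wN N x - w x)"
proof -
  have "integrable U2 (\<lambda>x. f (u x))" if u: "integrable U2 u" for u
  proof (rule Bochner_Integration.integrable_bound)
    have [measurable]: "u \<in> borel_measurable borel" using borel_measurable_integrable[OF u] by simp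
    show "integrable U2 (\<lambda>x. L * \<bar>u x\<bar> + \<bar>f 0\<bar>)" using u by auto
    show "(\<lambda>x. f (u x)) \<in> borel_measurable U2" by simp
    show "AE x in U2. norm (f (u x)) \<le> norm (L * \<bar>u x\<bar> + \<bar>f 0\<bar>)"
    proof (rule AE_I2)
      fix x show "norm (f (u x)) \<le> norm (L * \<bar>u x\<bar> + \<bar>f 0\<bar>)"
        using assms(1)[of "u x" 0] by simp
    qed
  qed
  note * = this
  have iw: "integrable U2 (diff1 h w)" "integrable U2 (diff1 h (wN N))"
    by (intro U2.square_integrable_integrable diff1_square_integrable sq per perN bounded_cont_square_integrable bounded_contN h)+
  show i: "integrable U2 (\<lambda>x. f (diff1 h w x))" "integrable U2 (\<lambda>x. f (diff1 h (wN N) x))"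
    by (intro * iw)+
  have L: "0 \<le> L" using order_trans[OF abs_ge_zero assms(1)[of 1 0]] by simp
  have "(\<integral>x. \<bar>f (diff1 h (wN N) x) - f (diff1 h w x)\<bar> \<partial>U2) \<le> (\<integral>x. L * \<bar>diff1 h (wN N) x - diff1 h w x\<bar> \<partial>U2)"
    using i assms(1) diff1_wN(2)[OF h] by (intro integral_mono) auto
  also have "\<dots> \<le> L * (2 * norm2 U2 (\<lambda>x. wN N x - w x))"
    using diff1_wN(1)[OF h] L by (simp add: mult_left_mono)
  finally show "(\<integral>x. \<bar>f (diff1 h (wN N) x) - f (diff1 h w x)\<bar> \<partial>U2) \<le> 2 * L * norm2 U2 (\<lambda>x. wN N x - w x)"
    by simp
qed

text \<open>Over a full period in \<open>x2\<close> the two \<open>S\<close> terms cancel. The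
  profile, and with it \<open>K\<close>, is fixed while \<open>N\<close> grows, so the term with
  \<open>K\<close> and the error \<open>eN\<close> disappears; the result no longer contains
  \<open>K\<close>, which may then grow.\<close>

lemma Q_bound:
  assumes P: "profile \<psi> \<Phi> S H Q K C" and h: "0 \<le> h" "h \<le> 1"
  shows "(\<integral>x. Q (diff1 h w x) \<partial>U2) \<le> 4 * h * E0"
proof (rule tendsto_zero_le)
  interpret profile \<psi> \<Phi> S H Q K C by (rule P)
  fix N
  interpret fp: flow_profile "wN N" "vN N" "w2N N" "GN N" "G1N N" "eN N" \<psi> \<Phi> S H Q K C ..
  note I = integrable_profile[OF Q_Lipschitz _ h]
  \<comment> \<open>Periodicity of the means in \<open>x2\<close> comes from the characters; the
    locale speaks of \<open>x1\<close> only.\<close>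
  have per2: "wN N (x, 1) = wN N (x, 0)" for x
    using fourier_sum_periodic(2)[of _ _ "(x, 0)"] by (simp add: wN_def Fej_def)
  have "\<bar>\<integral>y. \<integral>x. Q (diff1 h (wN N) (x, y)) \<partial>U \<partial>U\<bar> \<le> 2 * K * h * (\<integral>x. \<bar>eN N x\<bar> \<partial>U2) + 4 * h * E0"
    using fp.Karman_Howarth_Monin[of h 0 1] Karman_Howarth_Monin_error[OF K_nonneg h(1), of N] h by (simp add: diff1_def per2)
  then have 1: "(\<integral>x. Q (diff1 h (wN N) x) \<partial>U2) \<le> 2 * K * h * (\<integral>x. \<bar>eN N x\<bar> \<partial>U2) + 4 * h * E0"
    by (simp add: integral_U2[OF I(2)])
  have "(\<integral>x. Q (diff1 h w x) \<partial>U2) - (\<integral>x. Q (diff1 h (wN N) x) \<partial>U2) = - (\<integral>x. Q (diff1 h (wN N) x) - Q (diff1 h w x) \<partial>U2)"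
    using I(1,2) by simp
  also have "\<dots> \<le> (\<integral>x. \<bar>Q (diff1 h (wN N) x) - Q (diff1 h w x)\<bar> \<partial>U2)"
    using integral_abs_bound[of U2 "\<lambda>x. Q (diff1 h (wN N) x) - Q (diff1 h w x)"] by linarith
  also have "\<dots> \<le> 2 * C * norm2 U2 (\<lambda>x. wN N x - w x)" by (rule I(3)) simp
  finally show "(\<integral>x. Q (diff1 h w x) \<partial>U2) \<le> 4 * h * E0 + (2 * K * h * (\<integral>x. \<bar>eN N x\<bar> \<partial>U2) + 2 * C * norm2 U2 (\<lambda>x. wN N x - w x))"
    using 1 by simp
next
  show "(\<lambda>N. 2 * K * h * (\<integral>x. \<bar>eN N x\<bar> \<partial>U2) + 2 * C * norm2 U2 (\<lambda>x. wN N x - w x)) \<longlonglongrightarrow> 0"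
    by (intro tendsto_add_zero tendsto_mult_right_zero eN_tendsto wN_tendsto)
qed

text \<open>Fatou's lemma along the cubic profiles: \<open>Q n\<close> is nonnegative and tends to
  \<open>|u| ^ 3 / 6\<close>, and its integrals are at most \<open>4 * h * E0\<close>. Finiteness of
  the third moment is a conclusion here.\<close>

lemma cubic_bound:
  assumes h: "0 \<le> h" "h \<le> 1"
  shows "(\<integral>\<^sup>+x. ennreal (\<bar>diff1 h w x\<bar> ^ 3) \<partial>U2) \<le> ennreal (24 * h * E0)"
proof -
  obtain \<psi> \<Phi> S H Q K where P: "\<And>n. profile (\<psi> n) (\<Phi> n) (S n) (H n) (Q n) (K n) (K n * K n)"
    and Q: "\<And>n u. 0 \<le> Q n u" "\<And>u. (\<lambda>n. Q n u) \<longlonglongrightarrow> \<bar>u\<bar> ^ 3 / 6"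
    by (rule cubic_profiles) blast
  have [measurable]: "diff1 h w \<in> borel_measurable borel" "Q n \<in> borel_measurable borel" for n
    using diff1_square_integrable(1)[OF sq(1) per h] profile.measurable_profile(5)[OF P] by (simp_all add: square_integrable_def)
  have "(\<integral>\<^sup>+x. ennreal (\<bar>diff1 h w x\<bar> ^ 3 / 6) \<partial>U2) = (\<integral>\<^sup>+x. liminf (\<lambda>n. ennreal (Q n (diff1 h w x))) \<partial>U2)"
  proof (rule nn_integral_cong)
    fix x
    have "(\<lambda>n. ennreal (Q n (diff1 h w x))) \<longlonglongrightarrow> ennreal (\<bar>diff1 h w x\<bar> ^ 3 / 6)"
      by (intro tendsto_ennrealI Q)
    then show "ennreal (\<bar>diff1 h w x\<bar> ^ 3 / 6) = liminf (\<lambda>n. ennreal (Q n (diff1 h w x)))"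
      by (intro lim_imp_Liminf[symmetric]) auto
  qed
  also have "\<dots> \<le> liminf (\<lambda>n. \<integral>\<^sup>+x. ennreal (Q n (diff1 h w x)) \<partial>U2)"
    by (rule nn_integral_liminf) simp
  also have "\<dots> \<le> liminf (\<lambda>n. ennreal (4 * h * E0))"
  proof (intro Liminf_mono always_eventually allI)
    fix n
    have "(\<integral>\<^sup>+x. ennreal (Q n (diff1 h w x)) \<partial>U2) = ennreal (\<integral>x. Q n (diff1 h w x) \<partial>U2)"
      using Q(1) integrable_profile(1)[OF profile.Q_Lipschitz[OF P] _ h] by (intro nn_integral_eq_integral) auto
    then show "(\<integral>\<^sup>+x. ennreal (Q n (diff1 h w x)) \<partial>U2) \<le> ennreal (4 * h * E0)"
      using Q_bound[OF P h] by (simp add: ennreal_leI)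
  qed
  also have "\<dots> = ennreal (4 * h * E0)" by (simp add: Liminf_const)
  finally have *: "(\<integral>\<^sup>+x. ennreal (\<bar>diff1 h w x\<bar> ^ 3 / 6) \<partial>U2) \<le> ennreal (4 * h * E0)" .
  have "(\<integral>\<^sup>+x. ennreal (\<bar>diff1 h w x\<bar> ^ 3) \<partial>U2) = (\<integral>\<^sup>+x. 6 * ennreal (\<bar>diff1 h w x\<bar> ^ 3 / 6) \<partial>U2)"
    by (intro nn_integral_cong) (simp flip: ennreal_numeral ennreal_mult')
  also have "\<dots> = 6 * (\<integral>\<^sup>+x. ennreal (\<bar>diff1 h w x\<bar> ^ 3 / 6) \<partial>U2)"
    by (intro nn_integral_cmult) simp
  also have "\<dots> \<le> 6 * ennreal (4 * h * E0)" by (intro mult_left_mono *) auto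
  also have "\<dots> = ennreal (24 * h * E0)"
    using h E0_nonneg by (simp flip: ennreal_numeral ennreal_mult')
  finally show ?thesis .
qed

lemma powr_24: "(24::real) powr (2/3) \<le> 9"
proof -
  have "(24::real) powr (2/3) \<le> 27 powr (2/3)" by (intro powr_mono2) auto
  also have "(27::real) powr (2/3) = (3 powr 3) powr (2/3)" by simp
  also have "\<dots> = 3 powr 2" by (subst powr_powr) simp
  finally show ?thesis by simp
qed

text \<open>The constant is \<open>2 * 9\<close>, with 2 from \<open>nn_integral_lower_power\<close>
  and \<open>24 powr (2/3) \<le> 27 powr (2/3) = 9\<close>.\<close>

lemma square_bound:
  assumes h: "0 \<le> h" "h \<le> 1"
  shows "(\<integral>\<^sup>+x. ennreal ((diff1 h w x)\<^sup>2) \<partial>U2) \<le> ennreal (18 * (h * E0) powr (2/3))"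
proof -
  have m: "diff1 h w \<in> borel_measurable U2"
    using diff1_square_integrable(1)[OF sq(1) per h] by (simp add: square_integrable_def)
  have "(\<integral>\<^sup>+x. ennreal (\<bar>diff1 h w x\<bar> powr 3) \<partial>U2) \<le> ennreal (24 * h * E0)"
    using cubic_bound[OF h] by (simp add: powr_numeral)
  then have "(\<integral>\<^sup>+x. ennreal (\<bar>diff1 h w x\<bar> powr 2) \<partial>U2) \<le> ennreal (2 * (24 * h * E0) powr (2/3))"
    using h E0_nonneg by (intro nn_integral_lower_power[OF U2.prob_space_axioms m]) auto
  then have "(\<integral>\<^sup>+x. ennreal ((diff1 h w x)\<^sup>2) \<partial>U2) \<le> ennreal (2 * (24 * h * E0) powr (2/3))"
    by simp
  also have "2 * (24 * h * E0) powr (2/3) = 2 * (24 powr (2/3) * (h * E0) powr (2/3))"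
    using h E0_nonneg by (simp add: powr_mult mult.assoc)
  also have "\<dots> \<le> 18 * (h * E0) powr (2/3)"
    using mult_right_mono[OF powr_24, of "(h * E0) powr (2/3)"] by (simp add: mult.commute)
  finally show ?thesis by (simp add: ennreal_leI)
qed

text \<open>For \<open>S u = u\<^sup>2 / 2\<close> this is half the quantity whose essential
  supremum over \<open>b\<close> is to be bounded.\<close>

definition increment_energy :: "(real \<Rightarrow> real) \<Rightarrow> real \<Rightarrow> (real \<times> real \<Rightarrow> real) \<Rightarrow> real \<Rightarrow> ennreal" where
  "increment_energy S h f b = (\<integral>\<^sup>+z. ennreal (S (diff1 (fst z) f (snd z, b))) \<partial>(seg 0 h \<Otimes>\<^sub>M U))"

text \<open>The fluxes through the strip between the two slices are bounded by integrals over the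
  whole square, so \<open>a\<close> and \<open>b\<close> may be arbitrary and in either order. The
  means are continuous, so every single slice makes sense.\<close>

lemma increment_energy_approx:
  assumes P: "profile \<psi> \<Phi> S H Q K C" and S: "\<And>u. 0 \<le> S u" and h: "0 \<le> h" "h \<le> 1" and a: "0 \<le> a" "a \<le> 1" and b: "0 \<le> b" "b \<le> 1"
  shows "increment_energy S h (wN N) b \<le> increment_energy S h (wN N) a + ennreal ((\<integral>x. \<bar>Q (diff1 h (wN N) x)\<bar> \<partial>U2) + (2 * K * h * (\<integral>x. \<bar>eN N x\<bar> \<partial>U2) + 4 * h * E0))"
proof -
  interpret profile \<psi> \<Phi> S H Q K C by (rule P)
  interpret fp: flow_profile "wN N" "vN N" "w2N N" "GN N" "G1N N" "eN N" \<psi> \<Phi> S H Q K C ..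
  let ?s = "\<lambda>b z. S (diff1 (fst z) (wN N) (snd z, b))"
  let ?I = "\<lambda>b. \<integral>z. ?s b z \<partial>(seg 0 h \<Otimes>\<^sub>M U)"
  let ?c = "(\<integral>x. \<bar>Q (diff1 h (wN N) x)\<bar> \<partial>U2) + (2 * K * h * (\<integral>x. \<bar>eN N x\<bar> \<partial>U2) + 4 * h * E0)"
  have cQ: "continuous_on UNIV (\<lambda>x. Q (diff1 h (wN N) x))"
    unfolding diff1_def by (rule continuous_on_compose2[OF continuous(4)]) (auto intro!: continuous_intros)
  have i: "integrable (seg 0 h \<Otimes>\<^sub>M U) (?s b)" for b
    unfolding diff1_def by (intro integrable_segs_continuous continuous_intros)
  have F: "increment_energy S h (wN N) b = ennreal (?I b)" for b
    unfolding increment_energy_def using i S by (intro nn_integral_eq_integral) auto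
  have c0: "0 \<le> ?c" using h E0_nonneg K_nonneg by (intro add_nonneg_nonneg) auto
  have main: "\<bar>?I b - ?I a\<bar> \<le> ?c" if ab: "0 \<le> a" "a \<le> b" "b \<le> 1" for a b
  proof -
    have "(\<integral>t. \<integral>x. S (diff1 t (wN N) (x, b)) - S (diff1 t (wN N) (x, a)) \<partial>U \<partial>seg 0 h) = ?I b - ?I a"
      using segs.integral_fst'[OF Bochner_Integration.integrable_diff[OF i[of b] i[of a]]] i by simp
    moreover have "\<bar>\<integral>y. \<integral>x. Q (diff1 h (wN N) (x, y)) \<partial>U \<partial>seg a b\<bar> \<le> (\<integral>x. \<bar>Q (diff1 h (wN N) x)\<bar> \<partial>U2)"
    proof -
      have iQ: "integrable (U \<Otimes>\<^sub>M seg c d) (\<lambda>x. Q (diff1 h (wN N) x))" for c d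
        by (intro integrable_segs_continuous cQ)
      have i1: "integrable (seg c d) (\<lambda>y. \<integral>x. Q (diff1 h (wN N) (x, y)) \<partial>U)" for c d
        using segs.integrable_snd[of 0 1 c d "\<lambda>x y. Q (diff1 h (wN N) (x, y))"] iQ by (simp add: case_prod_beta')
      have i2: "integrable (seg c d) (\<lambda>y. \<integral>x. \<bar>Q (diff1 h (wN N) (x, y))\<bar> \<partial>U)" for c d
        using segs.integrable_snd[of 0 1 c d "\<lambda>x y. \<bar>Q (diff1 h (wN N) (x, y))\<bar>"] integrable_abs[OF iQ] by (simp add: case_prod_beta')
      have "\<bar>\<integral>y. \<integral>x. Q (diff1 h (wN N) (x, y)) \<partial>U \<partial>seg a b\<bar> \<le> (\<integral>y. \<bar>\<integral>x. Q (diff1 h (wN N) (x, y)) \<partial>U\<bar> \<partial>seg a b)"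
        by (rule integral_abs_bound)
      also have "\<dots> \<le> (\<integral>y. \<integral>x. \<bar>Q (diff1 h (wN N) (x, y))\<bar> \<partial>U \<partial>seg a b)"
        using i1 i2 by (intro integral_mono integral_abs_bound integrable_abs) auto
      also have "\<dots> \<le> (\<integral>y. \<integral>x. \<bar>Q (diff1 h (wN N) (x, y))\<bar> \<partial>U \<partial>U)"
        using i2[of 0 1] borel_measurable_integrable[OF i2[of 0 1]] ab by (intro integral_seg_subset_mono) auto
      also have "\<dots> = (\<integral>x. \<bar>Q (diff1 h (wN N) x)\<bar> \<partial>U2)"
        by (rule integral_U2[symmetric, OF integrable_abs[OF iQ]])
      finally show ?thesis .
    qed
    ultimately show ?thesis
      using fp.Karman_Howarth_Monin[OF h ab] Karman_Howarth_Monin_error[OF K_nonneg h(1), of N] by linarith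
  qed
  have "\<bar>?I b - ?I a\<bar> \<le> ?c"
    using main[of a b] main[of b a] a b by (cases "a \<le> b") (auto simp: abs_minus_commute)
  then have "?I b \<le> ?I a + ?c" by linarith
  then show ?thesis
    unfolding F by (subst ennreal_plus[OF _ c0, symmetric]) (auto intro!: ennreal_leI simp: S)
qed

text \<open>Averaging \<open>increment_energy_approx\<close> over \<open>a\<close> replaces the
  slice at \<open>a\<close> by an integral over the square. Of \<open>8 * h * E0\<close> one half is
  the forcing, the other the integral of \<open>|Q|\<close>, at most a sixth of
  \<open>cubic_bound\<close>; the factor 9 is half of the 18 in \<open>square_bound\<close>, as
  \<open>S u \<le> u\<^sup>2 / 2\<close>.\<close>

lemma sup_profile:
  assumes P: "profile \<psi> \<Phi> S H Q K C" and S: "\<And>u. 0 \<le> S u" "\<And>u. S u \<le> u\<^sup>2 / 2" and Q: "\<And>u. \<bar>Q u\<bar> \<le> \<bar>u\<bar> ^ 3 / 6"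
    and h: "0 \<le> h" "h \<le> 1"
  shows "AE b in U. increment_energy S h w b \<le> ennreal (8 * h * E0 + 9 * (h * (h * E0) powr (2/3)))"
proof -
  interpret profile \<psi> \<Phi> S H Q K C by (rule P)
  let ?A1 = "9 * (h * (h * E0) powr (2/3))"
  let ?A = "ennreal (8 * h * E0 + ?A1)"
  let ?n = "\<lambda>N. norm2 U2 (\<lambda>x. wN N x - w x)"
  let ?\<delta> = "\<lambda>N. h * (2 * K * ?n N)"
  let ?r = "\<lambda>N. 2 * K * h * (\<integral>x. \<bar>eN N x\<bar> \<partial>U2) + 2 * C * ?n N"
  let ?D = "\<lambda>N b. \<integral>\<^sup>+z. ennreal \<bar>S (diff1 (fst z) (wN N) (snd z, b)) - S (diff1 (fst z) w (snd z, b))\<bar> \<partial>(seg 0 h \<Otimes>\<^sub>M U)"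
  have A1: "0 \<le> ?A1" using h by simp
  have \<delta>0: "0 \<le> ?\<delta> N" and r0: "0 \<le> ?r N" for N
    using h K_nonneg C_nonneg by (auto intro!: add_nonneg_nonneg)
  have mS: "(\<lambda>x. S (diff1 (f x) w (g x, k x))) \<in> borel_measurable M" "(\<lambda>x. S (diff1 (f x) (wN N) (g x, k x))) \<in> borel_measurable M"
    if [measurable]: "f \<in> borel_measurable M" "g \<in> borel_measurable M" "k \<in> borel_measurable M" for f g k N and M :: "'x measure"
    unfolding diff1_def by simp_all
  have [measurable]: "(\<lambda>z. S (diff1 (fst z) w (snd z, b))) \<in> borel_measurable borel"
    "(\<lambda>z. S (diff1 (fst z) (wN N) (snd z, b))) \<in> borel_measurable borel" for b N
    by (intro mS; simp)+
  have mF: "increment_energy S h w \<in> borel_measurable borel" "increment_energy S h (wN N) \<in> borel_measurable borel" "?D N \<in> borel_measurable borel" for N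
  proof -
    have sf: "sigma_finite_measure (seg 0 h \<Otimes>\<^sub>M U)"
      by (intro finite_measure.axioms(1) finite_measure_pair_measure finite_measure_seg)
    note mn = sigma_finite_measure.borel_measurable_nn_integral[OF sf]
    show "increment_energy S h w \<in> borel_measurable borel"
      unfolding increment_energy_def[abs_def]
      by (rule mn, unfold split_beta) (intro measurable_compose[OF _ measurable_ennreal] mS; measurable)
    show "increment_energy S h (wN N) \<in> borel_measurable borel"
      unfolding increment_energy_def[abs_def]
      by (rule mn, unfold split_beta) (intro measurable_compose[OF _ measurable_ennreal] mS; measurable)
    show "?D N \<in> borel_measurable borel"
      by (rule mn, unfold split_beta)
         (intro measurable_compose[OF _ measurable_ennreal] borel_measurable_abs borel_measurable_diff mS; measurable)
  qed
  have rot: "(\<integral>\<^sup>+b. \<integral>\<^sup>+z. \<phi> (fst z) (snd z, b) \<partial>(seg 0 h \<Otimes>\<^sub>M U) \<partial>U) \<le> ennreal (h * B)"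
    if m: "(\<lambda>(t, z). \<phi> t z) \<in> borel_measurable (borel \<Otimes>\<^sub>M borel)" and B: "\<And>t. 0 \<le> t \<Longrightarrow> t \<le> h \<Longrightarrow> (\<integral>\<^sup>+z. \<phi> t z \<partial>U2) \<le> ennreal B" "0 \<le> B"
    for \<phi> B
  proof -
    have "(\<integral>\<^sup>+b. \<integral>\<^sup>+z. \<phi> (fst z) (snd z, b) \<partial>(seg 0 h \<Otimes>\<^sub>M U) \<partial>U) = (\<integral>\<^sup>+t. \<integral>\<^sup>+z. \<phi> t z \<partial>U2 \<partial>seg 0 h)"
      by (rule nn_integral_rotate[OF m])
    also have "\<dots> \<le> (\<integral>\<^sup>+t. ennreal B \<partial>seg 0 h)"
      using AE_seg_mem[of 0 h] B(1) by (intro nn_integral_mono_AE) (auto elim!: AE_mp)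
    also have "\<dots> = ennreal (h * B)"
      using h B(2) by (simp add: emeasure_seg_UNIV ennreal_mult' mult.commute)
    finally show ?thesis .
  qed
  have D: "(\<integral>\<^sup>+b. ?D N b \<partial>U) \<le> ennreal (?\<delta> N)" for N
  proof (rule rot[of "\<lambda>t z. ennreal \<bar>S (diff1 t (wN N) z) - S (diff1 t w z)\<bar>"])
    show "(\<lambda>(t, z). ennreal \<bar>S (diff1 t (wN N) z) - S (diff1 t w z)\<bar>) \<in> borel_measurable (borel \<Otimes>\<^sub>M borel)"
      unfolding diff1_def split_beta by measurable
    fix t assume "0 \<le> t" "t \<le> h"
    then have t: "0 \<le> t" "t \<le> 1" using h by auto
    note I = integrable_profile(1)[OF S_Lipschitz _ t] integrable_profile(2,3)[OF S_Lipschitz _ t, where N = N]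
    have "(\<integral>\<^sup>+z. ennreal \<bar>S (diff1 t (wN N) z) - S (diff1 t w z)\<bar> \<partial>U2) = ennreal (\<integral>z. \<bar>S (diff1 t (wN N) z) - S (diff1 t w z)\<bar> \<partial>U2)"
      using I by (intro nn_integral_eq_integral) auto
    also have "\<dots> \<le> ennreal (2 * K * ?n N)" by (intro ennreal_leI I) simp
    finally show "(\<integral>\<^sup>+z. ennreal \<bar>S (diff1 t (wN N) z) - S (diff1 t w z)\<bar> \<partial>U2) \<le> ennreal (2 * K * ?n N)" .
  qed (use K_nonneg in auto)
  have F: "(\<integral>\<^sup>+b. increment_energy S h w b \<partial>U) \<le> ennreal ?A1"
    unfolding increment_energy_def mult.left_commute[of 9]
  proof (rule rot[of "\<lambda>t z. ennreal (S (diff1 t w z))"])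
    show "(\<lambda>(t, z). ennreal (S (diff1 t w z))) \<in> borel_measurable (borel \<Otimes>\<^sub>M borel)"
      unfolding diff1_def split_beta by measurable
    fix t assume t: "0 \<le> t" "t \<le> h"
    have [measurable]: "diff1 t w \<in> borel_measurable borel"
      using diff1_square_integrable(1)[OF sq(1) per, of t] t h by (simp add: square_integrable_def)
    have "(\<integral>\<^sup>+z. ennreal (S (diff1 t w z)) \<partial>U2) \<le> (\<integral>\<^sup>+z. ennreal (1/2) * ennreal ((diff1 t w z)\<^sup>2) \<partial>U2)"
      using S(2) by (intro nn_integral_mono, subst ennreal_mult'[symmetric]) (auto intro!: ennreal_leI)
    also have "\<dots> = ennreal (1/2) * (\<integral>\<^sup>+z. ennreal ((diff1 t w z)\<^sup>2) \<partial>U2)"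
      by (intro nn_integral_cmult) simp
    also have "\<dots> \<le> ennreal (1/2) * ennreal (18 * (t * E0) powr (2/3))"
      using t h by (intro mult_left_mono square_bound) auto
    also have "\<dots> = ennreal (9 * (t * E0) powr (2/3))"
      by (subst ennreal_mult'[symmetric]) auto
    also have "\<dots> \<le> ennreal (9 * (h * E0) powr (2/3))"
      using t E0_nonneg by (intro ennreal_leI mult_left_mono powr_mono2 mult_right_mono) auto
    finally show "(\<integral>\<^sup>+z. ennreal (S (diff1 t w z)) \<partial>U2) \<le> ennreal (9 * (h * E0) powr (2/3))" .
  qed auto
  have Qb: "(\<integral>x. \<bar>Q (diff1 h (wN N) x)\<bar> \<partial>U2) \<le> 4 * h * E0 + 2 * C * ?n N" for N
  proof -
    note I = integrable_profile(1)[OF Q_Lipschitz measurable_profile(5) h] integrable_profile(2,3)[OF Q_Lipschitz measurable_profile(5) h, where N = N]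
    have [measurable]: "diff1 h w \<in> borel_measurable borel"
      using diff1_square_integrable(1)[OF sq(1) per h] by (simp add: square_integrable_def)
    have "ennreal (\<integral>x. \<bar>Q (diff1 h w x)\<bar> \<partial>U2) = (\<integral>\<^sup>+x. ennreal \<bar>Q (diff1 h w x)\<bar> \<partial>U2)"
      using I(1) by (intro nn_integral_eq_integral[symmetric]) auto
    also have "\<dots> \<le> (\<integral>\<^sup>+x. ennreal (1/6) * ennreal (\<bar>diff1 h w x\<bar> ^ 3) \<partial>U2)"
      using Q by (intro nn_integral_mono, subst ennreal_mult'[symmetric]) (auto intro!: ennreal_leI)
    also have "\<dots> = ennreal (1/6) * (\<integral>\<^sup>+x. ennreal (\<bar>diff1 h w x\<bar> ^ 3) \<partial>U2)"
      by (intro nn_integral_cmult) simp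
    also have "\<dots> \<le> ennreal (1/6) * ennreal (24 * h * E0)"
      by (intro mult_left_mono cubic_bound h) auto
    also have "\<dots> = ennreal (4 * h * E0)"
      by (subst ennreal_mult'[symmetric]) (auto simp: mult.assoc)
    finally have 1: "(\<integral>x. \<bar>Q (diff1 h w x)\<bar> \<partial>U2) \<le> 4 * h * E0"
      using h E0_nonneg by (simp add: ennreal_le_iff)
    have "(\<integral>x. \<bar>Q (diff1 h (wN N) x)\<bar> \<partial>U2) \<le> (\<integral>x. \<bar>Q (diff1 h w x)\<bar> + \<bar>Q (diff1 h (wN N) x) - Q (diff1 h w x)\<bar> \<partial>U2)"
      using I(1,2) by (intro integral_mono) auto
    also have "\<dots> = (\<integral>x. \<bar>Q (diff1 h w x)\<bar> \<partial>U2) + (\<integral>x. \<bar>Q (diff1 h (wN N) x) - Q (diff1 h w x)\<bar> \<partial>U2)"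
      using I(1,2) by (intro Bochner_Integration.integral_add) auto
    finally show ?thesis using 1 I(3) by linarith
  qed
  have le1: "increment_energy S h w b \<le> increment_energy S h (wN N) b + ?D N b" and le2: "increment_energy S h (wN N) b \<le> increment_energy S h w b + ?D N b" for N b
  proof -
    have e: "ennreal (S x) \<le> ennreal (S y) + ennreal \<bar>S y - S x\<bar>" "ennreal (S y) \<le> ennreal (S x) + ennreal \<bar>S y - S x\<bar>" for x y
      using S(1) by (auto simp flip: ennreal_plus intro!: ennreal_leI)
    show "increment_energy S h w b \<le> increment_energy S h (wN N) b + ?D N b" "increment_energy S h (wN N) b \<le> increment_energy S h w b + ?D N b"
      unfolding increment_energy_def by (subst nn_integral_add[symmetric]; auto intro!: nn_integral_mono e)+
  qed
  have step: "increment_energy S h w b \<le> ?D N b + ennreal (?\<delta> N + ?r N) + ?A" if b: "0 \<le> b" "b \<le> 1" for N b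
  proof -
    let ?c = "(\<integral>x. \<bar>Q (diff1 h (wN N) x)\<bar> \<partial>U2) + (2 * K * h * (\<integral>x. \<bar>eN N x\<bar> \<partial>U2) + 4 * h * E0)"
    \<comment> \<open>\<open>U\<close> is a probability measure, so the left side may be written as
      an average over \<open>a\<close> before slices are compared.\<close>
    have "increment_energy S h (wN N) b = (\<integral>\<^sup>+a. increment_energy S h (wN N) b \<partial>U)"
      using U.emeasure_space_1 by simp
    also have "\<dots> \<le> (\<integral>\<^sup>+a. increment_energy S h (wN N) a + ennreal ?c \<partial>U)"
      using AE_seg_mem[of 0 1] increment_energy_approx[OF P S(1) h _ _ b, of _ N] by (intro nn_integral_mono_AE) (auto elim!: AE_mp)
    also have "\<dots> = (\<integral>\<^sup>+a. increment_energy S h (wN N) a \<partial>U) + ennreal ?c"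
      using U.emeasure_space_1 mF by (subst nn_integral_add) auto
    also have "(\<integral>\<^sup>+a. increment_energy S h (wN N) a \<partial>U) \<le> (\<integral>\<^sup>+a. increment_energy S h w a + ?D N a \<partial>U)"
      by (intro nn_integral_mono le2)
    also have "\<dots> = (\<integral>\<^sup>+a. increment_energy S h w a \<partial>U) + (\<integral>\<^sup>+a. ?D N a \<partial>U)"
      using mF by (intro nn_integral_add) auto
    also have "\<dots> \<le> ennreal ?A1 + ennreal (?\<delta> N)" by (intro add_mono F D)
    also have "ennreal ?c \<le> ennreal (8 * h * E0 + ?r N)"
      using Qb[of N] by (intro ennreal_leI) linarith
    also have "ennreal ?A1 + ennreal (?\<delta> N) + ennreal (8 * h * E0 + ?r N) = ennreal (?\<delta> N + ?r N) + ?A"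
      using A1 \<delta>0[of N] r0[of N] h E0_nonneg
      by (simp flip: ennreal_plus add: add_nonneg_nonneg)
    finally have *: "increment_energy S h (wN N) b \<le> ennreal (?\<delta> N + ?r N) + ?A" by (simp add: add_right_mono)
    have "increment_energy S h w b \<le> increment_energy S h (wN N) b + ?D N b" by (rule le1)
    also have "\<dots> \<le> (ennreal (?\<delta> N + ?r N) + ?A) + ?D N b" by (intro add_right_mono *)
    finally show ?thesis by (simp add: ac_simps)
  qed
  \<comment> \<open>Slices of the means approach those of \<open>w\<close> only after integration in
    \<open>b\<close>. Subtraction in \<open>ennreal\<close> is truncated, so this integral measures
    exactly the excess over \<open>?A\<close>, and it is forced to vanish.\<close>
  have "(\<integral>\<^sup>+b. increment_energy S h w b - ?A \<partial>U) \<le> ennreal (?\<delta> N + (?\<delta> N + ?r N))" for N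
  proof -
    have "(\<integral>\<^sup>+b. increment_energy S h w b - ?A \<partial>U) \<le> (\<integral>\<^sup>+b. ?D N b + ennreal (?\<delta> N + ?r N) \<partial>U)"
      using AE_seg_mem[of 0 1] step[of _ N]
      by (intro nn_integral_mono_AE) (auto elim!: AE_mp simp: ennreal_minus_le_iff add.commute)
    also have "\<dots> = (\<integral>\<^sup>+b. ?D N b \<partial>U) + ennreal (?\<delta> N + ?r N)"
      using U.emeasure_space_1 mF by (subst nn_integral_add) auto
    also have "\<dots> \<le> ennreal (?\<delta> N) + ennreal (?\<delta> N + ?r N)" by (intro add_right_mono D)
    also have "\<dots> = ennreal (?\<delta> N + (?\<delta> N + ?r N))"
      using \<delta>0[of N] r0[of N] by (intro ennreal_plus[symmetric]) auto
    finally show ?thesis .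
  qed
  moreover have "(\<lambda>N. ennreal (?\<delta> N + (?\<delta> N + ?r N))) \<longlonglongrightarrow> ennreal 0"
    by (intro tendsto_ennrealI tendsto_add_zero tendsto_mult_right_zero eN_tendsto wN_tendsto)
  ultimately have "(\<integral>\<^sup>+b. increment_energy S h w b - ?A \<partial>U) \<le> ennreal 0"
    by (intro LIMSEQ_le_const[of _ "ennreal 0"]) auto
  then have "AE b in U. increment_energy S h w b - ?A = 0"
    using mF by (subst nn_integral_0_iff_AE[symmetric]) auto
  then show ?thesis
    by eventually_elim (simp add: diff_eq_0_iff_ennreal)
qed

text \<open>There is one exceptional set for each profile, countably many in all; off their union
  Fatou's lemma gives the limit \<open>u\<^sup>2 / 2\<close>, and the factor 1/2 doubles the
  constants 8 and 9.\<close>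

lemma sup_bound:
  assumes h: "0 \<le> h" "h \<le> 1"
  shows "AE b in U. (\<integral>\<^sup>+z. ennreal ((diff1 (fst z) w (snd z, b))\<^sup>2) \<partial>(seg 0 h \<Otimes>\<^sub>M U)) \<le> ennreal (16 * h * E0 + 18 * (h * (h * E0) powr (2/3)))"
proof -
  obtain \<psi> \<Phi> S H Q K where P: "\<And>n. profile (\<psi> n) (\<Phi> n) (S n) (H n) (Q n) (K n) (K n * K n)"
    and S: "\<And>n u. 0 \<le> S n u" "\<And>n u. S n u \<le> u\<^sup>2 / 2" "\<And>n u. \<bar>u\<bar> \<le> real n \<Longrightarrow> S n u = u\<^sup>2 / 2"
    and Q: "\<And>n u. \<bar>Q n u\<bar> \<le> \<bar>u\<bar> ^ 3 / 6"
    by (rule quadratic_profiles) blast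
  let ?A = "8 * h * E0 + 9 * (h * (h * E0) powr (2/3))"
  have A0: "0 \<le> ?A" using h E0_nonneg by simp
  have "AE b in U. \<forall>n. increment_energy (S n) h w b \<le> ennreal ?A"
    unfolding AE_all_countable by (intro allI sup_profile[OF P S(1,2) Q h])
  then show ?thesis
  proof (rule AE_mp, intro AE_I2 impI)
    fix b assume b: "\<forall>n. increment_energy (S n) h w b \<le> ennreal ?A"
    let ?u = "\<lambda>z. diff1 (fst z) w (snd z, b)"
    have [measurable]: "?u \<in> borel_measurable borel" "S n \<in> borel_measurable borel" for n
      unfolding diff1_def using profile.measurable_profile(3)[OF P] by simp_all
    have lim: "(\<lambda>n. ennreal (S n u)) \<longlonglongrightarrow> ennreal (u\<^sup>2 / 2)" for u
    proof (rule tendsto_eventually)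
      obtain m where "\<bar>u\<bar> < real m" using reals_Archimedean2 by blast
      then show "\<forall>\<^sub>F n in sequentially. ennreal (S n u) = ennreal (u\<^sup>2 / 2)"
        by (intro eventually_mono[OF eventually_ge_at_top[of m]] arg_cong[of _ _ ennreal] S(3)) simp
    qed
    have "(\<integral>\<^sup>+z. ennreal ((?u z)\<^sup>2 / 2) \<partial>(seg 0 h \<Otimes>\<^sub>M U)) = (\<integral>\<^sup>+z. liminf (\<lambda>n. ennreal (S n (?u z))) \<partial>(seg 0 h \<Otimes>\<^sub>M U))"
      by (intro nn_integral_cong lim_imp_Liminf[symmetric] lim) auto
    also have "\<dots> \<le> liminf (\<lambda>n. \<integral>\<^sup>+z. ennreal (S n (?u z)) \<partial>(seg 0 h \<Otimes>\<^sub>M U))"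
      by (rule nn_integral_liminf) simp
    also have "\<dots> \<le> liminf (\<lambda>n. ennreal ?A)"
      using b by (intro Liminf_mono always_eventually allI) (simp add: increment_energy_def)
    also have "\<dots> = ennreal ?A" by (simp add: Liminf_const)
    finally have *: "(\<integral>\<^sup>+z. ennreal ((?u z)\<^sup>2 / 2) \<partial>(seg 0 h \<Otimes>\<^sub>M U)) \<le> ennreal ?A" .
    have "(\<integral>\<^sup>+z. ennreal ((?u z)\<^sup>2) \<partial>(seg 0 h \<Otimes>\<^sub>M U)) = (\<integral>\<^sup>+z. ennreal 2 * ennreal ((?u z)\<^sup>2 / 2) \<partial>(seg 0 h \<Otimes>\<^sub>M U))"
      by (intro nn_integral_cong, subst ennreal_mult'[symmetric]) auto
    also have "\<dots> = ennreal 2 * (\<integral>\<^sup>+z. ennreal ((?u z)\<^sup>2 / 2) \<partial>(seg 0 h \<Otimes>\<^sub>M U))"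
      by (intro nn_integral_cmult) simp
    also have "\<dots> \<le> ennreal 2 * ennreal ?A" by (intro mult_left_mono *) auto
    also have "\<dots> = ennreal (2 * ?A)" by (subst ennreal_mult'[symmetric]) auto
    finally show "(\<integral>\<^sup>+z. ennreal ((?u z)\<^sup>2) \<partial>(seg 0 h \<Otimes>\<^sub>M U)) \<le> ennreal (16 * h * E0 + 18 * (h * (h * E0) powr (2/3)))"
      by (simp add: algebra_simps)
  qed
qed

end

section \<open>Integrability\<close>

lemma tangent_cube: "0 \<le> (c::real) \<Longrightarrow> 0 \<le> x \<Longrightarrow> 3 * c\<^sup>2 * x \<le> x ^ 3 + 2 * c ^ 3"
proof -
  assume "0 \<le> c" "0 \<le> x"
  then have "0 \<le> (x - c)\<^sup>2 * (x + 2 * c)" by simp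
  also have "\<dots> = x ^ 3 + 2 * c ^ 3 - 3 * c\<^sup>2 * x" by (simp add: power2_eq_square power3_eq_cube algebra_simps)
  finally show ?thesis by simp
qed

text \<open>Jensen's inequality, by integrating the tangent at \<open>c\<close>.\<close>

lemma nn_integral_cube_ge:
  fixes X :: "'a \<Rightarrow> real"
  assumes [measurable]: "X \<in> borel_measurable M" and X: "\<And>x. 0 \<le> X x" and c: "0 \<le> c" and m: "emeasure M (space M) = ennreal m" "0 \<le> m"
    and le: "ennreal (m * c) \<le> (\<integral>\<^sup>+x. ennreal (X x) \<partial>M)"
  shows "ennreal (m * c ^ 3) \<le> (\<integral>\<^sup>+x. ennreal (X x ^ 3) \<partial>M)"
proof -
  have "ennreal (m * c ^ 3) + ennreal (2 * m * c ^ 3) = ennreal (3 * c\<^sup>2) * ennreal (m * c)"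
    using c m by (subst ennreal_plus[symmetric], auto, subst ennreal_mult'[symmetric]) (auto simp: power2_eq_square power3_eq_cube algebra_simps)
  also have "\<dots> \<le> ennreal (3 * c\<^sup>2) * (\<integral>\<^sup>+x. ennreal (X x) \<partial>M)"
    by (intro mult_left_mono le) auto
  also have "\<dots> = (\<integral>\<^sup>+x. ennreal (3 * c\<^sup>2) * ennreal (X x) \<partial>M)"
    by (intro nn_integral_cmult[symmetric]) simp
  also have "\<dots> \<le> (\<integral>\<^sup>+x. ennreal (X x ^ 3) + ennreal (2 * c ^ 3) \<partial>M)"
  proof (rule nn_integral_mono)
    fix x
    show "ennreal (3 * c\<^sup>2) * ennreal (X x) \<le> ennreal (X x ^ 3) + ennreal (2 * c ^ 3)"
      using ennreal_leI[OF tangent_cube[OF c X[of x]]] X[of x] c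
      by (subst ennreal_mult'[symmetric], simp, subst ennreal_plus[symmetric]) auto
  qed
  also have "\<dots> = (\<integral>\<^sup>+x. ennreal (X x ^ 3) \<partial>M) + ennreal (2 * c ^ 3) * ennreal m"
    by (subst nn_integral_add) (auto simp: m)
  also have "ennreal (2 * c ^ 3) * ennreal m = ennreal (2 * m * c ^ 3)"
    using c by (subst ennreal_mult'[symmetric]) (auto simp: mult_ac)
  finally have "ennreal (2 * m * c ^ 3) + ennreal (m * c ^ 3) \<le> ennreal (2 * m * c ^ 3) + (\<integral>\<^sup>+x. ennreal (X x ^ 3) \<partial>M)"
    by (simp only: add.commute)
  then show ?thesis unfolding ennreal_add_left_cancel_le by simp
qed

lemma nn_integral_square_ge:
  fixes X :: "'a \<Rightarrow> real"
  assumes M: "prob_space M" and [measurable]: "X \<in> borel_measurable M" and X: "\<And>x. 0 \<le> X x" and c: "0 \<le> c"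
    and le: "ennreal c \<le> (\<integral>\<^sup>+x. ennreal (X x) \<partial>M)"
  shows "ennreal (c\<^sup>2) \<le> (\<integral>\<^sup>+x. ennreal ((X x)\<^sup>2) \<partial>M)"
proof -
  interpret prob_space M by (rule M)
  have "ennreal (c\<^sup>2) = (ennreal c)\<^sup>2" by (simp add: ennreal_power c)
  also have "\<dots> \<le> (\<integral>\<^sup>+x. ennreal (X x) * 1 \<partial>M)\<^sup>2"
    using le by (intro power_mono) auto
  also have "\<dots> \<le> (\<integral>\<^sup>+x. (ennreal (X x))\<^sup>2 \<partial>M) * (\<integral>\<^sup>+x. 1\<^sup>2 \<partial>M)"
    by (rule Cauchy_Schwarz_nn_integral) auto
  also have "\<dots> = (\<integral>\<^sup>+x. ennreal ((X x)\<^sup>2) \<partial>M)"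
    using X by (simp add: emeasure_space_1 ennreal_power)
  finally show ?thesis .
qed

lemma integral_U_shift:
  fixes f :: "real \<Rightarrow> real"
  assumes f: "integrable U f" and per: "\<And>x. f (x + 1) = f x" and h: "0 \<le> h" "h \<le> 1"
  shows "integrable U (\<lambda>x. f (x + h))" "(\<integral>x. f (x + h) \<partial>U) = (\<integral>x. f x \<partial>U)"
proof -
  have [measurable]: "f \<in> borel_measurable borel" using borel_measurable_integrable[OF f] by simp
  have n: "(\<integral>\<^sup>+x. ennreal (norm (f (x + h))) \<partial>U) = (\<integral>\<^sup>+x. ennreal (norm (f x)) \<partial>U)"
    "(\<integral>\<^sup>+x. ennreal (f (x + h)) \<partial>U) = (\<integral>\<^sup>+x. ennreal (f x) \<partial>U)"
    "(\<integral>\<^sup>+x. ennreal (- f (x + h)) \<partial>U) = (\<integral>\<^sup>+x. ennreal (- f x) \<partial>U)"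
    by (rule nn_integral_U_shift[OF _ _ h]; simp add: per)+
  show i: "integrable U (\<lambda>x. f (x + h))"
    using f unfolding integrable_iff_bounded n by simp
  show "(\<integral>x. f (x + h) \<partial>U) = (\<integral>x. f x \<partial>U)"
    unfolding real_lebesgue_integral_def[OF f] real_lebesgue_integral_def[OF i] n ..
qed

text \<open>The positive part of \<open>a - b\<close> is bounded by the two \<open>L1\<close>
  errors, so its integral is 0.\<close>

lemma AE_le_of_L1_limit:
  fixes a b :: "'a \<Rightarrow> real"
  assumes [measurable]: "a \<in> borel_measurable M" "b \<in> borel_measurable M"
    and le: "\<And>N. AE x in M. aN N x \<le> bN N x"
    and a: "\<And>N. (\<integral>\<^sup>+x. ennreal \<bar>aN N x - a x\<bar> \<partial>M) \<le> ennreal (r N)" "r \<longlonglongrightarrow> 0"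
    and b: "\<And>N. (\<integral>\<^sup>+x. ennreal \<bar>bN N x - b x\<bar> \<partial>M) \<le> ennreal (s N)" "s \<longlonglongrightarrow> 0"
    and m: "\<And>N. aN N \<in> borel_measurable M" "\<And>N. bN N \<in> borel_measurable M" and nn: "\<And>N. 0 \<le> r N" "\<And>N. 0 \<le> s N"
  shows "AE x in M. a x \<le> b x"
proof -
  note [measurable] = m
  have "(\<integral>\<^sup>+x. ennreal (a x - b x) \<partial>M) \<le> ennreal (r N + s N)" for N
  proof -
    have "(\<integral>\<^sup>+x. ennreal (a x - b x) \<partial>M) \<le> (\<integral>\<^sup>+x. ennreal \<bar>aN N x - a x\<bar> + ennreal \<bar>bN N x - b x\<bar> \<partial>M)"
    proof (rule nn_integral_mono_AE)
      show "AE x in M. ennreal (a x - b x) \<le> ennreal \<bar>aN N x - a x\<bar> + ennreal \<bar>bN N x - b x\<bar>"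
        using le[of N]
      proof eventually_elim
        case (elim x)
        then have "a x - b x \<le> \<bar>aN N x - a x\<bar> + \<bar>bN N x - b x\<bar>" by linarith
        from ennreal_leI[OF this] show ?case by simp
      qed
    qed
    also have "\<dots> = (\<integral>\<^sup>+x. ennreal \<bar>aN N x - a x\<bar> \<partial>M) + (\<integral>\<^sup>+x. ennreal \<bar>bN N x - b x\<bar> \<partial>M)"
      by (intro nn_integral_add) auto
    also have "\<dots> \<le> ennreal (r N) + ennreal (s N)" by (intro add_mono a b)
    finally show ?thesis using nn by simp
  qed
  moreover have "(\<lambda>N. ennreal (r N + s N)) \<longlonglongrightarrow> ennreal 0"
    by (intro tendsto_ennrealI tendsto_add_zero a b)
  ultimately have "(\<integral>\<^sup>+x. ennreal (a x - b x) \<partial>M) \<le> ennreal 0"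
    by (intro LIMSEQ_le_const[of _ "ennreal 0"]) auto
  then have "AE x in M. ennreal (a x - b x) = 0"
    by (subst nn_integral_0_iff_AE[symmetric]) auto
  then show ?thesis by eventually_elim (simp add: ennreal_eq_0_iff)
qed

lemma FTC_abs_le:
  fixes F f :: "real \<Rightarrow> real"
  assumes c: "continuous_on UNIV f" and D: "\<And>x. (F has_real_derivative f x) (at x)" and x: "x \<in> {0..1}" "x0 \<in> {0..1}"
  shows "\<bar>F x - F x0\<bar> \<le> (\<integral>x. \<bar>f x\<bar> \<partial>U)"
proof -
  have "\<bar>F b - F a\<bar> \<le> (\<integral>x. \<bar>f x\<bar> \<partial>U)" if ab: "0 \<le> a" "a \<le> b" "b \<le> 1" for a b
  proof -
    have "(\<integral>x. f x \<partial>seg a b) = F b - F a"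
      using D by (intro integral_seg_FTC ab c) (simp add: has_real_derivative_iff_has_vector_derivative)
    then have "\<bar>F b - F a\<bar> \<le> (\<integral>x. \<bar>f x\<bar> \<partial>seg a b)"
      by (metis integral_abs_bound)
    also have "\<dots> \<le> (\<integral>x. \<bar>f x\<bar> \<partial>U)"
      by (intro integral_seg_subset_mono integrable_seg_continuous borel_measurable_continuous_onI continuous_intros c ab) auto
    finally show ?thesis .
  qed
  from this[of x0 x] this[of x x0] x show ?thesis by (cases "x0 \<le> x") (auto simp: abs_minus_commute)
qed

section \<open>One-dimensional inequalities on almost every slice in \<open>x1\<close>\<close>

context burgers
begin

lemma wN_mean: "(\<integral>x. wN N (x, y) \<partial>U) = 0"
proof -
  have i: "integrable U (\<lambda>x. c * echar k (x, y))" for c k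
    by (intro integrable_seg_continuous continuous_intros)
  have echar: "(\<integral>x. echar k (x, y) \<partial>U) = (if fst k = 0 then 1 else 0) * cis (2 * pi * (of_int (snd k) * y))" for k
  proof -
    have "echar k (x, y) = cis (2 * pi * (of_int (fst k) * x)) * cis (2 * pi * (of_int (snd k) * y))" for x
      by (simp add: echar_def cis_mult algebra_simps)
    then show ?thesis by (simp add: integral_cis_U)
  qed
  have I: "integrable U (\<lambda>x. Fej N (\<lambda>x. of_real (w x)) (x, y))"
    by (intro integrable_seg_continuous continuous_intros)
  have "(\<integral>x. Fej N (\<lambda>x. of_real (w x)) (x, y) \<partial>U) = (\<Sum>k\<in>fbox N. (fej2 N k * rfcoeff w k) * (\<integral>x. echar k (x, y) \<partial>U))"
    unfolding Fej_def fourier_sum_def using i by (subst Bochner_Integration.integral_sum) auto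
  also have "\<dots> = 0"
    unfolding echar by (intro sum.neutral) (auto simp: fcoeff_0)
  finally show ?thesis
    unfolding wN_def using integral_Re[OF I] by simp
qed

text \<open>A continuous function of mean zero has a zero: the mean value theorem applied to its
  antiderivative.\<close>

lemma wN_zero: "\<exists>x0\<in>{0..1}. wN N (x0, y) = 0"
proof -
  have c: "continuous_on UNIV (\<lambda>x. wN N (x, y))" by (intro continuous_intros)
  obtain F where F: "\<And>x. (F has_real_derivative wN N (x, y)) (at x)" using antiderivative_exists[OF c] by metis
  have "F 1 - F 0 = 0"
    using integral_seg_FTC[of 0 1 "\<lambda>x. wN N (x, y)" F] c F wN_mean
    by (simp add: has_real_derivative_iff_has_vector_derivative)
  moreover obtain z where "0 < z" "z < 1" "F 1 - F 0 = (1 - 0) * wN N (z, y)"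
    using MVT2[of 0 1 F "\<lambda>x. wN N (x, y)"] F by auto
  ultimately show ?thesis by (intro bexI[of _ z]) auto
qed

text \<open>The fundamental theorem from a zero of the slice, for \<open>wN\<close> and for its
  square.\<close>

lemma wN_pointwise:
  assumes x: "x \<in> {0..1}"
  shows "\<bar>wN N (x, y)\<bar> \<le> (\<integral>x. \<bar>vN N (x, y)\<bar> \<partial>U)" "wN N (x, y) * wN N (x, y) \<le> (\<integral>x. 2 * \<bar>wN N (x, y) * vN N (x, y)\<bar> \<partial>U)"
proof -
  obtain x0 where x0: "x0 \<in> {0..1}" "wN N (x0, y) = 0" using wN_zero by blast
  have "\<bar>wN N (x, y) - wN N (x0, y)\<bar> \<le> (\<integral>x. \<bar>vN N (x, y)\<bar> \<partial>U)"
    by (rule FTC_abs_le[OF _ DERIV_wN x x0(1)]) (intro continuous_intros)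
  then show "\<bar>wN N (x, y)\<bar> \<le> (\<integral>x. \<bar>vN N (x, y)\<bar> \<partial>U)" using x0 by simp
  have "\<bar>wN N (x, y) * wN N (x, y) - wN N (x0, y) * wN N (x0, y)\<bar> \<le> (\<integral>x. \<bar>2 * (wN N (x, y) * vN N (x, y))\<bar> \<partial>U)"
  proof (rule FTC_abs_le[OF _ _ x x0(1)])
    show "continuous_on UNIV (\<lambda>x. 2 * (wN N (x, y) * vN N (x, y)))" by (intro continuous_intros)
    show "((\<lambda>x. wN N (x, y) * wN N (x, y)) has_real_derivative 2 * (wN N (x, y) * vN N (x, y))) (at x)" for x
      by (auto intro!: derivative_eq_intros DERIV_wN)
  qed
  then show "wN N (x, y) * wN N (x, y) \<le> (\<integral>x. 2 * \<bar>wN N (x, y) * vN N (x, y)\<bar> \<partial>U)" using x0 by (simp add: abs_mult)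
qed

lemma AE_U2_fst: "AE z in U2. fst z \<in> {0..1}"
  using AE_segs_mem[of 0 1 0 1] by (auto elim!: AE_mp)

text \<open>Averaging moduli in \<open>x1\<close> contracts \<open>L1\<close>; it carries the right
  sides of the slice inequalities to the limit.\<close>

lemma nn_integral_average_le:
  assumes f: "integrable U2 f" and k: "integrable U2 k"
  shows "(\<integral>\<^sup>+z. ennreal \<bar>(\<integral>x. \<bar>f (x, snd z)\<bar> \<partial>U) - (\<integral>x. \<bar>k (x, snd z)\<bar> \<partial>U)\<bar> \<partial>U2) \<le> ennreal (\<integral>z. \<bar>f z - k z\<bar> \<partial>U2)"
proof -
  have [measurable]: "f \<in> borel_measurable borel" "k \<in> borel_measurable borel"
    using borel_measurable_integrable[OF f] borel_measurable_integrable[OF k] by simp_all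
  have AE: "AE y in U. integrable U (\<lambda>x. f (x, y))" "AE y in U. integrable U (\<lambda>x. k (x, y))"
    using U2.AE_integrable_snd[of "\<lambda>x y. f (x, y)"] U2.AE_integrable_snd[of "\<lambda>x y. k (x, y)"] f k by simp_all
  have m: "(\<lambda>z. ennreal \<bar>(\<integral>x. \<bar>f (x, snd z)\<bar> \<partial>U) - (\<integral>x. \<bar>k (x, snd z)\<bar> \<partial>U)\<bar>) \<in> borel_measurable borel"
  proof -
    have "(\<lambda>z. \<integral>x. \<bar>l (x, snd z)\<bar> \<partial>U) \<in> borel_measurable (borel :: (real \<times> real) measure)"
      if [measurable]: "l \<in> borel_measurable borel" for l :: "real \<times> real \<Rightarrow> real"
      by (rule U.borel_measurable_lebesgue_integral) (simp add: split_beta)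
    then show ?thesis by simp
  qed
  have "(\<integral>\<^sup>+z. ennreal \<bar>(\<integral>x. \<bar>f (x, snd z)\<bar> \<partial>U) - (\<integral>x. \<bar>k (x, snd z)\<bar> \<partial>U)\<bar> \<partial>U2)
    = (\<integral>\<^sup>+y. ennreal \<bar>(\<integral>x. \<bar>f (x, y)\<bar> \<partial>U) - (\<integral>x. \<bar>k (x, y)\<bar> \<partial>U)\<bar> \<partial>U)"
    unfolding nn_integral_U2[OF m] using U.emeasure_space_1 by simp
  also have "\<dots> \<le> (\<integral>\<^sup>+y. \<integral>\<^sup>+x. ennreal \<bar>f (x, y) - k (x, y)\<bar> \<partial>U \<partial>U)"
  proof (rule nn_integral_mono_AE)
    show "AE y in U. ennreal \<bar>(\<integral>x. \<bar>f (x, y)\<bar> \<partial>U) - (\<integral>x. \<bar>k (x, y)\<bar> \<partial>U)\<bar> \<le> (\<integral>\<^sup>+x. ennreal \<bar>f (x, y) - k (x, y)\<bar> \<partial>U)"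
      using AE
    proof eventually_elim
      case (elim y)
      have "(\<integral>x. \<bar>f (x, y)\<bar> \<partial>U) - (\<integral>x. \<bar>k (x, y)\<bar> \<partial>U) = (\<integral>x. \<bar>f (x, y)\<bar> - \<bar>k (x, y)\<bar> \<partial>U)"
        using elim by simp
      also have "\<bar>\<dots>\<bar> \<le> (\<integral>x. \<bar>\<bar>f (x, y)\<bar> - \<bar>k (x, y)\<bar>\<bar> \<partial>U)" by (rule integral_abs_bound)
      also have "\<dots> \<le> (\<integral>x. \<bar>f (x, y) - k (x, y)\<bar> \<partial>U)"
        using elim by (intro integral_mono) auto
      finally show ?case
        using elim by (subst nn_integral_eq_integral) (auto intro: ennreal_leI)
    qed
  qed
  also have "\<dots> = (\<integral>\<^sup>+z. ennreal \<bar>f z - k z\<bar> \<partial>U2)" by (subst nn_integral_U2) auto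
  also have "\<dots> = ennreal (\<integral>z. \<bar>f z - k z\<bar> \<partial>U2)" using f k by (intro nn_integral_eq_integral) auto
  finally show ?thesis .
qed

text \<open>The inequalities for the Fejer means survive the limit in \<open>L1\<close>: the first
  uses convergence of \<open>wN\<close> and \<open>vN\<close>, the second that of
  \<open>wN * wN\<close> and \<open>wN * vN\<close>.\<close>

lemma w_pointwise:
  "AE z in U2. \<bar>w z\<bar> \<le> (\<integral>x. \<bar>v (x, snd z)\<bar> \<partial>U)"
  "AE z in U2. w z * w z \<le> (\<integral>x. \<bar>2 * (w (x, snd z) * v (x, snd z))\<bar> \<partial>U)"
proof -
  note s = bounded_cont_square_integrable[OF bounded_contN(1)] bounded_cont_square_integrable[OF bounded_contN(2)]
  note i = U2.square_integrable_integrable square_integrable_mult_integrable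
  have mI: "(\<lambda>z. \<integral>x. \<bar>k (x, snd z)\<bar> \<partial>U) \<in> borel_measurable (borel :: (real \<times> real) measure)"
    if [measurable]: "k \<in> borel_measurable borel" for k :: "real \<times> real \<Rightarrow> real"
    by (rule U.borel_measurable_lebesgue_integral) (simp add: split_beta)
  show "AE z in U2. \<bar>w z\<bar> \<le> (\<integral>x. \<bar>v (x, snd z)\<bar> \<partial>U)"
  proof (rule AE_le_of_L1_limit[OF _ _ _ _ wN_tendsto _ vN_tendsto])
    show "AE z in U2. \<bar>wN N z\<bar> \<le> (\<integral>x. \<bar>vN N (x, snd z)\<bar> \<partial>U)" for N
      using AE_U2_fst
    proof eventually_elim
      case (elim z) then show ?case using wN_pointwise(1)[of "fst z" N "snd z"] by simp
    qed
    fix N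
    have "(\<integral>\<^sup>+z. ennreal \<bar>\<bar>wN N z\<bar> - \<bar>w z\<bar>\<bar> \<partial>U2) \<le> (\<integral>\<^sup>+z. ennreal \<bar>wN N z - w z\<bar> \<partial>U2)"
      by (intro nn_integral_mono ennreal_leI) auto
    also have "\<dots> = ennreal (\<integral>z. \<bar>wN N z - w z\<bar> \<partial>U2)"
      by (intro nn_integral_eq_integral integrable_abs Bochner_Integration.integrable_diff i s sq) auto
    also have "\<dots> \<le> ennreal (norm2 U2 (\<lambda>z. wN N z - w z))"
      by (intro ennreal_leI U2.integral_abs_le_norm2 square_integrable_diff s sq)
    finally show "(\<integral>\<^sup>+z. ennreal \<bar>\<bar>wN N z\<bar> - \<bar>w z\<bar>\<bar> \<partial>U2) \<le> ennreal (norm2 U2 (\<lambda>z. wN N z - w z))" .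
    show "(\<integral>\<^sup>+z. ennreal \<bar>(\<integral>x. \<bar>vN N (x, snd z)\<bar> \<partial>U) - (\<integral>x. \<bar>v (x, snd z)\<bar> \<partial>U)\<bar> \<partial>U2) \<le> ennreal (norm2 U2 (\<lambda>z. vN N z - v z))"
      by (rule order_trans[OF nn_integral_average_le[where f = "vN N" and k = v]]; intro i s sq ennreal_leI U2.integral_abs_le_norm2 square_integrable_diff)
  qed (use mI in auto)
  have L: "(\<lambda>N. \<integral>x. \<bar>wN N x * wN N x - w x * w x\<bar> \<partial>U2) \<longlonglongrightarrow> 0" "(\<lambda>N. \<integral>x. \<bar>wN N x * vN N x - w x * v x\<bar> \<partial>U2) \<longlonglongrightarrow> 0"
    by (intro norm2_tendsto_mult_L1 s sq wN_tendsto vN_tendsto)+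
  show "AE z in U2. w z * w z \<le> (\<integral>x. \<bar>2 * (w (x, snd z) * v (x, snd z))\<bar> \<partial>U)"
  proof (rule AE_le_of_L1_limit[OF _ _ _ _ L(1) _ tendsto_mult_right_zero[OF L(2), of 2]])
    show "AE z in U2. wN N z * wN N z \<le> (\<integral>x. \<bar>2 * (wN N (x, snd z) * vN N (x, snd z))\<bar> \<partial>U)" for N
      using AE_U2_fst
    proof eventually_elim
      case (elim z) then show ?case using wN_pointwise(2)[of "fst z" N "snd z"] by (simp add: abs_mult)
    qed
    fix N
    show "(\<integral>\<^sup>+z. ennreal \<bar>wN N z * wN N z - w z * w z\<bar> \<partial>U2) \<le> ennreal (\<integral>z. \<bar>wN N z * wN N z - w z * w z\<bar> \<partial>U2)"
      by (intro order_eq_refl nn_integral_eq_integral integrable_abs Bochner_Integration.integrable_diff square_integrable_mult_integrable s sq) auto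
    have "(\<integral>\<^sup>+z. ennreal \<bar>(\<integral>x. \<bar>2 * (wN N (x, snd z) * vN N (x, snd z))\<bar> \<partial>U) - (\<integral>x. \<bar>2 * (w (x, snd z) * v (x, snd z))\<bar> \<partial>U)\<bar> \<partial>U2)
       \<le> ennreal (\<integral>z. \<bar>2 * (wN N z * vN N z) - 2 * (w z * v z)\<bar> \<partial>U2)"
      by (rule nn_integral_average_le[of "\<lambda>z. 2 * (wN N z * vN N z)" "\<lambda>z. 2 * (w z * v z)"]; intro integrable_mult_right square_integrable_mult_integrable s sq)
    also have "(\<integral>z. \<bar>2 * (wN N z * vN N z) - 2 * (w z * v z)\<bar> \<partial>U2) = 2 * (\<integral>z. \<bar>wN N z * vN N z - w z * v z\<bar> \<partial>U2)"
      unfolding right_diff_distrib[symmetric] abs_mult by simp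
    finally show "(\<integral>\<^sup>+z. ennreal \<bar>(\<integral>x. \<bar>2 * (wN N (x, snd z) * vN N (x, snd z))\<bar> \<partial>U) - (\<integral>x. \<bar>2 * (w (x, snd z) * v (x, snd z))\<bar> \<partial>U)\<bar> \<partial>U2)
       \<le> ennreal (2 * (\<integral>z. \<bar>wN N z * vN N z - w z * v z\<bar> \<partial>U2))" .
  qed (use mI[of "\<lambda>z. 2 * (w z * v z)"] mI[of "\<lambda>z. 2 * (wN N z * vN N z)" for N] in auto)
qed

lemma w_mean: "AE y in U. (\<integral>x. w (x, y) \<partial>U) = 0"
proof -
  let ?n = "\<lambda>N. norm2 U2 (\<lambda>x. wN N x - w x)"
  have m: "(\<lambda>y. \<integral>x. w (x, y) \<partial>U) \<in> borel_measurable borel"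
    by (rule U.borel_measurable_lebesgue_integral) (simp add: split_beta)
  have "(\<integral>\<^sup>+y. ennreal \<bar>\<integral>x. w (x, y) \<partial>U\<bar> \<partial>U) \<le> ennreal (?n N)" for N
  proof -
    have "(\<integral>\<^sup>+y. ennreal \<bar>\<integral>x. w (x, y) \<partial>U\<bar> \<partial>U) \<le> (\<integral>\<^sup>+y. \<integral>\<^sup>+x. ennreal \<bar>wN N (x, y) - w (x, y)\<bar> \<partial>U \<partial>U)"
    proof (rule nn_integral_mono)
      fix y
      show "ennreal \<bar>\<integral>x. w (x, y) \<partial>U\<bar> \<le> (\<integral>\<^sup>+x. ennreal \<bar>wN N (x, y) - w (x, y)\<bar> \<partial>U)"
      proof (cases "integrable U (\<lambda>x. w (x, y))")
        case True
        have iN: "integrable U (\<lambda>x. wN N (x, y))" by (intro integrable_seg_continuous continuous_intros)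
        have "(\<integral>x. w (x, y) \<partial>U) = - (\<integral>x. wN N (x, y) - w (x, y) \<partial>U)"
          using True iN wN_mean by simp
        also have "\<bar>\<dots>\<bar> \<le> (\<integral>x. \<bar>wN N (x, y) - w (x, y)\<bar> \<partial>U)"
          using integral_abs_bound by simp
        finally show ?thesis
          using True iN by (subst nn_integral_eq_integral) (auto intro: ennreal_leI)
      \<comment> \<open>A slice that is not integrable has Bochner integral 0, and the inequality is
        trivial there.\<close>
      qed (simp add: not_integrable_integral_eq)
    qed
    also have "\<dots> = (\<integral>\<^sup>+z. ennreal \<bar>wN N z - w z\<bar> \<partial>U2)" by (subst nn_integral_U2) auto
    also have "\<dots> = ennreal (\<integral>z. \<bar>wN N z - w z\<bar> \<partial>U2)"
      by (intro nn_integral_eq_integral integrable_abs Bochner_Integration.integrable_diff U2.square_integrable_integrable bounded_cont_square_integrable bounded_contN sq) auto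
    also have "\<dots> \<le> ennreal (?n N)"
      by (intro ennreal_leI U2.integral_abs_le_norm2 square_integrable_diff bounded_cont_square_integrable bounded_contN sq)
    finally show ?thesis .
  qed
  moreover have "(\<lambda>N. ennreal (?n N)) \<longlonglongrightarrow> ennreal 0" by (intro tendsto_ennrealI wN_tendsto)
  ultimately have "(\<integral>\<^sup>+y. ennreal \<bar>\<integral>x. w (x, y) \<partial>U\<bar> \<partial>U) \<le> ennreal 0"
    by (intro LIMSEQ_le_const[of _ "ennreal 0"]) auto
  then have "AE y in U. ennreal \<bar>\<integral>x. w (x, y) \<partial>U\<bar> = 0"
    using m by (subst nn_integral_0_iff_AE[symmetric]) auto
  then show ?thesis by eventually_elim (simp add: ennreal_eq_0_iff)
qed

lemma AE_y_integrable: "AE y in U. integrable U (\<lambda>x. w (x, y))"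
  using U2.AE_integrable_snd[of "\<lambda>x y. w (x, y)"] U2.square_integrable_integrable[OF sq(1)] by simp

text \<open>By the vanishing mean over a period, \<open>w (x, y)\<close> is minus the average of its
  increments \<open>diff1 t w (x, y)\<close> over \<open>t\<close> in \<open>[0, 1]\<close>.\<close>

lemma w_le_average: "AE y in U. \<forall>x\<in>{0..1}. ennreal \<bar>w (x, y)\<bar> \<le> (\<integral>\<^sup>+t. ennreal \<bar>diff1 t w (x, y)\<bar> \<partial>U)"
  using w_mean AE_y_integrable
proof eventually_elim
  case (elim y)
  show ?case
  proof
    fix x :: real assume x: "x \<in> {0..1}"
    have p: "w (t + 1, y) = w (t, y)" for t using per[of "(t, y)"] by simp
    note sh = integral_U_shift[of "\<lambda>x. w (x, y)" x, OF elim(2) p]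
    have i: "integrable U (\<lambda>t. w (t + x, y))" and I: "(\<integral>t. w (t + x, y) \<partial>U) = 0"
      using sh x elim(1) by auto
    have d: "diff1 t w (x, y) = w (t + x, y) - w (x, y)" for t by (simp add: diff1_def add.commute)
    have "\<bar>w (x, y)\<bar> = \<bar>\<integral>t. diff1 t w (x, y) \<partial>U\<bar>"
      unfolding d using i I U.prob_space by simp
    also have "\<dots> \<le> (\<integral>t. \<bar>diff1 t w (x, y)\<bar> \<partial>U)" by (rule integral_abs_bound)
    finally show "ennreal \<bar>w (x, y)\<bar> \<le> (\<integral>\<^sup>+t. ennreal \<bar>diff1 t w (x, y)\<bar> \<partial>U)"
      unfolding d using i by (subst nn_integral_eq_integral) (auto intro: ennreal_leI)
  qed
qed

end

lemma nn_integral_U2_swap: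
  fixes \<phi> :: "real \<Rightarrow> real \<times> real \<Rightarrow> ennreal"
  assumes [measurable]: "(\<lambda>(t, z). \<phi> t z) \<in> borel_measurable (borel \<Otimes>\<^sub>M borel)"
  shows "(\<integral>\<^sup>+y. \<integral>\<^sup>+x. \<integral>\<^sup>+t. \<phi> t (x, y) \<partial>U \<partial>U \<partial>U) = (\<integral>\<^sup>+t. \<integral>\<^sup>+z. \<phi> t z \<partial>U2 \<partial>U)"
proof -
  interpret P: pair_sigma_finite U U2 ..
  have m: "(\<lambda>z. \<integral>\<^sup>+t. \<phi> t z \<partial>U) \<in> borel_measurable borel"
  proof (rule U.borel_measurable_nn_integral)
    have "(\<lambda>z. (snd z, fst z)) \<in> (borel :: (real \<times> real) measure) \<Otimes>\<^sub>M (borel :: real measure) \<rightarrow>\<^sub>M borel \<Otimes>\<^sub>M borel" by simp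
    from measurable_compose[OF this assms]
    have "(\<lambda>(z, t). \<phi> t z) \<in> borel_measurable (borel \<Otimes>\<^sub>M borel)" by (simp add: split_beta)
    then show "(\<lambda>(z, t). \<phi> t z) \<in> borel_measurable (borel \<Otimes>\<^sub>M U)" by (simp cong: measurable_cong_sets sets_pair_measure_cong)
  qed
  have "sets (U \<Otimes>\<^sub>M U2) = sets (borel \<Otimes>\<^sub>M borel)"
    by (intro sets_pair_measure_cong sets_seg sets_segs)
  from measurable_cong_sets[OF this refl] have "(\<lambda>(t, z). \<phi> t z) \<in> borel_measurable (U \<Otimes>\<^sub>M U2)"
    using assms by blast
  from P.Fubini'[OF this] show ?thesis
    by (simp add: nn_integral_U2[OF m])
qed

lemma AE_U2_D:
  assumes "AE z in U2. P z"
  shows "AE y in U. AE x in U. P (x, y)"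
proof -
  obtain N where N: "N \<in> null_sets U2" "{z \<in> space U2. \<not> P z} \<subseteq> N"
    using assms by (auto simp: eventually_ae_filter)
  have [measurable]: "N \<in> sets borel" using null_setsD2[OF N(1)] by (simp only: sets_segs)
  have m: "(\<lambda>y. \<integral>\<^sup>+x. indicator N (x, y) \<partial>U :: ennreal) \<in> borel_measurable borel"
    by (rule U.borel_measurable_nn_integral) (simp add: split_beta)
  have "(\<integral>\<^sup>+y. \<integral>\<^sup>+x. indicator N (x, y) \<partial>U \<partial>U) = (0 :: ennreal)"
    using nn_integral_indicator[OF null_setsD2[OF N(1)]] null_setsD1[OF N(1)]
    by (subst nn_integral_U2[symmetric]) auto
  then have "AE y in U. (\<integral>\<^sup>+x. indicator N (x, y) \<partial>U) = (0 :: ennreal)"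
    using m by (subst nn_integral_0_iff_AE[symmetric]) auto
  then show ?thesis
  proof eventually_elim
    case (elim y)
    then have "AE x in U. indicator N (x, y) = (0 :: ennreal)"
      by (subst nn_integral_0_iff_AE[symmetric]) auto
    then show ?case
      by eventually_elim (use N in \<open>auto simp: indicator_def split: if_splits\<close>)
  qed
qed

lemma ennreal_power2_le_imp_le:
  assumes "x\<^sup>2 \<le> (ennreal c)\<^sup>2" "0 \<le> c"
  shows "x \<le> ennreal c"
proof (cases x rule: ennreal_cases)
  case (real r)
  then show ?thesis
    using assms by (auto simp: ennreal_power ennreal_le_iff intro: power2_le_imp_le)
next
  case top
  then show ?thesis
    using assms by (simp add: ennreal_power power2_eq_square ennreal_top_mult top_unique ennreal_mult_eq_top_iff)
qed

lemma nn_integral_powr_half: "(\<integral>\<^sup>+t. ennreal (t powr (-1/2)) \<partial>U) = 2"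
proof -
  have "((\<lambda>t. t powr (-1/2)) has_integral (1 powr (-1/2 + 1) / (-1/2 + 1))) {0..1::real}"
    by (rule has_integral_powr_from_0) auto
  from nn_integral_has_integral_lebesgue'[OF _ this]
  have "(\<integral>\<^sup>+t. ennreal (t powr (-1/2)) * indicator {0..1} t \<partial>lborel) = ennreal (1 powr (-1/2 + 1) / (-1/2 + 1))"
    by simp
  then show ?thesis by (subst nn_integral_seg) auto
qed

section \<open>Moments of \<open>w\<close> obtained from the increment bounds\<close>

context burgers
begin

text \<open>The bound of \<open>sup_bound\<close> at \<open>h = 1\<close>, with 16 raised to
  18.\<close>

definition M0 where "M0 = 18 * (E0 + E0 powr (2/3))"

lemma M0_nonneg: "0 \<le> M0" using E0_nonneg by (simp add: M0_def)

lemma measurable_diff1_w: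
  assumes [measurable]: "f \<in> borel_measurable borel"
  shows "(\<lambda>(t, z). ennreal (f (diff1 t w z))) \<in> borel_measurable (borel \<Otimes>\<^sub>M borel)"
  unfolding diff1_def split_beta by measurable

text \<open>\<open>w_le_average\<close> and Jensen's inequality bound the cube by averaged cubes of
  increments; \<open>cubic_bound\<close> applies to each shift \<open>t \<le> 1\<close>.\<close>

lemma w_cube: "(\<integral>\<^sup>+z. ennreal (\<bar>w z\<bar> ^ 3) \<partial>U2) \<le> ennreal (24 * E0)"
proof -
  have "(\<integral>\<^sup>+z. ennreal (\<bar>w z\<bar> ^ 3) \<partial>U2) = (\<integral>\<^sup>+y. \<integral>\<^sup>+x. ennreal (\<bar>w (x, y)\<bar> ^ 3) \<partial>U \<partial>U)"
    by (rule nn_integral_U2) simp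
  also have "\<dots> \<le> (\<integral>\<^sup>+y. \<integral>\<^sup>+x. \<integral>\<^sup>+t. ennreal (\<bar>diff1 t w (x, y)\<bar> ^ 3) \<partial>U \<partial>U \<partial>U)"
  proof (rule nn_integral_mono_AE)
    show "AE y in U. (\<integral>\<^sup>+x. ennreal (\<bar>w (x, y)\<bar> ^ 3) \<partial>U) \<le> (\<integral>\<^sup>+x. \<integral>\<^sup>+t. ennreal (\<bar>diff1 t w (x, y)\<bar> ^ 3) \<partial>U \<partial>U)"
      using w_le_average
    proof eventually_elim
      case (elim y)
      show ?case
      proof (rule nn_integral_mono_AE)
        show "AE x in U. ennreal (\<bar>w (x, y)\<bar> ^ 3) \<le> (\<integral>\<^sup>+t. ennreal (\<bar>diff1 t w (x, y)\<bar> ^ 3) \<partial>U)"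
          using AE_seg_mem[of 0 1]
        proof eventually_elim
          case (elim x)
          have "ennreal (1 * \<bar>w (x, y)\<bar> ^ 3) \<le> (\<integral>\<^sup>+t. ennreal (\<bar>diff1 t w (x, y)\<bar> ^ 3) \<partial>U)"
            using \<open>\<forall>x\<in>{0..1}. _ x\<close> elim U.emeasure_space_1
            by (intro nn_integral_cube_ge) (auto simp: diff1_def)
          then show ?case by simp
        qed
      qed
    qed
  qed
  also have "\<dots> = (\<integral>\<^sup>+t. \<integral>\<^sup>+z. ennreal (\<bar>diff1 t w z\<bar> ^ 3) \<partial>U2 \<partial>U)"
    by (rule nn_integral_U2_swap) (rule measurable_diff1_w, simp)
  also have "\<dots> \<le> (\<integral>\<^sup>+t. ennreal (24 * E0) \<partial>U)"
  proof (rule nn_integral_mono_AE)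
    show "AE t in U. (\<integral>\<^sup>+z. ennreal (\<bar>diff1 t w z\<bar> ^ 3) \<partial>U2) \<le> ennreal (24 * E0)"
      using AE_seg_mem[of 0 1]
    proof eventually_elim
      case (elim t)
      have "(\<integral>\<^sup>+z. ennreal (\<bar>diff1 t w z\<bar> ^ 3) \<partial>U2) \<le> ennreal (24 * t * E0)" using elim by (intro cubic_bound) auto
      also have "\<dots> \<le> ennreal (24 * E0)"
        using elim E0_nonneg by (intro ennreal_leI mult_right_mono) auto
      finally show ?case .
    qed
  qed
  also have "\<dots> = ennreal (24 * E0)" using U.emeasure_space_1 by simp
  finally show ?thesis .
qed

text \<open>The same averaging with squares instead of cubes, and with \<open>sup_bound\<close> at
  \<open>h = 1\<close>, which is available slice by slice.\<close>

lemma slices: "AE y in U. (\<integral>\<^sup>+x. ennreal ((w (x, y))\<^sup>2) \<partial>U) \<le> ennreal M0"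
  using w_le_average sup_bound[OF zero_le_one order_refl]
proof eventually_elim
  case (elim y)
  have "(\<integral>\<^sup>+x. ennreal ((w (x, y))\<^sup>2) \<partial>U) \<le> (\<integral>\<^sup>+x. \<integral>\<^sup>+t. ennreal ((diff1 t w (x, y))\<^sup>2) \<partial>U \<partial>U)"
  proof (rule nn_integral_mono_AE)
    show "AE x in U. ennreal ((w (x, y))\<^sup>2) \<le> (\<integral>\<^sup>+t. ennreal ((diff1 t w (x, y))\<^sup>2) \<partial>U)"
      using AE_seg_mem[of 0 1]
    proof eventually_elim
      case (elim x)
      have "ennreal (\<bar>w (x, y)\<bar>\<^sup>2) \<le> (\<integral>\<^sup>+t. ennreal (\<bar>diff1 t w (x, y)\<bar>\<^sup>2) \<partial>U)"
        using \<open>\<forall>x\<in>{0..1}. _ x\<close> elim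
        by (intro nn_integral_square_ge U.prob_space_axioms) (auto simp: diff1_def)
      then show ?case by simp
    qed
  qed
  also have "\<dots> = (\<integral>\<^sup>+z. ennreal ((diff1 (fst z) w (snd z, y))\<^sup>2) \<partial>(seg 0 1 \<Otimes>\<^sub>M U))"
    by (subst U2.nn_integral_snd[symmetric]) (simp_all add: diff1_def)
  also have "\<dots> \<le> ennreal (16 * 1 * E0 + 18 * (1 * (1 * E0) powr (2/3)))" by (rule elim(2))
  also have "\<dots> \<le> ennreal M0"
    using E0_nonneg by (intro ennreal_leI) (simp add: M0_def)
  finally show ?case .
qed

lemma w_eq_0:
  assumes "E0 = 0" shows "AE z in U2. w z = 0"
proof -
  have "(\<integral>\<^sup>+z. ennreal (\<bar>w z\<bar> ^ 3) \<partial>U2) = 0" using w_cube assms by simp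
  then have "AE z in U2. ennreal (\<bar>w z\<bar> ^ 3) = 0" by (subst nn_integral_0_iff_AE[symmetric]) auto
  then show ?thesis by eventually_elim (simp add: ennreal_eq_0_iff)
qed

lemma Lp_eq_0:
  assumes "E0 = 0" shows "(\<integral>\<^sup>+z. ennreal (\<bar>w z\<bar> powr p) \<partial>U2) = 0"
  using w_eq_0[OF assms] by (subst nn_integral_0_iff_AE) (auto elim!: AE_mp)

text \<open>Where \<open>\<bar>w\<bar> > 2 \<surd>M\<close>, the average of \<open>w\<close> over a distance \<open>h = 4M/w\<^sup>2\<close> is at most \<open>\<bar>w\<bar>/2\<close>, so that
  \<open>w\<close> is controlled by its increments up to \<open>h\<close>.\<close>

lemma Lp_mid_pointwise:
  assumes p: "3 \<le> p" and y: "(\<integral>\<^sup>+x. ennreal ((w (x, y))\<^sup>2) \<partial>U) \<le> ennreal M0" and M: "0 < M0" and x: "x \<in> {0..1}"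
  shows "ennreal (\<bar>w (x, y)\<bar> powr p) \<le> ennreal ((2 * sqrt M0) powr (p - 3)) * ennreal (\<bar>w (x, y)\<bar> ^ 3)
    + ennreal (8 * (2 * sqrt M0) powr (p - 3)) * (\<integral>\<^sup>+t. ennreal (t powr (-(p-1)/2)) * ennreal (\<bar>diff1 t w (x, y)\<bar> ^ 3) \<partial>U)"
proof -
  let ?l = "2 * sqrt M0" and ?a = "\<bar>w (x, y)\<bar>"
  have l: "0 < ?l" "?l\<^sup>2 = 4 * M0" using M by (auto simp: power_mult_distrib)
  have pw: "?a powr p = ?a powr (p - 3) * ?a ^ 3"
  proof (cases "?a = 0")
    case False
    have "?a powr p = ?a powr (p - 3 + 3)" by simp
    also have "\<dots> = ?a powr (p - 3) * ?a powr 3" by (rule powr_add)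
    also have "?a powr 3 = ?a ^ 3" using False by simp
    finally show ?thesis .
  qed (use p in simp)
  show ?thesis
  proof (cases "?a \<le> ?l")
    case True
    then have "?a powr (p - 3) \<le> ?l powr (p - 3)" using p by (intro powr_mono2) auto
    then have "ennreal (?a powr p) \<le> ennreal (?l powr (p - 3)) * ennreal (?a ^ 3)"
      unfolding pw by (subst ennreal_mult'[symmetric]) (auto intro!: ennreal_leI mult_right_mono)
    then show ?thesis by (simp add: add_increasing2)
  next
    case False
    define a where "a = ?a"
    have a: "?l < a" "0 < a" using False l by (auto simp: a_def)
    define h where "h = ?l\<^sup>2 / a\<^sup>2"
    have "?l\<^sup>2 \<le> a\<^sup>2" using a l by (intro power_mono) auto
    moreover have "0 < a\<^sup>2" "0 < ?l\<^sup>2" using a(2) l(1) by (simp_all only: zero_less_power)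
    ultimately have h: "0 < h" "h \<le> 1" unfolding h_def by (simp_all only: divide_pos_pos divide_le_eq_1_pos)
    have ha: "a = ?l * h powr (-1/2)"
    proof -
      have "h = (?l / a)\<^sup>2" by (simp add: h_def power_divide)
      also have "\<dots> = (?l / a) powr 2" by (rule powr_numeral[OF less_imp_le[OF divide_pos_pos[OF l(1) a(2)]], symmetric])
      finally have "h powr (-1/2) = (?l / a) powr (-1)" by (simp add: powr_powr)
      also have "\<dots> = a / ?l" using divide_pos_pos[OF l(1) a(2)] by (subst powr_minus_divide) (simp only: powr_one divide_divide_eq_right mult_1_left)
      finally show ?thesis using M by simp
    qed
    have mw: "(\<lambda>t. w (x + t, y)) \<in> borel_measurable borel" by simp
    have "(\<integral>\<^sup>+t. (ennreal \<bar>w (x + t, y)\<bar>)\<^sup>2 \<partial>seg 0 h) \<le> (\<integral>\<^sup>+t. ennreal ((w (x + t, y))\<^sup>2) \<partial>U)"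
      using h by (auto simp: nn_integral_seg ennreal_power indicator_def intro!: nn_integral_mono)
    also have "\<dots> = (\<integral>\<^sup>+t. ennreal ((w (t, y))\<^sup>2) \<partial>U)"
      using nn_integral_U_shift[of "\<lambda>t. ennreal ((w (t, y))\<^sup>2)" x] x per[of "(t, y)" for t] by (simp add: add.commute)
    also note y
    finally have B: "(\<integral>\<^sup>+t. (ennreal \<bar>w (x + t, y)\<bar>)\<^sup>2 \<partial>seg 0 h) \<le> ennreal M0" .
    \<comment> \<open>The choice of \<open>h\<close> means
      \<open>M0 * h = (h * a / 2)\<^sup>2\<close>: Cauchy-Schwarz bounds the integral of
      \<open>|w|\<close> over the distance \<open>h\<close> by half of \<open>h * a\<close>, so the
      increments account for the other half.\<close>
    have "(\<integral>\<^sup>+t. ennreal \<bar>w (x + t, y)\<bar> * 1 \<partial>seg 0 h)\<^sup>2 \<le> (\<integral>\<^sup>+t. (ennreal \<bar>w (x + t, y)\<bar>)\<^sup>2 \<partial>seg 0 h) * (\<integral>\<^sup>+t. 1\<^sup>2 \<partial>seg 0 h)"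
      by (rule Cauchy_Schwarz_nn_integral) simp_all
    also have "\<dots> \<le> ennreal M0 * ennreal h"
      using h by (intro mult_mono B) (simp_all add: emeasure_seg_UNIV)
    also have "ennreal M0 * ennreal h = (ennreal (h * a / 2))\<^sup>2"
    proof -
      have "M0 * h = (h * a / 2)\<^sup>2" using a l(2) by (simp add: h_def power2_eq_square field_simps)
      then show ?thesis using h a M by (simp add: ennreal_power ennreal_mult'[symmetric])
    qed
    finally have A: "(\<integral>\<^sup>+t. ennreal \<bar>w (x + t, y)\<bar> \<partial>seg 0 h) \<le> ennreal (h * a / 2)"
      using h a by (intro ennreal_power2_le_imp_le) auto
    let ?D = "\<integral>\<^sup>+t. ennreal \<bar>diff1 t w (x, y)\<bar> \<partial>seg 0 h"
    have "ennreal (h * a / 2) + ennreal (h * a / 2) = (\<integral>\<^sup>+t. ennreal a \<partial>seg 0 h)"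
      using h a by (simp add: emeasure_seg_UNIV ennreal_mult'[symmetric] mult.commute flip: ennreal_plus)
    also have "\<dots> \<le> (\<integral>\<^sup>+t. ennreal \<bar>diff1 t w (x, y)\<bar> + ennreal \<bar>w (x + t, y)\<bar> \<partial>seg 0 h)"
    proof (rule nn_integral_mono)
      fix t
      have "a \<le> \<bar>diff1 t w (x, y)\<bar> + \<bar>w (x + t, y)\<bar>" by (simp add: a_def diff1_def)
      from ennreal_leI[OF this] show "ennreal a \<le> ennreal \<bar>diff1 t w (x, y)\<bar> + ennreal \<bar>w (x + t, y)\<bar>" by simp
    qed
    also have "\<dots> = ?D + (\<integral>\<^sup>+t. ennreal \<bar>w (x + t, y)\<bar> \<partial>seg 0 h)"
      by (intro nn_integral_add) (simp_all add: diff1_def)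
    also have "\<dots> \<le> ?D + ennreal (h * a / 2)" by (intro add_left_mono A)
    finally have "ennreal (h * a / 2) + ennreal (h * a / 2) \<le> ennreal (h * a / 2) + ?D"
      by (simp only: add.commute)
    then have "ennreal (h * a / 2) \<le> ?D"
      unfolding ennreal_add_left_cancel_le by simp
    then have "ennreal (h * (a / 2) ^ 3) \<le> (\<integral>\<^sup>+t. ennreal (\<bar>diff1 t w (x, y)\<bar> ^ 3) \<partial>seg 0 h)"
      using h a by (intro nn_integral_cube_ge) (auto simp: diff1_def emeasure_seg_UNIV)
    note cube = this
    have "ennreal (a powr p) = ennreal (8 * ?l powr (p - 3) * h powr (-(p-1)/2)) * ennreal (h * (a / 2) ^ 3)"
    proof -
      have "a powr (p - 3) = ?l powr (p - 3) * h powr (-(p-3)/2)"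
      proof -
        have "a powr (p - 3) = ?l powr (p - 3) * (h powr (-1/2)) powr (p - 3)"
          using l h by (subst ha) (simp add: powr_mult)
        also have "(h powr (-1/2)) powr (p - 3) = h powr (-(p-3)/2)"
          unfolding powr_powr by (rule arg_cong[of _ _ "(powr) h"]) (simp add: field_simps)
        finally show ?thesis .
      qed
      also have "h powr (-(p-3)/2) = h powr (-(p-1)/2 + 1)" by (rule arg_cong[of _ _ "(powr) h"]) (simp add: field_simps)
      also have "\<dots> = h powr (-(p-1)/2) * h" using h by (simp only: powr_add) simp
      finally have "a powr (p - 3) = ?l powr (p - 3) * (h powr (-(p-1)/2) * h)" .
      then have "a powr p = 8 * ?l powr (p - 3) * h powr (-(p-1)/2) * (h * (a / 2) ^ 3)"
        using pw unfolding a_def[symmetric] by (simp add: power3_eq_cube)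
      then show ?thesis using l h by (subst ennreal_mult'[symmetric]) auto
    qed
    also have "\<dots> \<le> ennreal (8 * ?l powr (p - 3) * h powr (-(p-1)/2)) * (\<integral>\<^sup>+t. ennreal (\<bar>diff1 t w (x, y)\<bar> ^ 3) \<partial>seg 0 h)"
      by (intro mult_left_mono cube) auto
    also have "\<dots> = ennreal (8 * ?l powr (p - 3)) * (\<integral>\<^sup>+t. ennreal (h powr (-(p-1)/2)) * ennreal (\<bar>diff1 t w (x, y)\<bar> ^ 3) \<partial>seg 0 h)"
      by (subst nn_integral_cmult) (simp_all add: diff1_def ennreal_mult' mult.assoc)
    \<comment> \<open>The exponent is negative and \<open>t \<le> h\<close>, so \<open>h\<close> may
      be replaced by \<open>t\<close>. The weight no longer depends on the point, and the order of
      integration can be exchanged later.\<close>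
    also have "(\<integral>\<^sup>+t. ennreal (h powr (-(p-1)/2)) * ennreal (\<bar>diff1 t w (x, y)\<bar> ^ 3) \<partial>seg 0 h)
       \<le> (\<integral>\<^sup>+t. ennreal (t powr (-(p-1)/2)) * ennreal (\<bar>diff1 t w (x, y)\<bar> ^ 3) \<partial>seg 0 h)"
    proof (rule nn_integral_mono_AE)
      have "AE t in seg 0 h. 0 < t \<and> t \<le> h"
        using AE_lborel_singleton[of 0] unfolding AE_seg by eventually_elim auto
      then show "AE t in seg 0 h. ennreal (h powr (-(p-1)/2)) * ennreal (\<bar>diff1 t w (x, y)\<bar> ^ 3)
          \<le> ennreal (t powr (-(p-1)/2)) * ennreal (\<bar>diff1 t w (x, y)\<bar> ^ 3)"
        by eventually_elim (use p in \<open>auto intro!: mult_right_mono ennreal_leI powr_mono2'\<close>)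
    qed
    also have "\<dots> \<le> (\<integral>\<^sup>+t. ennreal (t powr (-(p-1)/2)) * ennreal (\<bar>diff1 t w (x, y)\<bar> ^ 3) \<partial>U)"
      using h by (subst (1 2) nn_integral_seg) (auto simp: diff1_def indicator_def intro!: nn_integral_mono)
    finally show ?thesis
      unfolding a_def by (simp add: add_increasing mult_left_mono)
  qed
qed

end

lemma nn_integral_linear:
  assumes [measurable]: "f \<in> borel_measurable M" "k \<in> borel_measurable M"
  shows "(\<integral>\<^sup>+x. a * f x + b * k x \<partial>M) = a * (\<integral>\<^sup>+x. f x \<partial>M) + b * (\<integral>\<^sup>+x. k x \<partial>M)"
  by (simp add: nn_integral_add nn_integral_cmult)

context burgers
begin

text \<open>\<open>cubic_bound\<close> supplies a factor \<open>t\<close>, leaving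
  \<open>t powr (-(p-3)/2)\<close>. For \<open>p \<le> 4\<close> and \<open>t \<le> 1\<close> this
  is at most \<open>t powr (-1/2)\<close>, whose integral is 2; hence
  \<open>48 = 24 * 2\<close>.\<close>

lemma weighted_increments:
  assumes p: "3 \<le> p" "p \<le> 4"
  shows "(\<integral>\<^sup>+y. \<integral>\<^sup>+x. \<integral>\<^sup>+t. ennreal (t powr (-(p-1)/2)) * ennreal (\<bar>diff1 t w (x, y)\<bar> ^ 3) \<partial>U \<partial>U \<partial>U) \<le> ennreal (48 * E0)"
proof -
  have "(\<integral>\<^sup>+y. \<integral>\<^sup>+x. \<integral>\<^sup>+t. ennreal (t powr (-(p-1)/2)) * ennreal (\<bar>diff1 t w (x, y)\<bar> ^ 3) \<partial>U \<partial>U \<partial>U)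
    = (\<integral>\<^sup>+t. \<integral>\<^sup>+z. ennreal (t powr (-(p-1)/2)) * ennreal (\<bar>diff1 t w z\<bar> ^ 3) \<partial>U2 \<partial>U)"
    by (rule nn_integral_U2_swap[of "\<lambda>t z. ennreal (t powr (-(p-1)/2)) * ennreal (\<bar>diff1 t w z\<bar> ^ 3)"])
       (unfold diff1_def split_beta, measurable)
  also have "\<dots> \<le> (\<integral>\<^sup>+t. ennreal (24 * E0) * ennreal (t powr (-1/2)) \<partial>U)"
  proof (rule nn_integral_mono_AE)
    have "AE t in U. 0 < t \<and> t \<le> 1"
      using AE_lborel_singleton[of 0] unfolding AE_seg by eventually_elim auto
    then show "AE t in U. (\<integral>\<^sup>+z. ennreal (t powr (-(p-1)/2)) * ennreal (\<bar>diff1 t w z\<bar> ^ 3) \<partial>U2) \<le> ennreal (24 * E0) * ennreal (t powr (-1/2))"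
    proof eventually_elim
      case (elim t)
      have "(\<integral>\<^sup>+z. ennreal (t powr (-(p-1)/2)) * ennreal (\<bar>diff1 t w z\<bar> ^ 3) \<partial>U2) = ennreal (t powr (-(p-1)/2)) * (\<integral>\<^sup>+z. ennreal (\<bar>diff1 t w z\<bar> ^ 3) \<partial>U2)"
        by (rule nn_integral_cmult) (simp add: diff1_def)
      also have "\<dots> \<le> ennreal (t powr (-(p-1)/2)) * ennreal (24 * t * E0)"
        using elim by (intro mult_left_mono cubic_bound) auto
      also have "\<dots> = ennreal (24 * E0 * t powr (-(p-3)/2))"
      proof -
        have "t powr (-(p-3)/2) = t powr (-(p-1)/2 + 1)" by (rule arg_cong[of _ _ "(powr) t"]) (simp add: field_simps)
        also have "\<dots> = t powr (-(p-1)/2) * t" using elim by (simp only: powr_add) simp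
        finally show ?thesis by (subst ennreal_mult'[symmetric]) (auto simp: mult_ac)
      qed
      also have "\<dots> \<le> ennreal (24 * E0 * t powr (-1/2))"
        using elim p E0_nonneg powr_mono'[of "-1/2" "-(p-3)/2" t] by (intro ennreal_leI mult_left_mono) auto
      also have "\<dots> = ennreal (24 * E0) * ennreal (t powr (-1/2))"
        using E0_nonneg by (subst ennreal_mult'[symmetric]) auto
      finally show ?case .
    qed
  qed
  also have "\<dots> = ennreal (24 * E0) * 2"
    by (subst nn_integral_cmult) (simp_all add: nn_integral_powr_half[simplified])
  also have "\<dots> = ennreal (48 * E0)"
    using E0_nonneg by (simp add: mult.commute flip: ennreal_numeral ennreal_mult')
  finally show ?thesis .
qed

text \<open>Integrating \<open>Lp_mid_pointwise\<close> gives \<open>408 = 24 + 8 * 48\<close>, from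
  \<open>w_cube\<close> and \<open>weighted_increments\<close>.\<close>

lemma Lp_mid:
  assumes p: "3 \<le> p" "p \<le> 4"
  shows "(\<integral>\<^sup>+z. ennreal (\<bar>w z\<bar> powr p) \<partial>U2) \<le> ennreal (408 * ((2 * sqrt M0) powr (p - 3) * E0))"
proof (cases "E0 = 0")
  case True
  then show ?thesis using Lp_eq_0[of p] by simp
next
  case False
  then have M: "0 < M0" using E0_nonneg by (simp add: M0_def add_pos_nonneg)
  let ?l = "(2 * sqrt M0) powr (p - 3)"
  let ?I = "\<lambda>x y. \<integral>\<^sup>+t. ennreal (t powr (-(p-1)/2)) * ennreal (\<bar>diff1 t w (x, y)\<bar> ^ 3) \<partial>U"
  have mI: "(\<lambda>x. ?I x y) \<in> borel_measurable borel" "(\<lambda>y. \<integral>\<^sup>+x. ?I x y \<partial>U) \<in> borel_measurable borel" for y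
    by ((intro U.borel_measurable_nn_integral)+, unfold split_beta diff1_def, measurable)+
  have mw: "(\<lambda>y. \<integral>\<^sup>+x. ennreal (\<bar>w (x, y)\<bar> ^ 3) \<partial>U) \<in> borel_measurable borel"
    by (rule U.borel_measurable_nn_integral) (simp add: split_beta)
  have "(\<integral>\<^sup>+z. ennreal (\<bar>w z\<bar> powr p) \<partial>U2) = (\<integral>\<^sup>+y. \<integral>\<^sup>+x. ennreal (\<bar>w (x, y)\<bar> powr p) \<partial>U \<partial>U)"
    by (rule nn_integral_U2) simp
  also have "\<dots> \<le> (\<integral>\<^sup>+y. \<integral>\<^sup>+x. ennreal ?l * ennreal (\<bar>w (x, y)\<bar> ^ 3) + ennreal (8 * ?l) * ?I x y \<partial>U \<partial>U)"
  proof (rule nn_integral_mono_AE)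
    show "AE y in U. (\<integral>\<^sup>+x. ennreal (\<bar>w (x, y)\<bar> powr p) \<partial>U) \<le> (\<integral>\<^sup>+x. ennreal ?l * ennreal (\<bar>w (x, y)\<bar> ^ 3) + ennreal (8 * ?l) * ?I x y \<partial>U)"
      using slices
    proof eventually_elim
      case (elim y)
      show ?case
        using AE_seg_mem[of 0 1] Lp_mid_pointwise[OF p(1) elim M]
        by (intro nn_integral_mono_AE) (auto elim!: AE_mp)
    qed
  qed
  also have "\<dots> = (\<integral>\<^sup>+y. ennreal ?l * (\<integral>\<^sup>+x. ennreal (\<bar>w (x, y)\<bar> ^ 3) \<partial>U) + ennreal (8 * ?l) * (\<integral>\<^sup>+x. ?I x y \<partial>U) \<partial>U)"
    by (intro nn_integral_cong nn_integral_linear; simp only: measurable_seg mI; measurable)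
  also have "\<dots> = ennreal ?l * (\<integral>\<^sup>+y. \<integral>\<^sup>+x. ennreal (\<bar>w (x, y)\<bar> ^ 3) \<partial>U \<partial>U) + ennreal (8 * ?l) * (\<integral>\<^sup>+y. \<integral>\<^sup>+x. ?I x y \<partial>U \<partial>U)"
    by (rule nn_integral_linear; simp only: measurable_seg mI mw)
  also have "(\<integral>\<^sup>+y. \<integral>\<^sup>+x. ennreal (\<bar>w (x, y)\<bar> ^ 3) \<partial>U \<partial>U) = (\<integral>\<^sup>+z. ennreal (\<bar>w z\<bar> ^ 3) \<partial>U2)"
    by (rule nn_integral_U2[symmetric]) simp
  also have "ennreal ?l * (\<integral>\<^sup>+z. ennreal (\<bar>w z\<bar> ^ 3) \<partial>U2) + ennreal (8 * ?l) * (\<integral>\<^sup>+y. \<integral>\<^sup>+x. ?I x y \<partial>U \<partial>U)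
     \<le> ennreal ?l * ennreal (24 * E0) + ennreal (8 * ?l) * ennreal (48 * E0)"
    by (intro add_mono mult_left_mono w_cube weighted_increments p) auto
  also have "ennreal ?l * ennreal (24 * E0) = ennreal (?l * (24 * E0))"
    by (rule ennreal_mult'[symmetric]) simp
  also have "ennreal (8 * ?l) * ennreal (48 * E0) = ennreal (8 * ?l * (48 * E0))"
    by (rule ennreal_mult'[symmetric]) simp
  also have "ennreal (?l * (24 * E0)) + ennreal (8 * ?l * (48 * E0)) = ennreal (?l * (24 * E0) + 8 * ?l * (48 * E0))"
    by (rule ennreal_plus[symmetric]) (use E0_nonneg in simp_all)
  also have "?l * (24 * E0) + 8 * ?l * (48 * E0) = 408 * (?l * E0)" by simp
  finally show ?thesis .
qed

text \<open>\<open>\<alpha>\<close> and \<open>\<beta>\<close> are the \<open>L2\<close> norms of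
  the slices of \<open>w\<close> and \<open>v\<close>. The first inequality of
  \<open>w_pointwise\<close> gives \<open>|w| \<le> \<beta>\<close> and so
  \<open>\<alpha> \<le> \<beta>\<close>; the second, with Cauchy-Schwarz, gives the bound by
  \<open>2 * \<alpha> * \<beta>\<close>.\<close>

lemma slice_facts:
  "AE y in U. \<exists>\<alpha> \<beta>. 0 \<le> \<alpha> \<and> \<alpha> \<le> \<beta> \<and> \<alpha>\<^sup>2 \<le> M0 \<and> (\<integral>\<^sup>+x. ennreal ((w (x, y))\<^sup>2) \<partial>U) = ennreal (\<alpha>\<^sup>2)
     \<and> (\<integral>\<^sup>+x. ennreal ((v (x, y))\<^sup>2) \<partial>U) = ennreal (\<beta>\<^sup>2) \<and> (AE x in U. w (x, y) * w (x, y) \<le> 2 * \<alpha> * \<beta>)"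
proof -
  have i: "integrable U2 (\<lambda>z. (w z)\<^sup>2)" "integrable U2 (\<lambda>z. (v z)\<^sup>2)" using sq by (auto simp: square_integrable_def)
  have s: "AE y in U. square_integrable U (\<lambda>x. w (x, y))" "AE y in U. square_integrable U (\<lambda>x. v (x, y))"
    using U2.AE_integrable_snd[of "\<lambda>x y. (w (x, y))\<^sup>2"] U2.AE_integrable_snd[of "\<lambda>x y. (v (x, y))\<^sup>2"] i
    by (simp_all add: square_integrable_def case_prod_beta')
  show ?thesis
    using s slices AE_U2_D[OF w_pointwise(1)] AE_U2_D[OF w_pointwise(2)]
  proof eventually_elim
    case (elim y)
    let ?a = "norm2 U (\<lambda>x. w (x, y))" and ?b = "norm2 U (\<lambda>x. v (x, y))"
    have eq: "(\<integral>\<^sup>+x. ennreal ((w (x, y))\<^sup>2) \<partial>U) = ennreal (?a\<^sup>2)" "(\<integral>\<^sup>+x. ennreal ((v (x, y))\<^sup>2) \<partial>U) = ennreal (?b\<^sup>2)"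
      using elim(1,2) by (simp_all add: nn_integral_eq_integral norm2_square square_integrable_def)
    have M: "?a\<^sup>2 \<le> M0" using elim(3) M0_nonneg unfolding eq by (simp add: ennreal_le_iff)
    have b: "(\<integral>x. \<bar>v (x, y)\<bar> \<partial>U) \<le> ?b" by (rule U.integral_abs_le_norm2[OF elim(2)])
    have "(\<integral>\<^sup>+x. ennreal ((w (x, y))\<^sup>2) \<partial>U) \<le> (\<integral>\<^sup>+x. ennreal (?b\<^sup>2) \<partial>U)"
    proof (rule nn_integral_mono_AE)
      show "AE x in U. ennreal ((w (x, y))\<^sup>2) \<le> ennreal (?b\<^sup>2)"
        using elim(4)
      proof eventually_elim
        case (elim x)
        then have "\<bar>w (x, y)\<bar> \<le> \<bar>?b\<bar>" using b by simp
        then show ?case by (intro ennreal_leI) (simp only: abs_le_square_iff)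
      qed
    qed
    also have "\<dots> = ennreal (?b\<^sup>2)" using U.emeasure_space_1 by simp
    finally have "?a\<^sup>2 \<le> ?b\<^sup>2" unfolding eq by (simp add: ennreal_le_iff)
    then have ab: "?a \<le> ?b" by (rule power2_le_imp_le) simp
    have "(\<integral>x. \<bar>2 * (w (x, y) * v (x, y))\<bar> \<partial>U) = 2 * (\<integral>x. \<bar>w (x, y)\<bar> * \<bar>v (x, y)\<bar> \<partial>U)"
      by (simp add: abs_mult)
    also have "\<dots> \<le> 2 * ?a * ?b" using Cauchy_Schwarz_norm2_abs[OF elim(1,2)] by simp
    finally have "AE x in U. w (x, y) * w (x, y) \<le> 2 * ?a * ?b"
      using elim(5) by (auto elim!: AE_mp)
    then show ?case using ab M eq by (intro exI[of _ ?a] exI[of _ ?b]) auto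
  qed
qed

lemma v_square: "(\<integral>\<^sup>+y. \<integral>\<^sup>+x. ennreal ((v (x, y))\<^sup>2) \<partial>U \<partial>U) = ennreal ((norm2 U2 v)\<^sup>2)"
  using sq by (subst nn_integral_U2[symmetric]) (auto simp: nn_integral_eq_integral norm2_square square_integrable_def)

lemma L2_le: "(\<integral>\<^sup>+z. ennreal ((w z)\<^sup>2) \<partial>U2) \<le> ennreal ((norm2 U2 v)\<^sup>2)"
proof -
  have "(\<integral>\<^sup>+z. ennreal ((w z)\<^sup>2) \<partial>U2) = (\<integral>\<^sup>+y. \<integral>\<^sup>+x. ennreal ((w (x, y))\<^sup>2) \<partial>U \<partial>U)"
    by (rule nn_integral_U2) simp
  also have "\<dots> \<le> (\<integral>\<^sup>+y. \<integral>\<^sup>+x. ennreal ((v (x, y))\<^sup>2) \<partial>U \<partial>U)"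
  proof (rule nn_integral_mono_AE)
    show "AE y in U. (\<integral>\<^sup>+x. ennreal ((w (x, y))\<^sup>2) \<partial>U) \<le> (\<integral>\<^sup>+x. ennreal ((v (x, y))\<^sup>2) \<partial>U)"
      using slice_facts by eventually_elim (auto intro!: ennreal_leI power_mono)
  qed
  finally show ?thesis unfolding v_square .
qed

text \<open>On a slice \<open>|w| powr p\<close> is \<open>w\<^sup>2\<close> to the power
  \<open>?q\<close> times \<open>w\<^sup>2\<close>, so the integral is at most
  \<open>(2 a b)^?q a\<^sup>2\<close>. The target is \<open>a^(2 ?q) b\<^sup>2\<close>, because
  \<open>a\<^sup>2 \<le> M0\<close> on every slice while \<open>b\<^sup>2\<close> integrates to the
  squared norm of \<open>v\<close>.\<close>

lemma Lp_high:
  assumes p: "2 < p" "p \<le> 6"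
  shows "(\<integral>\<^sup>+z. ennreal (\<bar>w z\<bar> powr p) \<partial>U2) \<le> ennreal (4 * M0 powr ((p - 2) / 2) * (norm2 U2 v)\<^sup>2)"
proof -
  let ?q = "(p - 2) / 2"
  have q: "0 < ?q" "?q \<le> 2" using p by auto
  have "(\<integral>\<^sup>+z. ennreal (\<bar>w z\<bar> powr p) \<partial>U2) = (\<integral>\<^sup>+y. \<integral>\<^sup>+x. ennreal (\<bar>w (x, y)\<bar> powr p) \<partial>U \<partial>U)"
    by (rule nn_integral_U2) simp
  also have "\<dots> \<le> (\<integral>\<^sup>+y. ennreal (4 * M0 powr ?q) * (\<integral>\<^sup>+x. ennreal ((v (x, y))\<^sup>2) \<partial>U) \<partial>U)"
  proof (rule nn_integral_mono_AE)
    show "AE y in U. (\<integral>\<^sup>+x. ennreal (\<bar>w (x, y)\<bar> powr p) \<partial>U) \<le> ennreal (4 * M0 powr ?q) * (\<integral>\<^sup>+x. ennreal ((v (x, y))\<^sup>2) \<partial>U)"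
      using slice_facts
    proof eventually_elim
      case (elim y)
      then obtain a b where ab: "0 \<le> a" "a \<le> b" "a\<^sup>2 \<le> M0" "(\<integral>\<^sup>+x. ennreal ((w (x, y))\<^sup>2) \<partial>U) = ennreal (a\<^sup>2)"
        "(\<integral>\<^sup>+x. ennreal ((v (x, y))\<^sup>2) \<partial>U) = ennreal (b\<^sup>2)" "AE x in U. w (x, y) * w (x, y) \<le> 2 * a * b" by blast
      have "(\<integral>\<^sup>+x. ennreal (\<bar>w (x, y)\<bar> powr p) \<partial>U) \<le> (\<integral>\<^sup>+x. ennreal ((2 * a * b) powr ?q) * ennreal ((w (x, y))\<^sup>2) \<partial>U)"
      proof (rule nn_integral_mono_AE)
        show "AE x in U. ennreal (\<bar>w (x, y)\<bar> powr p) \<le> ennreal ((2 * a * b) powr ?q) * ennreal ((w (x, y))\<^sup>2)"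
          using ab(6)
        proof eventually_elim
          case (elim x)
          have "\<bar>w (x, y)\<bar> powr p = ((w (x, y))\<^sup>2) powr ?q * (w (x, y))\<^sup>2"
          proof (cases "w (x, y) = 0")
            case False
            then have sq: "(w (x, y))\<^sup>2 = \<bar>w (x, y)\<bar> powr 2" by simp
            have "2 * ?q + 2 = p" by (simp add: field_simps)
            then show ?thesis unfolding sq powr_powr by (simp only: powr_add[symmetric])
          qed (use p in simp)
          also have "\<dots> \<le> (2 * a * b) powr ?q * (w (x, y))\<^sup>2"
            using elim q by (intro mult_right_mono powr_mono2) (auto simp: power2_eq_square)
          finally show ?case by (subst ennreal_mult'[symmetric]) (auto intro: ennreal_leI)
        qed
      qed
      also have "\<dots> = ennreal ((2 * a * b) powr ?q) * ennreal (a\<^sup>2)"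
        by (subst nn_integral_cmult) (simp_all add: ab)
      also have "\<dots> = ennreal ((2 * a * b) powr ?q * a\<^sup>2)" by (subst ennreal_mult'[symmetric]) auto
      also have "\<dots> \<le> ennreal (4 * M0 powr ?q * b\<^sup>2)"
      proof (intro ennreal_leI, cases "a = 0")
        case False
        then have a: "0 < a" "0 < b" using ab by auto
        \<comment> \<open>Of \<open>a\<^sup>2\<close> the part \<open>a powr (2 - ?q)\<close> is
          raised to \<open>b powr (2 - ?q)\<close>, which uses \<open>a \<le> b\<close> and
          \<open>?q \<le> 2\<close>; the rest makes \<open>a powr (2 * ?q)\<close>. The constant 4
          bounds \<open>2 powr ?q\<close>.\<close>
        have "(2 * a * b) powr ?q * a\<^sup>2 = 2 powr ?q * (a powr ?q * b powr ?q * a powr (2 - ?q) * a powr ?q)"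
          using a by (simp add: powr_mult mult.assoc flip: powr_add)
        also have "\<dots> \<le> 2 powr 2 * (a powr ?q * b powr ?q * b powr (2 - ?q) * a powr ?q)"
          using a q ab by (intro mult_mono powr_mono powr_mono2) auto
        also have "a powr ?q * b powr ?q * b powr (2 - ?q) * a powr ?q = (a powr 2) powr ?q * b powr 2"
        proof -
          have "a powr ?q * b powr ?q * b powr (2 - ?q) * a powr ?q = (a powr ?q * a powr ?q) * (b powr ?q * b powr (2 - ?q))"
            by (simp only: mult_ac)
          also have "a powr ?q * a powr ?q = a powr (2 * ?q)" by (simp only: powr_add[symmetric] mult_2)
          also have "b powr ?q * b powr (2 - ?q) = b powr 2" by (subst powr_add[symmetric]) simp
          finally show ?thesis by (simp only: powr_powr)
        qed
        also have "\<dots> = (a\<^sup>2) powr ?q * b\<^sup>2" using a by simp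
        also have "\<dots> \<le> M0 powr ?q * b\<^sup>2" using ab q by (intro mult_right_mono powr_mono2) auto
        finally show "(2 * a * b) powr ?q * a\<^sup>2 \<le> 4 * M0 powr ?q * b\<^sup>2" by simp
      qed simp
      also have "\<dots> = ennreal (4 * M0 powr ?q) * (\<integral>\<^sup>+x. ennreal ((v (x, y))\<^sup>2) \<partial>U)"
        unfolding ab by (subst ennreal_mult'[symmetric]) auto
      finally show ?case .
    qed
  qed
  also have "\<dots> = ennreal (4 * M0 powr ?q) * (\<integral>\<^sup>+y. \<integral>\<^sup>+x. ennreal ((v (x, y))\<^sup>2) \<partial>U \<partial>U)"
  proof (rule nn_integral_cmult)
    have "(\<lambda>y. \<integral>\<^sup>+x. ennreal ((v (x, y))\<^sup>2) \<partial>U) \<in> borel_measurable borel"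
      by (rule U.borel_measurable_nn_integral) (simp add: split_beta)
    then show "(\<lambda>y. \<integral>\<^sup>+x. ennreal ((v (x, y))\<^sup>2) \<partial>U) \<in> borel_measurable U" by simp
  qed
  also have "\<dots> = ennreal (4 * M0 powr ?q * (norm2 U2 v)\<^sup>2)"
    unfolding v_square by (subst ennreal_mult'[symmetric]) auto
  finally show ?thesis .
qed

end

section \<open>Passage from the torus to Borel representatives\<close>

lemma borel_unit_square [measurable]: "{0..<1} \<times> {0..<1} \<in> sets (borel :: (real \<times> real) measure)"
proof -
  have "{0..<1} \<times> {0..<1} = {x :: real \<times> real. 0 \<le> fst x \<and> fst x < 1 \<and> 0 \<le> snd x \<and> snd x < 1}" by auto
  also have "\<dots> \<in> sets borel" by measurable
  finally show ?thesis .
qed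

lemma AE_lborel2_boundary: "AE x in lborel. fst x \<noteq> (1::real) \<and> snd x \<noteq> (1::real)"
proof -
  have "AE x in lborel \<Otimes>\<^sub>M lborel. fst x \<noteq> (1::real) \<and> snd x \<noteq> (1::real)"
  proof (rule lborel_pair.AE_pair_measure)
    show "{x \<in> space (lborel \<Otimes>\<^sub>M lborel). fst x \<noteq> (1::real) \<and> snd x \<noteq> (1::real)} \<in> sets (lborel \<Otimes>\<^sub>M lborel)"
      by measurable
    show "AE x in lborel. AE y in lborel. fst (x, y) \<noteq> (1::real) \<and> snd (x, y) \<noteq> (1::real)"
      using AE_lborel_singleton[of "1::real"] by (auto elim!: AE_mp)
  qed
  then show ?thesis by (simp only: lborel_prod)
qed

lemma measurable_torus_ident [measurable]: "(\<lambda>x. x) \<in> torus \<rightarrow>\<^sub>M borel"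
  unfolding torus_def by (intro measurable_restrict_space1 measurable_completion) simp

text \<open>\<open>torus\<close> lives on the completed sigma-algebra of a half-open square,
  \<open>U2\<close> on the Borel sets with the closed square. The edges are null, and the identity
  map forgets the completion.\<close>

lemma U2_eq_distr: "U2 = distr torus borel (\<lambda>x. x)"
proof (rule measure_eqI)
  fix A assume AU: "A \<in> sets U2"
  then have A[measurable]: "A \<in> sets borel" by (simp only: sets_segs)
  let ?S = "{0..<1} \<times> {0..<1} :: (real \<times> real) set"
  have "emeasure U2 A = (\<integral>\<^sup>+x. indicator A x \<partial>U2)"
    by (rule nn_integral_indicator[OF AU, symmetric])
  also have "\<dots> = (\<integral>\<^sup>+x. indicator A x * indicator ({0..1} \<times> {0..1}) x \<partial>lborel)"
    by (rule nn_integral_segs) simp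
  also have "\<dots> = (\<integral>\<^sup>+x. indicator (A \<inter> ?S) x \<partial>lborel)"
    using AE_lborel2_boundary by (intro nn_integral_cong_AE) (auto elim!: AE_mp simp: indicator_def)
  also have "\<dots> = emeasure lborel (A \<inter> ?S)" by (rule nn_integral_indicator) simp
  also have "\<dots> = emeasure lebesgue (A \<inter> ?S)" by simp
  also have "\<dots> = emeasure torus (A \<inter> ?S)"
    unfolding torus_def by (subst emeasure_restrict_space) auto
  also have "\<dots> = emeasure (distr torus borel (\<lambda>x. x)) A"
    by (simp only: emeasure_distr[OF measurable_torus_ident A]) (simp add: torus_def)
  finally show "emeasure U2 A = emeasure (distr torus borel (\<lambda>x. x)) A" .
qed (simp only: sets_segs sets_distr)

lemma nn_integral_torus: "f \<in> borel_measurable borel \<Longrightarrow> (\<integral>\<^sup>+x. f x \<partial>torus) = (\<integral>\<^sup>+x. f x \<partial>U2)"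
  unfolding U2_eq_distr by (subst nn_integral_distr) auto

lemma integral_torus:
  fixes f :: "real \<times> real \<Rightarrow> 'a::{banach, second_countable_topology}"
  shows "f \<in> borel_measurable borel \<Longrightarrow> (\<integral>x. f x \<partial>torus) = (\<integral>x. f x \<partial>U2)"
  unfolding U2_eq_distr by (subst integral_distr) auto

lemma AE_torus:
  assumes "N \<in> null_sets lborel" "\<And>x. x \<notin> N \<Longrightarrow> P x"
  shows "AE x in torus. P x"
proof -
  have "AE x in lebesgue. P x"
    using assms by (intro AE_completion AE_I'[of N]) auto
  then show ?thesis
    unfolding torus_def by (subst AE_restrict_space_iff) (auto elim!: AE_mp)
qed

lemma torus_periodic_int:
  assumes "torus_periodic f"
  shows "f (x + (of_int m, of_int n)) = f x"
proof -
  have 1: "f (y + (of_nat k, 0)) = f y" "f (y + (0, of_nat k)) = f y" for k y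
  proof (induction k)
    case (Suc k)
    have "y + (of_nat (Suc k), 0) = (y + (of_nat k, 0)) + (1, 0)" "y + (0, of_nat (Suc k)) = (y + (0, of_nat k)) + (0, 1)"
      by (simp_all add: prod_eq_iff)
    then show "f (y + (of_nat (Suc k), 0)) = f y" "f (y + (0, of_nat (Suc k))) = f y"
      using assms Suc unfolding torus_periodic_def by metis+
  qed (simp_all add: prod_eq_iff zero_prod_def[symmetric])
  have 2: "f (y + (of_int k, 0)) = f y" "f (y + (0, of_int k)) = f y" for k y
  proof -
    have "f (y + (of_int k, 0)) = f y \<and> f (y + (0, of_int k)) = f y"
    proof (cases k rule: int_cases2)
      case (nonneg i) then show ?thesis using 1 by simp
    next
      case (nonpos i)
      then show ?thesis
        using 1(1)[of "y + (of_int k, 0)" i] 1(2)[of "y + (0, of_int k)" i]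
        by (simp add: add.assoc zero_prod_def[symmetric])
    qed
    then show "f (y + (of_int k, 0)) = f y" "f (y + (0, of_int k)) = f y" by auto
  qed
  have "x + (of_int m, of_int n) = (x + (of_int m, 0)) + (0, of_int n)" by (simp add: prod_eq_iff)
  then show ?thesis using 2 by metis
qed

lemma null_translate:
  assumes "N \<in> null_sets lborel"
  shows "(\<lambda>x. x + c) -` N \<in> null_sets (lborel :: 'a::euclidean_space measure)"
proof -
  have "negligible N" using assms by (simp add: negligible_iff_null_sets null_sets_completionI)
  then have "negligible ((+) (- c) ` N)" by (rule negligible_translation)
  moreover have "(+) (- c) ` N = (\<lambda>x. x + c) -` N"
    by (auto simp: image_iff algebra_simps intro!: bexI[of _ "_ + c"])
  moreover have "(\<lambda>x. x + c) -` N \<in> sets borel"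
  proof -
    have "N \<in> sets borel" using assms by auto
    then show ?thesis using measurable_sets[of "\<lambda>x. x + c" "borel :: 'a measure" borel N] by simp
  qed
  ultimately show ?thesis by (simp add: negligible_iff_null_sets null_sets_completion_iff)
qed

text \<open>Equality holds at every point of the plane off \<open>N\<close>, not merely almost
  everywhere in the unit square: shifted arguments leave the square, and slices need the section of
  \<open>N\<close>.\<close>

definition agree :: "(real \<times> real \<Rightarrow> real) \<Rightarrow> (real \<times> real \<Rightarrow> real) \<Rightarrow> (real \<times> real) set \<Rightarrow> bool" where
  "agree f f' N \<longleftrightarrow> f' \<in> borel_measurable borel \<and> torus_periodic f' \<and> N \<in> null_sets lborel \<and> (\<forall>x. x \<notin> N \<longrightarrow> f x = f' x)"

text \<open>Compose a Borel function that agrees almost everywhere on the unit square with the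
  fractional parts \<open>?r\<close>. The preimage of the exceptional set lies in its countably many
  integer translates and is null.\<close>

lemma borel_version:
  assumes per: "torus_periodic f" and meas: "f \<in> borel_measurable torus"
  obtains f' N where "agree f f' N"
proof -
  let ?S = "{0..<1} \<times> {0..<1} :: (real \<times> real) set"
  have "(\<lambda>x. if x \<in> ?S then f x else 0) \<in> borel_measurable lebesgue"
    using meas unfolding torus_def by (intro borel_measurable_if_I) auto
  then obtain g where g[measurable]: "g \<in> borel_measurable lborel" and "AE x in lborel. (if x \<in> ?S then f x else 0) = g x"
    using completion_ex_borel_measurable_real by blast
  then obtain N0 where N0: "N0 \<in> null_sets lborel" "{x. (if x \<in> ?S then f x else 0) \<noteq> g x} \<subseteq> N0"
    by (auto simp: eventually_ae_filter)
  let ?r = "\<lambda>x :: real \<times> real. (fst x - of_int \<lfloor>fst x\<rfloor>, snd x - of_int \<lfloor>snd x\<rfloor>)"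
  have r[measurable]: "?r \<in> borel_measurable borel" by measurable
  have [measurable]: "g \<in> borel_measurable borel" using g by simp
  have rS: "?r x \<in> ?S" for x by (auto simp: floor_less_iff) linarith+
  let ?N = "?r -` N0"
  have "f x = g (?r x)" if "x \<notin> ?N" for x
  proof -
    have "f (?r x) = g (?r x)" 
    proof -
      have "\<not> (if ?r x \<in> ?S then f (?r x) else 0) \<noteq> g (?r x)" using N0(2) that by blast
      then show ?thesis using rS[of x] by (simp only: if_True not_not)
    qed
    moreover have "f (?r x + (of_int \<lfloor>fst x\<rfloor>, of_int \<lfloor>snd x\<rfloor>)) = f (?r x)" by (rule torus_periodic_int[OF per])
    moreover have "?r x + (of_int \<lfloor>fst x\<rfloor>, of_int \<lfloor>snd x\<rfloor>) = x" by (simp add: prod_eq_iff)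
    ultimately show ?thesis by metis
  qed
  moreover have "?N \<in> null_sets lborel"
  proof -
    have "?N \<in> sets borel" using measurable_sets[OF r, of N0] N0(1) by auto
    moreover have "?N \<subseteq> (\<Union>k\<in>(UNIV :: (int \<times> int) set). (\<lambda>x. x + (of_int (fst k), of_int (snd k))) -` N0)"
    proof
      fix x assume "x \<in> ?N"
      then have "x + (of_int (- \<lfloor>fst x\<rfloor>), of_int (- \<lfloor>snd x\<rfloor>)) \<in> N0" by (cases x) simp
      then show "x \<in> (\<Union>k\<in>(UNIV :: (int \<times> int) set). (\<lambda>x. x + (of_int (fst k), of_int (snd k))) -` N0)"
        by (intro UN_I[of "(- \<lfloor>fst x\<rfloor>, - \<lfloor>snd x\<rfloor>)"]) auto
    qed
    moreover have "(\<Union>k\<in>(UNIV :: (int \<times> int) set). (\<lambda>x. x + (of_int (fst k), of_int (snd k))) -` N0) \<in> null_sets lborel"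
      by (intro null_sets_UN' null_translate N0) auto
    ultimately show ?thesis using null_sets_subset[of _ lborel ?N] by auto
  qed
  moreover have "torus_periodic (\<lambda>x. g (?r x))"
    by (simp add: torus_periodic_def)
  moreover have "(\<lambda>x. g (?r x)) \<in> borel_measurable borel" by measurable
  ultimately have "agree f (\<lambda>x. g (?r x)) ?N" by (auto simp: agree_def)
  then show ?thesis by (rule that)
qed

lemma agree_nn_integral:
  assumes "agree f f' N" and F: "F \<in> borel_measurable borel"
  shows "(\<integral>\<^sup>+x. F (f x) \<partial>torus) = (\<integral>\<^sup>+x. F (f' x) \<partial>U2)"
    "(\<integral>\<^sup>+x. F (diff1 h f x) \<partial>torus) = (\<integral>\<^sup>+x. F (diff1 h f' x) \<partial>U2)"
proof -
  note [measurable] = F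
  have a: "f' \<in> borel_measurable borel" "N \<in> null_sets lborel" "\<And>x. x \<notin> N \<Longrightarrow> f x = f' x"
    using assms(1) by (auto simp: agree_def)
  note [measurable] = a(1)
  have "AE x in torus. f x = f' x" by (rule AE_torus[OF a(2)]) (rule a(3))
  then have "(\<integral>\<^sup>+x. F (f x) \<partial>torus) = (\<integral>\<^sup>+x. F (f' x) \<partial>torus)"
    by (intro nn_integral_cong_AE) (auto elim!: AE_mp)
  also have "\<dots> = (\<integral>\<^sup>+x. F (f' x) \<partial>U2)" by (rule nn_integral_torus) simp
  finally show "(\<integral>\<^sup>+x. F (f x) \<partial>torus) = (\<integral>\<^sup>+x. F (f' x) \<partial>U2)" .
  have "AE x in torus. diff1 h f x = diff1 h f' x"
    by (rule AE_torus[OF null_sets.Un[OF a(2) null_translate[OF a(2), of "(h, 0)"]]]) (auto simp: diff1_def a(3))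
  then have "(\<integral>\<^sup>+x. F (diff1 h f x) \<partial>torus) = (\<integral>\<^sup>+x. F (diff1 h f' x) \<partial>torus)"
    by (intro nn_integral_cong_AE) (auto elim!: AE_mp)
  also have "\<dots> = (\<integral>\<^sup>+x. F (diff1 h f' x) \<partial>U2)" by (rule nn_integral_torus) (simp add: diff1_def)
  finally show "(\<integral>\<^sup>+x. F (diff1 h f x) \<partial>torus) = (\<integral>\<^sup>+x. F (diff1 h f' x) \<partial>U2)" .
qed

lemma agree_square_integrable:
  assumes a: "agree f f' N" and f: "L2_torus f"
  shows "square_integrable U2 f'" "(\<integral>\<^sup>+x. ennreal ((f x)\<^sup>2) \<partial>torus) = ennreal ((norm2 U2 f')\<^sup>2)"
proof -
  have b: "f' \<in> borel_measurable borel" using a by (auto simp: agree_def)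
  note [measurable] = b
  have 1: "(\<integral>\<^sup>+x. ennreal ((f x)\<^sup>2) \<partial>torus) = (\<integral>\<^sup>+x. ennreal ((f' x)\<^sup>2) \<partial>U2)"
    by (rule agree_nn_integral(1)[OF a, of "\<lambda>r. ennreal (r\<^sup>2)"]) simp
  moreover have "(\<integral>\<^sup>+x. ennreal ((f x)\<^sup>2) \<partial>torus) < \<infinity>"
    using f by (auto simp: L2_torus_def integrable_iff_bounded)
  ultimately show s: "square_integrable U2 f'"
    by (auto simp: square_integrable_def integrable_iff_bounded)
  then show "(\<integral>\<^sup>+x. ennreal ((f x)\<^sup>2) \<partial>torus) = ennreal ((norm2 U2 f')\<^sup>2)"
    unfolding 1 by (simp add: nn_integral_eq_integral norm2_square square_integrable_def)
qed

section \<open>Fourier coefficients of distributions expressed on the unit square\<close>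

abbreviation freq :: "int \<times> int \<Rightarrow> real \<times> real" where
  "freq k \<equiv> (2 * pi * of_int (fst k), 2 * pi * of_int (snd k))"

lemma freqs_eq: "freqs = range freq"
proof
  show "freqs \<subseteq> range freq"
  proof
    fix x assume "x \<in> freqs"
    then obtain m n :: int where "x = freq (m, n)" by (auto simp: freqs_def)
    then show "x \<in> range freq" by (rule range_eqI)
  qed
qed (auto simp: freqs_def)

lemma freq_in_freqs: "freq k \<in> freqs"
  unfolding freqs_eq by (rule rangeI)

lemma exp_freq: "exp (- \<i> * complex_of_real (freq k \<bullet> x)) = cnj (echar k x)"
proof -
  have "cnj (echar k x) = cis (- (2 * pi * (of_int (fst k) * fst x + of_int (snd k) * snd x)))"
    by (simp add: echar_def cis_cnj)
  also have "- (2 * pi * (of_int (fst k) * fst x + of_int (snd k) * snd x)) = - (freq k \<bullet> x)"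
    by (simp add: inner_prod_def algebra_simps)
  finally show ?thesis by (simp add: cis_conv_exp)
qed

lemma fourier_coeff_dist_of:
  assumes a: "agree f f' N" and f: "f \<in> borel_measurable torus" and F: "F \<in> borel_measurable borel"
  shows "fourier_coeff (dist_of (\<lambda>x. F (f x))) (freq k) = rfcoeff (\<lambda>x. F (f' x)) k"
proof -
  note [measurable] = F f
  have b: "f' \<in> borel_measurable borel" "N \<in> null_sets lborel" "\<And>x. x \<notin> N \<Longrightarrow> f x = f' x"
    using a by (auto simp: agree_def)
  note [measurable] = b(1)
  have echar[measurable]: "(\<lambda>x. cnj (echar k x)) \<in> borel_measurable torus" "f' \<in> borel_measurable torus"
    by (intro measurable_compose[OF measurable_torus_ident]; simp)+
  have "AE x in torus. f x = f' x" by (rule AE_torus[OF b(2)]) (rule b(3))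
  then have "(\<integral>x. complex_of_real (F (f x)) * cnj (echar k x) \<partial>torus) = (\<integral>x. complex_of_real (F (f' x)) * cnj (echar k x) \<partial>torus)"
    by (intro integral_cong_AE) (auto elim!: AE_mp)
  also have "\<dots> = (\<integral>x. complex_of_real (F (f' x)) * cnj (echar k x) \<partial>U2)" by (rule integral_torus) simp
  finally show ?thesis
    unfolding fourier_coeff_def dist_of_def fcoeff_def exp_freq .
qed

lemma fourier_coeff_D:
  "fourier_coeff (dist_D1 (dist_of f)) k = \<i> * of_real (fst k) * fourier_coeff (dist_of f) k"
  "fourier_coeff (dist_D2 (dist_of f)) k = \<i> * of_real (snd k) * fourier_coeff (dist_of f) k"
proof -
  have 1: "vector_derivative (\<lambda>t. exp (- \<i> * complex_of_real (k \<bullet> (t, snd x)))) (at (fst x)) = - \<i> * fst k * exp (- \<i> * complex_of_real (k \<bullet> x))" for x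
  proof (rule vector_derivative_at)
    have "((\<lambda>z. exp (- \<i> * (of_real (fst k) * z + of_real (snd k * snd x)))) has_field_derivative
       - \<i> * fst k * exp (- \<i> * (of_real (fst k) * of_real (fst x) + of_real (snd k * snd x)))) (at (of_real (fst x)))"
      by (auto intro!: derivative_eq_intros)
    from has_vector_derivative_real_field[OF this]
    show "((\<lambda>t. exp (- \<i> * complex_of_real (k \<bullet> (t, snd x)))) has_vector_derivative - \<i> * fst k * exp (- \<i> * complex_of_real (k \<bullet> x))) (at (fst x))"
      by (simp add: inner_prod_def)
  qed
  have 2: "vector_derivative (\<lambda>t. exp (- \<i> * complex_of_real (k \<bullet> (fst x, t)))) (at (snd x)) = - \<i> * snd k * exp (- \<i> * complex_of_real (k \<bullet> x))" for x
  proof (rule vector_derivative_at)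
    have "((\<lambda>z. exp (- \<i> * (of_real (fst k * fst x) + of_real (snd k) * z))) has_field_derivative
       - \<i> * snd k * exp (- \<i> * (of_real (fst k * fst x) + of_real (snd k) * of_real (snd x)))) (at (of_real (snd x)))"
      by (auto intro!: derivative_eq_intros)
    from has_vector_derivative_real_field[OF this]
    show "((\<lambda>t. exp (- \<i> * complex_of_real (k \<bullet> (fst x, t)))) has_vector_derivative - \<i> * snd k * exp (- \<i> * complex_of_real (k \<bullet> x))) (at (snd x))"
      by (simp add: inner_prod_def)
  qed
  have 3: "(\<integral>x. of_real (f x) * (- \<i> * of_real c * F x) \<partial>torus) = - (\<i> * of_real c * (\<integral>x. of_real (f x) * F x \<partial>torus))" for c F
  proof -
    have "(\<integral>x. of_real (f x) * (- \<i> * of_real c * F x) \<partial>torus) = (\<integral>x. (- \<i> * of_real c) * (of_real (f x) * F x) \<partial>torus)"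
      by (simp add: mult_ac)
    then show ?thesis by (simp only: integral_mult_right_zero) simp
  qed
  show "fourier_coeff (dist_D1 (dist_of f)) k = \<i> * of_real (fst k) * fourier_coeff (dist_of f) k"
    unfolding fourier_coeff_def dist_D1_def dist_of_def 1 3 by simp
  show "fourier_coeff (dist_D2 (dist_of f)) k = \<i> * of_real (snd k) * fourier_coeff (dist_of f) k"
    unfolding fourier_coeff_def dist_D2_def dist_of_def 2 3 by simp
qed

text \<open>Fejer means depend on the coefficients alone and converge in \<open>L2\<close> to both
  functions.\<close>

lemma norm2_eq_of_rfcoeff_eq:
  assumes f: "square_integrable U2 f" and k: "square_integrable U2 k" and eq: "\<And>n. rfcoeff f n = rfcoeff k n"
  shows "norm2 U2 f = norm2 U2 k"
proof -
  have F: "Fejr N f x = Fejr N k x" for N x by (simp add: Fej_def eq)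
  have "(\<lambda>N. norm2 U2 (\<lambda>x. Fejr N f x - f x) + norm2 U2 (\<lambda>x. Fejr N k x - k x)) \<longlonglongrightarrow> 0"
    by (intro tendsto_add_zero Fejr_tendsto f k)
  moreover have "norm2 U2 (\<lambda>x. f x - k x) \<le> 0 + (norm2 U2 (\<lambda>x. Fejr N f x - f x) + norm2 U2 (\<lambda>x. Fejr N k x - k x))" for N
    using norm2_diff_triangle[OF f square_integrable_Fejr[of N f] k] norm2_minus[of U2 f "Fejr N f"] unfolding F by simp
  ultimately have "norm2 U2 (\<lambda>x. f x - k x) \<le> 0" by (rule tendsto_zero_le[rotated])
  then show ?thesis
    using norm2_triangle_le[OF f k] norm2_triangle_le[OF k f] norm2_minus[of U2 k f] by simp
qed

lemma square_integral_eq: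
  assumes g: "L2_torus g" "\<And>k. k \<in> freqs \<Longrightarrow> fourier_coeff (dist_of g) k = c k" and a: "agree g g' N"
  shows "square_integral c = ennreal ((norm2 U2 g')\<^sup>2)"
proof -
  have "(\<integral>\<^sup>+x. ennreal ((f x)\<^sup>2) \<partial>torus) = ennreal ((norm2 U2 g')\<^sup>2)"
    if f: "L2_torus f" "\<forall>k\<in>freqs. fourier_coeff (dist_of f) k = c k" for f
  proof -
    obtain f' M where b: "agree f f' M" using borel_version f(1) by (auto simp: L2_torus_def)
    have "rfcoeff f' k = rfcoeff g' k" for k
    proof -
      have "fourier_coeff (dist_of f) (freq k) = rfcoeff f' k"
        by (rule fourier_coeff_dist_of[OF b, of "\<lambda>x. x"]) (use f in \<open>simp_all add: L2_torus_def\<close>)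
      moreover have "fourier_coeff (dist_of g) (freq k) = rfcoeff g' k"
        by (rule fourier_coeff_dist_of[OF a, of "\<lambda>x. x"]) (use g(1) in \<open>simp_all add: L2_torus_def\<close>)
      ultimately show ?thesis using f(2) g(2) freq_in_freqs[of k] by metis
    qed
    then have "norm2 U2 f' = norm2 U2 g'" by (rule norm2_eq_of_rfcoeff_eq[OF agree_square_integrable(1)[OF b f(1)] agree_square_integrable(1)[OF a g(1)]])
    then show ?thesis using agree_square_integrable(2)[OF b f(1)] by simp
  qed
  then show ?thesis
    unfolding square_integral_def using g by (intro antisym INF_lower2[of g] INF_greatest) auto
qed

lemma square_integral_finite:
  assumes "square_integral c \<noteq> \<infinity>"
  obtains g where "L2_torus g" "\<And>k. k \<in> freqs \<Longrightarrow> fourier_coeff (dist_of g) k = c k"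
proof -
  have "{g. L2_torus g \<and> (\<forall>k\<in>freqs. fourier_coeff (dist_of g) k = c k)} \<noteq> {}"
  proof
    assume e: "{g. L2_torus g \<and> (\<forall>k\<in>freqs. fourier_coeff (dist_of g) k = c k)} = {}"
    have "square_integral c = \<infinity>" unfolding square_integral_def e by simp
    with assms show False by contradiction
  qed
  then show ?thesis using that by auto
qed

text \<open>Finite integrals provide \<open>L2\<close> functions with the prescribed coefficients.
  Dividing \<open>eta\<close> by \<open>|k1|\<close> is undone mode by mode, which turns the
  definition of \<open>eta\<close> into the equation of the locale.\<close>

lemma burgers_version:
  assumes w: "L2_torus w" "vanishing_mean1 (dist_of w)" and fin: "eta_integral w \<noteq> \<infinity>" "D1_integral w \<noteq> \<infinity>"
  obtains w' v' g' N where "agree w w' N" "burgers w' v' g'"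
    "eta_integral w = ennreal ((norm2 U2 g')\<^sup>2)" "D1_integral w = ennreal ((norm2 U2 v')\<^sup>2)"
proof -
  obtain g where g: "L2_torus g" "\<And>k. k \<in> freqs \<Longrightarrow> fourier_coeff (dist_of g) k = inv_abs_D1_coeff (eta w) k"
    using square_integral_finite fin(1) unfolding eta_integral_def by blast
  obtain v where v: "L2_torus v" "\<And>k. k \<in> freqs \<Longrightarrow> fourier_coeff (dist_of v) k = fourier_coeff (dist_D1 (dist_of w)) k"
    using square_integral_finite fin(2) unfolding D1_integral_def by blast
  obtain w' N where w': "agree w w' N" using borel_version w(1) by (auto simp: L2_torus_def)
  obtain g' N1 where g': "agree g g' N1" using borel_version g(1) by (auto simp: L2_torus_def)
  obtain v' N2 where v': "agree v v' N2" using borel_version v(1) by (auto simp: L2_torus_def)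
  have m: "w \<in> borel_measurable torus" "g \<in> borel_measurable torus" "v \<in> borel_measurable torus"
    using w g v by (auto simp: L2_torus_def)
  have fw: "fourier_coeff (dist_of w) (freq k) = rfcoeff w' k"
    and fw2: "fourier_coeff (dist_of (\<lambda>x. 1/2 * (w x)\<^sup>2)) (freq k) = rfcoeff (\<lambda>x. 1/2 * (w' x)\<^sup>2) k"
    and fg: "fourier_coeff (dist_of g) (freq k) = rfcoeff g' k" and fv: "fourier_coeff (dist_of v) (freq k) = rfcoeff v' k" for k
    by (rule fourier_coeff_dist_of[OF w' m(1), of "\<lambda>x. x"], simp)
       (rule fourier_coeff_dist_of[OF w' m(1), of "\<lambda>x. 1/2 * x\<^sup>2"], simp,
        rule fourier_coeff_dist_of[OF g' m(2), of "\<lambda>x. x"], simp,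
        rule fourier_coeff_dist_of[OF v' m(3), of "\<lambda>x. x"], simp)
  have eta: "fourier_coeff (eta w) (freq k) = 2 * pi * \<i> * of_int (snd k) * rfcoeff w' k - 2 * pi * \<i> * of_int (fst k) * rfcoeff (\<lambda>x. 1/2 * (w' x)\<^sup>2) k" for k
  proof -
    have "fourier_coeff (eta w) (freq k) = fourier_coeff (dist_D2 (dist_of w)) (freq k) - fourier_coeff (dist_D1 (dist_of (\<lambda>x. 1/2 * (w x)\<^sup>2))) (freq k)"
      by (simp add: eta_def dist_diff_def fourier_coeff_def)
    also have "\<dots> = 2 * pi * \<i> * of_int (snd k) * rfcoeff w' k - 2 * pi * \<i> * of_int (fst k) * rfcoeff (\<lambda>x. 1/2 * (w' x)\<^sup>2) k"
      unfolding fourier_coeff_D fw fw2 fst_conv snd_conv of_real_mult of_real_of_int_eq of_real_numeral by (simp only: mult_ac)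
    finally show ?thesis .
  qed
  have z: "rfcoeff w' k = 0" if "fst k = 0" for k
    using w(2) freq_in_freqs[of k] that unfolding vanishing_mean1_def fw[symmetric] by simp
  have "burgers w' v' g'"
  proof
    show "square_integrable U2 w'" "square_integrable U2 v'" "square_integrable U2 g'" using agree_square_integrable w' v' g' w v g by blast+
    show "rfcoeff v' k = 2 * pi * \<i> * of_int (fst k) * rfcoeff w' k" for k
      using v(2)[OF freq_in_freqs[of k]] unfolding fv fourier_coeff_D fw fst_conv of_real_mult of_real_of_int_eq of_real_numeral by (simp only: mult_ac)
    show "fst k = 0 \<Longrightarrow> rfcoeff w' k = 0" for k by (rule z)
    show "w' (x + (1, 0)) = w' x" for x using w' unfolding agree_def torus_periodic_def by blast
    show "2 * pi * \<i> * of_int (snd k) * rfcoeff w' k = 2 * pi * \<i> * of_int (fst k) * rfcoeff (\<lambda>x. 1/2 * (w' x)\<^sup>2) k + 2 * pi * of_int \<bar>fst k\<bar> * rfcoeff g' k" for k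
    proof (cases "fst k = 0")
      \<comment> \<open>At \<open>k1 = 0\<close> the coefficient of \<open>g'\<close> carries no
        information about \<open>eta\<close>; the equation holds because the mean of
        \<open>w\<close> in \<open>x1\<close> vanishes.\<close>
      case True
      then show ?thesis by (simp add: z)
    next
      case False
      have "rfcoeff g' k = fourier_coeff (eta w) (freq k) / complex_of_real \<bar>fst (freq k)\<bar>"
        using g(2)[OF freq_in_freqs[of k]] False unfolding fg inv_abs_D1_coeff_def by simp
      then have "fourier_coeff (eta w) (freq k) = 2 * pi * of_int \<bar>fst k\<bar> * rfcoeff g' k"
        using False by (simp add: abs_mult)
      then show ?thesis unfolding eta by (simp add: algebra_simps)
    qed
  qed
  moreover have "eta_integral w = ennreal ((norm2 U2 g')\<^sup>2)"
    unfolding eta_integral_def by (rule square_integral_eq[OF g g'])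
  moreover have "D1_integral w = ennreal ((norm2 U2 v')\<^sup>2)"
    unfolding D1_integral_def by (rule square_integral_eq[OF v v'])
  ultimately show ?thesis using that w' by blast
qed

text \<open>Subsets of null sets are measurable in the completion. This is required because
  \<open>esssup\<close> of a non-measurable function is \<open>top\<close> by definition, and the
  slice integrals of the original \<open>w\<close> are known only off a null set.\<close>

lemma measurable_lebesgue_on_off_null:
  fixes f g :: "real \<Rightarrow> ennreal"
  assumes g: "g \<in> borel_measurable borel" and N: "N \<in> null_sets lborel" and eq: "\<And>x. x \<notin> N \<Longrightarrow> f x = g x"
  shows "f \<in> borel_measurable (lebesgue_on S)"
proof (rule measurable_restrict_space1, rule measurableI)
  fix A :: "ennreal set" assume A: "A \<in> sets borel"
  have "f -` A = (g -` A - N) \<union> (f -` A \<inter> N)" using eq by auto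
  moreover have "g -` A - N \<in> sets lebesgue"
    using measurable_sets[OF g A] N by (auto intro!: sets.Diff)
  moreover have "f -` A \<inter> N \<in> sets lebesgue"
    by (rule null_sets_completion[OF N]) auto
  ultimately have "f -` A \<in> sets lebesgue" by (metis sets.Un)
  then show "f -` A \<inter> space lebesgue \<in> sets lebesgue" by simp
qed simp

lemma null_sections:
  assumes N: "N \<in> null_sets (lborel :: (real \<times> real) measure)"
  obtains N2 where "N2 \<in> null_sets lborel" "\<And>y. y \<notin> N2 \<Longrightarrow> (\<lambda>x. (x, y)) -` N \<in> null_sets lborel"
proof -
  have [measurable]: "N \<in> sets borel" using N by auto
  have "N \<in> sets (lborel \<Otimes>\<^sub>M lborel)" unfolding lborel_prod using N by auto
  note [measurable] = this
  have s: "(\<lambda>x. (x, y)) -` N \<in> sets borel" for y :: real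
  proof -
    have "(\<lambda>x. (x, y)) \<in> (borel :: real measure) \<rightarrow>\<^sub>M (borel :: (real \<times> real) measure)" by measurable
    from measurable_sets[OF this, of N] show ?thesis by simp
  qed
  have "(\<integral>\<^sup>+y. \<integral>\<^sup>+x. indicator N (x, y) \<partial>lborel \<partial>lborel) = (\<integral>\<^sup>+z. indicator N z \<partial>(lborel \<Otimes>\<^sub>M lborel))"
    by (rule lborel_pair.nn_integral_snd) measurable
  also have "\<dots> = emeasure lborel N" unfolding lborel_prod by (rule nn_integral_indicator) simp
  also have "\<dots> = 0" using N by auto
  finally have "(\<integral>\<^sup>+y. \<integral>\<^sup>+x. indicator N (x, y) \<partial>lborel \<partial>lborel) = (0 :: ennreal)" .
  then have "AE y in lborel. (\<integral>\<^sup>+x. indicator N (x, y) \<partial>lborel) = (0 :: ennreal)"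
    by (subst nn_integral_0_iff_AE[symmetric]) measurable
  then obtain N2 where N2: "N2 \<in> null_sets lborel" "{y. (\<integral>\<^sup>+x. indicator N (x, y) \<partial>lborel) \<noteq> (0 :: ennreal)} \<subseteq> N2"
    by (auto simp: eventually_ae_filter)
  have "(\<lambda>x. (x, y)) -` N \<in> null_sets lborel" if y: "y \<notin> N2" for y
  proof -
    have "emeasure lborel ((\<lambda>x. (x, y)) -` N) = (\<integral>\<^sup>+x. indicator ((\<lambda>x. (x, y)) -` N) x \<partial>lborel)"
      using s by (intro nn_integral_indicator[symmetric]) simp
    also have "\<dots> = (\<integral>\<^sup>+x. indicator N (x, y) \<partial>lborel)" by (intro nn_integral_cong) (simp add: indicator_def)
    also have "\<dots> = 0" using N2(2) y by blast
    finally show ?thesis using s by auto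
  qed
  with N2(1) show ?thesis by (rule that)
qed

text \<open>For \<open>y\<close> outside one null set \<open>N2\<close> the section of
  \<open>N\<close> is null, and so are its translates. The inner integrals of \<open>w\<close> and
  \<open>w'\<close> then agree for every shift at once, so the bound of \<open>sup_bound\<close>
  transfers.\<close>

lemma esssup_increments:
  assumes a: "agree w w' N" and B: "burgers w' v' g'" and h: "0 < h" "h \<le> 1"
  shows "esssup (lebesgue_on {0..<1})
      (\<lambda>x2. \<integral>\<^sup>+h'\<in>{0..h}. (\<integral>\<^sup>+x1\<in>{0..<1}. ennreal (\<bar>diff1 h' w (x1, x2)\<bar>\<^sup>2) \<partial>lebesgue) \<partial>lebesgue)
    \<le> ennreal (16 * h * (norm2 U2 v' * norm2 U2 g') + 18 * (h * (h * (norm2 U2 v' * norm2 U2 g')) powr (2/3)))"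
proof -
  interpret burgers w' v' g' by (rule B)
  have ag: "N \<in> null_sets lborel" "\<And>x. x \<notin> N \<Longrightarrow> w x = w' x" using a by (auto simp: agree_def)
  let ?\<phi> = "\<lambda>x2. \<integral>\<^sup>+h'\<in>{0..h}. (\<integral>\<^sup>+x1\<in>{0..<1}. ennreal (\<bar>diff1 h' w (x1, x2)\<bar>\<^sup>2) \<partial>lebesgue) \<partial>lebesgue"
  let ?\<phi>' = "\<lambda>y. \<integral>\<^sup>+z. ennreal ((diff1 (fst z) w' (snd z, y))\<^sup>2) \<partial>(seg 0 h \<Otimes>\<^sub>M U)"
  obtain N2 where N2: "N2 \<in> null_sets lborel" "\<And>y. y \<notin> N2 \<Longrightarrow> (\<lambda>x. (x, y)) -` N \<in> null_sets lborel"
    using null_sections[OF ag(1)] by blast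
  have eq: "?\<phi> y = ?\<phi>' y" if y: "y \<notin> N2" for y
  proof -
    have inner: "(\<integral>\<^sup>+x1\<in>{0..<1}. ennreal (\<bar>diff1 t w (x1, y)\<bar>\<^sup>2) \<partial>lebesgue) = (\<integral>\<^sup>+x. ennreal ((diff1 t w' (x, y))\<^sup>2) \<partial>U)" for t
    proof -
      let ?M = "(\<lambda>x. (x, y)) -` N"
      have "?M \<union> (\<lambda>x. x + t) -` ?M \<in> null_sets lborel"
        by (intro null_sets.Un null_translate N2(2)[OF y])
      then have "AE x in lborel. diff1 t w (x, y) = diff1 t w' (x, y)"
      proof (rule AE_I', intro subsetI)
        fix x assume x: "x \<in> {x \<in> space lborel. diff1 t w (x, y) \<noteq> diff1 t w' (x, y)}"
        show "x \<in> ?M \<union> (\<lambda>x. x + t) -` ?M"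
        proof (rule ccontr)
          assume "x \<notin> ?M \<union> (\<lambda>x. x + t) -` ?M"
          then have "w (x, y) = w' (x, y)" "w (x + t, y) = w' (x + t, y)" by (auto intro: ag(2))
          with x show False by (simp add: diff1_def)
        qed
      qed
      then have "(\<integral>\<^sup>+x1\<in>{0..<1}. ennreal (\<bar>diff1 t w (x1, y)\<bar>\<^sup>2) \<partial>lebesgue) = (\<integral>\<^sup>+x. ennreal ((diff1 t w' (x, y))\<^sup>2) * indicator {0..1} x \<partial>lborel)"
        unfolding nn_integral_completion
        using AE_lborel_singleton[of "1::real"] by (intro nn_integral_cong_AE) (auto elim!: AE_mp simp: indicator_def)
      then show ?thesis by (simp add: nn_integral_seg diff1_def)
    qed
    have m: "(\<lambda>t. \<integral>\<^sup>+x. ennreal ((diff1 t w' (x, y))\<^sup>2) \<partial>U) \<in> borel_measurable borel"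
      by (rule U.borel_measurable_nn_integral) (simp add: split_beta diff1_def)
    have "?\<phi> y = (\<integral>\<^sup>+t. \<integral>\<^sup>+x. ennreal ((diff1 t w' (x, y))\<^sup>2) \<partial>U \<partial>seg 0 h)"
      unfolding inner unfolding nn_integral_completion using m by (simp add: nn_integral_seg)
    also have "\<dots> = ?\<phi>' y"
      by (subst U.nn_integral_fst[symmetric]) (simp_all add: diff1_def)
    finally show ?thesis .
  qed
  have m': "?\<phi>' \<in> borel_measurable borel"
  proof -
    have sf: "sigma_finite_measure (seg 0 h \<Otimes>\<^sub>M U)"
      by (intro finite_measure.axioms(1) finite_measure_pair_measure finite_measure_seg)
    show ?thesis
      by (rule sigma_finite_measure.borel_measurable_nn_integral[OF sf], unfold split_beta diff1_def) measurable
  qed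
  have "AE y in lborel. 0 \<le> y \<and> y \<le> 1 \<longrightarrow> ?\<phi>' y \<le> ennreal (16 * h * E0 + 18 * (h * (h * E0) powr (2/3)))"
    using sup_bound[of h] h unfolding AE_seg by simp
  moreover have "AE y in lborel. y \<notin> N2" using N2(1) by (rule AE_not_in)
  ultimately have "AE y in lborel. 0 \<le> y \<and> y \<le> 1 \<longrightarrow> ?\<phi> y \<le> ennreal (16 * h * E0 + 18 * (h * (h * E0) powr (2/3)))"
  proof eventually_elim
    case (elim y)
    then show ?case unfolding eq[OF elim(2)] by blast
  qed
  then have "AE y in lebesgue_on {0..<1}. ?\<phi> y \<le> ennreal (16 * h * E0 + 18 * (h * (h * E0) powr (2/3)))"
  proof (subst AE_restrict_space_iff, simp, intro AE_completion, eventually_elim, intro impI)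
    fix y :: real
    assume le: "0 \<le> y \<and> y \<le> 1 \<longrightarrow> ?\<phi> y \<le> ennreal (16 * h * E0 + 18 * (h * (h * E0) powr (2/3)))" and "y \<in> {0..<1}"
    then have "0 \<le> y \<and> y \<le> 1" by simp
    with le show "?\<phi> y \<le> ennreal (16 * h * E0 + 18 * (h * (h * E0) powr (2/3)))" by (rule mp)
  qed
  then show ?thesis
    unfolding E0_def by (intro esssup_I measurable_lebesgue_on_off_null[OF m' N2(1) eq])
qed

section \<open>Rules for the power function \<open>epow\<close>\<close>

lemma epow_ennreal: "0 \<le> x \<Longrightarrow> epow (ennreal x) a = (if a = 0 then 1 else ennreal (x powr a))"
  by (simp add: epow_def)

lemma epow_mono: "t \<le> s \<Longrightarrow> 0 \<le> a \<Longrightarrow> epow t a \<le> epow s a"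
  by (cases t rule: ennreal_cases; cases s rule: ennreal_cases)
     (auto simp: epow_def top_unique intro!: ennreal_leI powr_mono2)

text \<open>For \<open>c \<ge> 1\<close> and \<open>p \<ge> 1\<close> the root of \<open>c\<close>
  is at most \<open>c\<close>, so one constant serves all exponents.\<close>

lemma epow_le:
  assumes "t \<le> ennreal (c * T)" "1 \<le> c" "0 \<le> T" "1 \<le> p"
  shows "epow t (1 / p) \<le> ennreal (c * T powr (1 / p))"
proof -
  have "epow t (1 / p) \<le> epow (ennreal (c * T)) (1 / p)" using assms by (intro epow_mono) auto
  also have "\<dots> = ennreal (c powr (1 / p) * T powr (1 / p))" using assms by (simp add: epow_ennreal powr_mult)
  also have "\<dots> \<le> ennreal (c * T powr (1 / p))"
  proof (intro ennreal_leI mult_right_mono)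
    have "c powr (1 / p) \<le> c powr 1" using assms by (intro powr_mono) auto
    then show "c powr (1 / p) \<le> c" using assms by simp
  qed simp
  finally show ?thesis .
qed

lemma epow_square_half: "0 \<le> x \<Longrightarrow> epow (ennreal (x\<^sup>2)) (1/2) = ennreal x"
  by (cases "x = 0") (simp_all add: epow_ennreal powr_half_sqrt, simp add: epow_def)

section \<open>The \<open>L^p\<close> bounds in the form required by (ii) and (iii)\<close>

context burgers
begin

definition B0 where "B0 = E0 + E0 powr (2/3)"

lemma B0: "0 \<le> B0" "M0 = 18 * B0" "E0 powr (2/3) \<le> B0"
  using E0_nonneg by (auto simp: B0_def M0_def)

lemma w_measurable: "w \<in> borel_measurable U2" by simp

lemma Lp_below_3:
  assumes p: "1 \<le> p" "p \<le> 3"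
  shows "(\<integral>\<^sup>+z. ennreal (\<bar>w z\<bar> powr p) \<partial>U2) \<le> ennreal (48 * E0 powr (p/3))"
proof -
  have "(\<integral>\<^sup>+z. ennreal (\<bar>w z\<bar> powr 3) \<partial>U2) \<le> ennreal (24 * E0)"
    using w_cube by (simp add: powr_numeral)
  then have "(\<integral>\<^sup>+z. ennreal (\<bar>w z\<bar> powr p) \<partial>U2) \<le> ennreal (2 * (24 * E0) powr (p/3))"
    using p E0_nonneg by (intro nn_integral_lower_power[OF U2.prob_space_axioms w_measurable]) auto
  also have "\<dots> \<le> ennreal (48 * E0 powr (p/3))"
  proof (rule ennreal_leI)
    have "(24::real) powr (p/3) \<le> 24 powr 1" using p by (intro powr_mono) auto
    then have "24 powr (p/3) * E0 powr (p/3) \<le> 24 * E0 powr (p/3)" by (intro mult_right_mono) auto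
    then show "2 * (24 * E0) powr (p/3) \<le> 48 * E0 powr (p/3)"
      using E0_nonneg by (simp add: powr_mult mult.commute)
  qed
  finally show ?thesis .
qed

text \<open>Up to 3, \<open>E0 powr (p/3)\<close> splits into \<open>E0 powr (2/3)\<close> and its
  power \<open>(p-2)/2\<close>. Above 3, \<open>M0\<close> contributes the power
  \<open>(p-3)/2\<close> of \<open>B0\<close>, and a factor \<open>E0 powr (1/3)\<close> contributes
  1/2, together again \<open>(p-2)/2\<close>. The constant is \<open>408 * 9 = 3672\<close>, rounded
  up.\<close>

lemma Lp_ii:
  assumes p: "2 < p" "p < 10/3"
  shows "(\<integral>\<^sup>+z. ennreal (\<bar>w z\<bar> powr p) \<partial>U2) \<le> ennreal (4000 * (E0 powr (2/3) * B0 powr ((p-2)/2)))"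
proof (cases "p \<le> 3")
  case True
  have "(\<integral>\<^sup>+z. ennreal (\<bar>w z\<bar> powr p) \<partial>U2) \<le> ennreal (48 * E0 powr (p/3))"
    using p True by (intro Lp_below_3) auto
  also have "\<dots> \<le> ennreal (4000 * (E0 powr (2/3) * B0 powr ((p-2)/2)))"
  proof (intro ennreal_leI mult_mono)
    have "2/3 + 2/3 * ((p-2)/2) = p/3" by (simp add: field_simps)
    then have "E0 powr (p/3) = E0 powr (2/3) * (E0 powr (2/3)) powr ((p-2)/2)"
      unfolding powr_powr by (simp only: powr_add[symmetric])
    also have "\<dots> \<le> E0 powr (2/3) * B0 powr ((p-2)/2)"
      using p B0 by (intro mult_left_mono powr_mono2) auto
    finally show "E0 powr (p/3) \<le> E0 powr (2/3) * B0 powr ((p-2)/2)" .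
  qed auto
  finally show ?thesis .
next
  case False
  then have p3: "3 \<le> p" "p \<le> 4" using p by auto
  have "(\<integral>\<^sup>+z. ennreal (\<bar>w z\<bar> powr p) \<partial>U2) \<le> ennreal (408 * ((2 * sqrt M0) powr (p - 3) * E0))"
    by (rule Lp_mid[OF p3])
  also have "\<dots> \<le> ennreal (4000 * (E0 powr (2/3) * B0 powr ((p-2)/2)))"
  proof (rule ennreal_leI)
    have e1: "1/2 * (p-3) + 1/3 * (3/2) = (p-2)/2" by (simp add: field_simps)
    have "2 * sqrt M0 = 2 * sqrt 18 * B0 powr (1/2)"
      using B0 by (simp add: real_sqrt_mult powr_half_sqrt)
    then have "(2 * sqrt M0) powr (p-3) = (2 * sqrt 18) powr (p-3) * B0 powr (1/2 * (p-3))"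
      using B0 by (simp add: powr_mult powr_powr)
    also have "\<dots> \<le> 9 * B0 powr (1/2 * (p-3))"
    proof (rule mult_right_mono)
      have s: "2 * sqrt 18 \<le> (9::real)" "1 \<le> 2 * sqrt (18::real)"
      proof -
        have "sqrt 18 \<le> (9/2 :: real)" by (rule real_le_lsqrt) (auto simp: power2_eq_square)
        then show "2 * sqrt 18 \<le> (9::real)" by simp
        have "1/2 \<le> sqrt (18::real)" by (rule real_le_rsqrt) (simp add: power2_eq_square)
        then show "1 \<le> 2 * sqrt (18::real)" by simp
      qed
      have "(2 * sqrt 18) powr (p-3) \<le> (2 * sqrt (18::real)) powr 1" using s p3 p by (intro powr_mono) auto
      then show "(2 * sqrt 18) powr (p-3) \<le> 9" using s by simp
    qed simp
    finally have 1: "(2 * sqrt M0) powr (p-3) \<le> 9 * B0 powr (1/2 * (p-3))" .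
    have "E0 = E0 powr (2/3 + 1/3)" using E0_nonneg by simp
    also have "\<dots> = E0 powr (2/3) * (E0 powr (2/3)) powr (1/2)" by (simp only: powr_add powr_powr) simp
    also have "\<dots> \<le> E0 powr (2/3) * B0 powr (1/2)"
      using B0 by (intro mult_left_mono powr_mono2) auto
    finally have 2: "E0 \<le> E0 powr (2/3) * B0 powr (1/2)" .
    have "(2 * sqrt M0) powr (p-3) * E0 \<le> (9 * B0 powr (1/2 * (p-3))) * (E0 powr (2/3) * B0 powr (1/2))"
      using E0_nonneg by (intro mult_mono 1 2) auto
    also have "\<dots> = 9 * (E0 powr (2/3) * (B0 powr (1/2 * (p-3)) * B0 powr (1/2)))" by (simp only: mult_ac)
    also have "B0 powr (1/2 * (p-3)) * B0 powr (1/2) = B0 powr ((p-2)/2)"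
      by (subst powr_add[symmetric]) (simp add: field_simps)
    finally show "408 * ((2 * sqrt M0) powr (p - 3) * E0) \<le> 4000 * (E0 powr (2/3) * B0 powr ((p-2)/2))"
      using mult_nonneg_nonneg[OF powr_ge_zero[of E0 "2/3"] powr_ge_zero[of B0 "(p-2)/2"]] by linarith
  qed
  finally show ?thesis .
qed

text \<open>\<open>L2_le\<close> is the Poincare inequality in \<open>x1\<close> with constant 1;
  lower exponents follow on a probability space.\<close>

lemma Lp_iii_low:
  assumes p: "1 \<le> p" "p \<le> 2" and X: "(norm2 U2 v)\<^sup>2 \<le> 2 * Y" and Y: "0 \<le> Y"
  shows "(\<integral>\<^sup>+z. ennreal (\<bar>w z\<bar> powr p) \<partial>U2) \<le> ennreal (4000 * Y powr (p/2))"
proof -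
  have "(\<integral>\<^sup>+z. ennreal (\<bar>w z\<bar> powr 2) \<partial>U2) \<le> ennreal (2 * Y)"
    using order_trans[OF L2_le ennreal_leI[OF X]] by simp
  then have "(\<integral>\<^sup>+z. ennreal (\<bar>w z\<bar> powr p) \<partial>U2) \<le> ennreal (2 * (2 * Y) powr (p/2))"
    using p Y by (intro nn_integral_lower_power[OF U2.prob_space_axioms w_measurable]) auto
  also have "\<dots> \<le> ennreal (4000 * Y powr (p/2))"
  proof (rule ennreal_leI)
    have "(2::real) powr (p/2) \<le> 2 powr 1" using p by (intro powr_mono) auto
    then have "2 powr (p/2) * Y powr (p/2) \<le> 2000 * Y powr (p/2)" by (intro mult_right_mono) auto
    then show "2 * (2 * Y) powr (p/2) \<le> 4000 * Y powr (p/2)"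
      using Y by (simp add: powr_mult mult.commute)
  qed
  finally show ?thesis .
qed

text \<open>As \<open>?q < 2\<close>, \<open>18 powr ?q \<le> 324\<close>; with the 4 of
  \<open>Lp_high\<close> and the 2 in the hypothesis on \<open>v\<close> the constant is 2592, below
  4000.\<close>

lemma Lp_iii_high:
  assumes p: "2 < p" "p < 6" and X: "(norm2 U2 v)\<^sup>2 \<le> 2 * Y" and Y: "0 \<le> Y" and Z: "B0 \<le> Z"
  shows "(\<integral>\<^sup>+z. ennreal (\<bar>w z\<bar> powr p) \<partial>U2) \<le> ennreal (4000 * (Y * Z powr ((p-2)/2)))"
proof -
  let ?q = "(p-2)/2"
  have "(\<integral>\<^sup>+z. ennreal (\<bar>w z\<bar> powr p) \<partial>U2) \<le> ennreal (4 * M0 powr ?q * (norm2 U2 v)\<^sup>2)"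
    using p by (intro Lp_high) auto
  also have "\<dots> \<le> ennreal (4000 * (Y * Z powr ?q))"
  proof (rule ennreal_leI)
    have "(18::real) powr ?q \<le> 18 powr 2" using p by (intro powr_mono) auto
    then have "M0 powr ?q \<le> 324 * Z powr ?q"
      unfolding B0(2) using B0(1) Z p by (subst powr_mult) (auto intro!: mult_mono powr_mono2)
    then have "M0 powr ?q * (norm2 U2 v)\<^sup>2 \<le> (324 * Z powr ?q) * (2 * Y)"
      using X by (intro mult_mono) auto
    moreover have "0 \<le> Y * Z powr ?q" using Y by simp
    ultimately show "4 * M0 powr ?q * (norm2 U2 v)\<^sup>2 \<le> 4000 * (Y * Z powr ?q)" by (simp add: mult_ac)
  qed
  finally show ?thesis .
qed

end

section \<open>The main theorem\<close>

lemma ennreal_mult_epow: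
  "0 \<le> a \<Longrightarrow> 0 \<le> b \<Longrightarrow> b \<noteq> 0 \<Longrightarrow> 0 \<le> c \<Longrightarrow> ennreal c * epow (ennreal a) b = ennreal (c * a powr b)"
  by (simp add: epow_ennreal ennreal_mult)

lemma epow_top: "a \<noteq> 0 \<Longrightarrow> epow top a = top" and epow_top_nonzero: "epow top a \<noteq> 0"
  by (simp_all add: epow_def)

text \<open>Here the bounds for the Borel representative return to \<open>w\<close>. In the last
  claim \<open>Z\<close> stands for \<open>energy_eps\<close> and \<open>Y\<close> for
  \<open>energy_eps\<close> divided by \<open>\<epsilon>\<close>; two inequalities relate them to
  \<open>e\<close> and to the norm of \<open>v'\<close>.\<close>

lemma finite_energy_bounds:
  assumes a: "agree w w' N" and B: "burgers w' v' g'" and e: "e = norm2 U2 v' * norm2 U2 g'"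
  shows "0 < s \<Longrightarrow> s \<le> 1/3 \<Longrightarrow> besov_seminorm s 3 w \<le> ennreal 24 * epow (ennreal e) (1/3)"
    and "0 < h \<Longrightarrow> h \<le> 1 \<Longrightarrow> (\<integral>\<^sup>+x. ennreal (\<bar>diff1 h w x\<bar> ^ 3) \<partial>torus) \<le> ennreal 24 * ennreal h * ennreal e"
    and "0 < h \<Longrightarrow> h \<le> 1 \<Longrightarrow> esssup (lebesgue_on {0..<1})
           (\<lambda>x2. \<integral>\<^sup>+h'\<in>{0..h}. (\<integral>\<^sup>+x1\<in>{0..<1}. ennreal (\<bar>diff1 h' w (x1, x2)\<bar>\<^sup>2) \<partial>lebesgue) \<partial>lebesgue)
         \<le> ennreal 24 * (ennreal h * ennreal e + ennreal (h powr (5/3)) * epow (ennreal e) (2/3))"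
    and "1 \<le> p \<Longrightarrow> p < 10/3 \<Longrightarrow> \<alpha> = max 2 p \<Longrightarrow>
       Lp_norm p w \<le> ennreal 4000 * epow (ennreal e) (2 / (3 * \<alpha>)) * epow (ennreal e + epow (ennreal e) (2/3)) ((\<alpha> - 2) / (2 * \<alpha>))"
    and "0 \<le> Y \<Longrightarrow> e \<le> Z \<Longrightarrow> (norm2 U2 v')\<^sup>2 \<le> 2 * Y \<Longrightarrow> 1 \<le> p \<Longrightarrow> p < 6 \<Longrightarrow> \<alpha> = max 2 p \<Longrightarrow>
       Lp_norm p w \<le> ennreal 4000 * ennreal (Y powr (1/\<alpha>)) * epow (ennreal Z + epow (ennreal Z) (2/3)) ((\<alpha> - 2) / (2 * \<alpha>))"
proof -
  interpret burgers w' v' g' by (rule B)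
  have eE: "e = E0" by (simp add: e E0_def)
  have e0: "0 \<le> e" by (simp add: eE E0_nonneg)
  have cube: "(\<integral>\<^sup>+x. ennreal (\<bar>diff1 h w x\<bar> ^ 3) \<partial>torus) \<le> ennreal (24 * h * e)" if "0 < h" "h \<le> 1" for h
  proof -
    have "(\<integral>\<^sup>+x. ennreal (\<bar>diff1 h w x\<bar> ^ 3) \<partial>torus) = (\<integral>\<^sup>+x. ennreal (\<bar>diff1 h w' x\<bar> ^ 3) \<partial>U2)"
      by (rule agree_nn_integral(2)[OF a, of "\<lambda>r. ennreal (\<bar>r\<bar> ^ 3)"]) simp
    then show ?thesis using cubic_bound[of h] that by (simp add: eE)
  qed
  show "(\<integral>\<^sup>+x. ennreal (\<bar>diff1 h w x\<bar> ^ 3) \<partial>torus) \<le> ennreal 24 * ennreal h * ennreal e" if "0 < h" "h \<le> 1"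
    using cube[OF that] that e0 by (simp add: ennreal_mult del: ennreal_numeral)
  show "besov_seminorm s 3 w \<le> ennreal 24 * epow (ennreal e) (1/3)" if s: "0 < s" "s \<le> 1/3"
    unfolding besov_seminorm_def
  proof (rule SUP_least)
    fix h :: real assume "h \<in> {0<..1}"
    then have h: "0 < h" "h \<le> 1" by auto
    have "Lp_norm 3 (diff1 h w) \<le> ennreal (24 * (h * e) powr (1/3))"
      unfolding Lp_norm_def using cube[OF h] h e0 by (intro epow_le) (auto simp: powr_numeral mult.assoc)
    then have "ennreal (1 / h powr s) * Lp_norm 3 (diff1 h w) \<le> ennreal (1 / h powr s) * ennreal (24 * (h * e) powr (1/3))"
      by (rule mult_left_mono) simp
    also have "\<dots> = ennreal (24 * (h powr (1/3 - s) * e powr (1/3)))"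
      using h e0 by (subst ennreal_mult'[symmetric]) (auto simp: powr_mult powr_diff)
    \<comment> \<open>The remaining power \<open>h powr (1/3 - s)\<close> is at most 1 because
      \<open>s \<le> 1/3\<close> and \<open>h \<le> 1\<close>.\<close>
    also have "\<dots> \<le> ennreal (24 * (1 * e powr (1/3)))"
      using h s by (intro ennreal_leI mult_left_mono mult_right_mono powr_le1) auto
    also have "\<dots> = ennreal 24 * epow (ennreal e) (1/3)"
      using e0 by (subst ennreal_mult_epow) auto
    finally show "ennreal (1 / h powr s) * Lp_norm 3 (diff1 h w) \<le> ennreal 24 * epow (ennreal e) (1/3)" .
  qed
  show "esssup (lebesgue_on {0..<1})
           (\<lambda>x2. \<integral>\<^sup>+h'\<in>{0..h}. (\<integral>\<^sup>+x1\<in>{0..<1}. ennreal (\<bar>diff1 h' w (x1, x2)\<bar>\<^sup>2) \<partial>lebesgue) \<partial>lebesgue)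
         \<le> ennreal 24 * (ennreal h * ennreal e + ennreal (h powr (5/3)) * epow (ennreal e) (2/3))" if h: "0 < h" "h \<le> 1"
  proof (rule order_trans[OF esssup_increments[OF a B h]])
    have "h * (h * e) powr (2/3) = h powr (5/3) * e powr (2/3)"
    proof -
      have "h powr (5/3) = h powr (1 + 2/3)" by simp
      also have "\<dots> = h * h powr (2/3)" using h by (simp only: powr_add) simp
      finally show ?thesis using h e0 by (simp add: powr_mult)
    qed
    moreover have "16 * a + 18 * b \<le> 24 * (a + b)" if "0 \<le> a" "0 \<le> b" for a b :: real
      using that by simp
    ultimately have "16 * h * e + 18 * (h * (h * e) powr (2/3)) \<le> 24 * (h * e + h powr (5/3) * e powr (2/3))"
      using h e0 by (simp only: mult.assoc) simp
    then have "ennreal (16 * h * e + 18 * (h * (h * e) powr (2/3))) \<le> ennreal (24 * (h * e + h powr (5/3) * e powr (2/3)))"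
      by (rule ennreal_leI)
    also have "\<dots> = ennreal 24 * (ennreal h * ennreal e + ennreal (h powr (5/3)) * epow (ennreal e) (2/3))"
      using h e0 by (simp add: ennreal_mult_epow ennreal_mult distrib_left del: ennreal_numeral)
    finally show "ennreal (16 * h * (norm2 U2 v' * norm2 U2 g') + 18 * (h * (h * (norm2 U2 v' * norm2 U2 g')) powr (2/3)))
       \<le> ennreal 24 * (ennreal h * ennreal e + ennreal (h powr (5/3)) * epow (ennreal e) (2/3))"
      unfolding e .
  qed
  have Lp: "Lp_norm p w = epow (\<integral>\<^sup>+z. ennreal (\<bar>w' z\<bar> powr p) \<partial>U2) (1 / p)" for p
    unfolding Lp_norm_def by (subst agree_nn_integral(1)[OF a, of "\<lambda>r. ennreal (\<bar>r\<bar> powr p)"]) auto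
  have sum: "ennreal Z + epow (ennreal Z) (2/3) = ennreal (Z + Z powr (2/3))" if "0 \<le> Z" for Z
    using that by (simp add: epow_ennreal)
  show "Lp_norm p w \<le> ennreal 4000 * epow (ennreal e) (2 / (3 * \<alpha>)) * epow (ennreal e + epow (ennreal e) (2/3)) ((\<alpha> - 2) / (2 * \<alpha>))"
    if p: "1 \<le> p" "p < 10/3" and \<alpha>: "\<alpha> = max 2 p"
  proof (cases "p \<le> 2")
    case True
    then have "\<alpha> = 2" using \<alpha> by simp
    have "(\<integral>\<^sup>+z. ennreal (\<bar>w' z\<bar> powr p) \<partial>U2) \<le> ennreal (48 * e powr (p/3))"
      unfolding eE using p True by (intro Lp_below_3) auto
    also have "\<dots> \<le> ennreal (4000 * e powr (p/3))" by (intro ennreal_leI mult_right_mono) auto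
    finally have "Lp_norm p w \<le> ennreal (4000 * (e powr (p/3)) powr (1/p))"
      unfolding Lp using p by (intro epow_le) auto
    also have "(e powr (p/3)) powr (1/p) = e powr (1/3)" using p by (simp add: powr_powr)
    also have "ennreal (4000 * e powr (1/3)) = ennreal 4000 * epow (ennreal e) (1/3)"
      using e0 by (subst ennreal_mult_epow) auto
    finally show ?thesis using \<open>\<alpha> = 2\<close> by (simp add: epow_def[of _ 0])
  next
    case False
    then have "\<alpha> = p" using \<alpha> by simp
    have "(\<integral>\<^sup>+z. ennreal (\<bar>w' z\<bar> powr p) \<partial>U2) \<le> ennreal (4000 * (e powr (2/3) * B0 powr ((p-2)/2)))"
      unfolding eE using p False by (intro Lp_ii) auto
    then have "Lp_norm p w \<le> ennreal (4000 * (e powr (2/3) * B0 powr ((p-2)/2)) powr (1/p))"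
      unfolding Lp using p by (intro epow_le) auto
    also have "(e powr (2/3) * B0 powr ((p-2)/2)) powr (1/p) = e powr (2 / (3 * p)) * B0 powr ((p-2) / (2 * p))"
      by (simp add: powr_mult powr_powr)
    also have "ennreal (4000 * (e powr (2 / (3 * p)) * B0 powr ((p-2) / (2 * p))))
       = ennreal 4000 * epow (ennreal e) (2 / (3 * p)) * epow (ennreal B0) ((p - 2) / (2 * p))"
      using p False e0 B0(1) by (simp add: ennreal_mult_epow ennreal_mult mult.assoc epow_ennreal del: ennreal_numeral)
    finally show ?thesis
      unfolding \<open>\<alpha> = p\<close> sum[OF e0] by (simp add: B0_def eE)
  qed
  show "Lp_norm p w \<le> ennreal 4000 * ennreal (Y powr (1/\<alpha>)) * epow (ennreal Z + epow (ennreal Z) (2/3)) ((\<alpha> - 2) / (2 * \<alpha>))"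
    if Y: "0 \<le> Y" and Z: "e \<le> Z" and X: "(norm2 U2 v')\<^sup>2 \<le> 2 * Y" and p: "1 \<le> p" "p < 6" and \<alpha>: "\<alpha> = max 2 p"
  proof (cases "p \<le> 2")
    case True
    then have "\<alpha> = 2" using \<alpha> by simp
    have "Lp_norm p w \<le> ennreal (4000 * (Y powr (p/2)) powr (1/p))"
      unfolding Lp using p True by (intro epow_le Lp_iii_low X Y) auto
    also have "(Y powr (p/2)) powr (1/p) = Y powr (1/2)" using p by (simp add: powr_powr)
    finally show ?thesis
      using \<open>\<alpha> = 2\<close> by (simp add: epow_def[of _ 0] ennreal_mult del: ennreal_numeral)
  next
    case False
    then have "\<alpha> = p" using \<alpha> by simp
    have Z0: "0 \<le> Z" using Z e0 by simp
    let ?B = "Z + Z powr (2/3)"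
    have BZ: "B0 \<le> ?B" unfolding B0_def eE[symmetric] using Z e0 by (intro add_mono powr_mono2) auto
    have "Lp_norm p w \<le> ennreal (4000 * (Y * ?B powr ((p-2)/2)) powr (1/p))"
      unfolding Lp using p False Y by (intro epow_le Lp_iii_high X BZ) auto
    also have "(Y * ?B powr ((p-2)/2)) powr (1/p) = Y powr (1/p) * ?B powr ((p-2) / (2 * p))"
      using Y by (simp add: powr_mult powr_powr)
    also have "ennreal (4000 * (Y powr (1/p) * ?B powr ((p-2) / (2 * p))))
       = ennreal 4000 * ennreal (Y powr (1/p)) * epow (ennreal ?B) ((p - 2) / (2 * p))"
      using p False Z0 by (simp add: ennreal_mult mult.assoc epow_ennreal del: ennreal_numeral ennreal_plus)
    finally show ?thesis
      unfolding \<open>\<alpha> = p\<close> sum[OF Z0] .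
  qed
qed

theorem lemma2p7:
  shows "\<exists>(C1::real) > 0. \<exists>C2 :: real \<Rightarrow> real. (\<forall>p. 1 \<le> p \<and> p < 6 \<longrightarrow> C2 p > 0) \<and>
    (\<forall>w. L2_torus w \<and> vanishing_mean1 (dist_of w) \<longrightarrow>
      (\<forall>s. 0 < s \<and> s \<le> 1 / 3 \<longrightarrow>
         besov_seminorm s 3 w \<le> ennreal C1 * epow (energy w) (1 / 3)) \<and>
      (\<forall>p \<alpha>. 1 \<le> p \<and> p < 10 / 3 \<and> \<alpha> = max 2 p \<longrightarrow>
         Lp_norm p w \<le> ennreal (C2 p) * epow (energy w) (2 / (3 * \<alpha>))
           * epow (energy w + epow (energy w) (2 / 3)) ((\<alpha> - 2) / (2 * \<alpha>))) \<and>
      (\<forall>\<epsilon> p \<alpha>. 0 < \<epsilon> \<and> 1 \<le> p \<and> p < 6 \<and> \<alpha> = max 2 p \<longrightarrow>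
         Lp_norm p w \<le> ennreal (C2 p) * ennreal (\<epsilon> powr (- 1 / \<alpha>)) * epow (energy_eps \<epsilon> w) (1 / \<alpha>)
           * epow (energy_eps \<epsilon> w + epow (energy_eps \<epsilon> w) (2 / 3)) ((\<alpha> - 2) / (2 * \<alpha>))) \<and>
      (\<forall>h. 0 < h \<and> h \<le> 1 \<longrightarrow>
         (\<integral>\<^sup>+x. ennreal (\<bar>diff1 h w x\<bar> ^ 3) \<partial>torus) \<le> ennreal C1 * ennreal h * energy w \<and>
         esssup (lebesgue_on {0..<1})
           (\<lambda>x2. \<integral>\<^sup>+h'\<in>{0..h}. (\<integral>\<^sup>+x1\<in>{0..<1}. ennreal (\<bar>diff1 h' w (x1, x2)\<bar>\<^sup>2) \<partial>lebesgue) \<partial>lebesgue)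
         \<le> ennreal C1 * (ennreal h * energy w + ennreal (h powr (5 / 3)) * epow (energy w) (2 / 3))))"
\<comment> \<open>24 is the cubic constant. It exceeds the 16 and 18 of the bound uniform in
  \<open>x2\<close> and, being at least 1, its own cube root in the seminorm. The value 4000 serves
  all \<open>p\<close>.\<close>
proof (rule exI[of _ 24], rule conjI, simp, rule exI[of _ "\<lambda>_. 4000"], intro conjI allI impI)
  fix w assume "L2_torus w \<and> vanishing_mean1 (dist_of w)"
  then have w: "L2_torus w" "vanishing_mean1 (dist_of w)" by auto
  have fin: "eta_integral w \<noteq> \<infinity>" "D1_integral w \<noteq> \<infinity>" if "energy w \<noteq> \<infinity>"
    using that by (auto simp: energy_def split: if_splits)
  have finite: "\<exists>w' v' g' N. agree w w' N \<and> burgers w' v' g' \<and> eta_integral w = ennreal ((norm2 U2 g')\<^sup>2)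
      \<and> D1_integral w = ennreal ((norm2 U2 v')\<^sup>2) \<and> energy w = ennreal (norm2 U2 v' * norm2 U2 g')" if nt: "energy w \<noteq> \<infinity>"
  proof -
    obtain w' v' g' N where *: "agree w w' N" "burgers w' v' g'"
      "eta_integral w = ennreal ((norm2 U2 g')\<^sup>2)" "D1_integral w = ennreal ((norm2 U2 v')\<^sup>2)"
      by (rule burgers_version[OF w fin(1)[OF nt] fin(2)[OF nt]])
    then have "energy w = ennreal (norm2 U2 v' * norm2 U2 g')"
      by (simp add: energy_def epow_square_half ennreal_mult mult.commute)
    with * show ?thesis by blast
  qed
  { fix s :: real assume s: "0 < s \<and> s \<le> 1/3"
    show "besov_seminorm s 3 w \<le> ennreal 24 * epow (energy w) (1/3)"
    proof (cases "energy w = \<infinity>")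
      case False
      then obtain w' v' g' N where "agree w w' N" "burgers w' v' g'" "energy w = ennreal (norm2 U2 v' * norm2 U2 g')"
        using finite by blast
      with finite_energy_bounds(1)[of w w' N v' g' "norm2 U2 v' * norm2 U2 g'" s] s show ?thesis by simp
    qed (simp add: epow_top ennreal_mult_top) }
  { fix p \<alpha> :: real assume p: "1 \<le> p \<and> p < 10/3 \<and> \<alpha> = max 2 p"
    show "Lp_norm p w \<le> ennreal 4000 * epow (energy w) (2 / (3 * \<alpha>))
           * epow (energy w + epow (energy w) (2/3)) ((\<alpha> - 2) / (2 * \<alpha>))"
    proof (cases "energy w = \<infinity>")
      case False
      then obtain w' v' g' N where "agree w w' N" "burgers w' v' g'" "energy w = ennreal (norm2 U2 v' * norm2 U2 g')"
        using finite by blast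
      with finite_energy_bounds(4)[of w w' N v' g' "norm2 U2 v' * norm2 U2 g'" p \<alpha>] p show ?thesis by simp
    next
      case True
      \<comment> \<open>With infinite energy the first power is \<open>top\<close>, and the second
        factor is not 0, being \<open>top\<close> or, for \<open>\<alpha> = 2\<close>, equal to 1;
        so the product is not annihilated by \<open>0 * top = 0\<close>.\<close>
      moreover have "2 / (3 * \<alpha>) \<noteq> 0" using p by auto
      ultimately show ?thesis
        by (simp add: epow_top epow_top_nonzero ennreal_mult_top ennreal_top_mult)
    qed }
  { fix \<epsilon> p \<alpha> :: real assume p: "0 < \<epsilon> \<and> 1 \<le> p \<and> p < 6 \<and> \<alpha> = max 2 p"
    let ?E = "energy_eps \<epsilon> w"
    have \<alpha>: "1 / \<alpha> \<noteq> 0" "0 < \<alpha>" using p by auto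
    show "Lp_norm p w \<le> ennreal 4000 * ennreal (\<epsilon> powr (- 1 / \<alpha>)) * epow ?E (1 / \<alpha>)
           * epow (?E + epow ?E (2/3)) ((\<alpha> - 2) / (2 * \<alpha>))"
    proof (cases "energy w = \<infinity>")
      case True
      \<comment> \<open>Both integrals carry positive weights in \<open>energy_eps\<close>, so it is
        infinite as well.\<close>
      then have "eta_integral w = \<infinity> \<or> D1_integral w = \<infinity>"
        by (auto simp: energy_def epow_def ennreal_mult_eq_top_iff split: if_splits)
      then have E: "?E = \<infinity>"
        using p by (auto simp: energy_eps_def ennreal_mult_top ennreal_top_mult)
      then have "epow ?E (1 / \<alpha>) = \<infinity>" using \<alpha> by (simp add: epow_top)
      then show ?thesis
        using p E by (simp add: epow_top_nonzero ennreal_mult_top ennreal_top_mult)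
    next
      case False
      then obtain w' v' g' N where *: "agree w w' N" "burgers w' v' g'" "eta_integral w = ennreal ((norm2 U2 g')\<^sup>2)"
        "D1_integral w = ennreal ((norm2 U2 v')\<^sup>2)" using finite by blast
      let ?g = "norm2 U2 g'" and ?v = "norm2 U2 v'"
      define Z where "Z = 1/2 * (?g\<^sup>2 / \<epsilon> + \<epsilon> * ?v\<^sup>2)"
      have Z0: "0 \<le> Z" using p by (auto simp: Z_def)
      have E: "?E = ennreal Z"
      proof -
        have "?E = ennreal (1/2) * (ennreal (1/\<epsilon> * ?g\<^sup>2) + ennreal (\<epsilon> * ?v\<^sup>2))"
          unfolding energy_eps_def * using p by (simp only: ennreal_mult' less_imp_le zero_le_divide_1_iff)
        also have "ennreal (1/\<epsilon> * ?g\<^sup>2) + ennreal (\<epsilon> * ?v\<^sup>2) = ennreal (1/\<epsilon> * ?g\<^sup>2 + \<epsilon> * ?v\<^sup>2)"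
          using p by (intro ennreal_plus[symmetric]) auto
        also have "ennreal (1/2) * \<dots> = ennreal (1/2 * (1/\<epsilon> * ?g\<^sup>2 + \<epsilon> * ?v\<^sup>2))"
          by (rule ennreal_mult'[symmetric]) simp
        finally show ?thesis by (simp add: Z_def)
      qed
      \<comment> \<open>Young's inequality with weight \<open>\<epsilon>\<close>: the product energy
        is at most \<open>energy_eps\<close>.\<close>
      have "0 \<le> (?g - \<epsilon> * ?v)\<^sup>2 / \<epsilon>" using p by simp
      also have "\<dots> = ?g\<^sup>2 / \<epsilon> + \<epsilon> * ?v\<^sup>2 - 2 * (?v * ?g)"
        using p by (simp add: power2_eq_square field_simps)
      finally have Z: "?v * ?g \<le> Z" by (simp add: Z_def)
      have "\<epsilon> * ?v\<^sup>2 \<le> 2 * Z" using p by (simp add: Z_def)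
      then have X: "?v\<^sup>2 \<le> 2 * (Z / \<epsilon>)" using p by (simp add: field_simps)
      have Y: "0 \<le> Z / \<epsilon>" using Z0 p by simp
      have "ennreal ((Z / \<epsilon>) powr (1/\<alpha>)) = ennreal (\<epsilon> powr (- 1 / \<alpha>)) * epow ?E (1/\<alpha>)"
      proof -
        have "(Z / \<epsilon>) powr (1/\<alpha>) = \<epsilon> powr (- 1 / \<alpha>) * Z powr (1/\<alpha>)"
          using p Z0 by (simp add: powr_divide powr_minus_divide)
        then show ?thesis unfolding E using Z0 \<alpha> by (simp add: ennreal_mult_epow)
      qed
      then show ?thesis
        using finite_energy_bounds(5)[OF *(1,2) refl Y Z X, of p \<alpha>] p unfolding E by (simp add: mult.assoc)
    qed }
  { fix h :: real assume h: "0 < h \<and> h \<le> 1"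
    show "(\<integral>\<^sup>+x. ennreal (\<bar>diff1 h w x\<bar> ^ 3) \<partial>torus) \<le> ennreal 24 * ennreal h * energy w"
    proof (cases "energy w = \<infinity>")
      case False
      then obtain w' v' g' N where "agree w w' N" "burgers w' v' g'" "energy w = ennreal (norm2 U2 v' * norm2 U2 g')"
        using finite by blast
      with finite_energy_bounds(2)[of w w' N v' g' "norm2 U2 v' * norm2 U2 g'" h] h show ?thesis by simp
    qed (use h in \<open>simp add: ennreal_mult_top\<close>)
    show "esssup (lebesgue_on {0..<1})
           (\<lambda>x2. \<integral>\<^sup>+h'\<in>{0..h}. (\<integral>\<^sup>+x1\<in>{0..<1}. ennreal (\<bar>diff1 h' w (x1, x2)\<bar>\<^sup>2) \<partial>lebesgue) \<partial>lebesgue)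
         \<le> ennreal 24 * (ennreal h * energy w + ennreal (h powr (5/3)) * epow (energy w) (2/3))"
    proof (cases "energy w = \<infinity>")
      case False
      then obtain w' v' g' N where "agree w w' N" "burgers w' v' g'" "energy w = ennreal (norm2 U2 v' * norm2 U2 g')"
        using finite by blast
      with finite_energy_bounds(3)[of w w' N v' g' "norm2 U2 v' * norm2 U2 g'" h] h show ?thesis by simp
    qed (use h in \<open>simp add: ennreal_mult_top\<close>) }
qed simp

end
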